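(* Let $T>0$, $H\in(1/2,1)$, $d\ge1$, $c\in\mathbb R^d$, and let $b:[0,T]\times\mathbb R^d\to\mathbb R^d$ and $\sigma=(\sigma_1,\dots,\sigma_d):[0,T]\to\mathbb R^d$ be such that $b,\partial_{x_1}b,\dots,\partial_{x_d}b$ are bounded and continuous and $\sigma_1,\dots,\sigma_d$ are bounded and continuous. For $K\ge1$ let $\{X^K(t)\}_{t\in[0,T]}$ be the mild solution (in the sense defined in the context) of $$\frac{dX_i^K(t)}{dt}=b_i(t,X^K(t))+\sigma_i(t)X_i^K(t)\diamond\frac{dB_i^K(t)}{dt},\quad t\in\,]0,T],\qquad X_i^K(0)=c_i,\qquad i\in\{1,\dots,d\},$$ and let $\{X(t)\}_{t\in[0,T]}$ be the unique strong solution of the Itô-type stochastic differential equation $$dX_i(t)=b_i(t,X(t))\,dt+\sigma_i(t)X_i(t)\,dB_i(t),\quad t\in[0,T],\qquad X_i(0)=c_i,\qquad i\in\{1,\dots,d\}.$$ Then $X^K$ converges to $X$ as $K\to\infty$; more precisely, $$\lim_{K\to\infty}\sum_{i=1}^d\mathbb E\big[|X_i^K(t)-X_i(t)|\big]=0\qquad\text{for all }t\in[0,T].$$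
   Context: **Probability space.** $\Omega=C_0([0,T],\mathbb R^d)$ with its Borel sets and the probability measure $P^H$ under which the coordinate process $B(t,\omega)=\omega(t)$ is a $d$-dimensional fractional Brownian motion of Hurst parameter $H\in(1/2,1)$: its components $B_1,\dots,B_d$ are independent centered Gaussian processes with $\mathbb E[B_i(t)B_i(s)]=\frac12(t^{2H}+s^{2H}-|t-s|^{2H})$. **The space $\mathcal H_\phi$.** Let $\phi(s,t)=H(2H-1)|s-t|^{2H-2}$ and $\langle f,g\rangle_\phi=\int_0^T\int_0^T f(s)g(t)\phi(s,t)\,ds\,dt$, $|f|_\phi^2=\langle f,f\rangle_\phi$. $\mathcal H_\phi$ is the separable Hilbert space obtained as the closure (completion) of $L^2([0,T])$ with respect to $\langle\cdot,\cdot\rangle_\phi$. For $f\in\mathcal H_\phi$ set $\Phi[f](t)=\int_0^T f(s)\phi(t,s)\,ds$, so that $\int_0^t\Phi[f](r)\,dr=\langle f,\chi_{[0,t]}\rangle_\phi$. The fractional Wiener integral $\int_0^T f\,dB_i$ is the centered Gaussian random variable determined by linearity, $\int_0^T\chi_{[0,t]}dB_i=B_i(t)$ and $\mathbb E[(\int_0^T f\,dB_i)^2]=|f|_\phi^2$. **Approximating noise.** $\{e_k\}_{k\ge1}$ is a fixed complete orthonormal system of $\mathcal H_\phi$, $\xi_k=\Phi[e_k]$ (continuous functions on $[0,T]$), $Z_k^{(i)}=\int_0^T e_k\,dB_i$, and $\frac{dB_i^K(t)}{dt}=\sum_{k=1}^K\xi_k(t)Z_k^{(i)}$, the time derivative of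 the truncated Cameron–Martin expansion of $B_i$. **Stochastic exponentials and Wick product.** For $f\in\mathcal H_\phi$, $\mathcal E_i(f)=\exp\{\int_0^T f\,dB_i-\frac12|f|_\phi^2\}$. For $X\in\mathbb L^p(\Omega)$ with some $p>1$, $X\diamond\mathcal E_i(f)=\mathtt T_{-\Phi[f]_i}X\cdot\mathcal E_i(f)$, where $(\mathtt T_{-\Phi[f]_i}X)(\omega)=X(\omega-\epsilon_i\int_0^{\cdot}\Phi[f](r)\,dr)$ and $\{\epsilon_1,\dots,\epsilon_d\}$ is the canonical basis of $\mathbb R^d$. For $0\le r\le t\le T$, $\sigma_i^K(r,t;\cdot)$ is the orthogonal projection in $\mathcal H_\phi$ of $\chi_{[r,t]}\sigma_i$ onto $\operatorname{span}\{e_1,\dots,e_K\}$, and $\mathcal E_i^K(r,t)=\mathcal E_i(\sigma_i^K(r,t;\cdot))$. **Mild solution.** A $d$-dimensional process $\{X^K(t)\}_{t\in[0,T]}$ is a mild solution of the approximating Cauchy problem if: (1) $t\mapsto X^K(t)$ is almost surely continuous; (2) for all $i$ and $t$, $X_i^K(t)\in\mathbb L^p(\Omega)$ for some $p>1$; (3) for all $i$, almost surely $X_i^K(t)=c_i\mathcal E_i^K(0,t)+\int_0^t b_i(s,X^K(s))\diamond\mathcal E_i^K(s,t)\,ds$ for $t\in[0,T]$. **The Itô-type SDE.** The stochastic integral with respect to $B_i$ is the Itô-type (Wick–Itô–Skorokhod, i.e. divergence-type) integral for fractional Brownian motion, formally $\int_0^t F(s)\,dB_i(s)=\int_0^t F(s)\diamond\frac{dB_i(s)}{ds}\,ds$;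 it is characterized by $$\mathbb E\Big[\Big(\int_0^tF(s)\,dB_i(s)\Big)\mathcal E(f)\Big]=\int_0^t\mathbb E[F(s)\mathcal E(f)]\,\Phi[f_i](s)\,ds$$ for all $f=(f_1,\dots,f_d)$ with $f_j\in L^\infty([0,T])$, where $\mathcal E(f)=\prod_{j=1}^d\mathcal E_j(f_j)$. It is a standing assumption that $b$ and $\sigma$ possess enough regularity for the SDE to have a unique strong solution $X$; this solution satisfies $X(t)\in\mathbb L^p(\Omega)$ for all $p\ge1$ and $t\in[0,T]$. *)

theory Defs
  imports "HOL-Probability.Probability"
begin

section \<open>Random variables\<close>

definition Lp_rv :: "'w measure \<Rightarrow> real \<Rightarrow> ('w \<Rightarrow> real) \<Rightarrow> bool" where
  "Lp_rv M p X \<longleftrightarrow> X \<in> borel_measurable M \<and> integrable M (\<lambda>\<omega>. \<bar>X \<omega>\<bar> powr p)"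

text \<open>The Dirac mass at \<open>0\<close> counts as a (degenerate) centered Gaussian law.\<close>

definition centered_gaussian :: "'w measure \<Rightarrow> ('w \<Rightarrow> real) \<Rightarrow> bool" where
  "centered_gaussian M X \<longleftrightarrow> X \<in> borel_measurable M \<and>
     ((AE \<omega> in M. X \<omega> = 0) \<or>
      (\<exists>v>0. distributed M lborel X (\<lambda>x. ennreal (normal_density 0 v x))))"

section \<open>Path space and fractional Brownian motion\<close>

text \<open>
  A path in \<open>C\<^sub>0([0,T], \<real>\<^sup>d)\<close> is represented by its extension to the real line that is constant on
  \<open>(-\<infinity>,0]\<close> and on \<open>[T,\<infinity>)\<close>. This is an isometry for the sup norms, so the topology inherited from
  the type of bounded continuous functions is the uniform topology on \<open>[0,T]\<close>.
\<close>

type_synonym 'n path = "real \<Rightarrow>\<^sub>C (real ^ 'n)"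

definition path_space :: "real \<Rightarrow> ('n::finite) path set" where
  "path_space T = {\<omega>. apply_bcontfun \<omega> 0 = 0 \<and>
     (\<forall>t. apply_bcontfun \<omega> t = apply_bcontfun \<omega> (max 0 (min T t)))}"

definition B :: "'n \<Rightarrow> real \<Rightarrow> ('n::finite) path \<Rightarrow> real" where
  "B i t \<omega> = apply_bcontfun \<omega> t $ i"

definition fbm_law :: "real \<Rightarrow> real \<Rightarrow> ('n::finite) path measure \<Rightarrow> bool" where
  "fbm_law H T P \<longleftrightarrow>
     prob_space P \<and>
     space P = path_space T \<and>
     sets P = sets (restrict_space borel (path_space T)) \<and>
     prob_space.indep_vars P (\<lambda>i::'n. Pi\<^sub>M {0..T} (\<lambda>_. borel :: real measure))
       (\<lambda>i \<omega>. \<lambda>t\<in>{0..T}. B i t \<omega>) UNIV \<and>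
     (\<forall>i S a. finite S \<and> S \<subseteq> {0..T} \<longrightarrow> centered_gaussian P (\<lambda>\<omega>. \<Sum>t\<in>S. a t * B i t \<omega>)) \<and>
     (\<forall>i. \<forall>s\<in>{0..T}. \<forall>t\<in>{0..T}.
        (\<integral>\<omega>. B i t \<omega> * B i s \<omega> \<partial>P) =
          (t powr (2 * H) + s powr (2 * H) - \<bar>t - s\<bar> powr (2 * H)) / 2)"

section \<open>The Hilbert space generated by the covariance kernel\<close>

definition phi :: "real \<Rightarrow> real \<Rightarrow> real \<Rightarrow> real" where
  "phi H s t = H * (2 * H - 1) * \<bar>s - t\<bar> powr (2 * H - 2)"

definition L2 :: "real \<Rightarrow> (real \<Rightarrow> real) set" where
  "L2 T = {f. set_borel_measurable lborel {0..T} f \<and> set_integrable lborel {0..T} (\<lambda>s. (f s)\<^sup>2)}"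

definition Linf :: "real \<Rightarrow> (real \<Rightarrow> real) set" where
  "Linf T = {f. set_borel_measurable lborel {0..T} f \<and>
     (\<exists>C. AE s in lborel. s \<in> {0..T} \<longrightarrow> \<bar>f s\<bar> \<le> C)}"

definition phi_inner :: "real \<Rightarrow> real \<Rightarrow> (real \<Rightarrow> real) \<Rightarrow> (real \<Rightarrow> real) \<Rightarrow> real" where
  "phi_inner H T f g = (LBINT t:{0..T}. (LBINT s:{0..T}. f s * g t * phi H s t))"

text \<open>
  The space \<open>\<H>\<^sub>\<phi>\<close> is given, up to isometry, as a Hilbert space \<open>'h\<close> together with an isometric
  linear map \<open>J\<close> from \<open>L\<^sup>2([0,T])\<close> with the \<open>\<phi>\<close>-inner product onto a dense subspace. Its elements
  need not be functions.
\<close>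

definition phi_completion ::
  "real \<Rightarrow> real \<Rightarrow> ((real \<Rightarrow> real) \<Rightarrow> 'h::{real_inner, complete_space}) \<Rightarrow> bool" where
  "phi_completion H T J \<longleftrightarrow>
     (\<forall>f\<in>L2 T. \<forall>g\<in>L2 T. J (\<lambda>s. f s + g s) = J f + J g) \<and>
     (\<forall>f\<in>L2 T. \<forall>a. J (\<lambda>s. a * f s) = a *\<^sub>R J f) \<and>
     (\<forall>f\<in>L2 T. \<forall>g\<in>L2 T. inner (J f) (J g) = phi_inner H T f g) \<and>
     closure (J ` L2 T) = UNIV"

definition Phi_fun :: "real \<Rightarrow> real \<Rightarrow> (real \<Rightarrow> real) \<Rightarrow> real \<Rightarrow> real" where
  "Phi_fun H T f t = (LBINT s:{0..T}. f s * phi H t s)"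

text \<open>
  For an element \<open>h\<close> of the completion, \<open>\<Phi>[h]\<close> is the extension by continuity, with values in
  \<open>L\<^sup>1([0,T])\<close>, of the operator \<open>\<Phi>\<close> on \<open>L\<^sup>2([0,T])\<close>; it is determined up to null sets.
  It satisfies \<open>\<integral>\<^sub>0\<^sup>t \<Phi>[h](r) dr = \<langle>h, \<chi>\<^bsub>[0,t]\<^esub>\<rangle>\<close>.
\<close>

definition Phi_version ::
  "real \<Rightarrow> real \<Rightarrow> ((real \<Rightarrow> real) \<Rightarrow> 'h::{real_inner, complete_space}) \<Rightarrow> 'h \<Rightarrow> (real \<Rightarrow> real) \<Rightarrow> bool"
where
  "Phi_version H T J h g \<longleftrightarrow>
     set_integrable lborel {0..T} g \<and>
     (\<exists>f. (\<forall>n::nat. f n \<in> L2 T) \<and> (\<lambda>n. J (f n)) \<longlonglongrightarrow> h \<and>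
          (\<lambda>n. LBINT t:{0..T}. \<bar>Phi_fun H T (f n) t - g t\<bar>) \<longlonglongrightarrow> 0)"

definition Phi ::
  "real \<Rightarrow> real \<Rightarrow> ((real \<Rightarrow> real) \<Rightarrow> 'h::{real_inner, complete_space}) \<Rightarrow> 'h \<Rightarrow> real \<Rightarrow> real" where
  "Phi H T J h = (SOME g. Phi_version H T J h g)"

text \<open>Sequences \<open>(e\<^sub>k)\<close> are indexed by \<open>k \<ge> 1\<close>; the value \<open>e 0\<close> is irrelevant.\<close>

definition complete_orthonormal :: "(nat \<Rightarrow> 'h::real_inner) \<Rightarrow> bool" where
  "complete_orthonormal e \<longleftrightarrow>
     (\<forall>j\<ge>1. \<forall>k\<ge>1. inner (e j) (e k) = (if j = k then 1 else 0)) \<and>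
     closure (span (e ` {1..})) = UNIV"

definition orth_proj :: "'h::real_inner set \<Rightarrow> 'h \<Rightarrow> 'h" where
  "orth_proj S x = (THE y. y \<in> S \<and> (\<forall>z\<in>S. orthogonal (x - y) z))"

section \<open>Wiener integrals, stochastic exponentials, Wick product\<close>

text \<open>
  \<open>W i f\<close> is a version of the Wiener integral of \<open>f\<close> with respect to the \<open>i\<close>-th component. The
  versions are chosen such that \<open>f \<mapsto> W i f \<omega>\<close> is linear for every \<open>\<omega>\<close> (possible: choose versions
  on a Hamel basis). Thus \<open>W i\<close> on the span of \<open>e\<^sub>1, \<dots>, e\<^sub>K\<close> is determined by
  \<open>W i (e\<^sub>1), \<dots>, W i (e\<^sub>K)\<close>, and the integrand in the mild equation depends measurably on \<open>s\<close>.
\<close>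

definition wiener_integral ::
  "real \<Rightarrow> ('n::finite) path measure \<Rightarrow> ((real \<Rightarrow> real) \<Rightarrow> 'h::{real_inner, complete_space}) \<Rightarrow>
   ('n \<Rightarrow> 'h \<Rightarrow> 'n path \<Rightarrow> real) \<Rightarrow> bool" where
  "wiener_integral T P J W \<longleftrightarrow>
     (\<forall>i. (\<forall>\<omega>\<in>space P. linear (\<lambda>f. W i f \<omega>)) \<and>
          (\<forall>f. centered_gaussian P (W i f) \<and> (\<integral>\<omega>. (W i f \<omega>)\<^sup>2 \<partial>P) = (norm f)\<^sup>2) \<and>
          (\<forall>t\<in>{0..T}. AE \<omega> in P. W i (J (indicator {0..t})) \<omega> = B i t \<omega>))"

definition stoch_exp ::
  "('n \<Rightarrow> 'h::real_inner \<Rightarrow> ('n::finite) path \<Rightarrow> real) \<Rightarrow> 'n \<Rightarrow> 'h \<Rightarrow> 'n path \<Rightarrow> real" where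
  "stoch_exp W i f \<omega> = exp (W i f \<omega> - (norm f)\<^sup>2 / 2)"

definition translate ::
  "real \<Rightarrow> real \<Rightarrow> ((real \<Rightarrow> real) \<Rightarrow> 'h::{real_inner, complete_space}) \<Rightarrow> 'n \<Rightarrow> 'h \<Rightarrow>
   (('n::finite) path \<Rightarrow> real) \<Rightarrow> 'n path \<Rightarrow> real" where
  "translate H T J i f X \<omega> =
     X (\<omega> - Bcontfun (\<lambda>t. (LBINT r:{0..max 0 (min T t)}. Phi H T J f r) *\<^sub>R axis i 1))"

definition wick_exp ::
  "real \<Rightarrow> real \<Rightarrow> ((real \<Rightarrow> real) \<Rightarrow> 'h::{real_inner, complete_space}) \<Rightarrow>
   ('n \<Rightarrow> 'h \<Rightarrow> 'n path \<Rightarrow> real) \<Rightarrow> (('n::finite) path \<Rightarrow> real) \<Rightarrow> 'n \<Rightarrow> 'h \<Rightarrow> 'n path \<Rightarrow> real" where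
  "wick_exp H T J W X i f \<omega> = translate H T J i f X \<omega> * stoch_exp W i f \<omega>"

section \<open>Coefficients, approximating problem and mild solutions\<close>

definition bounded_C1 :: "real \<Rightarrow> (real \<Rightarrow> real ^ 'n \<Rightarrow> real ^ ('n::finite)) \<Rightarrow> bool" where
  "bounded_C1 T b \<longleftrightarrow>
     continuous_on ({0..T} \<times> UNIV) (\<lambda>(t, x). b t x) \<and>
     bounded ((\<lambda>(t, x). b t x) ` ({0..T} \<times> UNIV)) \<and>
     (\<forall>j. \<exists>D. continuous_on ({0..T} \<times> UNIV) (\<lambda>(t, x). D t x) \<and>
              bounded ((\<lambda>(t, x). D t x) ` ({0..T} \<times> UNIV)) \<and>
              (\<forall>t\<in>{0..T}. \<forall>x.
                 ((\<lambda>h. b t (x + h *\<^sub>R axis j 1)) has_vector_derivative D t x) (at 0)))"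

definition sigma_proj ::
  "((real \<Rightarrow> real) \<Rightarrow> 'h::{real_inner, complete_space}) \<Rightarrow> (nat \<Rightarrow> 'h) \<Rightarrow>
   (real \<Rightarrow> real ^ ('n::finite)) \<Rightarrow> nat \<Rightarrow> 'n \<Rightarrow> real \<Rightarrow> real \<Rightarrow> 'h" where
  "sigma_proj J e \<sigma> K i r t =
     orth_proj (span (e ` {1..K})) (J (\<lambda>s. indicator {r..t} s * \<sigma> s $ i))"

text \<open>
  The time integral in the mild equation is taken with respect to the complete Lebesgue measure:
  the path of \<open>Y\<close> is only almost surely continuous, so for fixed \<open>\<omega>\<close> and \<open>t\<close> the translated
  integrand coincides with a Borel function of \<open>s\<close> only up to a null set.
\<close>

definition mild_solution ::
  "real \<Rightarrow> real \<Rightarrow> ('n::finite) path measure \<Rightarrow> ((real \<Rightarrow> real) \<Rightarrow> 'h::{real_inner, complete_space}) \<Rightarrow>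
   ('n \<Rightarrow> 'h \<Rightarrow> 'n path \<Rightarrow> real) \<Rightarrow> (nat \<Rightarrow> 'h) \<Rightarrow>
   (real \<Rightarrow> real ^ 'n \<Rightarrow> real ^ 'n) \<Rightarrow> (real \<Rightarrow> real ^ 'n) \<Rightarrow> real ^ 'n \<Rightarrow> nat \<Rightarrow>
   (real \<Rightarrow> 'n path \<Rightarrow> real ^ 'n) \<Rightarrow> bool" where
  "mild_solution H T P J W e b \<sigma> c K Y \<longleftrightarrow>
     (AE \<omega> in P. continuous_on {0..T} (\<lambda>t. Y t \<omega>)) \<and>
     (\<forall>i. \<forall>t\<in>{0..T}. \<exists>p>1. Lp_rv P p (\<lambda>\<omega>. Y t \<omega> $ i)) \<and>
     (\<forall>i. AE \<omega> in P. \<forall>t\<in>{0..T}.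
        set_integrable lebesgue {0..t}
          (\<lambda>s. wick_exp H T J W (\<lambda>\<eta>. b s (Y s \<eta>) $ i) i (sigma_proj J e \<sigma> K i s t) \<omega>) \<and>
        Y t \<omega> $ i =
          c $ i * stoch_exp W i (sigma_proj J e \<sigma> K i 0 t) \<omega> +
          (LINT s:{0..t}|lebesgue.
             wick_exp H T J W (\<lambda>\<eta>. b s (Y s \<eta>) $ i) i (sigma_proj J e \<sigma> K i s t) \<omega>))"

section \<open>The stochastic differential equation of Ito type\<close>

definition multi_stoch_exp ::
  "((real \<Rightarrow> real) \<Rightarrow> 'h::real_inner) \<Rightarrow> ('n \<Rightarrow> 'h \<Rightarrow> ('n::finite) path \<Rightarrow> real) \<Rightarrow>
   ('n \<Rightarrow> real \<Rightarrow> real) \<Rightarrow> 'n path \<Rightarrow> real" where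
  "multi_stoch_exp J W f \<omega> = (\<Prod>j\<in>UNIV. stoch_exp W j (J (f j)) \<omega>)"

text \<open>\<open>I\<close> is a version of the Wick-Ito-Skorokhod integral of \<open>F\<close> over \<open>[0,t]\<close> with respect to \<open>B i\<close>.\<close>

definition ito_integral ::
  "real \<Rightarrow> real \<Rightarrow> ('n::finite) path measure \<Rightarrow> ((real \<Rightarrow> real) \<Rightarrow> 'h::{real_inner, complete_space}) \<Rightarrow>
   ('n \<Rightarrow> 'h \<Rightarrow> 'n path \<Rightarrow> real) \<Rightarrow> 'n \<Rightarrow> (real \<Rightarrow> 'n path \<Rightarrow> real) \<Rightarrow> real \<Rightarrow>
   ('n path \<Rightarrow> real) \<Rightarrow> bool" where
  "ito_integral H T P J W i F t I \<longleftrightarrow>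
     (\<exists>p>1. Lp_rv P p I) \<and>
     (\<forall>f. (\<forall>j. f j \<in> Linf T) \<longrightarrow>
        (\<forall>s\<in>{0..t}. integrable P (\<lambda>\<omega>. F s \<omega> * multi_stoch_exp J W f \<omega>)) \<and>
        set_integrable lborel {0..t}
          (\<lambda>s. (\<integral>\<omega>. F s \<omega> * multi_stoch_exp J W f \<omega> \<partial>P) * Phi_fun H T (f i) s) \<and>
        (\<integral>\<omega>. I \<omega> * multi_stoch_exp J W f \<omega> \<partial>P) =
          (LBINT s:{0..t}. (\<integral>\<omega>. F s \<omega> * multi_stoch_exp J W f \<omega> \<partial>P) * Phi_fun H T (f i) s))"

definition natural_filtration ::
  "('n::finite) path measure \<Rightarrow> real \<Rightarrow> 'n path measure" where
  "natural_filtration P t =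
     vimage_algebra (space P) (\<lambda>\<omega>. \<lambda>s\<in>{0..t}. apply_bcontfun \<omega> s) (Pi\<^sub>M {0..t} (\<lambda>_. borel))"

text \<open>
  The second condition is adaptedness to the filtration of \<open>B\<close> augmented by the null sets of \<open>P\<close>.
\<close>

definition strong_solution ::
  "real \<Rightarrow> real \<Rightarrow> ('n::finite) path measure \<Rightarrow> ((real \<Rightarrow> real) \<Rightarrow> 'h::{real_inner, complete_space}) \<Rightarrow>
   ('n \<Rightarrow> 'h \<Rightarrow> 'n path \<Rightarrow> real) \<Rightarrow>
   (real \<Rightarrow> real ^ 'n \<Rightarrow> real ^ 'n) \<Rightarrow> (real \<Rightarrow> real ^ 'n) \<Rightarrow> real ^ 'n \<Rightarrow>
   (real \<Rightarrow> 'n path \<Rightarrow> real ^ 'n) \<Rightarrow> bool" where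
  "strong_solution H T P J W b \<sigma> c Y \<longleftrightarrow>
     (AE \<omega> in P. continuous_on {0..T} (\<lambda>t. Y t \<omega>)) \<and>
     (\<forall>t\<in>{0..T}. Y t \<in> borel_measurable P \<and>
        (\<exists>Z \<in> borel_measurable (natural_filtration P t). AE \<omega> in P. Y t \<omega> = Z \<omega>)) \<and>
     (\<forall>i. \<forall>t\<in>{0..T}. \<exists>I.
        ito_integral H T P J W i (\<lambda>s \<omega>. \<sigma> s $ i * Y s \<omega> $ i) t I \<and>
        (AE \<omega> in P. Y t \<omega> $ i = c $ i + (LBINT s:{0..t}. b s (Y s \<omega>) $ i) + I \<omega>))"

definition unique_strong_solution ::
  "real \<Rightarrow> real \<Rightarrow> ('n::finite) path measure \<Rightarrow> ((real \<Rightarrow> real) \<Rightarrow> 'h::{real_inner, complete_space}) \<Rightarrow>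
   ('n \<Rightarrow> 'h \<Rightarrow> 'n path \<Rightarrow> real) \<Rightarrow>
   (real \<Rightarrow> real ^ 'n \<Rightarrow> real ^ 'n) \<Rightarrow> (real \<Rightarrow> real ^ 'n) \<Rightarrow> real ^ 'n \<Rightarrow>
   (real \<Rightarrow> 'n path \<Rightarrow> real ^ 'n) \<Rightarrow> bool" where
  "unique_strong_solution H T P J W b \<sigma> c X \<longleftrightarrow>
     strong_solution H T P J W b \<sigma> c X \<and>
     (\<forall>Y. strong_solution H T P J W b \<sigma> c Y \<longrightarrow>
        (AE \<omega> in P. \<forall>t\<in>{0..T}. Y t \<omega> = X t \<omega>))"

end

theory Submission
  imports Defs
begin

text \<open>
  The Wick product with \<open>\<E>\<^sub>i(f)\<close> is a translation of paths followed by multiplication with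
  \<open>\<E>\<^sub>i(f)\<close>, so by the Cameron--Martin--Girsanov theorem it is an isometry of \<open>L\<^sup>1(P)\<close>, and it depends
  continuously on \<open>f\<close> in the strong sense. Let \<open>F\<^sub>K\<close> be the map whose fixed points are the mild
  solutions \<open>X\<^sup>K\<close>; since the drift is Lipschitz in space, \<open>F\<^sub>K\<close> is Lipschitz for the \<open>L\<^sup>1\<close> distance,
  with an integral (Gronwall) bound whose constant does not depend on \<open>K\<close>. Hence it suffices to
  show the consistency \<open>F\<^sub>K(X)(t) \<longrightarrow> X(t)\<close> in \<open>L\<^sup>1\<close>.

  By the strong continuity and \<open>\<sigma>\<^sup>K \<longrightarrow> \<sigma>\<close> in \<open>\<H>\<^sub>\<phi>\<close>, \<open>F\<^sub>K(X)(t)\<close> is Cauchy in \<open>L\<^sup>1\<close>, and it is bounded in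
  \<open>L\<^sup>2\<close>. Its limit is identified with \<open>X(t)\<close> by testing against \<open>exp L\<close> for finite linear combinations
  \<open>L\<close> of values of the coordinate process: the Ito equation makes \<open>t \<mapsto> \<bbbE>[X\<^sub>i(t) exp L]\<close> solve a scalar linear
  integral equation, whose variation of constants formula is exactly the limit of
  \<open>\<bbbE>[F\<^sub>K(X)\<^sub>i(t) exp L]\<close>. Such exponentials separate square integrable random variables because
  Laplace transforms on the path space are unique.
\<close>

section \<open>Laplace transforms\<close>

text \<open>Continuity of the Wick product in f is obtained for one fixed random variable at a time,
  without a uniform rate. Hence different truncations are compared only at the fixed process X,
  never at the solutions X^K, and the Lipschitz estimate is applied for equal truncation indices.
  The Ito integral is given only through tested expectations, so the limit has to be identified
  weakly. The tests are exp L because such L translates explicitly at every path: L changes by a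
  number, and testing turns the Wick product into multiplication by a scalar. A Wiener integral of a
  general element is only a version, defined up to null sets, without such a pathwise rule. For
  these L the kernel transform is moreover continuous in time, which makes the tested equation a
  classical one. Since exp L is unbounded, L1 convergence has to be combined with L2 bounds, which
  come from the bounded drift and from the contraction property of the projections.\<close>

lemma powser_eq_0_imp_coeff_0:
  fixes a :: "nat \<Rightarrow> real"
  assumes "\<And>x. (\<lambda>n. a n * x ^ n) sums 0"
  shows "a n = 0"
  using assms
proof (induction n arbitrary: a)
  case 0
  show ?case using sums_unique2[OF 0[of 0] powser_sums_zero[of a]] by simp
next
  case (Suc n)
  have s: "summable (\<lambda>n. a n * x ^ n)" for x using Suc.prems sums_summable by blast
  have z: "(\<lambda>x. \<Sum>n. a n * x ^ n) = (\<lambda>x. 0)" using Suc.prems sums_unique by fastforce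
  \<comment> \<open>The derivative of the zero function is the series with coefficients
    \<open>diffs a\<close>. Its n-th coefficient is (n+1) times \<open>a (Suc n)\<close>, so the
    induction hypothesis for \<open>diffs a\<close> yields the next coefficient.\<close>
  have "(\<lambda>n. diffs a n * x ^ n) sums 0" for x
  proof -
    have "((\<lambda>x. \<Sum>n. a n * x ^ n) has_field_derivative (\<Sum>n. diffs a n * x ^ n)) (at x)"
      by (rule termdiffs_strong_converges_everywhere) (rule s)
    then have "(\<Sum>n. diffs a n * x ^ n) = 0" unfolding z
      using DERIV_unique DERIV_const by blast
    moreover have "summable (\<lambda>n. diffs a n * x ^ n)"
      by (rule termdiff_converges_all) (rule s)
    ultimately show ?thesis by (metis summable_sums)
  qed
  then have "diffs a n = 0" by (rule Suc.IH)
  then show ?case by (simp add: diffs_def)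
qed

lemma Lp_rv_2: "Lp_rv M 2 Y \<Longrightarrow> integrable M (\<lambda>\<omega>. (Y \<omega>)\<^sup>2)"
proof -
  have "\<bar>x\<bar> powr 2 = x\<^sup>2" for x :: real by (simp add: powr_numeral)
  then show "Lp_rv M 2 Y \<Longrightarrow> integrable M (\<lambda>\<omega>. (Y \<omega>)\<^sup>2)" by (simp add: Lp_rv_def)
qed

lemma exp_abs_le_exp_add: "exp \<bar>x\<bar> \<le> exp x + exp (- x :: real)"
  by (cases "x \<ge> 0") (auto simp: abs_if)

text \<open>Real exponential moments of both signs dominate the exponential series for complex z.
  The moments of f therefore determine the real Laplace transform and the characteristic function
  alike.\<close>

lemma integral_exp_series:
  fixes f :: "'a \<Rightarrow> real" and z :: complex
  assumes f[measurable]: "f \<in> borel_measurable M"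
    and int: "\<And>r. integrable M (\<lambda>x. exp (r * f x))"
  shows "(\<lambda>n. of_real ((\<integral>x. f x ^ n \<partial>M) / fact n) * z ^ n) sums (\<integral>x. exp (z * of_real (f x)) \<partial>M)"
proof -
  define F where "F n x = (z * of_real (f x)) ^ n /\<^sub>R fact n" for n x
  have sumF: "(\<lambda>n. F n x) sums exp (z * of_real (f x))" for x
    unfolding F_def by (rule exp_converges)
  have nF: "norm (F n x) = (norm z * \<bar>f x\<bar>) ^ n /\<^sub>R fact n" for n x
    by (simp add: F_def norm_power norm_mult)
  have sumN: "(\<lambda>n. norm (F n x)) sums exp (norm z * \<bar>f x\<bar>)" for x
    unfolding nF by (rule exp_converges)
  \<comment> \<open>The two signs of the exponent together control the absolute value.\<close>
  have intE: "integrable M (\<lambda>x. exp (norm z * \<bar>f x\<bar>))"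
  proof (rule Bochner_Integration.integrable_bound[OF Bochner_Integration.integrable_add[OF int[of
    "norm z"] int[of "- norm z"]]])
    show "AE x in M. norm (exp (norm z * \<bar>f x\<bar>)) \<le> norm (exp (norm z * f x) + exp (- norm z * f x))"
      using exp_abs_le_exp_add[of "norm z * f x" for x] by (auto simp: abs_mult intro!: AE_I2)
  qed measurable
  have intF: "integrable M (F n)" for n
  proof (rule Bochner_Integration.integrable_bound[OF intE])
    show "F n \<in> borel_measurable M" unfolding F_def by measurable
    show "AE x in M. norm (F n x) \<le> norm (exp (norm z * \<bar>f x\<bar>))"
    proof (rule AE_I2)
      fix x
      have "norm (F n x) \<le> (\<Sum>k. norm (F k x))"
        using sum_le_suminf[OF sums_summable[OF sumN[of x]], of "{n}"] by simp
      then show "norm (F n x) \<le> norm (exp (norm z * \<bar>f x\<bar>))"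
        using sums_unique[OF sumN[of x]] by simp
    qed
  qed
  have "summable (\<lambda>n. \<integral>x. norm (F n x) \<partial>M)"
  proof (rule summableI_nonneg_bounded)
    fix N
    have "(\<Sum>n<N. \<integral>x. norm (F n x) \<partial>M) = (\<integral>x. (\<Sum>n<N. norm (F n x)) \<partial>M)"
      using intF by (simp add: integrable_norm)
    also have "\<dots> \<le> (\<integral>x. exp (norm z * \<bar>f x\<bar>) \<partial>M)"
    proof (rule integral_mono[OF _ intE])
      show "integrable M (\<lambda>x. \<Sum>n<N. norm (F n x))" using intF by (simp add: integrable_norm)
      show "(\<Sum>n<N. norm (F n x)) \<le> exp (norm z * \<bar>f x\<bar>)" for x
        using sum_le_suminf[OF sums_summable[OF sumN[of x]], of "{..<N}"] sums_unique[OF sumN[of x]] by simp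
    qed
    finally show "(\<Sum>n<N. \<integral>x. norm (F n x) \<partial>M) \<le> (\<integral>x. exp (norm z * \<bar>f x\<bar>) \<partial>M)" .
  qed simp
  then have "(\<lambda>n. integral\<^sup>L M (F n)) sums (\<integral>x. (\<Sum>n. F n x) \<partial>M)"
    using intF sums_summable[OF sumN] by (intro sums_integral) auto
  moreover have "(\<Sum>n. F n x) = exp (z * of_real (f x))" for x
    using sumF sums_unique by metis
  moreover have "integral\<^sup>L M (F n) = of_real ((\<integral>x. f x ^ n \<partial>M) / fact n) * z ^ n" for n
  proof -
    have "integral\<^sup>L M (F n) = (\<integral>x. (z ^ n / fact n) * of_real (f x ^ n) \<partial>M)"
      by (rule Bochner_Integration.integral_cong) (auto simp: F_def power_mult_distrib scaleR_conv_of_real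
        field_simps)
    also have "\<dots> = (z ^ n / fact n) * of_real (\<integral>x. f x ^ n \<partial>M)"
      by (simp only: integral_mult_right_zero integral_complex_of_real)
    finally show ?thesis by simp
  qed
  ultimately show ?thesis by simp
qed

text \<open>Equal Laplace transforms on the real line force equal moments, as coefficients of power
  series. Equal moments give equal transforms at imaginary arguments, which are the characteristic
  functions.\<close>

lemma laplace_transform_unique:
  fixes f :: "'a \<Rightarrow> real" and g :: "'b \<Rightarrow> real"
  assumes fin: "finite_measure M" "finite_measure N"
    and f[measurable]: "f \<in> borel_measurable M" and g[measurable]: "g \<in> borel_measurable N"
    and intf: "\<And>r. integrable M (\<lambda>x. exp (r * f x))"
    and intg: "\<And>r. integrable N (\<lambda>x. exp (r * g x))"
    and eq: "\<And>r. (\<integral>x. exp (r * f x) \<partial>M) = (\<integral>x. exp (r * g x) \<partial>N)"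
  shows "distr M borel f = distr N borel g"
proof -
  interpret M: finite_measure M by fact
  interpret N: finite_measure N by fact
  define a where "a n = (\<integral>x. f x ^ n \<partial>M) / fact n - (\<integral>x. g x ^ n \<partial>N) / fact n" for n
  have "(\<lambda>n. a n * r ^ n) sums 0" for r
  proof -
    have eqc: "(\<integral>x. exp (complex_of_real r * of_real (f x)) \<partial>M) = (\<integral>x. exp (complex_of_real r * of_real (g x)) \<partial>N)"
    proof -
      have "(\<integral>x. exp (complex_of_real r * of_real (f x)) \<partial>M) = (\<integral>x. complex_of_real (exp (r * f x)) \<partial>M)"
        by (simp add: exp_of_real flip: of_real_mult)
      also have "\<dots> = (\<integral>x. complex_of_real (exp (r * g x)) \<partial>N)" using eq by simp
      finally show ?thesis by (simp add: exp_of_real flip: of_real_mult)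
    qed
    from sums_diff[OF integral_exp_series[OF f intf, of "of_real r"] integral_exp_series[OF g intg, of
      "of_real r"]] eqc
    have "(\<lambda>n. complex_of_real (a n * r ^ n)) sums of_real 0"
      by (simp add: a_def algebra_simps)
    then show ?thesis by (simp only: sums_of_real_iff)
  qed
  then have "a n = 0" for n by (rule powser_eq_0_imp_coeff_0)
  then have m: "(\<integral>x. f x ^ n \<partial>M) / fact n = (\<integral>x. g x ^ n \<partial>N) / fact n" for n by (simp add: a_def)
  have ch: "(\<integral>x. exp (z * of_real (f x)) \<partial>M) = (\<integral>x. exp (z * of_real (g x)) \<partial>N)" for z :: complex
    using integral_exp_series[OF f intf, of z] integral_exp_series[OF g intg, of z] unfolding m
    by (rule sums_unique2)
  have mass: "measure M (space M) = measure N (space N)" using eq[of 0] by simp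
  show ?thesis
  proof (cases "measure M (space M) = 0")
    case True
    then have "emeasure M (space M) = 0" "emeasure N (space N) = 0"
      using mass by (auto simp: M.emeasure_eq_measure N.emeasure_eq_measure)
    then have "emeasure M A = 0" "emeasure N A' = 0" for A A'
      by (metis emeasure_space le_zero_eq)+
    then show ?thesis by (intro measure_eqI) (auto simp: emeasure_distr)
  next
    case False
    \<comment> \<open>Levy's uniqueness theorem concerns probability measures, so both image
      measures are divided by their common positive mass.\<close>
    define m where "m = measure M (space M)"
    have mp: "m > 0" using False by (simp add: m_def zero_less_measure_iff)
    define DM where "DM = density (distr M borel f) (\<lambda>_. ennreal (1 / m))"
    define DN where "DN = density (distr N borel g) (\<lambda>_. ennreal (1 / m))"
    have "real_distribution DM"
      unfolding real_distribution_def real_distribution_axioms_def DM_def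
      using mp by (auto intro!: prob_spaceI simp: emeasure_density nn_integral_distr nn_integral_cmult_indicator
          emeasure_distr M.emeasure_eq_measure m_def[symmetric] ennreal_mult'[symmetric])
    moreover have "real_distribution DN"
      unfolding real_distribution_def real_distribution_axioms_def DN_def
      using mp mass by (auto intro!: prob_spaceI simp: emeasure_density nn_integral_distr nn_integral_cmult_indicator
          emeasure_distr N.emeasure_eq_measure m_def[symmetric] ennreal_mult'[symmetric])
    moreover have "char DM = char DN"
    proof
      fix t
      have "char DM t = (1 / m) *\<^sub>R (\<integral>x. exp (\<i> * of_real t * of_real (f x)) \<partial>M)"
        unfolding char_def DM_def using mp by (simp add: integral_density integral_distr mult.assoc)
      also have "\<dots> = (1 / m) *\<^sub>R (\<integral>x. exp (\<i> * of_real t * of_real (g x)) \<partial>N)" by (simp only: ch)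
      also have "\<dots> = char DN t"
        unfolding char_def DN_def using mp by (simp add: integral_density integral_distr mult.assoc)
      finally show "char DM t = char DN t" .
    qed
    ultimately have D: "DM = DN" by (rule Levy_uniqueness)
    show ?thesis
    proof (rule measure_eqI)
      fix A assume A: "A \<in> sets (distr M borel f)"
      then have [measurable]: "A \<in> sets borel" by simp
      have "ennreal (1 / m) * emeasure (distr M borel f) A = emeasure DM A"
        unfolding DM_def by (simp add: emeasure_density nn_integral_cmult_indicator)
      also have "\<dots> = ennreal (1 / m) * emeasure (distr N borel g) A"
        unfolding D unfolding DN_def by (simp add: emeasure_density nn_integral_cmult_indicator)
      finally show "emeasure (distr M borel f) A = emeasure (distr N borel g) A"
        using mp by (simp add: ennreal_mult_cancel_left)
    qed simp
  qed
qed

lemma (in prob_space) centered_gaussian_mgf: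
  assumes "centered_gaussian M X"
  shows "integrable M (\<lambda>\<omega>. (X \<omega>)\<^sup>2)"
    and "integrable M (\<lambda>\<omega>. exp (a * X \<omega>))"
    and "(\<integral>\<omega>. exp (a * X \<omega>) \<partial>M) = exp (a\<^sup>2 * (\<integral>\<omega>. (X \<omega>)\<^sup>2 \<partial>M) / 2)"
proof -
  have [measurable]: "X \<in> borel_measurable M" using assms by (simp add: centered_gaussian_def)
  have *: "integrable M (\<lambda>\<omega>. (X \<omega>)\<^sup>2) \<and> integrable M (\<lambda>\<omega>. exp (a * X \<omega>)) \<and>
    (\<integral>\<omega>. exp (a * X \<omega>) \<partial>M) = exp (a\<^sup>2 * (\<integral>\<omega>. (X \<omega>)\<^sup>2 \<partial>M) / 2)"
  proof (cases "AE \<omega> in M. X \<omega> = 0")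
    case True
    have 1: "integrable M (\<lambda>\<omega>. (X \<omega>)\<^sup>2) \<longleftrightarrow> integrable M (\<lambda>\<omega>. 0::real)"
      using True by (intro integrable_cong_AE) auto
    have 2: "integrable M (\<lambda>\<omega>. exp (a * X \<omega>)) \<longleftrightarrow> integrable M (\<lambda>\<omega>. 1::real)"
      using True by (intro integrable_cong_AE) auto
    have 3: "(\<integral>\<omega>. exp (a * X \<omega>) \<partial>M) = (\<integral>\<omega>. 1 \<partial>M)"
      using True by (intro integral_cong_AE) auto
    have 4: "(\<integral>\<omega>. (X \<omega>)\<^sup>2 \<partial>M) = (\<integral>\<omega>. 0 \<partial>M)"
      using True by (intro integral_cong_AE) auto
    show ?thesis using 1 2 3 4 by (simp add: prob_space)
  next
    case False
    then obtain v where v: "v > 0" and D: "distributed M lborel X (\<lambda>x. ennreal (normal_density 0 v x))"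
      using assms by (auto simp: centered_gaussian_def)
    have i2: "integrable M (\<lambda>\<omega>. (X \<omega>)\<^sup>2)"
      using distributed_integrable[OF D, of "\<lambda>x. x\<^sup>2"] integrable_normal_moment[OF v, of 0 2]
        by (simp add: mult.commute)
    have var: "(\<integral>\<omega>. (X \<omega>)\<^sup>2 \<partial>M) = v\<^sup>2"
      using normal_distributed_variance[OF v D] normal_distributed_expectation[OF v D] by simp
    \<comment> \<open>Completing the square: an exponential tilt moves the mean of a normal density
      to \<open>a * v\<^sup>2\<close> and leaves its variance unchanged.\<close>
    have nd: "normal_density 0 v x * exp (a * x) = exp (a\<^sup>2 * v\<^sup>2 / 2) * normal_density (a * v\<^sup>2) v x" for x
    proof -
      have "- x\<^sup>2 / (2 * v\<^sup>2) + a * x = a\<^sup>2 * v\<^sup>2 / 2 + - (x - a * v\<^sup>2)\<^sup>2 / (2 * v\<^sup>2)"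
        using v by (simp add: field_simps power2_eq_square)
      then show ?thesis
        unfolding normal_density_def by (simp add: exp_add[symmetric])
    qed
    have "integrable lborel (\<lambda>x. normal_density 0 v x * exp (a * x))"
      unfolding nd using v by simp
    then have i1: "integrable M (\<lambda>\<omega>. exp (a * X \<omega>))"
      by (subst distributed_integrable[OF D, of "\<lambda>x. exp (a * x)", symmetric]) auto
    have "(\<integral>\<omega>. exp (a * X \<omega>) \<partial>M) = (\<integral>x. normal_density 0 v x * exp (a * x) \<partial>lborel)"
      by (subst distributed_integral[OF D, of "\<lambda>x. exp (a * x)"]) auto
    also have "\<dots> = exp (a\<^sup>2 * v\<^sup>2 / 2)" unfolding nd using v by simp
    finally show ?thesis using i1 i2 var by simp
  qed
  show "integrable M (\<lambda>\<omega>. (X \<omega>)\<^sup>2)" "integrable M (\<lambda>\<omega>. exp (a * X \<omega>))"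
    "(\<integral>\<omega>. exp (a * X \<omega>) \<partial>M) = exp (a\<^sup>2 * (\<integral>\<omega>. (X \<omega>)\<^sup>2 \<partial>M) / 2)"
    using * by auto
qed

section \<open>Convergence and measurability\<close>

lemma abs_exp_diff_le: "\<bar>exp x - exp y\<bar> \<le> \<bar>x - y\<bar> * (exp x + exp (y::real))"
proof -
  have *: "exp v - exp u \<le> (v - u) * (exp u + exp v)" if "u \<le> v" for u v :: real
  proof -
    have "1 - (v - u) \<le> exp (- (v - u))" using exp_ge_add_one_self[of "-(v-u)"] by (simp only: diff_conv_add_uminus)
    then have "exp v * (1 - (v - u)) \<le> exp v * exp (- (v - u))" by (intro mult_left_mono) auto
    also have "\<dots> = exp u" by (simp add: exp_add[symmetric])
    finally have "exp v - exp u \<le> (v - u) * exp v" by (simp add: algebra_simps)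
    also have "\<dots> \<le> (v - u) * (exp u + exp v)" using that by (intro mult_left_mono) auto
    finally show ?thesis .
  qed
  show ?thesis using *[of x y] *[of y x] by (cases "x \<le> y") (auto simp: abs_if algebra_simps)
qed

text \<open>Young's inequality with weight \<epsilon> turns the product of increment and
  exponentials into a sum. Integrating it gives a term that is small through \<epsilon> and a term
  that is small through L2 convergence of the exponents.\<close>

lemma abs_exp_diff_le_weighted:
  assumes "\<epsilon> > 0"
  shows "\<bar>exp x - exp y\<bar> \<le> \<epsilon> * (exp (2 * x) + exp (2 * y)) + (x - y)\<^sup>2 / (2 * \<epsilon> :: real)"
proof -
  let ?G = "exp x + exp y"
  have "?G\<^sup>2 \<le> 2 * (exp (2 * x) + exp (2 * y))"
  proof -
    have "0 \<le> (exp x - exp y)\<^sup>2" by simp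
    then show ?thesis by (simp add: power2_eq_square algebra_simps flip: exp_add)
  qed
  then have "\<epsilon> * ?G\<^sup>2 \<le> \<epsilon> * (2 * (exp (2 * x) + exp (2 * y)))" using assms by (intro mult_left_mono) auto
  moreover have "2 * \<epsilon> * (\<bar>x - y\<bar> * ?G) \<le> \<epsilon> * (\<epsilon> * ?G\<^sup>2) + (x - y)\<^sup>2"
  proof -
    have "0 \<le> (\<bar>x - y\<bar> - \<epsilon> * ?G)\<^sup>2" by simp
    then show ?thesis by (simp add: power2_diff power_mult_distrib algebra_simps power2_eq_square)
  qed
  then have "\<bar>x - y\<bar> * ?G \<le> \<epsilon> * ?G\<^sup>2 / 2 + (x - y)\<^sup>2 / (2 * \<epsilon>)"
    using assms by (simp add: field_simps power2_eq_square)
  ultimately show ?thesis using abs_exp_diff_le[of x y] by linarith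
qed

lemma exp_tendsto_L1:
  fixes U :: "nat \<Rightarrow> 'a \<Rightarrow> real" and V :: "'a \<Rightarrow> real"
  assumes [measurable]: "\<And>n. U n \<in> borel_measurable M" "V \<in> borel_measurable M"
    and iU: "\<And>n. integrable M (\<lambda>x. exp (2 * U n x))" and iV: "integrable M (\<lambda>x. exp (2 * V x))"
    and bU: "\<And>n. (\<integral>x. exp (2 * U n x) \<partial>M) \<le> C"
    and i2: "\<And>n. integrable M (\<lambda>x. (U n x - V x)\<^sup>2)"
    and lim: "(\<lambda>n. \<integral>x. (U n x - V x)\<^sup>2 \<partial>M) \<longlonglongrightarrow> 0"
  shows "(\<lambda>n. \<integral>x. \<bar>exp (U n x) - exp (V x)\<bar> \<partial>M) \<longlonglongrightarrow> 0"
proof (rule LIMSEQ_I)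
  fix r :: real assume r: "r > 0"
  let ?D = "C + (\<integral>x. exp (2 * V x) \<partial>M)"
  have "0 \<le> (\<integral>x. exp (2 * U 0 x) \<partial>M)" "0 \<le> (\<integral>x. exp (2 * V x) \<partial>M)" by simp_all
  with bU[of 0] have Dpos: "?D \<ge> 0" by linarith
  \<comment> \<open>The summand 1 keeps the quotient meaningful for a vanishing moment bound and
    makes the first half of the estimate strictly less than r/2.\<close>
  define \<epsilon> where "\<epsilon> = r / (2 * (?D + 1))"
  have e: "\<epsilon> > 0" using r Dpos by (simp add: \<epsilon>_def)
  have "\<epsilon> * ?D < \<epsilon> * (?D + 1)" using e by simp
  also have "\<epsilon> * (?D + 1) = r / 2"
  proof -
    have "r / (2 * x) * x = r / 2" if "x > 0" for x :: real using that by simp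
    from this[of "?D + 1"] Dpos show ?thesis unfolding \<epsilon>_def by linarith
  qed
  finally have eD: "\<epsilon> * ?D < r / 2" .
  have "\<forall>\<^sub>F n in sequentially. (\<integral>x. (U n x - V x)\<^sup>2 \<partial>M) < r * \<epsilon>"
    using lim r e by (intro order_tendstoD(2)) auto
  then obtain N where N: "\<And>n. n \<ge> N \<Longrightarrow> (\<integral>x. (U n x - V x)\<^sup>2 \<partial>M) < r * \<epsilon>"
    by (auto simp: eventually_sequentially)
  show "\<exists>N. \<forall>n\<ge>N. norm ((\<integral>x. \<bar>exp (U n x) - exp (V x)\<bar> \<partial>M) - 0) < r"
  proof (intro exI allI impI)
    fix n assume n: "n \<ge> N"
    have "(\<integral>x. \<bar>exp (U n x) - exp (V x)\<bar> \<partial>M) \<le>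
      (\<integral>x. \<epsilon> * (exp (2 * U n x) + exp (2 * V x)) + (U n x - V x)\<^sup>2 / (2 * \<epsilon>) \<partial>M)"
    proof (rule integral_mono')
      show "integrable M (\<lambda>x. \<epsilon> * (exp (2 * U n x) + exp (2 * V x)) + (U n x - V x)\<^sup>2 / (2 * \<epsilon>))"
        using iU iV i2 by simp
      show "0 \<le> \<epsilon> * (exp (2 * U n x) + exp (2 * V x)) + (U n x - V x)\<^sup>2 / (2 * \<epsilon>)" for x
        using e by (intro add_nonneg_nonneg mult_nonneg_nonneg divide_nonneg_pos) auto
    qed (rule abs_exp_diff_le_weighted[OF e])
    also have "\<dots> = \<epsilon> * ((\<integral>x. exp (2 * U n x) \<partial>M) + (\<integral>x. exp (2 * V x) \<partial>M)) + (\<integral>x. (U n x - V x)\<^sup>2 \<partial>M) / (2 * \<epsilon>)"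
      using iU[of n] iV i2[of n] by simp
    also have "\<dots> < r"
    proof -
      have "\<epsilon> * ((\<integral>x. exp (2 * U n x) \<partial>M) + (\<integral>x. exp (2 * V x) \<partial>M)) \<le> \<epsilon> * ?D"
        using bU[of n] e by (intro mult_left_mono) auto
      moreover have "(\<integral>x. (U n x - V x)\<^sup>2 \<partial>M) / (2 * \<epsilon>) < r / 2"
        using N[OF n] e by (simp add: field_simps)
      ultimately show ?thesis using eD by linarith
    qed
    finally show "norm ((\<integral>x. \<bar>exp (U n x) - exp (V x)\<bar> \<partial>M) - 0) < r" by simp
  qed
qed

text \<open>The almost surely convergent subsequence is part of the conclusion because it allows
  Fatou's lemma to transfer second moment bounds to the limit.\<close>

lemma L1_complete:
  fixes u :: "nat \<Rightarrow> 'a \<Rightarrow> real"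
  assumes u: "\<And>n. integrable M (u n)"
    and cauchy: "\<And>\<epsilon>. \<epsilon> > 0 \<Longrightarrow> \<exists>N. \<forall>i\<ge>N. \<forall>j\<ge>N. (\<integral>x. \<bar>u i x - u j x\<bar> \<partial>M) < \<epsilon>"
  obtains v r where "integrable M v" "strict_mono (r :: nat \<Rightarrow> nat)" "AE x in M. (\<lambda>n. u (r n) x) \<longlonglongrightarrow> v x"
    "(\<lambda>n. \<integral>x. \<bar>u n x - v x\<bar> \<partial>M) \<longlonglongrightarrow> 0"
proof -
  have [measurable]: "u n \<in> borel_measurable M" for n using u by auto
  obtain r :: "nat \<Rightarrow> nat" where r: "strict_mono r" and c: "AE x in M. Cauchy (\<lambda>i. u (r i) x)"
    by (rule cauchy_L1_AE_cauchy_subseq[of M u]) (use u cauchy in auto)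
  define v where "v x = lim (\<lambda>i. u (r i) x)" for x
  have [measurable]: "v \<in> borel_measurable M" unfolding v_def by measurable
  have conv: "AE x in M. (\<lambda>i. u (r i) x) \<longlonglongrightarrow> v x"
    using c by eventually_elim (simp add: v_def real_Cauchy_convergent convergent_LIMSEQ_iff[symmetric]
      Cauchy_convergent_iff)
  \<comment> \<open>Integrability of \<open>v\<close> is still open at this point, so Fatou's lemma
    is applied to ennreal integrals along the subsequence.\<close>
  have key: "\<exists>N. \<forall>n\<ge>N. (\<integral>\<^sup>+x. ennreal \<bar>u n x - v x\<bar> \<partial>M) \<le> ennreal \<epsilon>" if e: "\<epsilon> > 0" for \<epsilon>
  proof -
    obtain N where N: "\<And>i j. i \<ge> N \<Longrightarrow> j \<ge> N \<Longrightarrow> (\<integral>x. \<bar>u i x - u j x\<bar> \<partial>M) < \<epsilon>" using cauchy[OF e] by blast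
    have "(\<integral>\<^sup>+x. ennreal \<bar>u n x - v x\<bar> \<partial>M) \<le> ennreal \<epsilon>" if n: "n \<ge> N" for n
    proof -
      have "(\<integral>\<^sup>+x. ennreal \<bar>u n x - v x\<bar> \<partial>M) = (\<integral>\<^sup>+x. liminf (\<lambda>i. ennreal \<bar>u n x - u (r i) x\<bar>) \<partial>M)"
      proof (rule nn_integral_cong_AE)
        show "AE x in M. ennreal \<bar>u n x - v x\<bar> = liminf (\<lambda>i. ennreal \<bar>u n x - u (r i) x\<bar>)"
          using conv
        proof eventually_elim
          case (elim x)
          then have "(\<lambda>i. ennreal \<bar>u n x - u (r i) x\<bar>) \<longlonglongrightarrow> ennreal \<bar>u n x - v x\<bar>"
            by (intro tendsto_ennrealI tendsto_intros)
          then show ?case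
            by (intro lim_imp_Liminf[symmetric]) (auto intro: tendsto_ennrealI)
        qed
      qed
      also have "\<dots> \<le> liminf (\<lambda>i. \<integral>\<^sup>+x. ennreal \<bar>u n x - u (r i) x\<bar> \<partial>M)"
        by (intro nn_integral_liminf) measurable
      also have "\<dots> \<le> ennreal \<epsilon>"
      proof (rule Liminf_le)
        show "sequentially \<noteq> bot" by simp
        have "(\<integral>\<^sup>+x. ennreal \<bar>u n x - u (r i) x\<bar> \<partial>M) \<le> ennreal \<epsilon>" if "i \<ge> N" for i
        proof -
          have "r i \<ge> N" using that seq_suble[OF r, of i] by simp
          then show ?thesis using N[OF n, of "r i"] u
            by (subst nn_integral_eq_integral) (auto intro!: ennreal_leI)
        qed
        then show "\<forall>\<^sub>F i in sequentially. (\<integral>\<^sup>+x. ennreal \<bar>u n x - u (r i) x\<bar> \<partial>M) \<le> ennreal \<epsilon>"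
          by (auto simp: eventually_sequentially)
      qed
      finally show ?thesis .
    qed
    then show ?thesis by blast
  qed
  obtain N1 where N1: "(\<integral>\<^sup>+x. ennreal \<bar>u N1 x - v x\<bar> \<partial>M) \<le> ennreal 1" using key[of 1] by force
  have "integrable M (\<lambda>x. u N1 x - v x)"
    by (rule integrableI_bounded) (auto intro: le_less_trans[OF N1])
  then have iv: "integrable M v"
    using Bochner_Integration.integrable_diff[OF u[of N1], of "\<lambda>x. u N1 x - v x"] by simp
  have "(\<lambda>n. \<integral>x. \<bar>u n x - v x\<bar> \<partial>M) \<longlonglongrightarrow> 0"
  proof (rule LIMSEQ_I)
    fix e :: real assume e: "e > 0"
    obtain N where N: "\<And>n. n \<ge> N \<Longrightarrow> (\<integral>\<^sup>+x. ennreal \<bar>u n x - v x\<bar> \<partial>M) \<le> ennreal (e / 2)"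
      using key[of "e/2"] e by auto
    have "norm ((\<integral>x. \<bar>u n x - v x\<bar> \<partial>M) - 0) < e" if "n \<ge> N" for n
    proof -
      have "ennreal (\<integral>x. \<bar>u n x - v x\<bar> \<partial>M) \<le> ennreal (e / 2)"
        using N[OF that] u iv by (subst (asm) nn_integral_eq_integral) auto
      then show ?thesis using e by (simp add: ennreal_le_iff)
    qed
    then show "\<exists>N. \<forall>n\<ge>N. norm ((\<integral>x. \<bar>u n x - v x\<bar> \<partial>M) - 0) < e" by blast
  qed
  with that iv r conv show thesis by blast
qed

text \<open>By continuity in s the function is the limit of its values at the grid points
  floor((n+1)s)/(n+1), and each approximation involves only countably many measurable
  sections.\<close>

lemma borel_measurable_caratheodory:
  fixes F :: "real \<Rightarrow> 'a \<Rightarrow> 'b::metric_space"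
  assumes m: "\<And>s. F s \<in> borel_measurable M"
    and c: "\<And>x. x \<in> space M \<Longrightarrow> continuous_on UNIV (\<lambda>s. F s x)"
  shows "(\<lambda>p. F (fst p) (snd p)) \<in> borel_measurable (borel \<Otimes>\<^sub>M M)"
proof (rule borel_measurable_LIMSEQ_metric)
  fix n :: nat
  have "(\<lambda>p. F (real_of_int k / real (Suc n)) (snd p)) \<in> borel_measurable ((borel :: real measure) \<Otimes>\<^sub>M M)" for k
    using m by (intro measurable_compose[OF measurable_snd]) auto
  moreover have "(\<lambda>p. \<lfloor>real (Suc n) * fst p\<rfloor>) \<in> measurable ((borel :: real measure) \<Otimes>\<^sub>M M) (count_space UNIV)"
    by measurable
  ultimately show "(\<lambda>p. F (real_of_int \<lfloor>real (Suc n) * fst p\<rfloor> / real (Suc n)) (snd p)) \<in> borel_measurable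
    (borel \<Otimes>\<^sub>M M)"
    by (rule measurable_compose_countable)
next
  fix p :: "real \<times> 'a" assume p: "p \<in> space (borel \<Otimes>\<^sub>M M)"
  let ?s = "fst p"
  have "(\<lambda>n. real_of_int \<lfloor>real (Suc n) * ?s\<rfloor> / real (Suc n)) \<longlonglongrightarrow> ?s"
  proof (rule real_tendsto_sandwich[where f="\<lambda>n. ?s - 1 / real (Suc n)" and h="\<lambda>_. ?s"])
    show "\<forall>\<^sub>F n in sequentially. ?s - 1 / real (Suc n) \<le> real_of_int \<lfloor>real (Suc n) * ?s\<rfloor> / real (Suc n)"
    proof (rule always_eventually, rule allI)
      fix n
      have "real (Suc n) * ?s - 1 \<le> real_of_int \<lfloor>real (Suc n) * ?s\<rfloor>" by linarith
      then have "(real (Suc n) * ?s - 1) / real (Suc n) \<le> real_of_int \<lfloor>real (Suc n) * ?s\<rfloor> / real (Suc n)"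
        by (rule divide_right_mono) simp
      then show "?s - 1 / real (Suc n) \<le> real_of_int \<lfloor>real (Suc n) * ?s\<rfloor> / real (Suc n)"
        by (simp add: diff_divide_distrib del: of_nat_Suc)
    qed
    show "\<forall>\<^sub>F n in sequentially. real_of_int \<lfloor>real (Suc n) * ?s\<rfloor> / real (Suc n) \<le> ?s"
    proof (rule always_eventually, rule allI)
      fix n
      have "real_of_int \<lfloor>real (Suc n) * ?s\<rfloor> / real (Suc n) \<le> real (Suc n) * ?s / real (Suc n)"
        by (rule divide_right_mono) auto
      then show "real_of_int \<lfloor>real (Suc n) * ?s\<rfloor> / real (Suc n) \<le> ?s" by (simp del: of_nat_Suc)
    qed
    show "(\<lambda>n. ?s - 1 / real (Suc n)) \<longlonglongrightarrow> ?s"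
      using tendsto_diff[OF tendsto_const LIMSEQ_inverse_real_of_nat, of ?s] by (simp add: inverse_eq_divide)
  qed simp
  moreover have "isCont (\<lambda>s. F s (snd p)) ?s"
    using c[of "snd p"] p by (auto simp: space_pair_measure continuous_on_eq_continuous_at)
  ultimately show "(\<lambda>n. F (real_of_int \<lfloor>real (Suc n) * ?s\<rfloor> / real (Suc n)) (snd p)) \<longlonglongrightarrow> F ?s (snd p)"
    by (rule isCont_tendsto_compose[rotated])
qed

text \<open>Iterating the inequality from the bound M produces M (Ct)^n / n!, which tends to 0. With
  ennreal values the statement applies directly to an upper limit of L1 distances.\<close>

lemma gronwall_eq_0:
  fixes v :: "real \<Rightarrow> ennreal"
  assumes [measurable]: "v \<in> borel_measurable borel"
    and M: "\<And>t. t \<in> {0..T} \<Longrightarrow> v t \<le> ennreal M" "M \<ge> 0" and C: "C \<ge> 0"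
    and le: "\<And>t. t \<in> {0..T} \<Longrightarrow> v t \<le> ennreal C * (\<integral>\<^sup>+s. v s * indicator {0..t} s \<partial>lborel)"
    and t: "t \<in> {0..T}"
  shows "v t = 0"
proof -
  have step: "v t \<le> ennreal (M * (C * t) ^ n / fact n)" if "t \<in> {0..T}" for n t
    using that
  proof (induction n arbitrary: t)
    case 0
    then show ?case using M by simp
  next
    case (Suc n)
    define F where "F s = M * C ^ n / fact (Suc n) * s ^ Suc n" for s :: real
    have D: "(F has_real_derivative M * (C * s) ^ n / fact n) (at s)" for s
    proof -
      have "(F has_real_derivative M * C ^ n / fact (Suc n) * (real (Suc n) * s ^ n)) (at s)"
        unfolding F_def using DERIV_cmult[OF DERIV_pow[of "Suc n" s UNIV], of "M * C ^ n / fact (Suc n)"] by simp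
      also have "M * C ^ n / fact (Suc n) * (real (Suc n) * s ^ n) = M * (C * s) ^ n / fact n"
        by (simp add: power_mult_distrib del: of_nat_Suc)
      finally show ?thesis .
    qed
    have "(\<integral>\<^sup>+s. v s * indicator {0..t} s \<partial>lborel) \<le> (\<integral>\<^sup>+s. ennreal (M * (C * s) ^ n / fact n) * indicator {0..t}
      s \<partial>lborel)"
      using Suc.IH Suc.prems by (intro nn_integral_mono) (auto simp: indicator_def)
    also have "\<dots> = ennreal (F t - F 0)"
      using Suc.prems M C by (intro nn_integral_FTC_Icc D) auto
    finally have "v t \<le> ennreal C * ennreal (F t - F 0)"
      using le[OF Suc.prems] by (meson mult_left_mono order_trans zero_le)
    also have "\<dots> = ennreal (M * (C * t) ^ Suc n / fact (Suc n))"
      using C by (simp add: F_def ennreal_mult'[symmetric] power_mult_distrib mult_ac)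
    finally show ?case .
  qed
  have "(\<lambda>n. M * ((C * t) ^ n /\<^sub>R fact n)) \<longlonglongrightarrow> M * 0"
    by (intro tendsto_mult tendsto_const summable_LIMSEQ_zero[OF summable_exp_generic])
  then have "(\<lambda>n. ennreal (M * (C * t) ^ n / fact n)) \<longlonglongrightarrow> ennreal 0"
    by (intro tendsto_ennrealI) (simp add: field_simps)
  then have "v t \<le> ennreal 0"
    by (rule LIMSEQ_le_const) (use step[OF t] in auto)
  then show ?thesis by simp
qed

section \<open>Orthogonal projections and a linear integral equation\<close>

text \<open>The Fourier sum of the orthogonal projection. It exhibits the projection as a finite
  combination of the e_k with coefficients continuous in x, from which measurability in time is read
  off later.\<close>

definition fproj :: "(nat \<Rightarrow> 'h::real_inner) \<Rightarrow> nat \<Rightarrow> 'h \<Rightarrow> 'h" where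
  "fproj e K x = (\<Sum>k=1..K. inner x (e k) *\<^sub>R e k)"

lemma fproj_orthogonal:
  assumes "complete_orthonormal e" and z: "z \<in> span (e ` {1..K})"
  shows "inner (x - fproj e K x) z = 0"
  using z
proof (induction rule: span_induct_alt)
  case base
  show ?case by simp
next
  case (step c y z)
  then obtain j where j: "j \<in> {1..K}" "y = e j" by auto
  have on: "\<And>j k. 1 \<le> j \<Longrightarrow> 1 \<le> k \<Longrightarrow> inner (e j) (e k) = (if j = k then 1 else 0)"
    using assms(1) by (auto simp: complete_orthonormal_def)
  have "inner (fproj e K x) (e j) = (\<Sum>k=1..K. inner x (e k) * (if k = j then 1 else 0))"
    unfolding fproj_def inner_sum_left using on j by (intro sum.cong) auto
  also have "\<dots> = inner x (e j)" using j by (simp add: if_distrib cong: if_cong)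
  finally have "inner (x - fproj e K x) y = 0" using j by (simp add: inner_diff_left)
  then show ?case using step by (simp add: inner_add_right)
qed

lemma fproj_in_span: "fproj e K x \<in> span (e ` {1..K})"
  unfolding fproj_def by (intro span_sum span_scale span_base) auto

lemma orth_proj_eq_fproj:
  assumes "complete_orthonormal e"
  shows "orth_proj (span (e ` {1..K})) x = fproj e K x"
  unfolding orth_proj_def
proof (rule the_equality)
  show "fproj e K x \<in> span (e ` {1..K}) \<and> (\<forall>z\<in>span (e ` {1..K}). orthogonal (x - fproj e K x) z)"
    using fproj_orthogonal[OF assms] fproj_in_span by (auto simp: orthogonal_def)
next
  fix y assume y: "y \<in> span (e ` {1..K}) \<and> (\<forall>z\<in>span (e ` {1..K}). orthogonal (x - y) z)"
  define z where "z = y - fproj e K x"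
  have z: "z \<in> span (e ` {1..K})" unfolding z_def using y fproj_in_span by (intro span_diff) auto
  have "inner z z = inner (x - fproj e K x) z - inner (x - y) z" by (simp add: z_def inner_diff_left)
  also have "\<dots> = 0" using fproj_orthogonal[OF assms z] y z by (auto simp: orthogonal_def)
  finally show "y = fproj e K x" by (simp add: z_def)
qed

lemma norm_fproj_error_le:
  assumes "complete_orthonormal e" and y: "y \<in> span (e ` {1..K})"
  shows "norm (x - fproj e K x) \<le> norm (x - y)"
proof -
  let ?p = "fproj e K x"
  have "inner (x - ?p) (?p - y) = 0"
    by (rule fproj_orthogonal[OF assms(1) span_diff[OF fproj_in_span y]])
  then have "(norm (x - y))\<^sup>2 = (norm (x - ?p))\<^sup>2 + (norm (?p - y))\<^sup>2"
    using norm_add_Pythagorean[of "x - ?p" "?p - y"] by (simp add: orthogonal_def)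
  then have "(norm (x - ?p))\<^sup>2 \<le> (norm (x - y))\<^sup>2" by simp
  then show ?thesis using power2_le_imp_le norm_ge_zero by blast
qed

lemma norm_fproj_le:
  assumes "complete_orthonormal e"
  shows "norm (fproj e K x) \<le> norm x"
proof -
  let ?p = "fproj e K x"
  have "inner (x - ?p) ?p = 0"
    by (rule fproj_orthogonal[OF assms(1) fproj_in_span])
  then have "(norm x)\<^sup>2 = (norm (x - ?p))\<^sup>2 + (norm ?p)\<^sup>2"
    using norm_add_Pythagorean[of "x - ?p" "?p"] by (simp add: orthogonal_def)
  then have "(norm ?p)\<^sup>2 \<le> (norm x)\<^sup>2" by simp
  then show ?thesis using power2_le_imp_le norm_ge_zero by blast
qed

lemma fproj_tendsto:
  assumes e: "complete_orthonormal e"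
  shows "(\<lambda>K. fproj e K x) \<longlonglongrightarrow> x"
proof (rule metric_LIMSEQ_I)
  fix r :: real assume r: "r > 0"
  have "x \<in> closure (span (e ` {1..}))" using e by (simp add: complete_orthonormal_def)
  then obtain y where y: "y \<in> span (e ` {1..})" "dist y x < r"
    using r by (auto simp: closure_approachable)
  then obtain S where S: "finite S" "S \<subseteq> e ` {1..}" "y \<in> span S"
    using span_explicit'[of "e ` {1..}"] unfolding span_explicit by (auto intro!: span_sum span_scale span_base)
  then obtain I where I: "finite I" "I \<subseteq> {1..}" "S = e ` I" by (metis finite_subset_image)
  \<comment> \<open>Adding 1 to \<open>I\<close> makes \<open>Max\<close> meaningful when the
    approximating combination is empty.\<close>
  have "dist (fproj e K x) x < r" if K: "K \<ge> Max (insert 1 I)" for K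
  proof -
    have "I \<subseteq> {1..K}" using I K by (auto intro: order_trans[OF Max_ge])
    then have "y \<in> span (e ` {1..K})" using S I span_mono by (metis image_mono subsetD)
    from norm_fproj_error_le[OF e this, of x] y show ?thesis
      by (simp add: dist_norm norm_minus_commute)
  qed
  then show "\<exists>no. \<forall>n\<ge>no. dist (fproj e n x) x < r" by blast
qed

text \<open>Variation of constants. Continuity of u is a consequence of the equation, whose
  right-hand side is built from indefinite integrals; after that the equation can be
  differentiated.\<close>

lemma linear_integral_equation:
  fixes u a \<beta> :: "real \<Rightarrow> real"
  assumes a: "continuous_on {0..T} a" and \<beta>: "continuous_on {0..T} \<beta>"
    and int: "\<And>t. t \<in> {0..T} \<Longrightarrow> set_integrable lborel {0..t} (\<lambda>s. a s * u s)"
    and eq: "\<And>t. t \<in> {0..T} \<Longrightarrow> u t = c + (LBINT s:{0..t}. \<beta> s) + (LBINT s:{0..t}. a s * u s)"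
    and t: "t \<in> {0..T}"
  shows "u t = c * exp (LBINT r:{0..t}. a r) + (LBINT s:{0..t}. \<beta> s * exp (LBINT r:{s..t}. a r))"
proof -
  have T: "T \<ge> 0" using t by simp
  have conv: "(LBINT s:{x..y}. f s) = integral {x..y} f" if "continuous_on {0..T} f" "x \<ge> 0" "y \<le> T" for f ::
    "real \<Rightarrow> real" and x y
  proof (rule set_borel_integral_eq_integral(2))
    show "set_integrable lborel {x..y} f"
      using that by (intro borel_integrable_atLeastAtMost' continuous_on_subset[OF that(1)]) auto
  qed
  have au: "(\<lambda>s. a s * u s) integrable_on {0..T}" "\<And>t. t \<in> {0..T} \<Longrightarrow> (LBINT s:{0..t}. a s * u s)
    = integral {0..t} (\<lambda>s. a s * u s)"
    using set_borel_integral_eq_integral[OF int] T by auto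
  have eq': "u t = c + integral {0..t} \<beta> + integral {0..t} (\<lambda>s. a s * u s)" if "t \<in> {0..T}" for t
    using eq[OF that] au(2)[OF that] conv[OF \<beta>, of 0 t] that by simp
  have "continuous_on {0..T} (\<lambda>t. c + integral {0..t} \<beta> + integral {0..t} (\<lambda>s. a s * u s))"
    by (intro continuous_intros \<beta> au indefinite_integral_continuous_1 integrable_continuous_real)
  then have cu: "continuous_on {0..T} u" by (rule continuous_on_eq) (simp add: eq')
  define A where "A t = integral {0..t} a" for t
  \<comment> \<open>The defect between the claimed formula and u, both multiplied by the integrating
    factor \<open>exp (- A t)\<close>. Its derivative vanishes and so does its value at 0.\<close>
  define w where "w t = c + integral {0..t} (\<lambda>s. exp (- A s) * \<beta> s) - exp (- A t) * u t" for t
  have dI: "((\<lambda>t. integral {0..t} f) has_real_derivative f x) (at x within {0..T})"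
    if "continuous_on {0..T} f" "x \<in> {0..T}" for f x
    using integral_has_real_derivative[OF that] .
  have dA: "(A has_real_derivative a x) (at x within {0..T})" if "x \<in> {0..T}" for x
    unfolding A_def using dI[OF a that] .
  have cA: "continuous_on {0..T} A"
    using dA by (meson DERIV_continuous continuous_on_eq_continuous_within)
  have cg: "continuous_on {0..T} (\<lambda>s. exp (- A s) * \<beta> s)" using cA \<beta> by (intro continuous_intros)
  have du: "(u has_real_derivative \<beta> x + a x * u x) (at x within {0..T})" if "x \<in> {0..T}" for x
  proof (rule has_field_derivative_transform_within[where d=1
    and f="\<lambda>t. c + integral {0..t} \<beta> + integral {0..t} (\<lambda>s. a s * u s)"])
    show "((\<lambda>t. c + integral {0..t} \<beta> + integral {0..t} (\<lambda>s. a s * u s)) has_real_derivative \<beta> x + a x * u x)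
      (at x within {0..T})"
      using dI[OF \<beta> that] dI[OF continuous_on_mult[OF a cu] that] by (auto intro!: derivative_eq_intros)
  qed (use that eq' in auto)
  have "(w has_real_derivative 0) (at x within {0..T})" if "x \<in> {0..T}" for x
    unfolding w_def using dI[OF cg that] dA[OF that] du[OF that]
    by (auto intro!: derivative_eq_intros simp: algebra_simps)
  then obtain k where "\<And>x. x \<in> {0..T} \<Longrightarrow> w x = k"
    using has_field_derivative_zero_constant[of "{0..T}" w] by auto
  then have "w t = w 0" using t T by auto
  moreover have "w 0 = 0" using eq'[of 0] T by (simp add: w_def A_def)
  ultimately have "exp (- A t) * u t = c + integral {0..t} (\<lambda>s. exp (- A s) * \<beta> s)" by (simp add: w_def)
  then have "exp (A t) * (exp (- A t) * u t) = exp (A t) * (c + integral {0..t} (\<lambda>s. exp (- A s) * \<beta> s))" by simp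
  then have "u t = exp (A t) * c + exp (A t) * integral {0..t} (\<lambda>s. exp (- A s) * \<beta> s)"
    by (simp add: algebra_simps flip: exp_add)
  also have "exp (A t) * integral {0..t} (\<lambda>s. exp (- A s) * \<beta> s)
    = integral {0..t} (\<lambda>s. exp (A t) * (exp (- A s) * \<beta> s))"
    by simp
  also have "\<dots> = integral {0..t} (\<lambda>s. \<beta> s * exp (A t - A s))"
    by (intro Henstock_Kurzweil_Integration.integral_cong) (simp add: exp_diff exp_minus field_simps)
  also have "\<dots> = (LBINT s:{0..t}. \<beta> s * exp (A t - A s))"
    using t by (intro conv[symmetric] continuous_intros cA \<beta>) auto
  also have "\<dots> = (LBINT s:{0..t}. \<beta> s * exp (LBINT r:{s..t}. a r))"
  proof (rule set_lebesgue_integral_cong)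
    show "\<forall>s. s \<in> {0..t} \<longrightarrow> \<beta> s * exp (A t - A s) = \<beta> s * exp (LBINT r:{s..t}. a r)"
    proof (intro allI impI)
      fix s assume s: "s \<in> {0..t}"
      have "integral {0..s} a + integral {s..t} a = integral {0..t} a"
        using s t a by (intro Henstock_Kurzweil_Integration.integral_combine integrable_continuous_real
          continuous_on_subset[OF a]) auto
      then show "\<beta> s * exp (A t - A s) = \<beta> s * exp (LBINT r:{s..t}. a r)"
        using s t by (simp add: A_def conv[OF a, of s t] algebra_simps)
    qed
  qed simp
  finally show ?thesis using conv[OF a, of 0 t] t by (simp add: A_def mult.commute)
qed

section \<open>Measures on the path space\<close>

lemma B_measurable_borel: "B i t \<in> borel_measurable borel"
proof (rule borel_measurable_continuous_onI)
  have "continuous_on UNIV (\<lambda>\<omega>. apply_bcontfun \<omega> t :: real ^ 'n)"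
    unfolding continuous_on_iff by (metis dist_fun_lt_imp_dist_val_lt)
  then show "continuous_on UNIV (B i t)" unfolding B_def by (intro continuous_on_component)
qed

lemma B_measurable:
  assumes "sets P = sets (restrict_space borel (path_space T))"
  shows "B i t \<in> borel_measurable P"
  using measurable_restrict_space1[OF B_measurable_borel] measurable_cong_sets[OF assms refl] by blast

lemma path_space_clamp:
  "\<omega> \<in> path_space T \<Longrightarrow> apply_bcontfun \<omega> t = apply_bcontfun \<omega> (max 0 (min T t))"
  unfolding path_space_def by blast

lemma B_clamp: "\<omega> \<in> path_space T \<Longrightarrow> B i t \<omega> = B i (max 0 (min T t)) \<omega>"
  unfolding B_def using path_space_clamp[of \<omega> T t] by simp

text \<open>Only countably many tubes are given by a grid size, a tolerance and a list of values
  from a countable dense set. One path from each nonempty tube suffices, because two paths in a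
  common tube are uniformly close.\<close>

lemma path_space_separable:
  assumes T: "T > 0"
  obtains D :: "('n::finite) path set" where "countable D" "D \<subseteq> path_space T"
    "\<And>\<omega> \<epsilon>. \<omega> \<in> path_space T \<Longrightarrow> \<epsilon> > 0 \<Longrightarrow> \<exists>d\<in>D. dist \<omega> d < \<epsilon>"
proof -
  obtain Q :: "(real ^ 'n) set" where Q: "countable Q" "\<And>X. open X \<Longrightarrow> X \<noteq> {} \<Longrightarrow> \<exists>d\<in>Q. d \<in> X"
    by (rule countable_dense_setE) blast
  \<comment> \<open>The index m encodes the tolerance 1/(m+1), n the number of grid cells and
    \<open>v\<close> the prescribed values. The conditions at neighbouring grid points overlap, so
    every time is covered by one of them.\<close>
  define tube :: "nat \<times> nat \<times> (real ^ 'n) list \<Rightarrow> 'n path set" where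
    "tube = (\<lambda>(m, n, v). {\<omega> \<in> path_space T. \<forall>j\<le>n. \<forall>t\<in>{0..T}. \<bar>t - T * real j / real n\<bar> \<le> T / real n \<longrightarrow>
       dist (apply_bcontfun \<omega> t) (v ! j) < 1 / real (Suc m)})"
  define I where "I = {x \<in> UNIV \<times> UNIV \<times> lists Q. tube x \<noteq> {}}"
  define D where "D = (\<lambda>x. SOME \<omega>. \<omega> \<in> tube x) ` I"
  have pick: "(SOME \<omega>. \<omega> \<in> tube x) \<in> tube x" if "x \<in> I" for x
    using that by (auto simp: I_def intro: someI_ex)
  have "countable (UNIV \<times> UNIV \<times> lists Q :: (nat \<times> nat \<times> (real ^ 'n) list) set)"
    using Q(1) by (intro countable_SIGMA countable_lists) auto
  then have "countable D" unfolding D_def I_def by (intro countable_image) (auto intro: countable_subset[rotated])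
  moreover have "D \<subseteq> path_space T" using pick unfolding D_def tube_def by fastforce
  moreover have "\<exists>d\<in>D. dist \<omega> d < \<epsilon>" if \<omega>: "\<omega> \<in> path_space T" and e: "\<epsilon> > 0" for \<omega> \<epsilon>
  proof -
    obtain m where m: "2 / real (Suc m) < \<epsilon>"
    proof -
      obtain m where "inverse (real (Suc m)) < \<epsilon> / 2" using reals_Archimedean[of "\<epsilon>/2"] e by auto
      then show ?thesis using that[of m] by (simp add: field_simps)
    qed
    have "uniformly_continuous_on {0..T} (apply_bcontfun \<omega>)"
      by (intro compact_uniformly_continuous) auto
    \<comment> \<open>Half of the tolerance is spent on the oscillation of the path over one cell,
      the other half on replacing its grid value by an element of \<open>Q\<close>.\<close>
    then obtain \<delta> where \<delta>: "\<delta> > 0" "\<And>s t. s \<in> {0..T} \<Longrightarrow> t \<in> {0..T} \<Longrightarrow> dist s t < \<delta> \<Longrightarrow>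
      dist (apply_bcontfun \<omega> s) (apply_bcontfun \<omega> t) < 1 / (2 * real (Suc m))"
      unfolding uniformly_continuous_on_def by (metis zero_less_divide_1_iff of_nat_0_less_iff zero_less_Suc
        mult_pos_pos zero_less_numeral)
    obtain n0 where n0: "inverse (real (Suc n0)) < \<delta> / T" using reals_Archimedean[of "\<delta>/T"] T \<delta> by auto
    define n where "n = Suc n0"
    have n: "n > 0" "T / real n < \<delta>" using n0 T by (auto simp: n_def field_simps)
    have "\<exists>q\<in>Q. dist (apply_bcontfun \<omega> (T * real j / real n)) q < 1 / (2 * real (Suc m))" for j
      using Q(2)[of "ball (apply_bcontfun \<omega> (T * real j / real n)) (1 / (2 * real (Suc m)))"] by auto
    then obtain q where q: "\<And>j. q j \<in> Q" "\<And>j. dist (apply_bcontfun \<omega> (T * real j / real n)) (q j) < 1 / (2 *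
      real (Suc m))"
      by metis
    define v where "v = map q [0..<Suc n]"
    have vj: "v ! j = q j" if "j \<le> n" for j using that by (simp add: v_def nth_append del: upt_Suc)
    have grid: "T * real j / real n \<in> {0..T}" if "j \<le> n" for j
      using that T n by (auto simp: divide_le_eq)
    have w: "\<omega> \<in> tube (m, n, v)"
      unfolding tube_def prod.case
    proof (intro CollectI conjI allI impI ballI \<omega>)
      fix j t assume j: "j \<le> n" and t: "t \<in> {0..T}" and d: "\<bar>t - T * real j / real n\<bar> \<le> T / real n"
      have "dist (apply_bcontfun \<omega> t) (apply_bcontfun \<omega> (T * real j / real n)) < 1 / (2 * real (Suc m))"
        using \<delta>(2)[OF t grid[OF j]] d n by (simp add: dist_real_def)
      with q(2)[of j] have "dist (apply_bcontfun \<omega> t) (q j) < 1 / (2 * real (Suc m)) + 1 / (2 * real (Suc m))"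
        by (smt (verit) dist_triangle)
      also have "\<dots> = 1 / real (Suc m)" by (simp add: field_simps)
      finally show "dist (apply_bcontfun \<omega> t) (v ! j) < 1 / real (Suc m)" using vj[OF j] by simp
    qed
    then have I: "(m, n, v) \<in> I" using q(1) by (auto simp: I_def v_def)
    define d where "d = (SOME \<omega>. \<omega> \<in> tube (m, n, v))"
    have dD: "d \<in> D" using I by (auto simp: D_def d_def)
    have d: "d \<in> tube (m, n, v)" unfolding d_def by (rule pick[OF I])
    have dist_in: "dist (apply_bcontfun \<omega> t) (apply_bcontfun d t) \<le> 2 / real (Suc m)" if t: "t \<in> {0..T}" for t
    proof -
      define j where "j = nat \<lfloor>real n * t / T\<rfloor>"
      have nt: "0 \<le> real n * t / T" "real n * t / T \<le> real n" using t T
        by (auto simp: divide_le_eq intro: mult_left_mono)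
      have j: "real j \<le> real n * t / T" "real n * t / T < real j + 1"
        using nt unfolding j_def by linarith+
      have jn: "j \<le> n" using j nt by linarith
      have "T * real j \<le> real n * t" "real n * t \<le> T * (real j + 1)" using j T by (auto simp: field_simps)
      then have "T * real j / real n \<le> t" "t \<le> T * real j / real n + T / real n"
        using n by (auto simp: field_simps)
      then have near: "\<bar>t - T * real j / real n\<bar> \<le> T / real n" by linarith
      have "dist (apply_bcontfun \<omega> t) (v ! j) < 1 / real (Suc m)"
        "dist (apply_bcontfun d t) (v ! j) < 1 / real (Suc m)"
        using w d jn t near unfolding tube_def by auto
      then have "dist (apply_bcontfun \<omega> t) (apply_bcontfun d t) < 1 / real (Suc m) + 1 / real (Suc m)"
        by (smt (verit) dist_triangle2)
      then show ?thesis by simp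
    qed
    have "dist \<omega> d \<le> 2 / real (Suc m)"
    proof (rule dist_bound)
      fix t
      have "d \<in> path_space T" using d by (auto simp: tube_def)
      then show "dist (apply_bcontfun \<omega> t) (apply_bcontfun d t) \<le> 2 / real (Suc m)"
        using dist_in[of "max 0 (min T t)"] path_space_clamp[OF \<omega>, of t] path_space_clamp[of d T t] T by simp
    qed
    then show ?thesis using m dD by force
  qed
  ultimately show thesis by (rule that)
qed

text \<open>By separability the Borel sets of the path space are generated by the coordinate process.\<close>

lemma measurable_path_space:
  fixes P :: "('n::finite) path measure"
  assumes T: "T > 0" and P: "sets P = sets (restrict_space borel (path_space T))"
    and f: "\<And>x. x \<in> space M \<Longrightarrow> f x \<in> path_space T"
    and B: "\<And>i t. t \<in> {0..T} \<Longrightarrow> (\<lambda>x. B i t (f x)) \<in> borel_measurable M"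
  shows "f \<in> measurable M P"
proof -
  obtain D :: "'n path set" where D: "countable D" "D \<subseteq> path_space T"
    "\<And>\<omega> \<epsilon>. \<omega> \<in> path_space T \<Longrightarrow> \<epsilon> > 0 \<Longrightarrow> \<exists>d\<in>D. dist \<omega> d < \<epsilon>"
    by (rule path_space_separable[OF T]) blast
  have B': "(\<lambda>x. B i t (f x)) \<in> borel_measurable M" for i t
  proof -
    have "(\<lambda>x. B i (max 0 (min T t)) (f x)) \<in> borel_measurable M" using T by (intro B) auto
    then show ?thesis by (rule measurable_cong[THEN iffD1, rotated]) (metis B_clamp f)
  qed
  have ev[measurable]: "(\<lambda>x. apply_bcontfun (f x) t) \<in> borel_measurable M" for t
    by (subst borel_measurable_euclidean_space)
      (use B'[of _ t] in \<open>auto simp: B_def Basis_vec_def inner_axis\<close>)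
  have cb: "{x \<in> space M. dist (f x) d \<le> q} \<in> sets M" if d: "d \<in> path_space T" for d q
  proof -
    \<comment> \<open>The sup distance of continuous paths is decided at rational times, which turns
      a closed ball condition into countably many conditions on coordinates.\<close>
    have "dist (f x) d \<le> q \<longleftrightarrow> (\<forall>t\<in>\<rat>. dist (apply_bcontfun (f x) t) (apply_bcontfun d t) \<le> q)" (is "?l \<longleftrightarrow> ?r") for x
    proof
      assume ?l then show ?r using dist_bounded order_trans by blast
    next
      assume r: ?r
      have "closed {t. dist (apply_bcontfun (f x) t) (apply_bcontfun d t) \<le> q}"
        by (intro closed_Collect_le continuous_intros) auto
      then have "closure \<rat> \<subseteq> {t. dist (apply_bcontfun (f x) t) (apply_bcontfun d t) \<le> q}"
        using r by (intro closure_minimal) auto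
      then show ?l unfolding Rats_closure_real by (intro dist_bound) auto
    qed
    then have "{x \<in> space M. dist (f x) d \<le> q} =
        {x \<in> space M. \<forall>r. dist (apply_bcontfun (f x) (of_rat r)) (apply_bcontfun d (of_rat r)) \<le> q}"
      by (simp add: Rats_def)
    also have "\<dots> \<in> sets M" by measurable
    finally show ?thesis .
  qed
  have "f \<in> borel_measurable M"
  proof (rule borel_measurableI)
    fix U :: "'n path set" assume U: "open U"
    define J where "J = {(d, q). d \<in> D \<and> q \<in> \<rat> \<and> (\<forall>\<omega>. dist \<omega> d \<le> q \<longrightarrow> \<omega> \<in> U)}"
    have "f -` U \<inter> space M = (\<Union>(d, q)\<in>J. {x \<in> space M. dist (f x) d \<le> q})"
    proof (intro set_eqI iffI)
      fix x assume x: "x \<in> f -` U \<inter> space M"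
      then obtain \<epsilon> where e: "\<epsilon> > 0" "\<And>\<omega>. dist \<omega> (f x) < \<epsilon> \<Longrightarrow> \<omega> \<in> U"
        using U unfolding open_dist by auto
      \<comment> \<open>The centre is chosen within \<epsilon>/4 of the given path and the radius
        lies between \<epsilon>/4 and \<epsilon>/2: the ball contains the path and stays inside the
        \<epsilon>-ball around it.\<close>
      obtain q where q: "q \<in> \<rat>" "\<epsilon> / 4 < q" "q < \<epsilon> / 2" using Rats_dense_in_real[of "\<epsilon>/4" "\<epsilon>/2"] e by auto
      obtain d where d: "d \<in> D" "dist (f x) d < \<epsilon> / 4" using D(3)[of "f x" "\<epsilon>/4"] f x e by auto
      have "\<omega> \<in> U" if "dist \<omega> d \<le> q" for \<omega>
      proof (rule e(2))
        show "dist \<omega> (f x) < \<epsilon>" using that d q dist_triangle2[of \<omega> "f x" d] e by linarith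
      qed
      then have "(d, q) \<in> J" using d q by (auto simp: J_def)
      then show "x \<in> (\<Union>(d, q)\<in>J. {x \<in> space M. dist (f x) d \<le> q})" using x d q by (intro UN_I[of "(d, q)"]) auto
    qed (auto simp: J_def)
    moreover have "countable J"
    proof (rule countable_subset)
      show "J \<subseteq> D \<times> \<rat>" by (auto simp: J_def)
    qed (use D countable_rat in auto)
    moreover have "{x \<in> space M. dist (f x) d \<le> q} \<in> sets M" if "(d, q) \<in> J" for d q
      using that D(2) by (intro cb) (auto simp: J_def)
    ultimately show "f -` U \<inter> space M \<in> sets M"
      by (auto intro!: sets.countable_UN')
  qed
  then have "f \<in> measurable M (restrict_space borel (path_space T))"
    by (intro measurable_restrict_space2) (auto intro: f)
  then show ?thesis using measurable_cong_sets[OF refl P] by blast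
qed

section \<open>Uniqueness of finite measures on the path space from exponentials of
  coordinates\<close>

definition linB :: "(real \<times> 'n \<times> real) list \<Rightarrow> ('n::finite) path \<Rightarrow> real" where
  "linB xs \<omega> = (\<Sum>(a, i, t)\<leftarrow>xs. a * B i t \<omega>)"

definition cylinder :: "real \<Rightarrow> ('n \<times> real \<times> real set) list \<Rightarrow> ('n::finite) path set" where
  "cylinder T ys = {\<omega> \<in> path_space T. \<forall>(i, t, A)\<in>set ys. B i t \<omega> \<in> A}"

lemma linB_Nil[simp]: "linB [] \<omega> = 0"
  and linB_Cons[simp]: "linB ((a, i, t) # xs) \<omega> = a * B i t \<omega> + linB xs \<omega>"
  by (simp_all add: linB_def)

lemma linB_measurable:
  assumes "sets P = sets (restrict_space borel (path_space T))"
  shows "linB xs \<in> borel_measurable P"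
proof (induction xs)
  case (Cons x xs)
  obtain a i t where x: "x = (a, i, t)" by (cases x)
  have "linB (x # xs) = (\<lambda>\<omega>. a * B i t \<omega> + linB xs \<omega>)" by (auto simp: x)
  then show ?case using Cons B_measurable[OF assms, of i t] by auto
next
  case Nil
  have "linB [] = (\<lambda>\<omega>. 0)" by auto
  then show ?case by simp
qed

lemma cylinder_sets:
  assumes P: "sets P = sets (restrict_space borel (path_space T))"
    and ys: "\<forall>(i, t, A)\<in>set ys. A \<in> sets borel"
  shows "cylinder T ys \<in> sets P"
  using ys
proof (induction ys)
  case Nil
  have "space P = path_space T" using sets_eq_imp_space_eq[OF P] by (simp add: space_restrict_space)
  then show ?case using sets.top[of P] by (simp add: cylinder_def)
next
  case (Cons y ys)
  obtain i t A where y: "y = (i, t, A)" by (cases y)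
  have sp: "space P = path_space T" using sets_eq_imp_space_eq[OF P] by (simp add: space_restrict_space)
  have "cylinder T (y # ys) = cylinder T ys \<inter> (B i t -` A \<inter> space P)"
    by (auto simp: cylinder_def y sp)
  moreover have "B i t -` A \<inter> space P \<in> sets P"
    using Cons.prems by (intro measurable_sets[OF B_measurable[OF P]]) (auto simp: y)
  ultimately show ?case using Cons by auto
qed

text \<open>Conditioning on one coordinate after the other: the weights \<open>exp L\<close> are positive, so that each step
  is an instance of the uniqueness theorem for one-dimensional Laplace transforms.\<close>

lemma cylinder_exp_eq:
  fixes \<mu> \<nu> :: "('n::finite) path measure"
  assumes fin: "finite_measure \<mu>" "finite_measure \<nu>"
    and \<mu>: "sets \<mu> = sets (restrict_space borel (path_space T))"
    and \<nu>: "sets \<nu> = sets (restrict_space borel (path_space T))"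
    and int: "\<And>xs. \<forall>(a, i, t)\<in>set xs. t \<in> {0..T} \<Longrightarrow> integrable \<mu> (\<lambda>\<omega>. exp (linB xs \<omega>))"
      "\<And>xs. \<forall>(a, i, t)\<in>set xs. t \<in> {0..T} \<Longrightarrow> integrable \<nu> (\<lambda>\<omega>. exp (linB xs \<omega>))"
    and eq: "\<And>xs. \<forall>(a, i, t)\<in>set xs. t \<in> {0..T} \<Longrightarrow> (\<integral>\<omega>. exp (linB xs \<omega>) \<partial>\<mu>) = (\<integral>\<omega>. exp (linB xs \<omega>) \<partial>\<nu>)"
    and ys: "\<forall>(i, t, A)\<in>set ys. t \<in> {0..T} \<and> A \<in> sets borel"
    and xs: "\<forall>(a, i, t)\<in>set xs. t \<in> {0..T}"
  shows "(\<integral>\<omega>. indicator (cylinder T ys) \<omega> * exp (linB xs \<omega>) \<partial>\<mu>)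
    = (\<integral>\<omega>. indicator (cylinder T ys) \<omega> * exp (linB xs \<omega>) \<partial>\<nu>)"
  using ys xs
proof (induction ys arbitrary: xs)
  case Nil
  have s: "space \<mu> = path_space T" "space \<nu> = path_space T"
    using sets_eq_imp_space_eq[OF \<mu>] sets_eq_imp_space_eq[OF \<nu>] by (simp_all add: space_restrict_space)
  have "(\<integral>\<omega>. indicator (cylinder T []) \<omega> * exp (linB xs \<omega>) \<partial>\<mu>) = (\<integral>\<omega>. exp (linB xs \<omega>) \<partial>\<mu>)"
    by (intro Bochner_Integration.integral_cong) (auto simp: cylinder_def s)
  moreover have "(\<integral>\<omega>. indicator (cylinder T []) \<omega> * exp (linB xs \<omega>) \<partial>\<nu>) = (\<integral>\<omega>. exp (linB xs \<omega>) \<partial>\<nu>)"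
    by (intro Bochner_Integration.integral_cong) (auto simp: cylinder_def s)
  ultimately show ?case using eq[OF Nil(2)] by simp
next
  case (Cons y ys)
  obtain i t A where y: "y = (i, t, A)" by (cases y)
  have t: "t \<in> {0..T}" and A[measurable]: "A \<in> sets borel"
    and ys: "\<forall>(i, t, A)\<in>set ys. t \<in> {0..T} \<and> A \<in> sets borel" using Cons.prems by (auto simp: y)
  note xs = Cons.prems(2)
  note [measurable] = linB_measurable[OF \<mu>] linB_measurable[OF \<nu>] B_measurable[OF \<mu>] B_measurable[OF \<nu>]
  have ysb: "\<forall>(i, t, A)\<in>set ys. A \<in> sets borel" using ys by auto
  note [measurable] = cylinder_sets[OF \<mu> ysb] cylinder_sets[OF \<nu> ysb]
  define w where "w \<omega> = indicator (cylinder T ys) \<omega> * exp (linB xs \<omega>)" for \<omega>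
  have w0: "w \<omega> \<ge> 0" for \<omega> by (simp add: w_def)
  have wm[measurable]: "w \<in> borel_measurable \<mu>" "w \<in> borel_measurable \<nu>" unfolding w_def by measurable
  \<comment> \<open>The Laplace variable r is absorbed into the weight as one more entry of the
    list. The induction hypothesis for the longer list is therefore exactly the equality of the
    Laplace transforms of the new coordinate; this is why \<open>xs\<close> is arbitrary in the
    induction.\<close>
  have we: "w \<omega> * exp (r * B i t \<omega>) = indicator (cylinder T ys) \<omega> * exp (linB ((r, i, t) # xs) \<omega>)" for r \<omega>
    by (simp add: w_def exp_add mult_ac)
  have x': "\<forall>(a, i, t)\<in>set ((r, i, t) # xs). t \<in> {0..T}" for r using xs t by auto
  have iw: "integrable \<mu> (\<lambda>\<omega>. w \<omega> * exp (r * B i t \<omega>))" "integrable \<nu> (\<lambda>\<omega>. w \<omega> * exp (r * B i t \<omega>))" for r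
    unfolding we using integrable_mult_indicator[OF _ int(1)[OF x'[of r]]] integrable_mult_indicator[OF _
      int(2)[OF x'[of r]]]
    by simp_all
  have iw0: "integrable \<mu> w" "integrable \<nu> w" using iw[of 0] by simp_all
  define M where "M = density \<mu> (\<lambda>\<omega>. ennreal (w \<omega>))"
  define N where "N = density \<nu> (\<lambda>\<omega>. ennreal (w \<omega>))"
  have "distr M borel (B i t) = distr N borel (B i t)"
  proof (rule laplace_transform_unique)
    show "finite_measure M" unfolding M_def using iw0
      by (intro finite_measureI) (simp add: emeasure_density nn_integral_eq_integral w0 cong: nn_integral_cong)
    show "finite_measure N" unfolding N_def using iw0
      by (intro finite_measureI) (simp add: emeasure_density nn_integral_eq_integral w0 cong: nn_integral_cong)
    show "B i t \<in> borel_measurable M" "B i t \<in> borel_measurable N" by (simp_all add: M_def N_def)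
    show "integrable M (\<lambda>x. exp (r * B i t x))" "integrable N (\<lambda>x. exp (r * B i t x))" for r
      unfolding M_def N_def using iw[of r] w0 by (simp_all add: integrable_density)
    show "(\<integral>x. exp (r * B i t x) \<partial>M) = (\<integral>x. exp (r * B i t x) \<partial>N)" for r
      unfolding M_def N_def using w0 Cons.IH[OF ys x'[of r]] by (simp add: integral_density we del: linB_Cons)
  qed
  then have "measure (distr M borel (B i t)) A = measure (distr N borel (B i t)) A" by simp
  then have "measure M (B i t -` A \<inter> space M) = measure N (B i t -` A \<inter> space N)"
    by (simp add: measure_distr M_def N_def)
  moreover have "measure M (B i t -` A \<inter> space M) = (\<integral>\<omega>. indicator (cylinder T (y # ys)) \<omega> * exp (linB xs \<omega>) \<partial>\<mu>)"
  proof -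
    have "measure M (B i t -` A \<inter> space M) = (\<integral>\<omega>. indicator (B i t -` A \<inter> space M) \<omega> \<partial>M)"
      by (simp add: M_def)
    also have "\<dots> = (\<integral>\<omega>. w \<omega> * indicator (B i t -` A \<inter> space \<mu>) \<omega> \<partial>\<mu>)"
      unfolding M_def using w0 by (subst integral_density) auto
    also have "\<dots> = (\<integral>\<omega>. indicator (cylinder T (y # ys)) \<omega> * exp (linB xs \<omega>) \<partial>\<mu>)"
      by (intro Bochner_Integration.integral_cong) (auto simp: w_def cylinder_def y indicator_def)
    finally show ?thesis .
  qed
  moreover have "measure N (B i t -` A \<inter> space N) = (\<integral>\<omega>. indicator (cylinder T (y # ys)) \<omega> * exp (linB xs \<omega>) \<partial>\<nu>)"
  proof -
    have "measure N (B i t -` A \<inter> space N) = (\<integral>\<omega>. indicator (B i t -` A \<inter> space N) \<omega> \<partial>N)"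
      by (simp add: N_def)
    also have "\<dots> = (\<integral>\<omega>. w \<omega> * indicator (B i t -` A \<inter> space \<nu>) \<omega> \<partial>\<nu>)"
      unfolding N_def using w0 by (subst integral_density) auto
    also have "\<dots> = (\<integral>\<omega>. indicator (cylinder T (y # ys)) \<omega> * exp (linB xs \<omega>) \<partial>\<nu>)"
      by (intro Bochner_Integration.integral_cong) (auto simp: w_def cylinder_def y indicator_def)
    finally show ?thesis .
  qed
  ultimately show ?case by simp
qed

text \<open>Cylinders are stable under intersection, by concatenation of their lists, and generate
  the Borel sets. With the empty weight \<open>cylinder_exp_eq\<close> gives equality of the
  measures on them.\<close>

lemma path_measure_eqI:
  fixes \<mu> \<nu> :: "('n::finite) path measure"
  assumes T: "T > 0" and fin: "finite_measure \<mu>" "finite_measure \<nu>"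
    and \<mu>: "sets \<mu> = sets (restrict_space borel (path_space T))"
    and \<nu>: "sets \<nu> = sets (restrict_space borel (path_space T))"
    and int: "\<And>xs. \<forall>(a, i, t)\<in>set xs. t \<in> {0..T} \<Longrightarrow> integrable \<mu> (\<lambda>\<omega>. exp (linB xs \<omega>))"
      "\<And>xs. \<forall>(a, i, t)\<in>set xs. t \<in> {0..T} \<Longrightarrow> integrable \<nu> (\<lambda>\<omega>. exp (linB xs \<omega>))"
    and eq: "\<And>xs. \<forall>(a, i, t)\<in>set xs. t \<in> {0..T} \<Longrightarrow> (\<integral>\<omega>. exp (linB xs \<omega>) \<partial>\<mu>) = (\<integral>\<omega>. exp (linB xs \<omega>) \<partial>\<nu>)"
  shows "\<mu> = \<nu>"
proof -
  interpret m: finite_measure \<mu> by fact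
  interpret n: finite_measure \<nu> by fact
  define E where "E = {cylinder T ys | ys :: ('n \<times> real \<times> real set) list. \<forall>(i, t, A)\<in>set ys. t \<in> {0..T}
    \<and> A \<in> sets borel}"
  have Ein: "cylinder T ys \<in> E" if "\<forall>(i, t, A)\<in>set ys. t \<in> {0..T} \<and> A \<in> sets borel" for ys ::
    "('n \<times> real \<times> real set) list"
    using that unfolding E_def by blast
  have Es: "X \<in> sets \<mu>" if "X \<in> E" for X using that cylinder_sets[OF \<mu>] unfolding E_def by force
  have Epow: "E \<subseteq> Pow (path_space T)" by (auto simp: E_def cylinder_def)
  have top: "cylinder T ([] :: ('n \<times> real \<times> real set) list) = path_space T" by (auto simp: cylinder_def)
  have sets: "sets (restrict_space borel (path_space T)) = sigma_sets (path_space T) E"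
  proof
    show "sigma_sets (path_space T) E \<subseteq> sets (restrict_space borel (path_space T))"
      using Es \<mu> sets.sigma_sets_subset[of E \<mu>] sets_eq_imp_space_eq[OF \<mu>]
      by (auto simp: space_restrict_space)
    \<comment> \<open>That the Borel sets belong to the sigma algebra of the cylinders is the
      measurability of the identity, and the latter can be checked on coordinates.\<close>
    have "(\<lambda>\<omega>. \<omega>) \<in> measurable (sigma (path_space T) E) (restrict_space borel (path_space T) :: 'n path measure)"
    proof (rule measurable_path_space[OF T refl])
      fix i t assume t: "t \<in> {0..T}"
      show "B i t \<in> borel_measurable (sigma (path_space T) E)"
      proof (rule measurableI)
        fix A :: "real set" assume A: "A \<in> sets borel"
        have "B i t -` A \<inter> space (sigma (path_space T) E) = cylinder T [(i, t, A)]"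
          using Epow by (auto simp: cylinder_def space_measure_of_conv)
        also have "\<dots> \<in> E" using t A by (intro Ein) auto
        finally show "B i t -` A \<inter> space (sigma (path_space T) E) \<in> sets (sigma (path_space T) E)"
          using Epow by (simp add: sets_measure_of)
      qed simp
    qed (use Epow in \<open>simp add: space_measure_of_conv\<close>)
    note id = measurable_sets[OF this]
    show "sets (restrict_space borel (path_space T)) \<subseteq> sigma_sets (path_space T) E"
    proof
      fix A :: "'n path set" assume A: "A \<in> sets (restrict_space borel (path_space T))"
      then have "A \<subseteq> path_space T" using sets.sets_into_space by (fastforce simp: space_restrict_space)
      then have "(\<lambda>\<omega>. \<omega>) -` A \<inter> path_space T = A" by auto
      then show "A \<in> sigma_sets (path_space T) E"
        using id[OF A] Epow by (simp add: sets_measure_of space_measure_of_conv)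
    qed
  qed
  show ?thesis
  proof (rule measure_eqI_generator_eq[where A="\<lambda>_. path_space T" and \<Omega>="path_space T" and E=E])
    show "Int_stable E"
    proof (rule Int_stableI)
      fix a b assume "a \<in> E" "b \<in> E"
      then obtain ys zs where "a = cylinder T ys" "\<forall>(i, t, A)\<in>set ys. t \<in> {0..T} \<and> A \<in> sets borel"
        "b = cylinder T zs" "\<forall>(i, t, A)\<in>set zs. t \<in> {0..T} \<and> A \<in> sets borel" unfolding E_def by blast
      moreover have "cylinder T ys \<inter> cylinder T zs = cylinder T (ys @ zs)" by (auto simp: cylinder_def ball_Un)
      ultimately show "a \<inter> b \<in> E" using Ein[of "ys @ zs"] by (simp only: set_append ball_Un simp_thms)
    qed
    show "E \<subseteq> Pow (path_space T)" by fact
    show "sets \<mu> = sigma_sets (path_space T) E" "sets \<nu> = sigma_sets (path_space T) E" using \<mu> \<nu> sets by auto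
    show "range (\<lambda>_. path_space T) \<subseteq> E" using Ein[of "[]"] top by auto
    show "emeasure \<mu> X = emeasure \<nu> X" if X: "X \<in> E" for X
    proof -
      obtain ys where ys: "X = cylinder T ys" "\<forall>(i, t, A)\<in>set ys. t \<in> {0..T} \<and> A \<in> sets borel" using X
        unfolding E_def by blast
      have XX: "X \<in> sets \<mu>" "X \<in> sets \<nu>" using Es[OF X] \<mu> \<nu> by auto
      have "measure \<mu> X = measure \<nu> X"
        using cylinder_exp_eq[OF fin \<mu> \<nu> int eq ys(2), of "[]"] XX unfolding ys(1)[symmetric] by simp
      then show ?thesis by (simp add: m.emeasure_eq_measure n.emeasure_eq_measure)
    qed
  qed auto
qed

section \<open>The kernel and its Hilbert space\<close>

lemma ennreal_norm_integral_le:
  fixes f :: "'a \<Rightarrow> 'b::{banach, second_countable_topology}"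
  shows "ennreal (norm (integral\<^sup>L M f)) \<le> (\<integral>\<^sup>+x. ennreal (norm (f x)) \<partial>M)"
  by (cases "integrable M f") (auto simp: integral_norm_bound_ennreal not_integrable_integral_eq)

lemma indicator_power2: "(indicator A x :: real)\<^sup>2 = indicator A x"
  by (simp add: indicator_def)

text \<open>The odd antiderivative of \<open>a * \<bar>x\<bar> powr (a - 1)\<close>.\<close>

definition powr_primitive :: "real \<Rightarrow> real \<Rightarrow> real" where
  "powr_primitive a x = sgn x * \<bar>x\<bar> powr a"

lemma continuous_powr_primitive: "a > 0 \<Longrightarrow> continuous_on UNIV (powr_primitive a)"
proof -
  assume a: "a > 0"
  have *: "powr_primitive a x = max 0 x powr a - max 0 (- x) powr a" for x
    by (auto simp: powr_primitive_def sgn_if max_def)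
  show ?thesis unfolding * using a
    by (intro continuous_intros continuous_on_powr') auto
qed

lemma has_integral_abs_powr:
  assumes a: "a > (-1::real)" and xy: "x \<le> y"
  shows "((\<lambda>s. \<bar>s\<bar> powr a) has_integral (powr_primitive (a + 1) y - powr_primitive (a + 1) x) / (a + 1)) {x..y}"
proof -
  define g :: "real \<Rightarrow> real" where "g s = \<bar>s\<bar> powr a" for s
  define K where "K x = powr_primitive (a + 1) x / (a + 1)" for x
  have pos: "(g has_integral K c) {0..c}" if "c \<ge> 0" for c
  proof -
    have "((\<lambda>x. x powr a) has_integral K c) {0..c}"
      using has_integral_powr_from_0[OF a that] that by (cases "c = 0") (auto simp: K_def powr_primitive_def)
    then show ?thesis by (rule has_integral_eq[rotated]) (auto simp: g_def)
  qed
  have neg: "(g has_integral - K c) {c..0}" if "c \<le> 0" for c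
  proof -
    have "(g has_integral K (- c)) {0..- c}" using pos[of "-c"] that by simp
    then have "((\<lambda>x. g (- x)) has_integral K (- c)) {- (- c)..- 0}"
      by (simp only: has_integral_reflect_real)
    moreover have "g (- x) = g x" for x by (simp add: g_def)
    moreover have "K (- c) = - K c" by (simp add: K_def powr_primitive_def sgn_minus)
    ultimately show ?thesis by (simp only: minus_minus minus_zero)
  qed
  \<comment> \<open>A symmetric interval containing both endpoints. Splitting it at the singularity
    0 handles all positions of x and y by additivity.\<close>
  define R where "R = max \<bar>x\<bar> \<bar>y\<bar>"
  have R: "R \<ge> 0" "-R \<le> x" "y \<le> R" "x \<le> R" "-R \<le> y" by (auto simp: R_def)
  have "(g has_integral (- K (-R) + K R)) {-R..R}"
    using R neg[of "-R"] pos[of R] by (intro has_integral_combine[where c=0]) auto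
  then have gi: "g integrable_on {-R..R}" by blast
  have gi': "g integrable_on {u..v}" if "-R \<le> u" "v \<le> R" for u v
    by (rule integrable_on_subinterval[OF gi]) (use that in auto)
  have I: "integral {-R..z} g = integral {-R..0} g + K z" if "-R \<le> z" "z \<le> R" for z
  proof (cases "z \<ge> 0")
    case True
    have "integral {-R..0} g + integral {0..z} g = integral {-R..z} g"
      using True R that by (intro Henstock_Kurzweil_Integration.integral_combine gi') auto
    then show ?thesis using integral_unique[OF pos[OF True]] by simp
  next
    case False
    have "integral {-R..z} g + integral {z..0} g = integral {-R..0} g"
      using False R that by (intro Henstock_Kurzweil_Integration.integral_combine gi') auto
    then show ?thesis using integral_unique[OF neg[of z]] False by simp
  qed
  have "integral {-R..x} g + integral {x..y} g = integral {-R..y} g"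
    using R xy by (intro Henstock_Kurzweil_Integration.integral_combine gi') auto
  then have "integral {x..y} g = K y - K x" using I[of x] I[of y] R by simp
  moreover have "g integrable_on {x..y}" using R by (intro gi') auto
  ultimately have "(g has_integral (K y - K x)) {x..y}" using integrable_integral by metis
  then show ?thesis by (simp add: g_def[abs_def] K_def diff_divide_distrib)
qed

text \<open>Translation by t reduces this to a power of the absolute value. The factor
  \<open>H\<close> is the kernel constant \<open>H * (2 * H - 1)\<close> divided by the exponent of
  the primitive.\<close>

lemma nn_integral_phi:
  assumes H: "1 / 2 < H" and xy: "x \<le> y"
  shows "(\<integral>\<^sup>+s. ennreal (phi H t s) * indicator {x..y} s \<partial>lborel) =
    ennreal (H * (powr_primitive (2 * H - 1) (y - t) - powr_primitive (2 * H - 1) (x - t)))"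
proof -
  define g :: "real \<Rightarrow> real" where "g s = H * (2 * H - 1) * \<bar>s\<bar> powr (2 * H - 2)" for s
  define I where "I = H * (powr_primitive (2 * H - 1) (y - t) - powr_primitive (2 * H - 1) (x - t))"
  have [measurable]: "g \<in> borel_measurable borel" unfolding g_def by measurable
  have g0: "g s \<ge> 0" for s using H by (simp add: g_def)
  have "((\<lambda>s. \<bar>s\<bar> powr (2 * H - 2)) has_integral (powr_primitive (2 * H - 1) (y - t) - powr_primitive (2 * H -
    1) (x - t)) / (2 * H - 1)) {x - t..y - t}"
    using has_integral_abs_powr[of "2 * H - 2" "x - t" "y - t"] H xy by simp
  from has_integral_mult_right[OF this, of "H * (2 * H - 1)"]
  have "(g has_integral I) {x - t..y - t}" using H by (simp add: g_def[abs_def] I_def)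
  then have hi: "((\<lambda>s. if s \<in> {x - t..y - t} then g s else 0) has_integral I) UNIV"
    by (simp only: has_integral_restrict_UNIV)
  have "(\<integral>\<^sup>+s. ennreal (phi H t s) * indicator {x..y} s \<partial>lborel) =
    (\<integral>\<^sup>+s. ennreal (phi H t (t + s)) * indicator {x..y} (t + s) \<partial>lborel)"
    using nn_integral_real_affine[of "\<lambda>s. ennreal (phi H t s) * indicator {x..y} s" 1 t]
    by (simp add: phi_def)
  also have "\<dots> = (\<integral>\<^sup>+s. ennreal (if s \<in> {x - t..y - t} then g s else 0) \<partial>lborel)"
    by (intro nn_integral_cong) (auto simp: phi_def g_def indicator_def)
  also have "\<dots> = ennreal I"
    by (rule nn_integral_has_integral_lborel[OF _ _ hi]) (auto simp: g0)
  finally show ?thesis by (simp add: I_def)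
qed

lemma phi_nonneg: "1 / 2 < H \<Longrightarrow> phi H s t \<ge> 0"
  by (simp add: phi_def)

lemma phi_commute: "phi H s t = phi H t s"
  by (simp add: phi_def abs_minus_commute)

lemma phi_measurable[measurable]: "(\<lambda>x. phi H (f x) (g x)) \<in> borel_measurable M"
  if [measurable]: "f \<in> borel_measurable M" "g \<in> borel_measurable M"
  unfolding phi_def by measurable

section \<open>The kernel inner product and the map from square integrable functions into the
  completion\<close>

locale phi_hilbert =
  fixes H T :: real and J :: "(real \<Rightarrow> real) \<Rightarrow> 'h::{real_inner, complete_space}"
  assumes T_pos: "T > 0" and H_gt: "1 / 2 < H" and H_lt: "H < 1"
    and completion: "phi_completion H T J"
begin

text \<open>A bound, uniform in t, for the mass of \<open>phi H t\<close> on [0,T]: that mass is H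
  times the sum of t^(2H-1) and (T-t)^(2H-1), each at most T^(2H-1).\<close>

definition phi_mass :: real where "phi_mass = 2 * H * T powr (2 * H - 1)"

lemma phi_mass_pos: "phi_mass \<ge> 0" using H_gt by (simp add: phi_mass_def)

lemma nn_integral_phi_le:
  assumes t: "t \<in> {0..T}"
  shows "(\<integral>\<^sup>+s. ennreal (phi H t s) * indicator {0..T} s \<partial>lborel) \<le> ennreal phi_mass"
proof -
  have "powr_primitive (2 * H - 1) (T - t) \<le> T powr (2 * H - 1)"
  proof -
    have "(T - t) powr (2 * H - 1) \<le> T powr (2 * H - 1)" using t H_gt by (intro powr_mono2) auto
    then show ?thesis using t by (auto simp: powr_primitive_def sgn_if)
  qed
  moreover have "- powr_primitive (2 * H - 1) (0 - t) \<le> T powr (2 * H - 1)"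
  proof -
    have "t powr (2 * H - 1) \<le> T powr (2 * H - 1)" using t H_gt by (intro powr_mono2) auto
    then show ?thesis using t by (auto simp: powr_primitive_def sgn_if)
  qed
  ultimately have "powr_primitive (2 * H - 1) (T - t) - powr_primitive (2 * H - 1) (0 - t) \<le> 2 * T powr (2 * H - 1)"
    by linarith
  then have "H * (powr_primitive (2 * H - 1) (T - t) - powr_primitive (2 * H - 1) (0 - t)) \<le> phi_mass"
    using mult_left_mono[of _ _ H] H_gt unfolding phi_mass_def by fastforce
  then show ?thesis using T_pos by (subst nn_integral_phi[OF H_gt]) (auto intro: ennreal_leI)
qed

lemma L2_measurable: "f \<in> L2 T \<Longrightarrow> (\<lambda>s. indicator {0..T} s * f s) \<in> borel_measurable borel"
  by (simp add: L2_def set_borel_measurable_def)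

lemma nn_integral_double_phi:
  assumes [measurable]: "f \<in> borel_measurable borel" and f0: "\<And>s. s \<notin> {0..T} \<Longrightarrow> f s = 0"
  shows "(\<integral>\<^sup>+t. (\<integral>\<^sup>+s. f s * ennreal (phi H t s) * indicator {0..T} t \<partial>lborel) \<partial>lborel)
    \<le> ennreal phi_mass * (\<integral>\<^sup>+s. f s \<partial>lborel)"
proof -
  have "(\<integral>\<^sup>+t. (\<integral>\<^sup>+s. f s * ennreal (phi H t s) * indicator {0..T} t \<partial>lborel) \<partial>lborel) =
    (\<integral>\<^sup>+s. (\<integral>\<^sup>+t. f s * ennreal (phi H t s) * indicator {0..T} t \<partial>lborel) \<partial>lborel)"
    by (rule lborel_pair.Fubini') measurable
  also have "\<dots> = (\<integral>\<^sup>+s. f s * (\<integral>\<^sup>+t. ennreal (phi H s t) * indicator {0..T} t \<partial>lborel) \<partial>lborel)"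
    by (intro nn_integral_cong) (simp add: phi_commute[of H _ s for s] mult.assoc nn_integral_cmult)
  also have "\<dots> \<le> (\<integral>\<^sup>+s. f s * ennreal phi_mass \<partial>lborel)"
  proof (intro nn_integral_mono)
    fix s show "f s * (\<integral>\<^sup>+t. ennreal (phi H s t) * indicator {0..T} t \<partial>lborel) \<le> f s * ennreal phi_mass"
      using nn_integral_phi_le[of s] f0[of s] by (cases "s \<in> {0..T}") (auto intro: mult_left_mono)
  qed
  also have "\<dots> = ennreal phi_mass * (\<integral>\<^sup>+s. f s \<partial>lborel)"
    by (simp add: nn_integral_multc mult.commute)
  finally show ?thesis .
qed

text \<open>Schur's test: the product of the two values of f is at most half the sum of their
  squares, and each square is integrated against a kernel of bounded mass. Hence L2 convergence
  implies convergence of the images under \<open>J\<close>.\<close>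

lemma phi_inner_le:
  assumes f: "f \<in> L2 T"
  shows "phi_inner H T f f \<le> phi_mass * (LBINT s:{0..T}. (f s)\<^sup>2)"
proof -
  define g where "g s = indicator {0..T} s * f s" for s
  have [measurable]: "g \<in> borel_measurable borel" using L2_measurable[OF f] by (simp add: g_def[abs_def])
  have i2: "integrable lborel (\<lambda>s. (g s)\<^sup>2)"
    using f by (simp add: L2_def set_integrable_def g_def power_mult_distrib indicator_power2)
  have half: "ennreal (1/2) + ennreal (1/2) = 1" by (subst ennreal_plus[symmetric]) simp_all
  have "ennreal (norm (phi_inner H T f f)) \<le>
    (\<integral>\<^sup>+t. ennreal (norm (indicator {0..T} t * (LBINT s:{0..T}. f s * f t * phi H s t))) \<partial>lborel)"
    unfolding phi_inner_def set_lebesgue_integral_def real_scaleR_def by (rule ennreal_norm_integral_le)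
  also have "\<dots> \<le> (\<integral>\<^sup>+t. (\<integral>\<^sup>+s. ennreal (1/2) * (ennreal ((g s)\<^sup>2) * ennreal (phi H t s) * indicator {0..T} t) +
      ennreal (1/2) * (ennreal ((g t)\<^sup>2) * ennreal (phi H s t) * indicator {0..T} s) \<partial>lborel) \<partial>lborel)"
  proof (intro nn_integral_mono)
    fix t
    have "ennreal (norm (indicator {0..T} t * (LBINT s:{0..T}. f s * f t * phi H s t))) =
      indicator {0..T} t * ennreal (norm (LBINT s:{0..T}. f s * f t * phi H s t))"
      by (auto simp: indicator_def)
    also have "\<dots> \<le> indicator {0..T} t * (\<integral>\<^sup>+s. ennreal (norm (indicator {0..T} s * (f s * f t * phi H s t))) \<partial>lborel)"
      unfolding set_lebesgue_integral_def real_scaleR_def by (intro mult_left_mono ennreal_norm_integral_le) auto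
    also have "\<dots> \<le> (\<integral>\<^sup>+s. ennreal (1/2) * (ennreal ((g s)\<^sup>2) * ennreal (phi H t s) * indicator {0..T} t) +
      ennreal (1/2) * (ennreal ((g t)\<^sup>2) * ennreal (phi H s t) * indicator {0..T} s) \<partial>lborel)"
    proof (cases "t \<in> {0..T}")
      case True
      have "ennreal (norm (indicator {0..T} s * (f s * f t * phi H s t)))
        \<le> ennreal (1/2) * (ennreal ((g s)\<^sup>2) * ennreal (phi H t s) * indicator {0..T} t) +
      ennreal (1/2) * (ennreal ((g t)\<^sup>2) * ennreal (phi H s t) * indicator {0..T} s)" for s
      proof (cases "s \<in> {0..T}")
        case s: True
        have "0 \<le> (\<bar>f s\<bar> - \<bar>f t\<bar>)\<^sup>2" by simp
        then have "\<bar>f s\<bar> * \<bar>f t\<bar> \<le> 1/2 * (f s)\<^sup>2 + 1/2 * (f t)\<^sup>2"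
          by (simp add: power2_diff)
        then have "\<bar>f s\<bar> * \<bar>f t\<bar> * phi H s t \<le> (1/2 * (f s)\<^sup>2 + 1/2 * (f t)\<^sup>2) * phi H s t"
          by (rule mult_right_mono) (rule phi_nonneg[OF H_gt])
        then have "norm (f s * f t * phi H s t) \<le> 1/2 * ((f s)\<^sup>2 * phi H t s) + 1/2 * ((f t)\<^sup>2 * phi H s t)"
          using phi_nonneg[OF H_gt, of s t] by (simp add: abs_mult phi_commute[of H t s] algebra_simps)
        then have "ennreal (norm (f s * f t * phi H s t)) \<le> ennreal (1/2 * ((f s)\<^sup>2 * phi H t s) + 1/2 * ((f t)\<^sup>2
          * phi H s t))"
          by (rule ennreal_leI)
        also have "\<dots> = ennreal (1/2 * ((f s)\<^sup>2 * phi H t s)) + ennreal (1/2 * ((f t)\<^sup>2 * phi H s t))"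
          by (rule ennreal_plus) (use phi_nonneg[OF H_gt] in \<open>auto intro!: mult_nonneg_nonneg divide_nonneg_pos\<close>)
        also have "\<dots> = ennreal (1/2) * (ennreal ((f s)\<^sup>2) * ennreal (phi H t s)) + ennreal (1/2) * (ennreal ((f
          t)\<^sup>2) * ennreal (phi H s t))"
          using phi_nonneg[OF H_gt] by (simp only: ennreal_mult'[symmetric] ennreal_mult''[symmetric]
            zero_le_power2 zero_le_divide_1_iff zero_le_numeral)
        finally show ?thesis using s True by (simp only: g_def indicator_simps mult_1_left mult_1_right)
      qed simp
      then show ?thesis using True by (auto intro: nn_integral_mono)
    qed simp
    finally show "ennreal (norm (indicator {0..T} t * (LBINT s:{0..T}. f s * f t * phi H s t)))
      \<le> (\<integral>\<^sup>+s. ennreal (1/2) * (ennreal ((g s)\<^sup>2) * ennreal (phi H t s) * indicator {0..T} t) +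
      ennreal (1/2) * (ennreal ((g t)\<^sup>2) * ennreal (phi H s t) * indicator {0..T} s) \<partial>lborel)" .
  qed
  also have "\<dots> = ennreal (1/2) * (\<integral>\<^sup>+t. (\<integral>\<^sup>+s. ennreal ((g s)\<^sup>2) * ennreal (phi H t s) * indicator {0..T} t
    \<partial>lborel) \<partial>lborel) +
     ennreal (1/2) * (\<integral>\<^sup>+t. (\<integral>\<^sup>+s. ennreal ((g t)\<^sup>2) * ennreal (phi H s t) * indicator {0..T} s \<partial>lborel) \<partial>lborel)"
    by (simp add: nn_integral_add nn_integral_cmult)
  \<comment> \<open>Exchanging the variables shows that the two halves agree, so they add up to a
    single double integral.\<close>
  also have "(\<integral>\<^sup>+t. (\<integral>\<^sup>+s. ennreal ((g t)\<^sup>2) * ennreal (phi H s t) * indicator {0..T} s \<partial>lborel) \<partial>lborel) =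
    (\<integral>\<^sup>+t. (\<integral>\<^sup>+s. ennreal ((g s)\<^sup>2) * ennreal (phi H t s) * indicator {0..T} t \<partial>lborel) \<partial>lborel)"
    by (rule lborel_pair.Fubini') measurable
  also have "ennreal (1/2) * (\<integral>\<^sup>+t. (\<integral>\<^sup>+s. ennreal ((g s)\<^sup>2) * ennreal (phi H t s) * indicator {0..T} t \<partial>lborel)
    \<partial>lborel) +
     ennreal (1/2) * (\<integral>\<^sup>+t. (\<integral>\<^sup>+s. ennreal ((g s)\<^sup>2) * ennreal (phi H t s) * indicator {0..T} t \<partial>lborel) \<partial>lborel)
     = (\<integral>\<^sup>+t. (\<integral>\<^sup>+s. ennreal ((g s)\<^sup>2) * ennreal (phi H t s) * indicator {0..T} t \<partial>lborel) \<partial>lborel)"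
    by (simp only: distrib_right[symmetric] half mult_1)
  also have "\<dots> \<le> ennreal phi_mass * (\<integral>\<^sup>+s. ennreal ((g s)\<^sup>2) \<partial>lborel)"
    by (rule nn_integral_double_phi) (measurable, simp add: g_def)
  also have "\<dots> = ennreal (phi_mass * (LBINT s:{0..T}. (f s)\<^sup>2))"
    using i2 phi_mass_pos by (subst nn_integral_eq_integral)
      (auto simp: ennreal_mult'[symmetric] set_lebesgue_integral_def g_def power_mult_distrib indicator_power2)
  finally have "norm (phi_inner H T f f) \<le> phi_mass * (LBINT s:{0..T}. (f s)\<^sup>2)"
    by (subst (asm) ennreal_le_iff) (auto intro!: mult_nonneg_nonneg phi_mass_pos simp: set_lebesgue_integral_def)
  then show ?thesis by simp
qed

lemma J_add: "f \<in> L2 T \<Longrightarrow> g \<in> L2 T \<Longrightarrow> J (\<lambda>s. f s + g s) = J f + J g"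
  and J_scale: "f \<in> L2 T \<Longrightarrow> J (\<lambda>s. a * f s) = a *\<^sub>R J f"
  and J_inner: "f \<in> L2 T \<Longrightarrow> g \<in> L2 T \<Longrightarrow> inner (J f) (J g) = phi_inner H T f g"
  and J_dense: "closure (J ` L2 T) = UNIV"
  using completion unfolding phi_completion_def by blast+

lemma L2_I:
  assumes "(\<lambda>s. indicator {0..T} s * f s) \<in> borel_measurable borel" "set_integrable lborel {0..T} (\<lambda>s. (f s)\<^sup>2)"
  shows "f \<in> L2 T"
  using assms by (simp add: L2_def set_borel_measurable_def)

lemma L2_bounded:
  assumes m: "(\<lambda>s. indicator {0..T} s * f s) \<in> borel_measurable borel" and b: "\<And>s. s \<in> {0..T} \<Longrightarrow> \<bar>f s\<bar> \<le> C"
  shows "f \<in> L2 T"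
proof (rule L2_I[OF m])
  have [measurable]: "(\<lambda>s. (indicator {0..T} s * f s)\<^sup>2) \<in> borel_measurable borel" using m by measurable
  have "set_integrable lborel {0..T} (\<lambda>s. (indicator {0..T} s * f s)\<^sup>2)"
  proof (rule set_integrable_bound[where f="\<lambda>_. C\<^sup>2"])
    show "set_integrable lborel {0..T} (\<lambda>_. C\<^sup>2)" by (intro borel_integrable_atLeastAtMost' continuous_intros)
    show "set_borel_measurable lborel {0..T} (\<lambda>s. (indicator {0..T} s * f s)\<^sup>2)"
      unfolding set_borel_measurable_def by measurable
    show "AE s in lborel. s \<in> {0..T} \<longrightarrow> norm ((indicator {0..T} s * f s)\<^sup>2) \<le> norm (C\<^sup>2)"
      using b by (auto simp: abs_le_square_iff[symmetric] intro!: AE_I2 dest: order_trans[OF _ abs_ge_self])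
  qed
  then show "set_integrable lborel {0..T} (\<lambda>s. (f s)\<^sup>2)"
    unfolding set_integrable_def by (rule Bochner_Integration.integrable_cong[THEN iffD1, rotated -1]) (auto
      simp: indicator_def)
qed

lemma L2_add: assumes f: "f \<in> L2 T" and g: "g \<in> L2 T" shows "(\<lambda>s. f s + g s) \<in> L2 T"
proof (rule L2_I)
  have m: "(\<lambda>s. indicator {0..T} s * f s + indicator {0..T} s * g s) \<in> borel_measurable borel"
    using L2_measurable[OF f] L2_measurable[OF g] by measurable
  then show m': "(\<lambda>s. indicator {0..T} s * (f s + g s)) \<in> borel_measurable borel" by (simp add: algebra_simps)
  have "set_integrable lborel {0..T} (\<lambda>s. 2 * (f s)\<^sup>2 + 2 * (g s)\<^sup>2)"
    using f g unfolding L2_def by (intro set_integral_add set_integrable_mult_right) auto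
  then show "set_integrable lborel {0..T} (\<lambda>s. (f s + g s)\<^sup>2)"
    unfolding set_integrable_def
  proof (rule Bochner_Integration.integrable_bound)
    have "(\<lambda>s. (indicator {0..T} s * (f s + g s))\<^sup>2) \<in> borel_measurable borel" using m' by measurable
    then show "(\<lambda>x. indicator {0..T} x *\<^sub>R (f x + g x)\<^sup>2) \<in> borel_measurable lborel"
      by (simp add: power_mult_distrib indicator_power2)
    show "AE x in lborel. norm (indicator {0..T} x *\<^sub>R (f x + g x)\<^sup>2)
      \<le> norm (indicator {0..T} x *\<^sub>R (2 * (f x)\<^sup>2 + 2 * (g x)\<^sup>2))"
    proof (rule AE_I2)
      fix x
      have "0 \<le> (f x - g x)\<^sup>2" by simp
      then have "(f x + g x)\<^sup>2 \<le> 2 * (f x)\<^sup>2 + 2 * (g x)\<^sup>2"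
        by (simp add: power2_sum power2_diff)
      then show "norm (indicator {0..T} x *\<^sub>R (f x + g x)\<^sup>2) \<le> norm (indicator {0..T} x *\<^sub>R (2 * (f x)\<^sup>2 + 2 * (g x)\<^sup>2))"
        by (simp add: indicator_def)
    qed
  qed
qed

lemma L2_scale: assumes f: "f \<in> L2 T" shows "(\<lambda>s. a * f s) \<in> L2 T"
proof (rule L2_I)
  have "(\<lambda>s. a * (indicator {0..T} s * f s)) \<in> borel_measurable borel"
    using L2_measurable[OF f] by measurable
  then show "(\<lambda>s. indicator {0..T} s * (a * f s)) \<in> borel_measurable borel" by (simp add: algebra_simps)
  have "set_integrable lborel {0..T} (\<lambda>s. a\<^sup>2 * (f s)\<^sup>2)"
    using f unfolding L2_def by (intro set_integrable_mult_right) auto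
  then show "set_integrable lborel {0..T} (\<lambda>s. (a * f s)\<^sup>2)" by (simp add: power_mult_distrib)
qed

lemma L2_diff: "f \<in> L2 T \<Longrightarrow> g \<in> L2 T \<Longrightarrow> (\<lambda>s. f s - g s) \<in> L2 T"
  using L2_add[of f "\<lambda>s. - 1 * g s"] L2_scale[of g "-1"] by simp

lemma J_diff: "f \<in> L2 T \<Longrightarrow> g \<in> L2 T \<Longrightarrow> J (\<lambda>s. f s - g s) = J f - J g"
  using J_add[of f "\<lambda>s. - 1 * g s"] L2_scale[of g "-1"] J_scale[of g "-1"] by simp

lemma L2_indicator: "A \<in> sets borel \<Longrightarrow> indicator A \<in> L2 T"
  by (rule L2_bounded[where C=1]) (auto simp: indicator_def)

lemma norm_J_le: assumes f: "f \<in> L2 T" shows "(norm (J f))\<^sup>2 \<le> phi_mass * (LBINT s:{0..T}. (f s)\<^sup>2)"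
  using phi_inner_le[OF f] J_inner[OF f f] by (simp add: power2_norm_eq_inner)

text \<open>\<open>J\<close> acts on functions on the whole line, not on classes. Functions that
  agree on [0,T] have images at distance zero by the Schur bound.\<close>

lemma J_cong:
  assumes f: "f \<in> L2 T" and g: "g \<in> L2 T" and eq: "\<And>s. s \<in> {0..T} \<Longrightarrow> f s = g s"
  shows "J f = J g"
proof -
  have "(LBINT s:{0..T}. (f s - g s)\<^sup>2) = (LBINT s:{0..T}. 0)"
    by (rule set_lebesgue_integral_cong) (auto simp: eq)
  then have "(norm (J f - J g))\<^sup>2 \<le> 0"
    using norm_J_le[OF L2_diff[OF f g]] J_diff[OF f g] by simp
  then show ?thesis by simp
qed

lemma J_tendsto:
  assumes f: "\<And>n. f n \<in> L2 T" and g: "g \<in> L2 T"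
    and lim: "\<And>s. s \<in> {0..T} \<Longrightarrow> (\<lambda>n. f n s) \<longlonglongrightarrow> g s"
    and w: "set_integrable lborel {0..T} w" "\<And>n s. s \<in> {0..T} \<Longrightarrow> (f n s - g s)\<^sup>2 \<le> w s"
  shows "(\<lambda>n. J (f n)) \<longlonglongrightarrow> J g"
proof -
  have "(\<lambda>n. LBINT s:{0..T}. (f n s - g s)\<^sup>2) \<longlonglongrightarrow> (LBINT s:{0..T}. 0)"
    unfolding set_lebesgue_integral_def
  proof (rule integral_dominated_convergence)
    show "integrable lborel (\<lambda>s. indicator {0..T} s *\<^sub>R w s)" using w(1) by (simp add: set_integrable_def)
    show "(\<lambda>x. indicator {0..T} x *\<^sub>R (f n x - g x)\<^sup>2) \<in> borel_measurable lborel" for n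
      using L2_diff[OF f g, of n] by (auto simp: L2_def set_integrable_def)
    show "AE x in lborel. (\<lambda>n. indicator {0..T} x *\<^sub>R (f n x - g x)\<^sup>2) \<longlonglongrightarrow> indicator {0..T} x *\<^sub>R 0"
    proof (rule AE_I2)
      fix x
      show "(\<lambda>n. indicator {0..T} x *\<^sub>R (f n x - g x)\<^sup>2) \<longlonglongrightarrow> indicator {0..T} x *\<^sub>R 0"
      proof (cases "x \<in> {0..T}")
        case True
        have "(\<lambda>n. (f n x - g x)\<^sup>2) \<longlonglongrightarrow> (g x - g x)\<^sup>2" using lim[OF True] by (intro tendsto_intros)
        then show ?thesis using True by simp
      qed simp
    qed
    show "AE x in lborel. norm (indicator {0..T} x *\<^sub>R (f n x - g x)\<^sup>2) \<le> indicator {0..T} x *\<^sub>R w x" for n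
      using w(2) by (auto simp: indicator_def intro!: AE_I2)
  qed simp
  then have "(\<lambda>n. phi_mass * (LBINT s:{0..T}. (f n s - g s)\<^sup>2)) \<longlonglongrightarrow> 0"
    using tendsto_mult_left[of _ 0 _ phi_mass] by simp
  then have "(\<lambda>n. (norm (J (f n) - J g))\<^sup>2) \<longlonglongrightarrow> 0"
    by (rule tendsto_sandwich[OF _ _ tendsto_const, rotated 2])
      (use norm_J_le[OF L2_diff[OF f g]] J_diff[OF f g] in auto)
  then have "(\<lambda>n. sqrt ((norm (J (f n) - J g))\<^sup>2)) \<longlonglongrightarrow> sqrt 0" by (intro tendsto_intros)
  then show ?thesis by (simp add: tendsto_norm_zero_iff LIM_zero_iff)
qed

end

text \<open>The integrand in component j whose Wiener integral is the part of \<open>linB xs\<close>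
  that involves that component.\<close>

definition stepf :: "(real \<times> 'n \<times> real) list \<Rightarrow> 'n \<Rightarrow> real \<Rightarrow> real" where
  "stepf xs j s = (\<Sum>(a, i, t)\<leftarrow>xs. if i = j then a * indicator {0..t} s else 0)"

lemma stepf_Nil: "stepf [] j s = 0"
  and stepf_Cons: "stepf ((a, i, t) # xs) j s = (if i = j then a * indicator {0..t} s else 0) + stepf xs j s"
  by (simp_all add: stepf_def)

lemma stepf_append: "stepf (xs @ ys) j s = stepf xs j s + stepf ys j s"
  by (simp add: stepf_def)

lemma stepf_measurable[measurable]: "stepf xs j \<in> borel_measurable borel"
proof (induction xs)
  case (Cons x xs)
  obtain a i t where x: "x = (a, i, t)" by (cases x)
  note [measurable] = Cons
  have "stepf (x # xs) j = (\<lambda>s. (if i = j then a * indicator {0..t} s else 0) + stepf xs j s)"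
    by (auto simp: x stepf_Cons)
  then show ?case by simp
next
  case Nil
  have "stepf [] j = (\<lambda>s. 0)" by (auto simp: stepf_Nil)
  then show ?case by simp
qed

lemma abs_stepf_le: "\<bar>stepf xs j s\<bar> \<le> (\<Sum>(a, i, t)\<leftarrow>xs. \<bar>a\<bar>)"
proof (induction xs)
  case (Cons x xs)
  obtain a i t where x: "x = (a, i, t)" by (cases x)
  show ?case using Cons by (auto simp: x stepf_Cons indicator_def abs_le_iff)
qed (simp add: stepf_Nil)

text \<open>Boundedness makes the step functions admissible tests in the characterization of the Ito
  integral.\<close>

lemma stepf_Linf: "stepf xs j \<in> Linf T"
  unfolding Linf_def set_borel_measurable_def using abs_stepf_le[of xs j]
  by (auto intro!: exI[of _ "\<Sum>(a, i, t)\<leftarrow>xs. \<bar>a\<bar>"])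

abbreviation valid_times :: "real \<Rightarrow> (real \<times> 'n \<times> real) list \<Rightarrow> bool" where
  "valid_times T xs \<equiv> \<forall>(a, i, t)\<in>set xs. t \<in> {0..T}"

lemma mono_powr_primitive:
  assumes a: "a > 0" and xy: "x \<le> y"
  shows "powr_primitive a x \<le> powr_primitive a y"
proof -
  have eq: "powr_primitive a x = max 0 x powr a - max 0 (- x) powr a" for x
    by (auto simp: powr_primitive_def sgn_if max_def)
  have "max 0 x powr a \<le> max 0 y powr a" "max 0 (- y) powr a \<le> max 0 (- x) powr a"
    using a xy by (auto intro!: powr_mono2)
  then show ?thesis unfolding eq by linarith
qed

lemma subspace_closure:
  fixes S :: "'a::real_normed_vector set"
  assumes S: "subspace S"
  shows "subspace (closure S)"
proof (rule subspaceI)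
  show "0 \<in> closure S" using subspace_0[OF S] closure_subset by blast
next
  fix x y assume "x \<in> closure S" "y \<in> closure S"
  then obtain u v where "\<And>n. u n \<in> S" "u \<longlonglongrightarrow> x" "\<And>n. v n \<in> S" "v \<longlonglongrightarrow> y"
    unfolding closure_sequential by blast
  then show "x + y \<in> closure S" unfolding closure_sequential
    by (intro exI[of _ "\<lambda>n. u n + v n"]) (auto intro: tendsto_add subspace_add[OF S])
next
  fix c x assume "x \<in> closure S"
  then obtain u where "\<And>n. u n \<in> S" "u \<longlonglongrightarrow> x" unfolding closure_sequential by blast
  then show "c *\<^sub>R x \<in> closure S" unfolding closure_sequential
    by (intro exI[of _ "\<lambda>n. c *\<^sub>R u n"]) (auto intro: tendsto_scaleR subspace_scale[OF S])
qed

section \<open>The operator Phi, and density of step functions\<close>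

context phi_hilbert
begin

lemma L2_integrable_abs:
  assumes f: "f \<in> L2 T"
  shows "(\<integral>\<^sup>+s. ennreal \<bar>indicator {0..T} s * f s\<bar> \<partial>lborel) < \<infinity>"
proof -
  have m[measurable]: "(\<lambda>s. indicator {0..T} s * f s) \<in> borel_measurable borel" by (rule L2_measurable[OF f])
  have "integrable lborel (\<lambda>s. indicator {0..T} s *\<^sub>R (1 + (f s)\<^sup>2))"
    using f borel_integrable_atLeastAtMost'[of 0 T "\<lambda>_. 1::real"]
    unfolding L2_def set_integrable_def scaleR_add_right by (intro Bochner_Integration.integrable_add) auto
  then have "integrable lborel (\<lambda>s. indicator {0..T} s * f s)"
  proof (rule Bochner_Integration.integrable_bound)
    have "\<bar>x\<bar> \<le> 1 + x\<^sup>2" for x :: real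
    proof -
      have "0 \<le> (\<bar>x\<bar> - 1)\<^sup>2" by simp
      then show ?thesis by (simp add: power2_diff)
    qed
    then show "AE x in lborel. norm (indicator {0..T} x * f x) \<le> norm (indicator {0..T} x *\<^sub>R (1 + (f x)\<^sup>2))"
      by (auto simp: indicator_def intro!: AE_I2 order_trans[OF _ abs_ge_self])
  qed simp
  then show ?thesis unfolding integrable_iff_bounded real_norm_def by blast
qed

lemma Phi_fun_eq: "Phi_fun H T f t = (\<integral>s. indicator {0..T} s * f s * phi H t s \<partial>lborel)"
  by (simp add: Phi_fun_def set_lebesgue_integral_def mult.assoc)

lemma nn_integral_Phi_finite:
  assumes f: "f \<in> L2 T"
  shows "(\<integral>\<^sup>+t. (\<integral>\<^sup>+s. ennreal \<bar>indicator {0..T} s * f s\<bar> * ennreal (phi H t s) * indicator {0..T} t \<partial>lborel)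
    \<partial>lborel) < \<infinity>"
proof -
  have m: "(\<lambda>s. indicator {0..T} s * f s) \<in> borel_measurable borel" by (rule L2_measurable[OF f])
  have "(\<integral>\<^sup>+t. (\<integral>\<^sup>+s. ennreal \<bar>indicator {0..T} s * f s\<bar> * ennreal (phi H t s) * indicator {0..T} t \<partial>lborel) \<partial>lborel)
    \<le> ennreal phi_mass * (\<integral>\<^sup>+s. ennreal \<bar>indicator {0..T} s * f s\<bar> \<partial>lborel)"
    using borel_measurable_abs[OF m] by (intro nn_integral_double_phi) auto
  also have "\<dots> < \<infinity>" using L2_integrable_abs[OF f] by (simp add: ennreal_mult_less_top)
  finally show ?thesis .
qed

lemma Phi_fun_measurable: "f \<in> L2 T \<Longrightarrow> Phi_fun H T f \<in> borel_measurable borel"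
proof -
  assume f: "f \<in> L2 T"
  define g where "g s = indicator {0..T} s * f s" for s
  have [measurable]: "g \<in> borel_measurable borel" unfolding g_def by (rule L2_measurable[OF f])
  have "Phi_fun H T f = (\<lambda>t. \<integral>s. g s * phi H t s \<partial>lborel)" by (simp add: fun_eq_iff Phi_fun_eq g_def)
  then show ?thesis by simp
qed

lemma Phi_fun_integrable:
  assumes f: "f \<in> L2 T"
  shows "set_integrable lborel {0..T} (Phi_fun H T f)"
  unfolding set_integrable_def
proof (rule integrableI_bounded)
  note [measurable] = Phi_fun_measurable[OF f]
  show "(\<lambda>x. indicator {0..T} x *\<^sub>R Phi_fun H T f x) \<in> borel_measurable lborel" by measurable
  have "(\<integral>\<^sup>+t. ennreal (norm (indicator {0..T} t *\<^sub>R Phi_fun H T f t)) \<partial>lborel) \<le>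
    (\<integral>\<^sup>+t. (\<integral>\<^sup>+s. ennreal \<bar>indicator {0..T} s * f s\<bar> * ennreal (phi H t s) * indicator {0..T} t \<partial>lborel) \<partial>lborel)"
  proof (intro nn_integral_mono)
    fix t
    show "ennreal (norm (indicator {0..T} t *\<^sub>R Phi_fun H T f t))
      \<le> (\<integral>\<^sup>+s. ennreal \<bar>indicator {0..T} s * f s\<bar> * ennreal (phi H t s) * indicator {0..T} t \<partial>lborel)"
    proof (cases "t \<in> {0..T}")
      case True
      have "ennreal (norm (Phi_fun H T f t)) \<le> (\<integral>\<^sup>+s. ennreal (norm (indicator {0..T} s * f s * phi H t s)) \<partial>lborel)"
        unfolding Phi_fun_eq by (rule ennreal_norm_integral_le)
      also have "\<dots> = (\<integral>\<^sup>+s. ennreal \<bar>indicator {0..T} s * f s\<bar> * ennreal (phi H t s) \<partial>lborel)"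
        using phi_nonneg[OF H_gt] by (intro nn_integral_cong) (simp add: abs_mult ennreal_mult)
      finally show ?thesis using True by simp
    qed simp
  qed
  also have "\<dots> < \<infinity>" by (rule nn_integral_Phi_finite[OF f])
  finally show "(\<integral>\<^sup>+t. ennreal (norm (indicator {0..T} t *\<^sub>R Phi_fun H T f t)) \<partial>lborel) < \<infinity>" .
qed

text \<open>The double integral of the absolute values is finite, so by Tonelli the inner integral
  converges for almost every t. Linearity of \<open>Phi_fun\<close> is accordingly an almost
  everywhere statement.\<close>

lemma AE_Phi_integrable:
  assumes f: "f \<in> L2 T"
  shows "AE t in lborel. t \<in> {0..T} \<longrightarrow> integrable lborel (\<lambda>s. indicator {0..T} s * f s * phi H t s)"
proof -
  define g where "g s = indicator {0..T} s * f s" for s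
  have [measurable]: "g \<in> borel_measurable borel" unfolding g_def by (rule L2_measurable[OF f])
  have "AE t in lborel. (\<integral>\<^sup>+s. ennreal \<bar>g s\<bar> * ennreal (phi H t s) * indicator {0..T} t \<partial>lborel) \<noteq> \<infinity>"
    using nn_integral_Phi_finite[OF f] by (intro nn_integral_PInf_AE) (measurable, simp add: g_def)
  then have "AE t in lborel. t \<in> {0..T} \<longrightarrow> integrable lborel (\<lambda>s. g s * phi H t s)"
  proof eventually_elim
    case (elim t)
    show ?case
    proof
      assume t: "t \<in> {0..T}"
      have "(\<integral>\<^sup>+s. ennreal (norm (g s * phi H t s)) \<partial>lborel) = (\<integral>\<^sup>+s. ennreal \<bar>g s\<bar> * ennreal (phi H t s) *
        indicator {0..T} t \<partial>lborel)"
        using phi_nonneg[OF H_gt] t by (intro nn_integral_cong) (simp add: abs_mult ennreal_mult)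
      then show "integrable lborel (\<lambda>s. g s * phi H t s)"
        using elim by (intro integrableI_bounded) (auto simp: less_top)
    qed
  qed
  then show ?thesis by (simp add: g_def)
qed

lemma Phi_fun_lincomb:
  assumes f: "f \<in> L2 T" and g: "g \<in> L2 T"
  shows "AE t in lborel. t \<in> {0..T} \<longrightarrow> Phi_fun H T (\<lambda>s. a * f s + g s) t = a * Phi_fun H T f t + Phi_fun H T g t"
  using AE_Phi_integrable[OF f] AE_Phi_integrable[OF g]
proof eventually_elim
  case (elim t)
  show ?case
  proof
    assume t: "t \<in> {0..T}"
    have "Phi_fun H T (\<lambda>s. a * f s + g s) t = (\<integral>s. a * (indicator {0..T} s * f s * phi H t s) + indicator
      {0..T} s * g s * phi H t s \<partial>lborel)"
      unfolding Phi_fun_eq by (intro Bochner_Integration.integral_cong) (simp_all add: algebra_simps)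
    then show "Phi_fun H T (\<lambda>s. a * f s + g s) t = a * Phi_fun H T f t + Phi_fun H T g t"
      using elim t by (simp add: Phi_fun_eq)
  qed
qed

lemma phi_inner_eq: "phi_inner H T f g = (LBINT t:{0..T}. g t * Phi_fun H T f t)"
proof -
  have "(LBINT s:{0..T}. f s * g t * phi H s t) = g t * Phi_fun H T f t" for t
  proof -
    have "(LBINT s:{0..T}. f s * g t * phi H s t) = (\<integral>s. g t * (indicator {0..T} s * f s * phi H t s) \<partial>lborel)"
      unfolding set_lebesgue_integral_def
      by (intro Bochner_Integration.integral_cong) (simp_all add: phi_commute[of H t] algebra_simps)
    then show ?thesis by (simp add: Phi_fun_eq)
  qed
  then show ?thesis by (simp add: phi_inner_def)
qed

lemma phi_inner_indicator:
  assumes "x \<ge> 0" "y \<le> T"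
  shows "phi_inner H T f (indicator {x..y}) = (LBINT t:{x..y}. Phi_fun H T f t)"
  unfolding phi_inner_eq set_lebesgue_integral_def
  by (intro Bochner_Integration.integral_cong) (use assms in \<open>auto simp: indicator_def\<close>)

text \<open>For square integrable functions this is the definition of the inner product. It passes
  to the limit on the left by L1 convergence and on the right by continuity of \<open>inner\<close>.
  Consequently the shift in \<open>translate\<close> does not depend on the version selected by
  \<open>Phi\<close>.\<close>

lemma Phi_version_integral:
  assumes v: "Phi_version H T J h g" and r: "r \<in> {0..T}"
  shows "(LBINT t:{0..r}. g t) = inner h (J (indicator {0..r}))"
proof -
  obtain f where f: "\<And>n. f n \<in> L2 T" "(\<lambda>n. J (f n)) \<longlonglongrightarrow> h"
    "(\<lambda>n. LBINT t:{0..T}. \<bar>Phi_fun H T (f n) t - g t\<bar>) \<longlonglongrightarrow> 0" and gi: "set_integrable lborel {0..T} g"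
    using v unfolding Phi_version_def by blast
  have gr: "set_integrable lborel {0..r} g" using r by (intro set_integrable_subset[OF gi]) auto
  have fr: "set_integrable lborel {0..r} (Phi_fun H T (f n))" for n
    using r by (intro set_integrable_subset[OF Phi_fun_integrable[OF f(1)]]) auto
  have "(\<lambda>n. LBINT t:{0..r}. Phi_fun H T (f n) t) = (\<lambda>n. inner (J (f n)) (J (indicator {0..r})))"
    using r phi_inner_indicator[of 0 r] J_inner[OF f(1) L2_indicator] by (simp add: fun_eq_iff)
  then have "(\<lambda>n. LBINT t:{0..r}. Phi_fun H T (f n) t) \<longlonglongrightarrow> inner h (J (indicator {0..r}))"
    using f(2) by (simp add: tendsto_inner)
  moreover have "(\<lambda>n. (LBINT t:{0..r}. Phi_fun H T (f n) t) - (LBINT t:{0..r}. g t)) \<longlonglongrightarrow> 0"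
  proof (rule Lim_null_comparison[OF _ f(3)], rule always_eventually, rule allI)
    fix n
    have i: "set_integrable lborel {0..T} (\<lambda>t. \<bar>Phi_fun H T (f n) t - g t\<bar>)"
      by (intro set_integrable_abs set_integral_diff Phi_fun_integrable f gi)
    have "norm ((LBINT t:{0..r}. Phi_fun H T (f n) t) - (LBINT t:{0..r}. g t))
      = norm (LBINT t:{0..r}. Phi_fun H T (f n) t - g t)"
      using fr gr by (simp add: set_integral_diff)
    also have "\<dots> \<le> (LBINT t:{0..r}. norm (Phi_fun H T (f n) t - g t))"
      by (rule set_integral_norm_bound) (intro set_integral_diff fr gr)
    also have "\<dots> \<le> (LBINT t:{0..T}. \<bar>Phi_fun H T (f n) t - g t\<bar>)"
      unfolding set_lebesgue_integral_def
    proof (rule integral_mono)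
      have "set_integrable lborel {0..r} (\<lambda>t. \<bar>Phi_fun H T (f n) t - g t\<bar>)"
        using r by (intro set_integrable_subset[OF i]) auto
      then show "integrable lborel (\<lambda>x. indicator {0..r} x *\<^sub>R norm (Phi_fun H T (f n) x - g x))"
        by (simp add: set_integrable_def)
      show "integrable lborel (\<lambda>x. indicator {0..T} x *\<^sub>R \<bar>Phi_fun H T (f n) x - g x\<bar>)"
        using i by (simp add: set_integrable_def)
    qed (use r in \<open>auto simp: indicator_def\<close>)
    finally show "norm ((LBINT t:{0..r}. Phi_fun H T (f n) t) - (LBINT t:{0..r}. g t))
      \<le> (LBINT t:{0..T}. \<bar>Phi_fun H T (f n) t - g t\<bar>)" .
  qed
  ultimately have "(LBINT t:{0..r}. g t) - inner h (J (indicator {0..r})) = 0"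
    using LIMSEQ_unique[OF _ LIM_zero_cancel] by fastforce
  then show ?thesis by simp
qed

lemma Phi_version_J: assumes f: "f \<in> L2 T" shows "Phi_version H T J (J f) (Phi_fun H T f)"
  unfolding Phi_version_def using Phi_fun_integrable[OF f] f
  by (auto intro!: exI[of _ "\<lambda>_. f"] simp: set_lebesgue_integral_def)

lemma Phi_version_lincomb:
  assumes v: "Phi_version H T J h g" and v': "Phi_version H T J h' g'"
  shows "Phi_version H T J (a *\<^sub>R h + h') (\<lambda>t. a * g t + g' t)"
proof -
  obtain f where f: "\<And>n. f n \<in> L2 T" "(\<lambda>n. J (f n)) \<longlonglongrightarrow> h"
    "(\<lambda>n. LBINT t:{0..T}. \<bar>Phi_fun H T (f n) t - g t\<bar>) \<longlonglongrightarrow> 0" and gi: "set_integrable lborel {0..T} g"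
    using v unfolding Phi_version_def by blast
  obtain f' where f': "\<And>n. f' n \<in> L2 T" "(\<lambda>n. J (f' n)) \<longlonglongrightarrow> h'"
    "(\<lambda>n. LBINT t:{0..T}. \<bar>Phi_fun H T (f' n) t - g' t\<bar>) \<longlonglongrightarrow> 0" and gi': "set_integrable lborel {0..T} g'"
    using v' unfolding Phi_version_def by blast
  define F where "F n s = a * f n s + f' n s" for n s
  have F: "F n \<in> L2 T" for n unfolding F_def[abs_def] by (intro L2_add L2_scale f f')
  have JF: "J (F n) = a *\<^sub>R J (f n) + J (f' n)" for n
    unfolding F_def[abs_def] using J_add[OF L2_scale[OF f(1)] f'(1)] J_scale[OF f(1)] by simp
  have i: "set_integrable lborel {0..T} (\<lambda>t. \<bar>Phi_fun H T (f n) t - g t\<bar>)" for n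
    by (intro set_integrable_abs set_integral_diff Phi_fun_integrable f gi)
  have i': "set_integrable lborel {0..T} (\<lambda>t. \<bar>Phi_fun H T (f' n) t - g' t\<bar>)" for n
    by (intro set_integrable_abs set_integral_diff Phi_fun_integrable f' gi')
  have gg: "set_integrable lborel {0..T} (\<lambda>t. a * g t + g' t)"
    using gi gi' by (intro set_integral_add set_integrable_mult_right) auto
  have "(\<lambda>n. LBINT t:{0..T}. \<bar>Phi_fun H T (F n) t - (a * g t + g' t)\<bar>) \<longlonglongrightarrow> 0"
  proof (rule tendsto_sandwich[OF _ _ tendsto_const], rule_tac[1-2] always_eventually, rule_tac[1-2] allI)
    fix n
    show "0 \<le> (LBINT t:{0..T}. \<bar>Phi_fun H T (F n) t - (a * g t + g' t)\<bar>)" by (simp add: set_lebesgue_integral_def)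
    have "(LBINT t:{0..T}. \<bar>Phi_fun H T (F n) t - (a * g t + g' t)\<bar>) \<le>
      (LBINT t:{0..T}. \<bar>a\<bar> * \<bar>Phi_fun H T (f n) t - g t\<bar> + \<bar>Phi_fun H T (f' n) t - g' t\<bar>)"
      unfolding set_lebesgue_integral_def
    proof (rule integral_mono_AE)
      show "integrable lborel (\<lambda>x. indicator {0..T} x *\<^sub>R \<bar>Phi_fun H T (F n) x - (a * g x + g' x)\<bar>)"
        using set_integrable_abs[OF set_integral_diff(1)[OF Phi_fun_integrable[OF F] gg]]
          by (simp add: set_integrable_def)
      show "integrable lborel (\<lambda>x. indicator {0..T} x *\<^sub>R (\<bar>a\<bar> * \<bar>Phi_fun H T (f n) x - g x\<bar> + \<bar>Phi_fun H T (f'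
        n) x - g' x\<bar>))"
        using set_integral_add(1)[OF set_integrable_mult_right[of "\<bar>a\<bar>", OF i] i'] by (simp add: set_integrable_def)
      show "AE x in lborel. indicator {0..T} x *\<^sub>R \<bar>Phi_fun H T (F n) x - (a * g x + g' x)\<bar> \<le>
        indicator {0..T} x *\<^sub>R (\<bar>a\<bar> * \<bar>Phi_fun H T (f n) x - g x\<bar> + \<bar>Phi_fun H T (f' n) x - g' x\<bar>)"
        using Phi_fun_lincomb[OF f(1)[of n] f'(1)[of n], of a]
      proof eventually_elim
        case (elim x)
        have "\<bar>a * p + q - (a * u + v)\<bar> \<le> \<bar>a\<bar> * \<bar>p - u\<bar> + \<bar>q - v\<bar>" for p q u v :: real
        proof -
          have "a * p + q - (a * u + v) = a * (p - u) + (q - v)" by (simp add: algebra_simps)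
          then show ?thesis by (metis abs_mult abs_triangle_ineq)
        qed
        then show ?case using elim by (auto simp: F_def[abs_def] indicator_def)
      qed
    qed
    also have "\<dots> = \<bar>a\<bar> * (LBINT t:{0..T}. \<bar>Phi_fun H T (f n) t - g t\<bar>) + (LBINT t:{0..T}. \<bar>Phi_fun H T (f' n) t
      - g' t\<bar>)"
      using set_integral_add(2)[OF set_integrable_mult_right[of "\<bar>a\<bar>", OF i] i'] by simp
    finally show "(LBINT t:{0..T}. \<bar>Phi_fun H T (F n) t - (a * g t + g' t)\<bar>) \<le>
      \<bar>a\<bar> * (LBINT t:{0..T}. \<bar>Phi_fun H T (f n) t - g t\<bar>) + (LBINT t:{0..T}. \<bar>Phi_fun H T (f' n) t - g' t\<bar>)" .
  next
    show "(\<lambda>n. \<bar>a\<bar> * (LBINT t:{0..T}. \<bar>Phi_fun H T (f n) t - g t\<bar>) + (LBINT t:{0..T}. \<bar>Phi_fun H T (f' n) t -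
      g' t\<bar>)) \<longlonglongrightarrow> 0"
      using tendsto_add[OF tendsto_mult_left[OF f(3), of "\<bar>a\<bar>"] f'(3)] by simp
  qed
  moreover have "(\<lambda>n. J (F n)) \<longlonglongrightarrow> a *\<^sub>R h + h'" unfolding JF by (intro tendsto_intros f f')
  ultimately show ?thesis unfolding Phi_version_def using F gg by blast
qed

text \<open>The directions of translation in the mild equation are projections onto spans of
  finitely many e_k, so versions for the e_k provide versions for all of them.\<close>

lemma Phi_version_span:
  assumes "\<And>x. x \<in> S \<Longrightarrow> \<exists>g. Phi_version H T J x g" and "h \<in> span S"
  shows "\<exists>g. Phi_version H T J h g"
  using assms(2)
proof (induction rule: span_induct_alt)
  case base
  have "(\<lambda>s. 0) \<in> L2 T" by (rule L2_bounded[where C=0]) auto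
  moreover from this have "J (\<lambda>s. 0) = 0" using J_scale[of "\<lambda>s. 0" 0] by simp
  ultimately show ?case using Phi_version_J by fastforce
next
  case (step c x y)
  then show ?case using assms(1) Phi_version_lincomb by blast
qed

abbreviation chi :: "real \<Rightarrow> 'h" where "chi t \<equiv> J (indicator {0..t})"

lemma J_zero[simp]: "J (\<lambda>s. 0) = 0"
proof -
  have "(\<lambda>s. 0) \<in> L2 T" by (rule L2_bounded[where C=0]) auto
  then show ?thesis using J_scale[of "\<lambda>s. 0" 0] by simp
qed

lemma L2_sum: "finite S \<Longrightarrow> (\<And>i. i \<in> S \<Longrightarrow> f i \<in> L2 T) \<Longrightarrow> (\<lambda>s. \<Sum>i\<in>S. f i s) \<in> L2 T"
proof (induction S rule: finite_induct)
  case empty then show ?case using L2_bounded[where C=0 and f="\<lambda>s. 0"] by simp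
next
  case (insert x F) then show ?case by (simp add: L2_add)
qed

lemma J_sum: "finite S \<Longrightarrow> (\<And>i. i \<in> S \<Longrightarrow> f i \<in> L2 T) \<Longrightarrow> J (\<lambda>s. \<Sum>i\<in>S. f i s) = (\<Sum>i\<in>S. J (f i))"
proof (induction S rule: finite_induct)
  case empty then show ?case by (simp add: J_zero)
next
  case (insert x F) then show ?case by (simp add: J_add L2_sum)
qed

text \<open>A disjoint-union induction from half-lines. Only the part in [0,T] is visible to
  \<open>J\<close>, so a half-line acts as an interval [0,t] or as the empty set.\<close>

lemma J_indicator_in_closure:
  assumes A: "A \<in> sets borel"
  shows "J (indicator A) \<in> closure (span (chi ` {0..T}))" (is "_ \<in> ?V")
proof -
  have sub: "subspace ?V" by (intro subspace_closure subspace_span)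
  have base: "chi t \<in> ?V" if "t \<in> {0..T}" for t
    using that closure_subset by (metis image_eqI span_base subsetD)
  have top: "J (indicator UNIV) \<in> ?V"
  proof -
    have "J (indicator UNIV) = chi T" using T_pos by (intro J_cong L2_indicator) (auto simp: indicator_def)
    then show ?thesis using base[of T] T_pos by simp
  qed
  have "Int_stable (range (\<lambda>a::real. {..a}))" by (auto simp: Int_stable_def)
  moreover have "range (\<lambda>a::real. {..a}) \<subseteq> Pow UNIV" by simp
  moreover have "A \<in> sigma_sets UNIV (range (\<lambda>a::real. {..a}))" using A by (simp add: borel_eq_atMost)
  ultimately show ?thesis
  proof (induction rule: sigma_sets_induct_disjoint)
    case (basic A)
    then obtain a where a: "A = {..a}" by auto
    show ?case
    proof (cases "a \<ge> 0")
      case True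
      have "J (indicator A) = chi (min a T)" unfolding a by (intro J_cong L2_indicator) (auto simp: indicator_def)
      then show ?thesis using base[of "min a T"] True T_pos by simp
    next
      case False
      have "J (indicator A) = J (\<lambda>s. 0)" unfolding a using False
        by (intro J_cong L2_indicator L2_bounded[where C=0]) (auto simp: indicator_def)
      then show ?thesis using subspace_0[OF sub] by (simp add: J_zero)
    qed
  next
    case empty
    have "indicator {} = (\<lambda>s::real. 0::real)" by auto
    then show ?case using subspace_0[OF sub] by (simp add: J_zero)
  next
    case (compl A)
    then have A: "A \<in> sets borel" by (simp add: borel_eq_atMost)
    have "indicator (UNIV - A) = (\<lambda>s. indicator UNIV s - indicator A s :: real)" by (auto simp: indicator_def)
    then have "J (indicator (UNIV - A)) = J (indicator UNIV) - J (indicator A)"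
      using J_diff[OF L2_indicator L2_indicator[OF A], of UNIV] by simp
    then show ?case using subspace_diff[OF sub top compl(2)] by simp
  next
    case (union A)
    have Ab: "A i \<in> sets borel" for i using union(2) by (auto simp: borel_eq_atMost)
    have "(\<lambda>n. J (\<lambda>s. \<Sum>i<n. indicator (A i) s)) \<longlonglongrightarrow> J (indicator (\<Union>i. A i))"
    proof (rule J_tendsto[where w="\<lambda>_. 1::real"])
      show "(\<lambda>s. \<Sum>i<n. indicator (A i) s) \<in> L2 T" for n by (intro L2_sum L2_indicator Ab) simp
      show "indicator (\<Union>i. A i) \<in> L2 T" using Ab by (intro L2_indicator) auto
      show "set_integrable lborel {0..T} (\<lambda>_. 1::real)" by (intro borel_integrable_atLeastAtMost' continuous_intros)
      show "(\<lambda>n. \<Sum>i<n. indicator (A i) s :: real) \<longlonglongrightarrow> indicator (\<Union>i. A i) s" for s :: real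
        by (rule indicator_sums[unfolded sums_def]) (use union(1) in \<open>auto simp: disjoint_family_on_def\<close>)
      show "((\<Sum>i<n. indicator (A i) s) - indicator (\<Union>i. A i) s)\<^sup>2 \<le> (1::real)" for n s
      proof -
        \<comment> \<open>Disjointness keeps the partial sums between 0 and 1, which supplies the
          constant dominating function.\<close>
        have eq: "(\<Sum>i<n. indicator (A i) s) = (indicator (\<Union>i<n. A i) s :: real)"
          by (rule indicator_UN_disjoint[symmetric]) (use union(1) in \<open>auto simp: disjoint_family_on_def\<close>)
        show ?thesis unfolding eq by (auto simp: indicator_def)
      qed
    qed
    moreover have "J (\<lambda>s. \<Sum>i<n. indicator (A i) s) \<in> ?V" for n
      using J_sum[of "{..<n}" "\<lambda>i. indicator (A i)"] L2_indicator[OF Ab] union(3)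
      by (simp add: subspace_sum[OF sub])
    ultimately show ?case using closed_sequentially[OF closed_closure, of
      "\<lambda>n. J (\<lambda>s. \<Sum>i<n. indicator (A i) s)"] by blast
  qed
qed

lemma span_chi_dense: "closure (span (chi ` {0..T})) = UNIV" (is "?V = _")
proof -
  have sub: "subspace ?V" by (intro subspace_closure subspace_span)
  have "J f \<in> ?V" if f: "f \<in> L2 T" for f
  proof -
    define g where "g s = indicator {0..T} s * f s" for s
    have [measurable]: "g \<in> borel_measurable borel" unfolding g_def by (rule L2_measurable[OF f])
    obtain F where F: "\<And>i. simple_function borel (F i)" "\<And>x. (\<lambda>i. F i x) \<longlonglongrightarrow> g x" "\<And>i x. norm (F i x) \<le> 2 * norm (g x)"
      using borel_measurable_implies_sequence_metric[of g borel 0] by (auto simp: dist_norm)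
    have fi: "finite (range (F i))" for i using simple_functionD(1)[OF F(1)] by simp
    have Fm: "F i \<in> borel_measurable borel" for i by (rule borel_measurable_simple_function[OF F(1)])
    have Aset: "F i -` {y} \<in> sets borel" for i y using measurable_sets[OF Fm, of "{y}" i] by simp
    have rep: "F i = (\<lambda>s. \<Sum>y\<in>range (F i). y * indicator (F i -` {y}) s)" for i
    proof
      fix s
      have "(\<Sum>y\<in>range (F i). y * indicator (F i -` {y}) s) = (\<Sum>y\<in>range (F i). if y = F i s then y else 0)"
        by (intro sum.cong) (auto simp: indicator_def)
      then show "F i s = (\<Sum>y\<in>range (F i). y * indicator (F i -` {y}) s)" using fi by simp
    qed
    have FL: "F i \<in> L2 T" for i
      by (subst rep) (intro L2_sum fi L2_scale L2_indicator Aset)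
    have gL: "g \<in> L2 T"
    proof (rule L2_I)
      show "set_integrable lborel {0..T} (\<lambda>s. (g s)\<^sup>2)" using f
        by (simp add: L2_def set_integrable_def g_def power_mult_distrib indicator_power2 mult.assoc[symmetric]
          flip: power2_eq_square)
    qed measurable
    have Jg: "J f = J g" by (rule J_cong[OF f gL]) (simp add: g_def)
    have "(\<lambda>i. J (F i)) \<longlonglongrightarrow> J g"
    proof (rule J_tendsto[OF FL gL F(2), where w="\<lambda>s. 9 * (g s)\<^sup>2"])
      show "set_integrable lborel {0..T} (\<lambda>s. 9 * (g s)\<^sup>2)" using gL by (simp add: L2_def)
      fix n s
      \<comment> \<open>The approximation satisfies the bound 2|g|, so its distance to g is at most
        3|g|; squaring gives the factor 9.\<close>
      have "\<bar>F n s - g s\<bar> \<le> 3 * \<bar>g s\<bar>" using F(3)[of n s] abs_triangle_ineq4[of "F n s" "g s"] by simp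
      then have "(F n s - g s)\<^sup>2 \<le> (3 * \<bar>g s\<bar>)\<^sup>2" by (metis abs_ge_zero power2_abs power_mono)
      then show "(F n s - g s)\<^sup>2 \<le> 9 * (g s)\<^sup>2" by (simp add: power_mult_distrib)
    qed
    moreover have "J (F i) \<in> ?V" for i
    proof -
      have "J (F i) = (\<Sum>y\<in>range (F i). J (\<lambda>s. y * indicator (F i -` {y}) s))"
        by (subst rep) (intro J_sum fi L2_scale L2_indicator Aset)
      also have "\<dots> = (\<Sum>y\<in>range (F i). y *\<^sub>R J (indicator (F i -` {y})))"
        by (intro sum.cong refl J_scale L2_indicator Aset)
      also have "\<dots> \<in> ?V" by (intro subspace_sum[OF sub] subspace_scale[OF sub] J_indicator_in_closure Aset)
      finally show ?thesis .
    qed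
    ultimately show ?thesis unfolding Jg using closed_sequentially[OF closed_closure, of "\<lambda>i. J (F i)"] by blast
  qed
  then have "J ` L2 T \<subseteq> ?V" by blast
  then have "closure (J ` L2 T) \<subseteq> ?V" by (rule closure_minimal) simp
  then show ?thesis using J_dense by blast
qed

lemma stepf_L2: "stepf xs j \<in> L2 T"
  by (rule L2_bounded[OF _ abs_stepf_le]) measurable

lemma J_stepf_Nil[simp]: "J (stepf [] j) = 0"
proof -
  have "stepf [] j = (\<lambda>s. 0)" by (simp add: fun_eq_iff stepf_Nil)
  then show ?thesis by (simp only: J_zero)
qed

lemma J_stepf_Cons[simp]: "J (stepf ((a, i, t) # xs) j) = (if i = j then a *\<^sub>R chi t else 0) + J (stepf xs j)"
proof -
  have "stepf ((a, i, t) # xs) j = (\<lambda>s. (if i = j then a else 0) * indicator {0..t} s + stepf xs j s)"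
    by (auto simp: fun_eq_iff stepf_Cons)
  then show ?thesis
    using J_add[OF L2_scale[OF L2_indicator] stepf_L2, of "{0..t}" "if i = j then a else 0" xs j]
      J_scale[OF L2_indicator, of "{0..t}" "if i = j then a else 0"] by simp
qed

lemma J_stepf_append: "J (stepf (xs @ ys) j) = J (stepf xs j) + J (stepf ys j)"
  using J_add[OF stepf_L2 stepf_L2, of xs j ys j] by (simp add: stepf_append[abs_def])

lemma span_chi_stepf:
  assumes "y \<in> span (chi ` {0..T})"
  shows "\<exists>xs. valid_times T xs \<and> J (stepf xs j) = y \<and> (\<forall>i. i \<noteq> j \<longrightarrow> J (stepf xs i) = 0)"
  using assms
proof (induction rule: span_induct_alt)
  case base show ?case by (rule exI[of _ "[]"]) simp
next
  case (step c x y)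
  then obtain xs t where "valid_times T xs" "J (stepf xs j) = y" "\<forall>i. i \<noteq> j \<longrightarrow> J (stepf xs i) = 0" "t \<in> {0..T}"
    "x = chi t"
    by auto
  then show ?case by (intro exI[of _ "(c, j, t) # xs"]) auto
qed

lemma stepf_dense:
  fixes h :: "'n::finite \<Rightarrow> 'h"
  assumes e: "\<epsilon> > 0"
  shows "\<exists>xs. valid_times T xs \<and> (\<forall>j. norm (J (stepf xs j) - h j) < \<epsilon>)"
proof -
  \<comment> \<open>One list must serve all components at once. Components are approximated one
    after the other, and the appended entries leave the other components unchanged.\<close>
  have "\<exists>xs. valid_times T xs \<and> (\<forall>j\<in>S. norm (J (stepf xs j) - h j) < \<epsilon>) \<and> (\<forall>j. j \<notin> S \<longrightarrow> J (stepf xs j) = 0)"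
    if "finite S" for S :: "'n set"
    using that
  proof (induction S rule: finite_induct)
    case empty show ?case by (rule exI[of _ "[]"]) simp
  next
    case (insert k S)
    then obtain xs where xs: "valid_times T xs" "\<forall>j\<in>S. norm (J (stepf xs j) - h j) < \<epsilon>"
      "\<forall>j. j \<notin> S \<longrightarrow> J (stepf xs j) = 0"
      by blast
    have "h k \<in> closure (span (chi ` {0..T}))" by (simp add: span_chi_dense)
    then obtain y where y: "y \<in> span (chi ` {0..T})" "dist y (h k) < \<epsilon>" using e closure_approachable by blast
    obtain ys where ys: "valid_times T ys" "J (stepf ys k) = y" "\<forall>i. i \<noteq> k \<longrightarrow> J (stepf ys i) = 0"
      using span_chi_stepf[OF y(1), of k] by blast
    show ?case
      by (rule exI[of _ "xs @ ys"]) (use xs ys y insert.hyps in \<open>auto simp: J_stepf_append dist_norm\<close>)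
  qed
  from this[of UNIV] show ?thesis by auto
qed

lemma Phi_fun_indicator:
  assumes r: "r \<in> {0..T}"
  shows "integrable lborel (\<lambda>s. indicator {0..T} s * indicator {0..r} s * phi H t s)" (is ?A)
    and "Phi_fun H T (indicator {0..r}) t = H * (powr_primitive (2 * H - 1) (r - t) - powr_primitive (2 * H -
      1) (0 - t))" (is ?B)
proof -
  have eq: "indicator {0..T} s * indicator {0..r} s * phi H t s = indicator {0..r} s * phi H t s" for s
    using r by (auto simp: indicator_def)
  let ?I = "H * (powr_primitive (2 * H - 1) (r - t) - powr_primitive (2 * H - 1) (0 - t))"
  have I: "?I \<ge> 0"
    using r H_gt mono_powr_primitive[of "2 * H - 1" "0 - t" "r - t"] by (intro mult_nonneg_nonneg) auto
  have "(\<integral>\<^sup>+s. ennreal (indicator {0..r} s * phi H t s) \<partial>lborel)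
    = (\<integral>\<^sup>+s. ennreal (phi H t s) * indicator {0..r} s \<partial>lborel)"
    by (intro nn_integral_cong) (auto simp: indicator_def)
  also have "\<dots> = ennreal ?I" using r by (intro nn_integral_phi[OF H_gt]) auto
  finally have "has_bochner_integral lborel (\<lambda>s. indicator {0..r} s * phi H t s) ?I"
    using phi_nonneg[OF H_gt] I by (intro has_bochner_integral_nn_integral) auto
  then show ?A ?B by (simp_all add: has_bochner_integral_iff eq Phi_fun_eq)
qed

text \<open>On intervals [0,r] the transform is an explicit difference of
  \<open>powr_primitive\<close> values. Its continuity is what provides the continuous coefficient
  for \<open>linear_integral_equation\<close>.\<close>

lemma continuous_Phi_fun_stepf:
  assumes "valid_times T xs"
  shows "continuous_on UNIV (Phi_fun H T (stepf xs j))"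
proof -
  have "(\<forall>t. integrable lborel (\<lambda>s. indicator {0..T} s * stepf xs j s * phi H t s))
    \<and> continuous_on UNIV (Phi_fun H T (stepf xs j))"
    using assms
  proof (induction xs)
    case Nil
    have e: "Phi_fun H T (stepf [] j) = (\<lambda>t. 0)" by (auto simp: Phi_fun_eq stepf_Nil)
    show ?case unfolding e by (simp add: stepf_Nil)
  next
    case (Cons x xs)
    obtain a i r where x: "x = (a, i, r)" by (cases x)
    have r: "r \<in> {0..T}" using Cons.prems x by auto
    let ?a = "if i = j then a else 0"
    have IH: "integrable lborel (\<lambda>s. indicator {0..T} s * stepf xs j s * phi H t s)"
      "continuous_on UNIV (Phi_fun H T (stepf xs j))" for t
      using Cons by auto
    have eq: "(\<lambda>s. indicator {0..T} s * stepf (x # xs) j s * phi H t s) =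
      (\<lambda>s. ?a * (indicator {0..T} s * indicator {0..r} s * phi H t s) + indicator {0..T} s * stepf xs j s * phi
        H t s)" for t
      by (auto simp: x fun_eq_iff stepf_Cons algebra_simps)
    have i: "integrable lborel (\<lambda>s. indicator {0..T} s * stepf (x # xs) j s * phi H t s)" for t
      unfolding eq by (intro Bochner_Integration.integrable_add Bochner_Integration.integrable_mult_right
        Phi_fun_indicator(1)[OF r] IH(1))
    have "Phi_fun H T (stepf (x # xs) j) t = ?a * (H * (powr_primitive (2 * H - 1) (r - t) - powr_primitive (2
      * H - 1) (0 - t))) + Phi_fun H T (stepf xs j) t" for t
    proof -
      have "Phi_fun H T (stepf (x # xs) j) t = ?a * Phi_fun H T (indicator {0..r}) t + Phi_fun H T (stepf xs j) t"
        unfolding Phi_fun_eq eq using Phi_fun_indicator(1)[OF r, of t] IH(1)[of t]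
        by (subst Bochner_Integration.integral_add) auto
      then show ?thesis using Phi_fun_indicator(2)[OF r, of t] by simp
    qed
    then have e: "Phi_fun H T (stepf (x # xs) j) = (\<lambda>t. ?a * (H * (powr_primitive (2 * H - 1) (r - t) -
      powr_primitive (2 * H - 1) (0 - t))) + Phi_fun H T (stepf xs j) t)" by auto
    have c: "continuous_on UNIV (powr_primitive (2 * H - 1))" using H_gt by (intro continuous_powr_primitive) auto
    have "continuous_on UNIV (Phi_fun H T (stepf (x # xs) j))" unfolding e
      by (intro continuous_intros IH(2) continuous_on_compose2[OF c]) auto
    then show ?case using i by blast
  qed
  then show ?thesis by blast
qed

end

section \<open>Girsanov's theorem\<close>

text \<open>The sum is at most d times its largest term. This yields exponential moments of sums
  over components from those of the single components, independently of their joint law.\<close>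

lemma exp_sum_le:
  fixes x :: "'n::finite \<Rightarrow> real"
  shows "exp (\<Sum>j\<in>UNIV. x j) \<le> (\<Sum>j\<in>UNIV. exp (real CARD('n) * x j))"
proof -
  obtain k where k: "\<And>j. x j \<le> x k"
  proof -
    have "Max (range x) \<in> range x" by (rule Max_in) auto
    then obtain k where "Max (range x) = x k" by (rule imageE)
    then show ?thesis using that[of k] Max_ge[of "range x"] by auto
  qed
  have "(\<Sum>j\<in>UNIV. x j) \<le> real CARD('n) * x k"
    using sum_bounded_above[of UNIV x "x k"] k by simp
  then have "exp (\<Sum>j\<in>UNIV. x j) \<le> exp (real CARD('n) * x k)" by simp
  also have "\<dots> \<le> (\<Sum>j\<in>UNIV. exp (real CARD('n) * x j))"
    by (rule member_le_sum[of k UNIV "\<lambda>j. exp (real CARD('n) * x j)"]) auto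
  finally show ?thesis .
qed

lemma path_space_diff: "\<omega> \<in> path_space T \<Longrightarrow> \<eta> \<in> path_space T \<Longrightarrow> \<omega> - \<eta> \<in> path_space T"
  unfolding path_space_def by (simp add: minus_bcontfun.rep_eq)

lemma B_diff: "B i t (\<omega> - \<eta>) = B i t \<omega> - B i t \<eta>"
  by (simp add: B_def minus_bcontfun.rep_eq)

lemma linB_diff: "linB xs (\<omega> - \<eta>) = linB xs \<omega> - linB xs \<eta>"
proof (induction xs)
  case (Cons x xs)
  then show ?case by (cases x) (simp add: B_diff algebra_simps)
qed simp

definition compB :: "(real \<times> 'n \<times> real) list \<Rightarrow> 'n \<Rightarrow> ('n::finite) path \<Rightarrow> real" where
  "compB xs j \<omega> = (\<Sum>(a, i, t)\<leftarrow>xs. if i = j then a * B j t \<omega> else 0)"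

lemma linB_eq_sum_compB: "linB xs \<omega> = (\<Sum>j\<in>UNIV. compB xs j \<omega>)"
proof (induction xs)
  case Nil show ?case by (simp add: compB_def)
next
  case (Cons x xs)
  obtain a i t where x: "x = (a, i, t)" by (cases x)
  have "(\<Sum>j\<in>UNIV. compB (x # xs) j \<omega>) = (\<Sum>j\<in>UNIV. (if i = j then a * B j t \<omega> else 0) + compB xs j \<omega>)"
    by (simp add: compB_def x)
  also have "\<dots> = a * B i t \<omega> + (\<Sum>j\<in>UNIV. compB xs j \<omega>)" by (simp add: sum.distrib)
  finally show ?case using Cons by (simp add: x)
qed

section \<open>Gaussian exponentials of Wiener integrals\<close>

locale fbm = phi_hilbert H T J
  for H T :: real and J :: "(real \<Rightarrow> real) \<Rightarrow> 'h::{real_inner, complete_space}" +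
  fixes P :: "('n::finite) path measure" and W :: "'n \<Rightarrow> 'h \<Rightarrow> 'n path \<Rightarrow> real"
  assumes law: "fbm_law H T P" and wiener: "wiener_integral T P J W"
begin

sublocale prob_space P
  using law by (simp add: fbm_law_def)

lemma sets_P: "sets P = sets (restrict_space borel (path_space T))" and space_P: "space P = path_space T"
  using law by (simp_all add: fbm_law_def)

lemmas B_meas[measurable] = B_measurable[OF sets_P]
lemmas linB_meas[measurable] = linB_measurable[OF sets_P]

lemma W_gauss: "centered_gaussian P (W i f)" and W_var: "(\<integral>\<omega>. (W i f \<omega>)\<^sup>2 \<partial>P) = (norm f)\<^sup>2"
  and W_linear: "\<omega> \<in> space P \<Longrightarrow> linear (\<lambda>f. W i f \<omega>)"
  and W_chi: "t \<in> {0..T} \<Longrightarrow> AE \<omega> in P. W i (chi t) \<omega> = B i t \<omega>"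
  using wiener unfolding wiener_integral_def by blast+

lemma W_meas[measurable]: "W i f \<in> borel_measurable P"
  using W_gauss[of i f] by (simp add: centered_gaussian_def)

lemmas W_add = linear_add[OF W_linear]
  and W_diff = linear_diff[OF W_linear]
  and W_scale = linear_scale[OF W_linear]

lemma W_sq_integrable: "integrable P (\<lambda>\<omega>. (W i f \<omega>)\<^sup>2)"
  and W_exp_integrable: "integrable P (\<lambda>\<omega>. exp (a * W i f \<omega>))"
  and W_mgf: "(\<integral>\<omega>. exp (a * W i f \<omega>) \<partial>P) = exp (a\<^sup>2 * (norm f)\<^sup>2 / 2)"
  using centered_gaussian_mgf[OF W_gauss[of i f]] by (simp_all add: W_var)

lemma W_cov: "(\<integral>\<omega>. W i f \<omega> * W i g \<omega> \<partial>P) = inner f g"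
proof -
  have "(\<integral>\<omega>. W i f \<omega> * W i g \<omega> \<partial>P) = (\<integral>\<omega>. ((W i (f + g) \<omega>)\<^sup>2 - (W i (f - g) \<omega>)\<^sup>2) / 4 \<partial>P)"
    by (intro Bochner_Integration.integral_cong) (simp_all add: W_add W_diff power2_sum power2_diff)
  also have "\<dots> = ((norm (f + g))\<^sup>2 - (norm (f - g))\<^sup>2) / 4"
    using W_sq_integrable by (simp add: W_var)
  also have "\<dots> = inner f g"
    by (simp add: power2_norm_eq_inner inner_add_left inner_add_right inner_diff_left inner_diff_right inner_commute)
  finally show ?thesis .
qed

text \<open>The inner product is read off from the covariance of the process through the isometry of
  the Wiener integral, in place of evaluating the double integral of the kernel.\<close>

lemma inner_chi:
  assumes "s \<in> {0..T}" "t \<in> {0..T}"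
  shows "inner (chi t) (chi s) = (t powr (2 * H) + s powr (2 * H) - \<bar>t - s\<bar> powr (2 * H)) / 2"
proof -
  fix i :: 'n
  have "inner (chi t) (chi s) = (\<integral>\<omega>. B i t \<omega> * B i s \<omega> \<partial>P)"
    unfolding W_cov[of i, symmetric] using W_chi[OF assms(1), of i] W_chi[OF assms(2), of i]
    by (intro integral_cong_AE) auto
  then show ?thesis using law assms unfolding fbm_law_def by simp
qed

text \<open>H-Hoelder continuity of \<open>chi\<close>; this is where the shift paths obtain their
  continuity.\<close>

lemma norm_chi_diff:
  assumes "s \<in> {0..T}" "t \<in> {0..T}"
  shows "norm (chi t - chi s) = \<bar>t - s\<bar> powr H"
proof -
  have "(norm (chi t - chi s))\<^sup>2 = inner (chi t) (chi t) - 2 * inner (chi t) (chi s) + inner (chi s) (chi s)"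
    by (simp add: power2_norm_eq_inner inner_diff_left inner_diff_right inner_commute)
  also have "\<dots> = \<bar>t - s\<bar> powr (2 * H)" using assms by (simp add: inner_chi field_simps)
  also have "\<dots> = (\<bar>t - s\<bar> powr H)\<^sup>2" by (simp add: power2_eq_square powr_add[symmetric])
  finally show ?thesis by simp
qed

lemma chi_0: "J (indicator {0}) = 0"
  using inner_chi[of 0 0] T_pos by simp

definition Wsum :: "('n \<Rightarrow> 'h) \<Rightarrow> 'n path \<Rightarrow> real" where
  "Wsum h \<omega> = (\<Sum>j\<in>UNIV. W j (h j) \<omega>)"

lemma Wsum_meas[measurable]: "Wsum h \<in> borel_measurable P"
  unfolding Wsum_def by measurable

lemma exp_Wsum_integrable: "integrable P (\<lambda>\<omega>. exp (a * Wsum h \<omega>))" (is ?A)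
  and exp_Wsum_le: "(\<integral>\<omega>. exp (a * Wsum h \<omega>) \<partial>P) \<le> (\<Sum>j\<in>UNIV. exp ((real CARD('n) * a)\<^sup>2 * (norm (h j))\<^sup>2 / 2))" (is ?B)
proof -
  let ?G = "\<lambda>\<omega>. \<Sum>j\<in>UNIV. exp (real CARD('n) * a * W j (h j) \<omega>)"
  have le: "exp (a * Wsum h \<omega>) \<le> ?G \<omega>" for \<omega>
    using exp_sum_le[of "\<lambda>j. a * W j (h j) \<omega>"] by (simp add: Wsum_def sum_distrib_left mult.assoc)
  have iG: "integrable P ?G" by (intro Bochner_Integration.integrable_sum W_exp_integrable)
  show A: ?A
    by (rule Bochner_Integration.integrable_bound[OF iG]) (use le
      in \<open>auto intro!: AE_I2 order_trans[OF _ abs_ge_self]\<close>)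
  have "(\<integral>\<omega>. exp (a * Wsum h \<omega>) \<partial>P) \<le> (\<integral>\<omega>. ?G \<omega> \<partial>P)"
    using A iG le by (rule integral_mono)
  also have "\<dots> = (\<Sum>j\<in>UNIV. exp ((real CARD('n) * a)\<^sup>2 * (norm (h j))\<^sup>2 / 2))"
    using W_exp_integrable by (simp add: W_mgf)
  finally show ?B .
qed

lemma Wsum_diff_sq:
  shows "integrable P (\<lambda>\<omega>. (Wsum h \<omega> - Wsum h' \<omega>)\<^sup>2)" (is ?A)
    and "(\<integral>\<omega>. (Wsum h \<omega> - Wsum h' \<omega>)\<^sup>2 \<partial>P) \<le> real CARD('n) * (\<Sum>j\<in>UNIV. (norm (h j - h' j))\<^sup>2)" (is ?B)
proof -
  let ?G = "\<lambda>\<omega>. real CARD('n) * (\<Sum>j\<in>UNIV. (W j (h j - h' j) \<omega>)\<^sup>2)"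
  have le: "(Wsum h \<omega> - Wsum h' \<omega>)\<^sup>2 \<le> ?G \<omega>" if "\<omega> \<in> space P" for \<omega>
  proof -
    have "Wsum h \<omega> - Wsum h' \<omega> = (\<Sum>j\<in>UNIV. W j (h j - h' j) \<omega>)"
      using that by (simp add: Wsum_def W_diff sum_subtractf)
    then show ?thesis using sum_squared_le_sum_of_squares[of "\<lambda>j. W j (h j - h' j) \<omega>" UNIV]
      by (simp add: mult.commute)
  qed
  have iG: "integrable P ?G" by (intro Bochner_Integration.integrable_mult_right
    Bochner_Integration.integrable_sum W_sq_integrable)
  show A: ?A
    by (rule Bochner_Integration.integrable_bound[OF iG]) (use le
      in \<open>auto intro!: AE_I2 order_trans[OF _ abs_ge_self]\<close>)
  have "(\<integral>\<omega>. (Wsum h \<omega> - Wsum h' \<omega>)\<^sup>2 \<partial>P) \<le> (\<integral>\<omega>. ?G \<omega> \<partial>P)"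
    using A iG le by (rule integral_mono)
  also have "\<dots> = real CARD('n) * (\<Sum>j\<in>UNIV. (norm (h j - h' j))\<^sup>2)"
    using W_sq_integrable by (simp add: W_var)
  finally show ?B .
qed

text \<open>A convergent sequence is bounded in norm, so the second moments of the exponentials are
  uniformly bounded, and the exponents converge in L2 by the isometry.\<close>

lemma exp_Wsum_tendsto:
  assumes lim: "\<And>j. (\<lambda>n. h n j) \<longlonglongrightarrow> h' j"
  shows "(\<lambda>n. \<integral>\<omega>. \<bar>exp (Wsum (h n) \<omega>) - exp (Wsum h' \<omega>)\<bar> \<partial>P) \<longlonglongrightarrow> 0"
proof -
  have "\<exists>R. \<forall>n. norm (h n j) \<le> R" for j
    using convergent_imp_Bseq[of "\<lambda>n. h n j"] lim[of j] by (auto simp: convergent_def Bseq_def)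
  then obtain R where R: "\<And>n j. norm (h n j) \<le> R j" by metis
  define C where "C = (\<Sum>j\<in>UNIV. exp ((real CARD('n) * 2)\<^sup>2 * (R j)\<^sup>2 / 2))"
  show ?thesis
  proof (rule exp_tendsto_L1[where C=C])
    show "(\<integral>\<omega>. exp (2 * Wsum (h n) \<omega>) \<partial>P) \<le> C" for n
    proof (rule order_trans[OF exp_Wsum_le])
      show "(\<Sum>j\<in>UNIV. exp ((real CARD('n) * 2)\<^sup>2 * (norm (h n j))\<^sup>2 / 2)) \<le> C" unfolding C_def
        using R by (intro sum_mono) (auto intro!: mult_left_mono power_mono)
    qed
    show "(\<lambda>n. \<integral>\<omega>. (Wsum (h n) \<omega> - Wsum h' \<omega>)\<^sup>2 \<partial>P) \<longlonglongrightarrow> 0"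
    proof (rule tendsto_sandwich[OF _ _ tendsto_const])
      show "\<forall>\<^sub>F n in sequentially. (\<integral>\<omega>. (Wsum (h n) \<omega> - Wsum h' \<omega>)\<^sup>2 \<partial>P)
        \<le> real CARD('n) * (\<Sum>j\<in>UNIV. (norm (h n j - h' j))\<^sup>2)"
        by (intro always_eventually allI Wsum_diff_sq(2))
      have "(\<lambda>n. real CARD('n) * (\<Sum>j\<in>UNIV. (norm (h n j - h' j))\<^sup>2))
        \<longlonglongrightarrow> real CARD('n) * (\<Sum>j\<in>UNIV. (norm (h' j - h' j))\<^sup>2)"
        by (intro tendsto_intros lim)
      then show "(\<lambda>n. real CARD('n) * (\<Sum>j\<in>UNIV. (norm (h n j - h' j))\<^sup>2)) \<longlonglongrightarrow> 0" by simp
    qed simp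
  qed (auto intro: exp_Wsum_integrable Wsum_diff_sq(1))
qed

lemma AE_compB:
  assumes "valid_times T xs"
  shows "AE \<omega> in P. compB xs j \<omega> = W j (J (stepf xs j)) \<omega>"
  using assms
proof (induction xs)
  case Nil
  have "W j 0 \<omega> = 0" if "\<omega> \<in> space P" for \<omega> using linear_0[OF W_linear[OF that]] .
  then show ?case by (auto simp: compB_def intro!: AE_I2)
next
  case (Cons x xs)
  obtain a i t where x: "x = (a, i, t)" by (cases x)
  have t: "t \<in> {0..T}" using Cons.prems x by auto
  have "AE \<omega> in P. compB xs j \<omega> = W j (J (stepf xs j)) \<omega>" using Cons by auto
  with W_chi[OF t, of j] AE_space show ?case
    by eventually_elim (auto simp: compB_def x W_add W_scale linear_0[OF W_linear])
qed

lemma AE_linB: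
  assumes "valid_times T xs"
  shows "AE \<omega> in P. linB xs \<omega> = Wsum (\<lambda>j. J (stepf xs j)) \<omega>"
proof -
  have "AE \<omega> in P. \<forall>j\<in>UNIV. compB xs j \<omega> = W j (J (stepf xs j)) \<omega>"
    using AE_compB[OF assms] by (subst AE_ball_countable) auto
  then show ?thesis by eventually_elim (simp add: linB_eq_sum_compB Wsum_def)
qed

text \<open>Independence is assumed for the component processes of B, so the product formula is
  available first for combinations of their values. The general \<open>exp_Wsum_mgf\<close> is
  derived from it.\<close>

lemma exp_linB_mgf:
  assumes xs: "valid_times T xs"
  shows "(\<integral>\<omega>. exp (linB xs \<omega>) \<partial>P) = exp (\<Sum>j\<in>UNIV. (norm (J (stepf xs j)))\<^sup>2 / 2)"
proof -
  \<comment> \<open>Writing each factor as a measurable function of the whole restricted path of one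
    component makes it inherit the independence.\<close>
  define F :: "'n \<Rightarrow> (real \<Rightarrow> real) \<Rightarrow> real" where "F j y = exp (\<Sum>(a, i, t)\<leftarrow>xs. if i = j then a * y t else 0)" for j y
  have Fm: "F j \<in> borel_measurable (Pi\<^sub>M {0..T} (\<lambda>_. borel))" for j
  proof -
    have "(\<lambda>y. (\<Sum>(a, i, t)\<leftarrow>xs. if i = j then a * y t else 0)) \<in> borel_measurable (Pi\<^sub>M {0..T} (\<lambda>_. borel :: real
      measure))"
      using xs
    proof (induction xs)
      case (Cons x xs)
      obtain a i t where x: "x = (a, i, t)" by (cases x)
      have [measurable]: "(\<lambda>y. y t) \<in> borel_measurable (Pi\<^sub>M {0..T} (\<lambda>_. borel :: real measure))"
        using Cons.prems x by (intro measurable_component_singleton) auto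
      have [measurable]: "(\<lambda>y. (\<Sum>(a, i, t)\<leftarrow>xs. if i = j then a * y t else 0)) \<in> borel_measurable (Pi\<^sub>M {0..T}
        (\<lambda>_. borel :: real measure))"
        using Cons by auto
      show ?case by (simp add: x)
    qed simp
    then show ?thesis unfolding F_def by measurable
  qed
  have "indep_vars (\<lambda>i::'n. Pi\<^sub>M {0..T} (\<lambda>_. borel :: real measure)) (\<lambda>i \<omega>. \<lambda>t\<in>{0..T}. B i t \<omega>) UNIV"
    using law by (simp add: fbm_law_def)
  then have "indep_vars (\<lambda>_. borel) (\<lambda>j \<omega>. F j (\<lambda>t\<in>{0..T}. B j t \<omega>)) UNIV"
    by (rule indep_vars_compose2) (rule Fm)
  moreover have "F j (\<lambda>t\<in>{0..T}. B j t \<omega>) = exp (compB xs j \<omega>)" for j \<omega>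
  proof -
    have "(\<Sum>(a, i, t)\<leftarrow>xs. if i = j then a * (\<lambda>t\<in>{0..T}. B j t \<omega>) t else 0) = compB xs j \<omega>"
      unfolding compB_def using xs by (intro arg_cong[where f=sum_list] map_cong) auto
    then show ?thesis by (simp add: F_def)
  qed
  ultimately have ind: "indep_vars (\<lambda>_. borel) (\<lambda>j \<omega>. exp (compB xs j \<omega>)) UNIV" by simp
  have m: "compB xs j \<in> borel_measurable P" for j
  proof -
    have "(\<lambda>\<omega>. exp (compB xs j \<omega>)) \<in> borel_measurable P" using ind by (auto simp: indep_vars_def)
    then have "(\<lambda>\<omega>. ln (exp (compB xs j \<omega>))) \<in> borel_measurable P" by measurable
    then show ?thesis by simp
  qed
  have e: "integrable P (\<lambda>\<omega>. exp (compB xs j \<omega>))" "(\<integral>\<omega>. exp (compB xs j \<omega>) \<partial>P)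
    = exp ((norm (J (stepf xs j)))\<^sup>2 / 2)" for j
  proof -
    note [measurable] = m
    have "integrable P (\<lambda>\<omega>. exp (compB xs j \<omega>)) \<longleftrightarrow> integrable P (\<lambda>\<omega>. exp (1 * W j (J (stepf xs j)) \<omega>))"
      using AE_compB[OF xs, of j] by (intro integrable_cong_AE) auto
    then show "integrable P (\<lambda>\<omega>. exp (compB xs j \<omega>))" using W_exp_integrable by blast
    have "(\<integral>\<omega>. exp (compB xs j \<omega>) \<partial>P) = (\<integral>\<omega>. exp (1 * W j (J (stepf xs j)) \<omega>) \<partial>P)"
      using AE_compB[OF xs, of j] by (intro integral_cong_AE) auto
    then show "(\<integral>\<omega>. exp (compB xs j \<omega>) \<partial>P) = exp ((norm (J (stepf xs j)))\<^sup>2 / 2)" by (simp only: W_mgf) simp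
  qed
  have "(\<integral>\<omega>. (\<Prod>j\<in>UNIV. exp (compB xs j \<omega>)) \<partial>P) = (\<Prod>j\<in>UNIV. \<integral>\<omega>. exp (compB xs j \<omega>) \<partial>P)"
    by (rule indep_vars_lebesgue_integral[OF _ ind e(1)]) simp
  then show ?thesis by (simp add: e(2) linB_eq_sum_compB exp_sum)
qed

text \<open>Step functions are dense and both sides are continuous in h, the left one by L1
  convergence of the exponentials. Thus independence reaches all Wiener integrals at the level of
  Laplace transforms.\<close>

lemma exp_Wsum_mgf: "(\<integral>\<omega>. exp (Wsum h \<omega>) \<partial>P) = exp (\<Sum>j\<in>UNIV. (norm (h j))\<^sup>2 / 2)"
proof -
  have "\<exists>xs. valid_times T xs \<and> (\<forall>j. norm (J (stepf xs j) - h j) < inverse (real (Suc n)))" for n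
    by (rule stepf_dense) simp
  then obtain xs where xs: "\<And>n. valid_times T (xs n)" "\<And>n j. norm (J (stepf (xs n) j) - h j) < inverse (real (Suc n))"
    by metis
  have lim: "(\<lambda>n. J (stepf (xs n) j)) \<longlonglongrightarrow> h j" for j
    by (rule LIM_zero_cancel, rule Lim_null_comparison[OF _ LIMSEQ_inverse_real_of_nat])
      (use xs(2) in \<open>auto intro!: always_eventually less_imp_le\<close>)
  have i: "integrable P (\<lambda>\<omega>. exp (Wsum h \<omega>))" for h using exp_Wsum_integrable[of 1 h] by simp
  let ?I = "\<lambda>n. \<integral>\<omega>. exp (Wsum (\<lambda>j. J (stepf (xs n) j)) \<omega>) \<partial>P"
  have "?I n = exp (\<Sum>j\<in>UNIV. (norm (J (stepf (xs n) j)))\<^sup>2 / 2)" for n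
  proof -
    have "?I n = (\<integral>\<omega>. exp (linB (xs n) \<omega>) \<partial>P)" using AE_linB[OF xs(1)[of n]] by (intro integral_cong_AE) auto
    then show ?thesis using exp_linB_mgf[OF xs(1)] by simp
  qed
  then have "?I = (\<lambda>n. exp (\<Sum>j\<in>UNIV. (norm (J (stepf (xs n) j)))\<^sup>2 / 2))" by auto
  then have 1: "?I \<longlonglongrightarrow> exp (\<Sum>j\<in>UNIV. (norm (h j))\<^sup>2 / 2)"
    by (simp only:) (intro tendsto_intros lim; simp)
  have "(\<lambda>n. ?I n - (\<integral>\<omega>. exp (Wsum h \<omega>) \<partial>P)) \<longlonglongrightarrow> 0"
  proof (rule Lim_null_comparison[OF _ exp_Wsum_tendsto[OF lim]], rule always_eventually, rule allI)
    fix n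
    have "norm (?I n - (\<integral>\<omega>. exp (Wsum h \<omega>) \<partial>P)) = norm (\<integral>\<omega>. exp (Wsum (\<lambda>j. J (stepf (xs n) j)) \<omega>) - exp (Wsum h
      \<omega>) \<partial>P)"
      using i by simp
    also have "\<dots> \<le> (\<integral>\<omega>. \<bar>exp (Wsum (\<lambda>j. J (stepf (xs n) j)) \<omega>) - exp (Wsum h \<omega>)\<bar> \<partial>P)"
      using integral_norm_bound[of P "\<lambda>\<omega>. exp (Wsum (\<lambda>j. J (stepf (xs n) j)) \<omega>) - exp (Wsum h \<omega>)"] by simp
    finally show "norm (?I n - (\<integral>\<omega>. exp (Wsum h \<omega>) \<partial>P)) \<le> (\<integral>\<omega>. \<bar>exp (Wsum (\<lambda>j. J (stepf (xs n) j)) \<omega>) - exp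
      (Wsum h \<omega>)\<bar> \<partial>P)" .
  qed
  then have "?I \<longlonglongrightarrow> (\<integral>\<omega>. exp (Wsum h \<omega>) \<partial>P)" by (rule LIM_zero_cancel)
  then show ?thesis using 1 LIMSEQ_unique by blast
qed

text \<open>The Cameron--Martin path of f, written with inner products. It equals the time integral
  of Phi[f] whenever a version of Phi[f] exists, but makes sense for every f, in particular for the
  limiting elements \<open>sig\<close>.\<close>

definition shift :: "'n \<Rightarrow> 'h \<Rightarrow> 'n path" where
  "shift i f = Bcontfun (\<lambda>t. inner f (chi (max 0 (min T t))) *\<^sub>R axis i 1)"

lemma norm_chi: "t \<in> {0..T} \<Longrightarrow> norm (chi t) \<le> T powr H"
  using norm_chi_diff[of 0 t] T_pos H_gt by (auto simp: chi_0 intro!: powr_mono2)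

lemma continuous_chi_clamp: "continuous_on UNIV (\<lambda>t. chi (max 0 (min T t)))"
  unfolding continuous_on_def
proof (intro ballI)
  fix s :: real
  have "((\<lambda>t. \<bar>max 0 (min T t) - max 0 (min T s)\<bar> powr H) \<longlongrightarrow> \<bar>max 0 (min T s) - max 0 (min T s)\<bar> powr H) (at s)"
    using H_gt by (intro tendsto_intros tendsto_powr') auto
  then have "((\<lambda>t. \<bar>max 0 (min T t) - max 0 (min T s)\<bar> powr H) \<longlongrightarrow> 0) (at s)" by simp
  then have "((\<lambda>t. chi (max 0 (min T t)) - chi (max 0 (min T s))) \<longlongrightarrow> 0) (at s)"
    by (rule Lim_null_comparison[rotated]) (use T_pos in \<open>auto simp: norm_chi_diff\<close>)
  then show "((\<lambda>t. chi (max 0 (min T t))) \<longlongrightarrow> chi (max 0 (min T s))) (at s within UNIV)"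
    by (rule LIM_zero_cancel)
qed

lemma apply_shift: "apply_bcontfun (shift i f) t = inner f (chi (max 0 (min T t))) *\<^sub>R axis i 1"
proof -
  have "(\<lambda>t. inner f (chi (max 0 (min T t))) *\<^sub>R axis i 1 :: real ^ 'n) \<in> bcontfun"
  proof (rule bcontfun_normI)
    show "continuous_on UNIV (\<lambda>t. inner f (chi (max 0 (min T t))) *\<^sub>R axis i 1 :: real ^ 'n)"
      by (intro continuous_intros continuous_chi_clamp)
    fix t
    have "\<bar>inner f (chi (max 0 (min T t)))\<bar> \<le> norm f * norm (chi (max 0 (min T t)))" by (rule Cauchy_Schwarz_ineq2)
    also have "\<dots> \<le> norm f * T powr H" using T_pos by (intro mult_left_mono norm_chi) auto
    finally show "norm (inner f (chi (max 0 (min T t))) *\<^sub>R axis i 1 :: real ^ 'n) \<le> norm f * T powr H" by simp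
  qed
  then show ?thesis by (simp add: shift_def Bcontfun_inverse)
qed

lemma B_shift: "t \<in> {0..T} \<Longrightarrow> B j t (shift i f) = (if j = i then inner f (chi t) else 0)"
  by (simp add: B_def apply_shift axis_def)

lemma shift_in: "shift i f \<in> path_space T"
  using T_pos by (simp add: path_space_def apply_shift chi_0)

lemma dist_shift: "dist (shift i f) (shift i g) \<le> norm (f - g) * T powr H"
proof (rule dist_bound)
  fix t
  have "dist (apply_bcontfun (shift i f) t) (apply_bcontfun (shift i g) t) = \<bar>inner (f - g) (chi (max 0 (min T t)))\<bar>"
    by (simp add: apply_shift dist_norm inner_diff_left flip: scaleR_diff_left)
  also have "\<dots> \<le> norm (f - g) * norm (chi (max 0 (min T t)))" by (rule Cauchy_Schwarz_ineq2)
  also have "\<dots> \<le> norm (f - g) * T powr H" using T_pos by (intro mult_left_mono norm_chi) auto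
  finally show "dist (apply_bcontfun (shift i f) t) (apply_bcontfun (shift i g) t) \<le> norm (f - g) * T powr H" .
qed

text \<open>The exact change of L under a translation of the path, by which both Girsanov's theorem
  and the tested Wick product become computable.\<close>

lemma linB_shift:
  assumes "valid_times T xs"
  shows "linB xs (shift i f) = inner f (J (stepf xs i))"
  using assms
proof (induction xs)
  case (Cons x xs)
  then show ?case by (cases x) (auto simp: B_shift inner_add_right)
qed simp

lemma translate_eq:
  assumes "\<exists>g. Phi_version H T J f g"
  shows "translate H T J i f X \<omega> = X (\<omega> - shift i f)"
proof -
  have "Phi_version H T J f (Phi H T J f)" unfolding Phi_def using assms by (rule someI_ex)
  from Phi_version_integral[OF this]
  have "(LBINT r:{0..max 0 (min T t)}. Phi H T J f r) = inner f (chi (max 0 (min T t)))" for t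
    using T_pos by auto
  then show ?thesis by (simp add: translate_def shift_def)
qed

lemma diff_in_space: "\<omega> \<in> space P \<Longrightarrow> \<eta> \<in> path_space T \<Longrightarrow> \<omega> - \<eta> \<in> space P"
  by (simp add: space_P path_space_diff)

lemma minus_shift_measurable[measurable]: "(\<lambda>\<omega>. \<omega> - shift i f) \<in> measurable P P"
  by (rule measurable_path_space[OF T_pos sets_P]) (auto simp: space_P B_diff intro: path_space_diff shift_in)

lemma stoch_exp_nonneg: "stoch_exp W i f \<omega> \<ge> 0"
  by (simp add: stoch_exp_def)

lemma stoch_exp_measurable[measurable]: "stoch_exp W i f \<in> borel_measurable P"
  unfolding stoch_exp_def by measurable

lemma stoch_exp_integral: "integrable P (stoch_exp W i f)" "(\<integral>\<omega>. stoch_exp W i f \<omega> \<partial>P) = 1"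
  using W_exp_integrable[of 1 i f] W_mgf[of 1 i f] by (simp_all add: stoch_exp_def[abs_def] exp_diff)

text \<open>Both measures have the same expectations of \<open>exp (linB xs)\<close>: the stochastic
  exponential adds f to the integrand of component i, and the translation removes precisely the
  mixed inner product that this creates.\<close>

lemma girsanov: "distr (density P (\<lambda>\<omega>. ennreal (stoch_exp W i f \<omega>))) P (\<lambda>\<omega>. \<omega> - shift i f) = P"
proof (rule path_measure_eqI[OF T_pos])
  let ?Q = "density P (\<lambda>\<omega>. ennreal (stoch_exp W i f \<omega>))"
  have "emeasure ?Q (space P) = (\<integral>\<^sup>+\<omega>. ennreal (stoch_exp W i f \<omega>) \<partial>P)"
    by (auto simp: emeasure_density intro!: nn_integral_cong)
  also have "\<dots> = ennreal 1"
    using stoch_exp_integral by (subst nn_integral_eq_integral) (auto simp: stoch_exp_nonneg)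
  finally have Q: "finite_measure ?Q" by (intro finite_measureI) simp
  then show "finite_measure (distr ?Q P (\<lambda>\<omega>. \<omega> - shift i f))"
    by (rule finite_measure.finite_measure_distr) simp
  show "finite_measure P" by unfold_locales
  show "sets (distr ?Q P (\<lambda>\<omega>. \<omega> - shift i f)) = sets (restrict_space borel (path_space T))" by (simp add: sets_P)
  show "sets P = sets (restrict_space borel (path_space T))" by (rule sets_P)
  fix xs :: "(real \<times> 'n \<times> real) list" assume xs: "valid_times T xs"
  \<comment> \<open>\<open>h\<close> is the combined integrand of the tilted exponential. The
    constant \<open>c\<close> collects the translation term and the normalization of the stochastic
    exponential, and is also the amount by which the half squared norms of \<open>h\<close> exceed
    those of the step functions.\<close>
  define h where "h j = J (stepf xs j) + (if j = i then f else 0)" for j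
  define c where "c = inner f (J (stepf xs i)) + (norm f)\<^sup>2 / 2"
  have eq: "AE \<omega> in P. stoch_exp W i f \<omega> * exp (linB xs (\<omega> - shift i f)) = exp (Wsum h \<omega>) / exp c"
    using AE_linB[OF xs] AE_space
  proof eventually_elim
    case (elim \<omega>)
    have "Wsum h \<omega> = (\<Sum>j\<in>UNIV. W j (J (stepf xs j)) \<omega> + (if j = i then W j f \<omega> else 0))"
      unfolding Wsum_def h_def using elim(2)
      by (intro sum.cong refl) (auto simp: W_add linear_0[OF W_linear])
    also have "\<dots> = linB xs \<omega> + W i f \<omega>" using elim(1) by (simp add: sum.distrib Wsum_def)
    finally show ?case
      by (simp add: linB_diff linB_shift[OF xs] stoch_exp_def c_def flip: exp_add exp_diff)
  qed
  have L: "integrable P (\<lambda>\<omega>. exp (linB xs \<omega>)) \<longleftrightarrow> integrable P (\<lambda>\<omega>. exp (1 * Wsum (\<lambda>j. J (stepf xs j)) \<omega>))"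
    using AE_linB[OF xs] by (intro integrable_cong_AE) auto
  then show "integrable P (\<lambda>\<omega>. exp (linB xs \<omega>))" using exp_Wsum_integrable by blast
  have "integrable P (\<lambda>\<omega>. stoch_exp W i f \<omega> * exp (linB xs (\<omega> - shift i f)))
    \<longleftrightarrow> integrable P (\<lambda>\<omega>. exp (1 * Wsum h \<omega>) / exp c)"
    using eq by (intro integrable_cong_AE) auto
  then have i: "integrable P (\<lambda>\<omega>. stoch_exp W i f \<omega> * exp (linB xs (\<omega> - shift i f)))"
    using exp_Wsum_integrable[of 1 h] by simp
  then show "integrable (distr ?Q P (\<lambda>\<omega>. \<omega> - shift i f)) (\<lambda>\<omega>. exp (linB xs \<omega>))"
    by (subst integrable_distr_eq) (auto simp: integrable_density stoch_exp_def)
  have "(\<integral>\<omega>. exp (linB xs \<omega>) \<partial>distr ?Q P (\<lambda>\<omega>. \<omega> - shift i f))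
    = (\<integral>\<omega>. stoch_exp W i f \<omega> * exp (linB xs (\<omega> - shift i f)) \<partial>P)"
    by (subst integral_distr) (auto simp: integral_density stoch_exp_def)
  also have "\<dots> = (\<integral>\<omega>. exp (Wsum h \<omega>) / exp c \<partial>P)" using eq by (intro integral_cong_AE) auto
  also have "\<dots> = exp ((\<Sum>j\<in>UNIV. (norm (h j))\<^sup>2 / 2) - c)" by (simp add: exp_Wsum_mgf exp_diff)
  also have "(\<Sum>j\<in>UNIV. (norm (h j))\<^sup>2 / 2) - c = (\<Sum>j\<in>UNIV. (norm (J (stepf xs j)))\<^sup>2 / 2)"
  proof -
    have "(norm (h j))\<^sup>2 / 2 = (norm (J (stepf xs j)))\<^sup>2 / 2 + (if j = i then c else 0)" for j
      by (simp add: h_def c_def power2_norm_eq_inner inner_add_left inner_add_right inner_commute)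
    then have "(\<Sum>j\<in>UNIV. (norm (h j))\<^sup>2 / 2) = (\<Sum>j\<in>UNIV. (norm (J (stepf xs j)))\<^sup>2 / 2 + (if j = i then c else 0))"
      by (intro sum.cong) auto
    then show ?thesis by (simp add: sum.distrib)
  qed
  also have "exp \<dots> = (\<integral>\<omega>. exp (linB xs \<omega>) \<partial>P)" by (simp add: exp_linB_mgf[OF xs])
  finally show "(\<integral>\<omega>. exp (linB xs \<omega>) \<partial>distr ?Q P (\<lambda>\<omega>. \<omega> - shift i f)) = (\<integral>\<omega>. exp (linB xs \<omega>) \<partial>P)" .
qed

section \<open>Continuity of the Wick product\<close>

text \<open>The Wick product expressed by \<open>shift\<close>, so that it is defined for all f,
  including the limits of the projections.\<close>

definition wick :: "'n \<Rightarrow> 'h \<Rightarrow> ('n path \<Rightarrow> real) \<Rightarrow> 'n path \<Rightarrow> real" where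
  "wick i f X \<omega> = X (\<omega> - shift i f) * stoch_exp W i f \<omega>"

lemma nn_integral_wick:
  assumes [measurable]: "X \<in> borel_measurable P"
  shows "(\<integral>\<^sup>+\<omega>. X (\<omega> - shift i f) * ennreal (stoch_exp W i f \<omega>) \<partial>P) = (\<integral>\<^sup>+\<omega>. X \<omega> \<partial>P)"
proof -
  let ?Q = "density P (\<lambda>\<omega>. ennreal (stoch_exp W i f \<omega>))"
  have m: "(\<lambda>\<omega>. \<omega> - shift i f) \<in> measurable ?Q P" by simp
  have "(\<integral>\<^sup>+\<omega>. X \<omega> \<partial>P) = (\<integral>\<^sup>+\<omega>. X \<omega> \<partial>distr ?Q P (\<lambda>\<omega>. \<omega> - shift i f))" by (simp only: girsanov)
  also have "\<dots> = (\<integral>\<^sup>+\<omega>. X (\<omega> - shift i f) \<partial>?Q)" by (rule nn_integral_distr[OF m]) simp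
  also have "\<dots> = (\<integral>\<^sup>+\<omega>. ennreal (stoch_exp W i f \<omega>) * X (\<omega> - shift i f) \<partial>P)"
    by (rule nn_integral_density) measurable
  finally show ?thesis by (simp add: mult.commute)
qed

lemma wick_integrable:
  assumes X: "integrable P X"
  shows "integrable P (wick i f X)" "(\<integral>\<omega>. wick i f X \<omega> \<partial>P) = (\<integral>\<omega>. X \<omega> \<partial>P)"
proof -
  have [measurable]: "X \<in> borel_measurable P" using X by auto
  let ?Q = "density P (\<lambda>\<omega>. ennreal (stoch_exp W i f \<omega>))"
  have m: "(\<lambda>\<omega>. \<omega> - shift i f) \<in> measurable ?Q P" by simp
  have "integrable (distr ?Q P (\<lambda>\<omega>. \<omega> - shift i f)) X" using X by (simp only: girsanov)
  then have "integrable ?Q (\<lambda>\<omega>. X (\<omega> - shift i f))" by (rule integrable_distr[OF m])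
  then show "integrable P (wick i f X)"
    by (subst (asm) integrable_density) (auto simp: stoch_exp_nonneg wick_def[abs_def] mult.commute)
  have "(\<integral>\<omega>. X \<omega> \<partial>P) = (\<integral>\<omega>. X \<omega> \<partial>distr ?Q P (\<lambda>\<omega>. \<omega> - shift i f))" by (simp only: girsanov)
  also have "\<dots> = (\<integral>\<omega>. X (\<omega> - shift i f) \<partial>?Q)" by (rule integral_distr[OF m]) simp
  also have "\<dots> = (\<integral>\<omega>. wick i f X \<omega> \<partial>P)"
    by (subst integral_density) (auto simp: stoch_exp_nonneg wick_def[abs_def] mult.commute)
  finally show "(\<integral>\<omega>. wick i f X \<omega> \<partial>P) = (\<integral>\<omega>. X \<omega> \<partial>P)" ..
qed

lemma wick_diff: "wick i f X \<omega> - wick i f Y \<omega> = wick i f (\<lambda>\<omega>. X \<omega> - Y \<omega>) \<omega>"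
  and wick_add: "wick i f X \<omega> + wick i f Y \<omega> = wick i f (\<lambda>\<omega>. X \<omega> + Y \<omega>) \<omega>"
  and wick_scale: "wick i f (\<lambda>\<omega>. c * X \<omega>) \<omega> = c * wick i f X \<omega>"
  and wick_abs: "\<bar>wick i f X \<omega>\<bar> = wick i f (\<lambda>\<omega>. \<bar>X \<omega>\<bar>) \<omega>"
  by (simp_all add: wick_def algebra_simps abs_mult stoch_exp_nonneg)

lemma wick_dist:
  assumes "integrable P X" "integrable P Y"
  shows "(\<integral>\<omega>. \<bar>wick i f X \<omega> - wick i f Y \<omega>\<bar> \<partial>P) = (\<integral>\<omega>. \<bar>X \<omega> - Y \<omega>\<bar> \<partial>P)"
  using wick_integrable(2)[of "\<lambda>\<omega>. \<bar>X \<omega> - Y \<omega>\<bar>" i f] assms by (simp add: wick_diff wick_abs)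

lemma Wsum_single: "\<omega> \<in> space P \<Longrightarrow> Wsum (\<lambda>j. if j = i then f else 0) \<omega> = W i f \<omega>"
proof -
  assume w: "\<omega> \<in> space P"
  have "Wsum (\<lambda>j. if j = i then f else 0) \<omega> = (\<Sum>j\<in>UNIV. if j = i then W i f \<omega> else 0)"
    unfolding Wsum_def by (intro sum.cong) (auto simp: linear_0[OF W_linear[OF w]])
  then show ?thesis by simp
qed

lemma stoch_exp_tendsto:
  assumes lim: "f \<longlonglongrightarrow> g"
  shows "(\<lambda>n. \<integral>\<omega>. \<bar>stoch_exp W i (f n) \<omega> - stoch_exp W i g \<omega>\<bar> \<partial>P) \<longlonglongrightarrow> 0"
proof -
  have 1: "(\<lambda>n. \<integral>\<omega>. \<bar>exp (W i (f n) \<omega>) - exp (W i g \<omega>)\<bar> \<partial>P) \<longlonglongrightarrow> 0"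
  proof -
    have "(\<lambda>n. if j = i then f n else 0) \<longlonglongrightarrow> (if j = i then g else 0)" for j using lim by simp
    from exp_Wsum_tendsto[where h="\<lambda>n j. if j = i then f n else 0" and h'="\<lambda>j. if j = i then g else 0", OF this]
    show ?thesis by (simp add: Wsum_single cong: Bochner_Integration.integral_cong)
  qed
  \<comment> \<open>The normalizing factor of the stochastic exponential. It converges separately,
    so a product estimate reduces the claim to the exponentials of the Wiener integrals.\<close>
  define c where "c h = exp (- (norm h)\<^sup>2 / 2)" for h :: 'h
  have c: "(\<lambda>n. c (f n)) \<longlonglongrightarrow> c g" unfolding c_def by (intro tendsto_intros lim) simp
  have iW: "integrable P (\<lambda>\<omega>. exp (W i h \<omega>))" for h using W_exp_integrable[of 1 i h] by simp
  have se: "stoch_exp W i h \<omega> = c h * exp (W i h \<omega>)" for h \<omega>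
    by (simp add: stoch_exp_def c_def flip: exp_add)
  have c0: "c h > 0" for h by (simp add: c_def)
  show ?thesis
  proof (rule tendsto_sandwich[OF _ _ tendsto_const], rule_tac[1-2] always_eventually, rule_tac[1-2] allI)
    fix n
    show "0 \<le> (\<integral>\<omega>. \<bar>stoch_exp W i (f n) \<omega> - stoch_exp W i g \<omega>\<bar> \<partial>P)" by simp
    have "(\<integral>\<omega>. \<bar>stoch_exp W i (f n) \<omega> - stoch_exp W i g \<omega>\<bar> \<partial>P) \<le>
      (\<integral>\<omega>. c (f n) * \<bar>exp (W i (f n) \<omega>) - exp (W i g \<omega>)\<bar> + \<bar>c (f n) - c g\<bar> * exp (W i g \<omega>) \<partial>P)"
    proof (rule integral_mono)
      fix \<omega>
      have "stoch_exp W i (f n) \<omega> - stoch_exp W i g \<omega> = c (f n) * (exp (W i (f n) \<omega>) - exp (W i g \<omega>)) + (c (f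
        n) - c g) * exp (W i g \<omega>)"
        by (simp add: se algebra_simps)
      also have "\<bar>\<dots>\<bar> \<le> \<bar>c (f n) * (exp (W i (f n) \<omega>) - exp (W i g \<omega>))\<bar> + \<bar>(c (f n) - c g) * exp (W i g \<omega>)\<bar>"
        by (rule abs_triangle_ineq)
      also have "\<dots> = c (f n) * \<bar>exp (W i (f n) \<omega>) - exp (W i g \<omega>)\<bar> + \<bar>c (f n) - c g\<bar> * exp (W i g \<omega>)"
        using c0[of "f n"] by (simp add: abs_mult)
      finally show "\<bar>stoch_exp W i (f n) \<omega> - stoch_exp W i g \<omega>\<bar>
        \<le> c (f n) * \<bar>exp (W i (f n) \<omega>) - exp (W i g \<omega>)\<bar> + \<bar>c (f n) - c g\<bar> * exp (W i g \<omega>)" .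
    qed (use iW stoch_exp_integral in auto)
    also have "\<dots> = c (f n) * (\<integral>\<omega>. \<bar>exp (W i (f n) \<omega>) - exp (W i g \<omega>)\<bar> \<partial>P) + \<bar>c (f n) - c g\<bar> * (\<integral>\<omega>. exp (W i g \<omega>) \<partial>P)"
      using iW by simp
    finally show "(\<integral>\<omega>. \<bar>stoch_exp W i (f n) \<omega> - stoch_exp W i g \<omega>\<bar> \<partial>P)
      \<le> c (f n) * (\<integral>\<omega>. \<bar>exp (W i (f n) \<omega>) - exp (W i g \<omega>)\<bar> \<partial>P) + \<bar>c (f n) - c g\<bar> * (\<integral>\<omega>. exp (W i g \<omega>) \<partial>P)" .
  next
    have "(\<lambda>n. c (f n) * (\<integral>\<omega>. \<bar>exp (W i (f n) \<omega>) - exp (W i g \<omega>)\<bar> \<partial>P) + \<bar>c (f n) - c g\<bar> * (\<integral>\<omega>. exp (W i g \<omega>)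
      \<partial>P)) \<longlonglongrightarrow> c g * 0 + \<bar>c g - c g\<bar> * (\<integral>\<omega>. exp (W i g \<omega>) \<partial>P)"
      by (intro tendsto_intros c 1)
    then show "(\<lambda>n. c (f n) * (\<integral>\<omega>. \<bar>exp (W i (f n) \<omega>) - exp (W i g \<omega>)\<bar> \<partial>P) + \<bar>c (f n) - c g\<bar> * (\<integral>\<omega>. exp (W i g
      \<omega>) \<partial>P)) \<longlonglongrightarrow> 0" by simp
  qed
qed

text \<open>
  The continuity is established first for bounded Lipschitz functions of the path, for which the
  shifts are uniformly close, then for closed sets, Borel sets and finally for all of \<open>L\<^sup>1\<close>.
\<close>

definition wick_cont :: "'n \<Rightarrow> (nat \<Rightarrow> 'h) \<Rightarrow> 'h \<Rightarrow> ('n path \<Rightarrow> real) \<Rightarrow> bool" where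
  "wick_cont i f g X \<longleftrightarrow> integrable P X \<and> (\<lambda>n. \<integral>\<omega>. \<bar>wick i (f n) X \<omega> - wick i g X \<omega>\<bar> \<partial>P) \<longlonglongrightarrow> 0"

text \<open>A three-term estimate in which the two outer terms equal the L1 distance of X and Y
  exactly, by the isometry, and hence do not depend on n.\<close>

lemma wick_cont_approx:
  assumes X: "integrable P X"
    and a: "\<And>\<epsilon>. \<epsilon> > 0 \<Longrightarrow> \<exists>Y. wick_cont i f g Y \<and> (\<integral>\<omega>. \<bar>X \<omega> - Y \<omega>\<bar> \<partial>P) < \<epsilon>"
  shows "wick_cont i f g X"
  unfolding wick_cont_def
proof (intro conjI X LIMSEQ_I)
  fix r :: real assume r: "r > 0"
  obtain Y where Y: "wick_cont i f g Y" "(\<integral>\<omega>. \<bar>X \<omega> - Y \<omega>\<bar> \<partial>P) < r / 3" using a[of "r/3"] r by auto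
  have iY: "integrable P Y" using Y by (simp add: wick_cont_def)
  obtain N where N: "\<And>n. n \<ge> N \<Longrightarrow> (\<integral>\<omega>. \<bar>wick i (f n) Y \<omega> - wick i g Y \<omega>\<bar> \<partial>P) < r / 3"
    using LIMSEQ_D[of _ 0 "r/3"] Y(1) r unfolding wick_cont_def by fastforce
  have "norm ((\<integral>\<omega>. \<bar>wick i (f n) X \<omega> - wick i g X \<omega>\<bar> \<partial>P) - 0) < r" if n: "n \<ge> N" for n
  proof -
    have "(\<integral>\<omega>. \<bar>wick i (f n) X \<omega> - wick i g X \<omega>\<bar> \<partial>P) \<le>
      (\<integral>\<omega>. \<bar>wick i (f n) X \<omega> - wick i (f n) Y \<omega>\<bar> + \<bar>wick i (f n) Y \<omega> - wick i g Y \<omega>\<bar> + \<bar>wick i g X \<omega> - wick i g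
        Y \<omega>\<bar> \<partial>P)"
      by (intro integral_mono Bochner_Integration.integrable_add integrable_abs
        Bochner_Integration.integrable_diff wick_integrable X iY) auto
    also have "\<dots> = (\<integral>\<omega>. \<bar>X \<omega> - Y \<omega>\<bar> \<partial>P) + (\<integral>\<omega>. \<bar>wick i (f n) Y \<omega> - wick i g Y \<omega>\<bar> \<partial>P) + (\<integral>\<omega>. \<bar>X \<omega> - Y \<omega>\<bar> \<partial>P)"
      using X iY by (simp add: wick_integrable wick_dist)
    also have "\<dots> < r" using N[OF n] Y(2) by simp
    finally show ?thesis by simp
  qed
  then show "\<exists>no. \<forall>n\<ge>no. norm ((\<integral>\<omega>. \<bar>wick i (f n) X \<omega> - wick i g X \<omega>\<bar> \<partial>P) - 0) < r" by blast
qed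

lemma wick_cont_seq:
  assumes X: "integrable P X" and Y: "\<And>m::nat. wick_cont i f g (Y m)"
    and lim: "(\<lambda>m. \<integral>\<omega>. \<bar>X \<omega> - Y m \<omega>\<bar> \<partial>P) \<longlonglongrightarrow> 0"
  shows "wick_cont i f g X"
proof (rule wick_cont_approx[OF X])
  fix \<epsilon> :: real assume e: "\<epsilon> > 0"
  have "\<forall>\<^sub>F m in sequentially. (\<integral>\<omega>. \<bar>X \<omega> - Y m \<omega>\<bar> \<partial>P) < \<epsilon>" using lim e by (rule order_tendstoD)
  then show "\<exists>Y. wick_cont i f g Y \<and> (\<integral>\<omega>. \<bar>X \<omega> - Y \<omega>\<bar> \<partial>P) < \<epsilon>"
    using Y by (auto simp: eventually_sequentially)
qed

text \<open>Agreement on the path space is enough because shifts by Cameron--Martin paths stay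
  inside it.\<close>

lemma wick_cont_cong:
  assumes "wick_cont i f g X" and eq: "\<And>\<omega>. \<omega> \<in> space P \<Longrightarrow> X \<omega> = Y \<omega>"
  shows "wick_cont i f g Y"
proof -
  have "wick i h X \<omega> = wick i h Y \<omega>" if "\<omega> \<in> space P" for h \<omega>
    using eq[OF diff_in_space[OF that shift_in]] by (simp add: wick_def)
  then have "(\<integral>\<omega>. \<bar>wick i (f n) X \<omega> - wick i g X \<omega>\<bar> \<partial>P) = (\<integral>\<omega>. \<bar>wick i (f n) Y \<omega> - wick i g Y \<omega>\<bar> \<partial>P)" for n
    by (intro Bochner_Integration.integral_cong) auto
  moreover have "integrable P X \<longleftrightarrow> integrable P Y" by (intro Bochner_Integration.integrable_cong) (auto simp: eq)
  ultimately show ?thesis using assms(1) by (simp add: wick_cont_def)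
qed

lemma wick_cont_add:
  assumes X: "wick_cont i f g X" and Y: "wick_cont i f g Y"
  shows "wick_cont i f g (\<lambda>\<omega>. X \<omega> + Y \<omega>)"
  unfolding wick_cont_def
proof
  have i: "integrable P X" "integrable P Y" using X Y by (auto simp: wick_cont_def)
  then show "integrable P (\<lambda>\<omega>. X \<omega> + Y \<omega>)" by simp
  show "(\<lambda>n. \<integral>\<omega>. \<bar>wick i (f n) (\<lambda>\<omega>. X \<omega> + Y \<omega>) \<omega> - wick i g (\<lambda>\<omega>. X \<omega> + Y \<omega>) \<omega>\<bar> \<partial>P) \<longlonglongrightarrow> 0"
  proof (rule tendsto_sandwich[OF _ _ tendsto_const], rule_tac[1-2] always_eventually, rule_tac[1-2] allI)
    fix n
    have "(\<integral>\<omega>. \<bar>wick i (f n) (\<lambda>\<omega>. X \<omega> + Y \<omega>) \<omega> - wick i g (\<lambda>\<omega>. X \<omega> + Y \<omega>) \<omega>\<bar> \<partial>P) \<le>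
      (\<integral>\<omega>. \<bar>wick i (f n) X \<omega> - wick i g X \<omega>\<bar> + \<bar>wick i (f n) Y \<omega> - wick i g Y \<omega>\<bar> \<partial>P)"
      by (intro integral_mono Bochner_Integration.integrable_add integrable_abs
        Bochner_Integration.integrable_diff wick_integrable i)
        (auto simp flip: wick_add)
    also have "\<dots> = (\<integral>\<omega>. \<bar>wick i (f n) X \<omega> - wick i g X \<omega>\<bar> \<partial>P) + (\<integral>\<omega>. \<bar>wick i (f n) Y \<omega> - wick i g Y \<omega>\<bar> \<partial>P)"
      using i by (simp add: wick_integrable)
    finally show "(\<integral>\<omega>. \<bar>wick i (f n) (\<lambda>\<omega>. X \<omega> + Y \<omega>) \<omega> - wick i g (\<lambda>\<omega>. X \<omega> + Y \<omega>) \<omega>\<bar> \<partial>P)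
      \<le> (\<integral>\<omega>. \<bar>wick i (f n) X \<omega> - wick i g X \<omega>\<bar> \<partial>P) + (\<integral>\<omega>. \<bar>wick i (f n) Y \<omega> - wick i g Y \<omega>\<bar> \<partial>P)" .
  next
    show "(\<lambda>n. (\<integral>\<omega>. \<bar>wick i (f n) X \<omega> - wick i g X \<omega>\<bar> \<partial>P) + (\<integral>\<omega>. \<bar>wick i (f n) Y \<omega> - wick i g Y \<omega>\<bar> \<partial>P)) \<longlonglongrightarrow> 0"
      using tendsto_add[OF conjunct2[OF X[unfolded wick_cont_def]] conjunct2[OF Y[unfolded wick_cont_def]]] by simp
  qed simp
qed

lemma wick_cont_scale:
  assumes X: "wick_cont i f g X"
  shows "wick_cont i f g (\<lambda>\<omega>. c * X \<omega>)"
proof -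
  have "\<bar>wick i (f n) (\<lambda>\<omega>. c * X \<omega>) \<omega> - wick i g (\<lambda>\<omega>. c * X \<omega>) \<omega>\<bar> = \<bar>c\<bar> * \<bar>wick i (f n) X \<omega> - wick i g X \<omega>\<bar>" for n \<omega>
    by (simp add: wick_scale abs_mult flip: right_diff_distrib)
  then show ?thesis using X tendsto_mult_left[of _ 0 sequentially "\<bar>c\<bar>"] by (simp add: wick_cont_def)
qed

lemma wick_cont_sum:
  "finite A \<Longrightarrow> (\<And>a. a \<in> A \<Longrightarrow> wick_cont i f g (X a)) \<Longrightarrow> wick_cont i f g (\<lambda>\<omega>. \<Sum>a\<in>A. X a \<omega>)"
proof (induction A rule: finite_induct)
  case empty show ?case by (simp add: wick_cont_def wick_def)
next
  case (insert a A) then show ?case by (simp add: wick_cont_add)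
qed

lemma wick_cont_lipschitz:
  assumes lim: "f \<longlonglongrightarrow> g" and [measurable]: "X \<in> borel_measurable P"
    and C: "\<And>\<omega>. \<bar>X \<omega>\<bar> \<le> C" and L: "\<And>\<omega> \<eta>. \<bar>X \<omega> - X \<eta>\<bar> \<le> L * dist \<omega> \<eta>" "L \<ge> 0"
  shows "wick_cont i f g X"
  unfolding wick_cont_def
proof
  show i: "integrable P X" by (rule integrable_const_bound[where B=C]) (auto simp: C)
  have C0: "C \<ge> 0" using C[of 0] by linarith
  show "(\<lambda>n. \<integral>\<omega>. \<bar>wick i (f n) X \<omega> - wick i g X \<omega>\<bar> \<partial>P) \<longlonglongrightarrow> 0"
  proof (rule tendsto_sandwich[OF _ _ tendsto_const], rule_tac[1-2] always_eventually, rule_tac[1-2] allI)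
    fix n
    let ?d = "L * (norm (f n - g) * T powr H)"
    have "(\<integral>\<omega>. \<bar>wick i (f n) X \<omega> - wick i g X \<omega>\<bar> \<partial>P) \<le>
      (\<integral>\<omega>. ?d * stoch_exp W i (f n) \<omega> + C * \<bar>stoch_exp W i (f n) \<omega> - stoch_exp W i g \<omega>\<bar> \<partial>P)"
    proof (rule integral_mono)
      fix \<omega>
      \<comment> \<open>The product is split so that the Lipschitz difference is multiplied by an
        exponential of mean one and the bounded factor by a difference of exponentials that vanishes
        in L1.\<close>
      have "wick i (f n) X \<omega> - wick i g X \<omega> = (X (\<omega> - shift i (f n)) - X (\<omega> - shift i g)) * stoch_exp W i (f n)
        \<omega> + X (\<omega> - shift i g) * (stoch_exp W i (f n) \<omega> - stoch_exp W i g \<omega>)"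
        by (simp add: wick_def algebra_simps)
      also have "\<bar>\<dots>\<bar> \<le> \<bar>(X (\<omega> - shift i (f n)) - X (\<omega> - shift i g)) * stoch_exp W i (f n) \<omega>\<bar> + \<bar>X (\<omega> - shift i
        g) * (stoch_exp W i (f n) \<omega> - stoch_exp W i g \<omega>)\<bar>"
        by (rule abs_triangle_ineq)
      also have "\<dots> = \<bar>X (\<omega> - shift i (f n)) - X (\<omega> - shift i g)\<bar> * stoch_exp W i (f n) \<omega> + \<bar>X (\<omega> - shift i g)\<bar>
        * \<bar>stoch_exp W i (f n) \<omega> - stoch_exp W i g \<omega>\<bar>"
        by (simp add: abs_mult stoch_exp_nonneg)
      also have "\<dots> \<le> ?d * stoch_exp W i (f n) \<omega> + C * \<bar>stoch_exp W i (f n) \<omega> - stoch_exp W i g \<omega>\<bar>"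
      proof (intro add_mono mult_right_mono C stoch_exp_nonneg)
        have "dist (\<omega> - shift i (f n)) (\<omega> - shift i g) = dist (shift i (f n)) (shift i g)"
          by (simp add: dist_norm norm_minus_commute)
        then have "L * dist (\<omega> - shift i (f n)) (\<omega> - shift i g) \<le> ?d"
          using dist_shift[of i "f n" g] L(2) by (simp add: mult_left_mono)
        then show "\<bar>X (\<omega> - shift i (f n)) - X (\<omega> - shift i g)\<bar> \<le> ?d" using L(1) order_trans by blast
      qed simp
      finally show "\<bar>wick i (f n) X \<omega> - wick i g X \<omega>\<bar> \<le> ?d * stoch_exp W i (f n) \<omega> + C * \<bar>stoch_exp W i (f n) \<omega>
        - stoch_exp W i g \<omega>\<bar>" .
    qed (use i stoch_exp_integral in \<open>auto intro!: wick_integrable\<close>)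
    also have "\<dots> = ?d + C * (\<integral>\<omega>. \<bar>stoch_exp W i (f n) \<omega> - stoch_exp W i g \<omega>\<bar> \<partial>P)"
      using stoch_exp_integral by simp
    finally show "(\<integral>\<omega>. \<bar>wick i (f n) X \<omega> - wick i g X \<omega>\<bar> \<partial>P)
      \<le> ?d + C * (\<integral>\<omega>. \<bar>stoch_exp W i (f n) \<omega> - stoch_exp W i g \<omega>\<bar> \<partial>P)" .
  next
    have "(\<lambda>n. L * (norm (f n - g) * T powr H) + C * (\<integral>\<omega>. \<bar>stoch_exp W i (f n) \<omega> - stoch_exp W i g \<omega>\<bar> \<partial>P))
      \<longlonglongrightarrow> L * (norm (g - g) * T powr H) + C * 0"
      by (intro tendsto_intros lim stoch_exp_tendsto)
    then show "(\<lambda>n. L * (norm (f n - g) * T powr H) + C * (\<integral>\<omega>. \<bar>stoch_exp W i (f n) \<omega> - stoch_exp W i g \<omega>\<bar> \<partial>P))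
      \<longlonglongrightarrow> 0" by simp
  qed simp
qed

lemma borel_measurable_P: "X \<in> borel_measurable borel \<Longrightarrow> X \<in> borel_measurable P"
  by (subst measurable_cong_sets[OF sets_P refl]) (rule measurable_restrict_space1)

lemma wick_cont_closed:
  fixes F :: "'n path set"
  assumes lim: "f \<longlonglongrightarrow> g" and F: "closed F" "F \<noteq> {}"
  shows "wick_cont i f g (indicator F)"
proof (rule wick_cont_seq)
  \<comment> \<open>These m-Lipschitz functions decrease to the indicator, since F is
    closed.\<close>
  define \<phi> where "\<phi> m \<omega> = max 0 (1 - real m * infdist \<omega> F)" for m :: nat and \<omega>
  have m[measurable]: "\<phi> m \<in> borel_measurable P" for m
    unfolding \<phi>_def by (intro borel_measurable_P borel_measurable_continuous_onI continuous_intros)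
  have [measurable]: "(indicator F :: 'n path \<Rightarrow> real) \<in> borel_measurable P"
    using F by (intro borel_measurable_P borel_measurable_indicator borel_closed)
  have r: "0 \<le> \<phi> m \<omega>" "\<phi> m \<omega> \<le> 1" for m \<omega> by (auto simp: \<phi>_def infdist_nonneg)
  show "integrable P (indicator F :: 'n path \<Rightarrow> real)" by (rule integrable_const_bound[where B=1]) auto
  show "wick_cont i f g (\<phi> m)" for m
  proof (rule wick_cont_lipschitz[OF lim m])
    show "\<bar>\<phi> m \<omega>\<bar> \<le> 1" for \<omega> using r[of m \<omega>] by simp
    show "\<bar>\<phi> m \<omega> - \<phi> m \<eta>\<bar> \<le> real m * dist \<omega> \<eta>" for \<omega> \<eta>
    proof -
      have "\<bar>\<phi> m \<omega> - \<phi> m \<eta>\<bar> \<le> \<bar>real m * infdist \<omega> F - real m * infdist \<eta> F\<bar>"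
        unfolding \<phi>_def by linarith
      also have "\<dots> = real m * \<bar>infdist \<omega> F - infdist \<eta> F\<bar>" by (simp add: abs_mult flip: right_diff_distrib)
      also have "\<dots> \<le> real m * dist \<omega> \<eta>" by (intro mult_left_mono infdist_triangle_abs) simp
      finally show ?thesis .
    qed
  qed simp
  have "(\<lambda>m. \<integral>\<omega>. \<bar>indicator F \<omega> - \<phi> m \<omega>\<bar> \<partial>P) \<longlonglongrightarrow> (\<integral>\<omega>. 0 \<partial>P)"
  proof (rule integral_dominated_convergence[where w="\<lambda>_. 1"])
    show "AE \<omega> in P. (\<lambda>m. \<bar>indicator F \<omega> - \<phi> m \<omega>\<bar>) \<longlonglongrightarrow> 0"
    proof (rule AE_I2)
      fix \<omega>
      have "\<phi> m \<omega> = 1" if "\<omega> \<in> F" for m using that by (simp add: \<phi>_def)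
      moreover have "\<forall>\<^sub>F m in sequentially. \<phi> m \<omega> = 0" if "\<omega> \<notin> F"
      proof -
        have d: "infdist \<omega> F > 0" using that F by (metis in_closed_iff_infdist_zero infdist_nonneg less_le)
        obtain N where N: "real N > 1 / infdist \<omega> F" using reals_Archimedean2 by blast
        have "\<phi> m \<omega> = 0" if "m \<ge> N" for m
        proof -
          have "1 / infdist \<omega> F < real m" using N that by linarith
          then show ?thesis using d by (simp add: \<phi>_def field_simps)
        qed
        then show ?thesis by (auto simp: eventually_sequentially)
      qed
      ultimately show "(\<lambda>m. \<bar>indicator F \<omega> - \<phi> m \<omega>\<bar>) \<longlonglongrightarrow> 0"
        by (cases "\<omega> \<in> F") (auto intro: tendsto_eventually elim: eventually_mono)
    qed
    show "AE \<omega> in P. norm \<bar>indicator F \<omega> - \<phi> m \<omega>\<bar> \<le> 1" for m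
      using r[of m] by (auto simp: indicator_def intro!: AE_I2)
  qed auto
  then show "(\<lambda>m. \<integral>\<omega>. \<bar>indicator F \<omega> - \<phi> m \<omega>\<bar> \<partial>P) \<longlonglongrightarrow> 0" by simp
qed

text \<open>Induction over disjoint unions, started at the intersection-stable generator of closed
  sets. Countable unions pass through by dominated convergence and
  \<open>wick_cont_seq\<close>.\<close>

lemma wick_cont_indicator:
  fixes A :: "'n path set"
  assumes lim: "f \<longlonglongrightarrow> g" and A: "A \<in> sets borel"
  shows "wick_cont i f g (indicator A)"
proof -
  have "Int_stable (Collect closed :: 'n path set set)" by (auto simp: Int_stable_def)
  moreover have "(Collect closed :: 'n path set set) \<subseteq> Pow UNIV" by simp
  moreover have "A \<in> sigma_sets UNIV (Collect closed)" using A by (simp add: borel_eq_closed)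
  ultimately show ?thesis
  proof (induction rule: sigma_sets_induct_disjoint)
    case (basic A)
    show ?case
    proof (cases "A = {}")
      \<comment> \<open>\<open>infdist\<close> from the empty set is 0 by convention, so the
        Lipschitz approximation would not converge to the indicator here.\<close>
      case True then show ?thesis by (simp add: wick_cont_def wick_def)
    next
      case False then show ?thesis using wick_cont_closed[OF lim] basic by blast
    qed
  next
    case empty show ?case by (simp add: wick_cont_def wick_def)
  next
    case (compl A)
    have "wick_cont i f g (\<lambda>\<omega>. indicator UNIV \<omega> + (-1) * indicator A \<omega>)"
      by (intro wick_cont_add wick_cont_scale compl(2) wick_cont_closed[OF lim]) auto
    then show ?case by (rule wick_cont_cong) (auto simp: indicator_def)
  next
    case (union A)
    have Ab[measurable]: "A m \<in> sets borel" for m using union(2) by (auto simp: borel_eq_closed)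
    have [measurable]: "(indicator (A m) :: 'n path \<Rightarrow> real) \<in> borel_measurable P"
      "(indicator (\<Union>m. A m) :: 'n path \<Rightarrow> real) \<in> borel_measurable P" for m
      by (intro borel_measurable_P; measurable)+
    show ?case
    proof (rule wick_cont_seq)
      show "integrable P (indicator (\<Union>m. A m) :: 'n path \<Rightarrow> real)" by (rule integrable_const_bound[where B=1]) auto
      show "wick_cont i f g (\<lambda>\<omega>. \<Sum>k<m. indicator (A k) \<omega>)" for m by (intro wick_cont_sum union(3)) simp
      have eq: "(\<Sum>k<m. indicator (A k) \<omega>) = (indicator (\<Union>k<m. A k) \<omega> :: real)" for m and \<omega> :: "'n path"
        by (rule indicator_UN_disjoint[symmetric]) (use union(1) in \<open>auto simp: disjoint_family_on_def\<close>)
      have "(\<lambda>m. \<integral>\<omega>. \<bar>indicator (\<Union>m. A m) \<omega> - (\<Sum>k<m. indicator (A k) \<omega>) :: real\<bar> \<partial>P) \<longlonglongrightarrow> (\<integral>\<omega>. 0 \<partial>P)"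
      proof (rule integral_dominated_convergence[where w="\<lambda>_. 1"])
        show "AE \<omega> in P. (\<lambda>m. \<bar>indicator (\<Union>m. A m) \<omega> - (\<Sum>k<m. indicator (A k) \<omega>)\<bar>) \<longlonglongrightarrow> (0::real)"
        proof (rule AE_I2)
          fix \<omega> :: "'n path"
          have "(\<lambda>m. \<Sum>k<m. indicator (A k) \<omega> :: real) \<longlonglongrightarrow> indicator (\<Union>k. A k) \<omega>"
            by (rule indicator_sums[unfolded sums_def]) (use union(1) in \<open>auto simp: disjoint_family_on_def\<close>)
          then have "(\<lambda>m. \<bar>indicator (\<Union>m. A m) \<omega> - (\<Sum>k<m. indicator (A k) \<omega>)\<bar>)
            \<longlonglongrightarrow> \<bar>indicator (\<Union>m. A m) \<omega> - indicator (\<Union>m. A m) \<omega> :: real\<bar>"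
            by (intro tendsto_intros)
          then show "(\<lambda>m. \<bar>indicator (\<Union>m. A m) \<omega> - (\<Sum>k<m. indicator (A k) \<omega>)\<bar>) \<longlonglongrightarrow> (0::real)" by simp
        qed
        show "AE \<omega> in P. norm \<bar>indicator (\<Union>m. A m) \<omega> - (\<Sum>k<m. indicator (A k) \<omega>) :: real\<bar> \<le> 1" for m
          unfolding eq by (auto simp: indicator_def intro!: AE_I2)
      qed auto
      then show "(\<lambda>m. \<integral>\<omega>. \<bar>indicator (\<Union>m. A m) \<omega> - (\<Sum>k<m. indicator (A k) \<omega>) :: real\<bar> \<partial>P) \<longlonglongrightarrow> 0" by simp
    qed
  qed
qed

lemma wick_tendsto:
  assumes flim: "f \<longlonglongrightarrow> g" and X: "integrable P X"
  shows "(\<lambda>n. \<integral>\<omega>. \<bar>wick i (f n) X \<omega> - wick i g X \<omega>\<bar> \<partial>P) \<longlonglongrightarrow> 0"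
proof -
  have "wick_cont i f g X" using X
  proof (induction rule: integrable_induct)
    case (base A c)
    \<comment> \<open>Sets of \<open>P\<close> are traces of Borel sets. The Borel set is used in
      their place, as the continuity of indicators was shown on the full space of bounded continuous
      functions.\<close>
    then have "A \<in> sets (restrict_space borel (path_space T))" by (simp add: sets_P)
    then obtain A' where A': "A' \<in> sets borel" "A = path_space T \<inter> A'" by (auto simp: sets_restrict_space)
    have "wick_cont i f g (\<lambda>\<omega>. c * indicator A' \<omega>)"
      by (intro wick_cont_scale wick_cont_indicator[OF flim A'(1)])
    then show ?case by (rule wick_cont_cong) (auto simp: A'(2) space_P indicator_def)
  next
    case (add X Y) then show ?case by (simp add: wick_cont_add)
  next
    case (lim X s)
    have s: "integrable P (s m)" "wick_cont i f g (s m)" for m using lim by blast+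
    have X: "integrable P X" using lim by blast
    have sX: "(\<lambda>m. s m \<omega>) \<longlonglongrightarrow> X \<omega>" "norm (s m \<omega>) \<le> 2 * norm (X \<omega>)" if "\<omega> \<in> space P" for m \<omega>
      using lim that by blast+
    note [measurable] = borel_measurable_integrable[OF s(1)] borel_measurable_integrable[OF X]
    show ?case
    proof (rule wick_cont_seq[OF X s(2)])
      have "(\<lambda>m. \<integral>\<omega>. \<bar>X \<omega> - s m \<omega>\<bar> \<partial>P) \<longlonglongrightarrow> (\<integral>\<omega>. 0 \<partial>P)"
      proof (rule integral_dominated_convergence[where w="\<lambda>\<omega>. 3 * \<bar>X \<omega>\<bar>"])
        show "AE \<omega> in P. (\<lambda>m. \<bar>X \<omega> - s m \<omega>\<bar>) \<longlonglongrightarrow> 0"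
        proof (rule AE_I2)
          fix \<omega> assume "\<omega> \<in> space P"
          then have "(\<lambda>m. \<bar>X \<omega> - s m \<omega>\<bar>) \<longlonglongrightarrow> \<bar>X \<omega> - X \<omega>\<bar>" by (intro tendsto_intros sX)
          then show "(\<lambda>m. \<bar>X \<omega> - s m \<omega>\<bar>) \<longlonglongrightarrow> 0" by simp
        qed
        show "AE \<omega> in P. norm \<bar>X \<omega> - s m \<omega>\<bar> \<le> 3 * \<bar>X \<omega>\<bar>" for m
        proof (rule AE_I2)
          fix \<omega> assume "\<omega> \<in> space P"
          from sX(2)[OF this, of m] show "norm \<bar>X \<omega> - s m \<omega>\<bar> \<le> 3 * \<bar>X \<omega>\<bar>" by simp
        qed
      qed (use X in auto)
      then show "(\<lambda>m. \<integral>\<omega>. \<bar>X \<omega> - s m \<omega>\<bar> \<partial>P) \<longlonglongrightarrow> 0" by simp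
    qed
  qed
  then show ?thesis by (simp add: wick_cont_def)
qed

text \<open>Since L at \<omega> is L at the translated path plus a constant, exp L can be pulled
  into the Wick product up to a scalar, and the Wick product preserves expectations.\<close>

lemma wick_exp_linB:
  assumes xs: "valid_times T xs" and X: "integrable P (\<lambda>\<omega>. X \<omega> * exp (linB xs \<omega>))"
  shows "integrable P (\<lambda>\<omega>. wick i f X \<omega> * exp (linB xs \<omega>))"
    and "(\<integral>\<omega>. wick i f X \<omega> * exp (linB xs \<omega>) \<partial>P) = exp (inner f (J (stepf xs i))) * (\<integral>\<omega>. X \<omega> * exp (linB xs \<omega>) \<partial>P)"
proof -
  have eq: "wick i f X \<omega> * exp (linB xs \<omega>) = exp (inner f (J (stepf xs i))) * wick i f (\<lambda>\<omega>. X \<omega> * exp (linB xs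
    \<omega>)) \<omega>" for \<omega>
    by (simp add: wick_def linB_diff linB_shift[OF xs] exp_diff)
  show "integrable P (\<lambda>\<omega>. wick i f X \<omega> * exp (linB xs \<omega>))"
    unfolding eq by (intro Bochner_Integration.integrable_mult_right wick_integrable X)
  show "(\<integral>\<omega>. wick i f X \<omega> * exp (linB xs \<omega>) \<partial>P) = exp (inner f (J (stepf xs i))) * (\<integral>\<omega>. X \<omega> * exp (linB xs \<omega>) \<partial>P)"
    unfolding eq by (simp add: wick_integrable(2)[OF X])
qed

lemma exp_linB_integrable:
  assumes xs: "valid_times T xs"
  shows "integrable P (\<lambda>\<omega>. exp (a * linB xs \<omega>))"
proof -
  have "integrable P (\<lambda>\<omega>. exp (a * linB xs \<omega>)) \<longleftrightarrow> integrable P (\<lambda>\<omega>. exp (a * Wsum (\<lambda>j. J (stepf xs j)) \<omega>))"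
    using AE_linB[OF xs] by (intro integrable_cong_AE) auto
  then show ?thesis using exp_Wsum_integrable by blast
qed

lemma integrable_mult_sq:
  fixes X Y :: "'n path \<Rightarrow> real"
  assumes [measurable]: "X \<in> borel_measurable P" "Y \<in> borel_measurable P"
    and "integrable P (\<lambda>\<omega>. (X \<omega>)\<^sup>2)" "integrable P (\<lambda>\<omega>. (Y \<omega>)\<^sup>2)"
  shows "integrable P (\<lambda>\<omega>. X \<omega> * Y \<omega>)"
proof (rule Bochner_Integration.integrable_bound[OF Bochner_Integration.integrable_add[OF assms(3,4)]])
  show "AE \<omega> in P. norm (X \<omega> * Y \<omega>) \<le> norm ((X \<omega>)\<^sup>2 + (Y \<omega>)\<^sup>2)"
  proof (rule AE_I2)
    fix \<omega>
    have "\<bar>X \<omega>\<bar> * \<bar>Y \<omega>\<bar> \<le> (X \<omega>)\<^sup>2 + (Y \<omega>)\<^sup>2"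
    proof -
      have "0 \<le> (\<bar>X \<omega>\<bar> - \<bar>Y \<omega>\<bar>)\<^sup>2" by simp
      then have "2 * (\<bar>X \<omega>\<bar> * \<bar>Y \<omega>\<bar>) \<le> (X \<omega>)\<^sup>2 + (Y \<omega>)\<^sup>2" by (simp add: power2_diff)
      moreover have "0 \<le> \<bar>X \<omega>\<bar> * \<bar>Y \<omega>\<bar>" by simp
      ultimately show ?thesis by linarith
    qed
    then show "norm (X \<omega> * Y \<omega>) \<le> norm ((X \<omega>)\<^sup>2 + (Y \<omega>)\<^sup>2)" by (simp add: abs_mult)
  qed
qed measurable

lemma exp_linB_mult_integrable:
  assumes xs: "valid_times T xs" and [measurable]: "X \<in> borel_measurable P" and X: "integrable P (\<lambda>\<omega>. (X \<omega>)\<^sup>2)"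
  shows "integrable P (\<lambda>\<omega>. X \<omega> * exp (linB xs \<omega>))"
proof (rule integrable_mult_sq[OF _ _ X])
  show "integrable P (\<lambda>\<omega>. (exp (linB xs \<omega>))\<^sup>2)"
    using exp_linB_integrable[OF xs, of 2] by (simp add: power2_eq_square flip: exp_add)
qed measurable

text \<open>The positive and the negative part of X - Y are taken as densities of two finite
  measures. Their exponentials have equal integrals, so the measures and the densities agree; at
  each point at most one part is nonzero, hence both vanish.\<close>

lemma AE_eq_if_exp_linB:
  assumes [measurable]: "X \<in> borel_measurable P" "Y \<in> borel_measurable P"
    and X: "integrable P (\<lambda>\<omega>. (X \<omega>)\<^sup>2)" and Y: "integrable P (\<lambda>\<omega>. (Y \<omega>)\<^sup>2)"
    and eq: "\<And>xs. valid_times T xs \<Longrightarrow> (\<integral>\<omega>. X \<omega> * exp (linB xs \<omega>) \<partial>P) = (\<integral>\<omega>. Y \<omega> * exp (linB xs \<omega>) \<partial>P)"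
  shows "AE \<omega> in P. X \<omega> = Y \<omega>"
proof -
  define D1 where "D1 \<omega> = max 0 (X \<omega> - Y \<omega>)" for \<omega>
  define D2 where "D2 \<omega> = max 0 (Y \<omega> - X \<omega>)" for \<omega>
  have [measurable]: "D1 \<in> borel_measurable P" "D2 \<in> borel_measurable P" unfolding D1_def D2_def by measurable
  have nn: "D1 \<omega> \<ge> 0" "D2 \<omega> \<ge> 0" for \<omega> by (auto simp: D1_def D2_def)
  have i: "integrable P (\<lambda>\<omega>. D1 \<omega> * exp (linB xs \<omega>))" "integrable P (\<lambda>\<omega>. D2 \<omega> * exp (linB xs \<omega>))" if xs:
    "valid_times T xs" for xs
  proof -
    have a: "integrable P (\<lambda>\<omega>. \<bar>X \<omega> * exp (linB xs \<omega>) - Y \<omega> * exp (linB xs \<omega>)\<bar>)"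
      using exp_linB_mult_integrable[OF xs _ X] exp_linB_mult_integrable[OF xs _ Y] by simp
    show "integrable P (\<lambda>\<omega>. D1 \<omega> * exp (linB xs \<omega>))" "integrable P (\<lambda>\<omega>. D2 \<omega> * exp (linB xs \<omega>))"
      by (rule Bochner_Integration.integrable_bound[OF a], measurable,
          auto simp: D1_def D2_def abs_mult max_def simp flip: left_diff_distrib intro!: AE_I2)+
  qed
  have i1: "integrable P D1" "integrable P D2" using i[of "[]"] by simp_all
  have fin: "finite_measure (density P (\<lambda>\<omega>. ennreal (D \<omega>)))" if D: "integrable P D" "\<And>\<omega>. D \<omega> \<ge> 0" for D
  proof (rule finite_measureI)
    have [measurable]: "D \<in> borel_measurable P" using D by auto
    have "emeasure (density P (\<lambda>\<omega>. ennreal (D \<omega>))) (space P) = (\<integral>\<^sup>+\<omega>. ennreal (D \<omega>) \<partial>P)"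
      by (auto simp: emeasure_density intro!: nn_integral_cong)
    also have "\<dots> = ennreal (\<integral>\<omega>. D \<omega> \<partial>P)" using D by (intro nn_integral_eq_integral) auto
    finally show "emeasure (density P (\<lambda>\<omega>. ennreal (D \<omega>))) (space (density P (\<lambda>\<omega>. ennreal (D \<omega>)))) \<noteq> \<infinity>" by simp
  qed
  have "density P (\<lambda>\<omega>. ennreal (D1 \<omega>)) = density P (\<lambda>\<omega>. ennreal (D2 \<omega>))"
  proof (rule path_measure_eqI[OF T_pos])
    fix xs :: "(real \<times> 'n \<times> real) list" assume xs: "valid_times T xs"
    show "integrable (density P (\<lambda>\<omega>. ennreal (D1 \<omega>))) (\<lambda>\<omega>. exp (linB xs \<omega>))"
      "integrable (density P (\<lambda>\<omega>. ennreal (D2 \<omega>))) (\<lambda>\<omega>. exp (linB xs \<omega>))"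
      using i[OF xs] nn by (simp_all add: integrable_density)
    have "(\<integral>\<omega>. D1 \<omega> * exp (linB xs \<omega>) \<partial>P) - (\<integral>\<omega>. D2 \<omega> * exp (linB xs \<omega>) \<partial>P)
      = (\<integral>\<omega>. D1 \<omega> * exp (linB xs \<omega>) - D2 \<omega> * exp (linB xs \<omega>) \<partial>P)"
      using i[OF xs] by simp
    also have "\<dots> = (\<integral>\<omega>. X \<omega> * exp (linB xs \<omega>) - Y \<omega> * exp (linB xs \<omega>) \<partial>P)"
      by (intro Bochner_Integration.integral_cong) (auto simp: D1_def D2_def max_def algebra_simps)
    also have "\<dots> = 0"
      using exp_linB_mult_integrable[OF xs _ X] exp_linB_mult_integrable[OF xs _ Y] eq[OF xs] by simp
    finally show "(\<integral>\<omega>. exp (linB xs \<omega>) \<partial>density P (\<lambda>\<omega>. ennreal (D1 \<omega>)))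
      = (\<integral>\<omega>. exp (linB xs \<omega>) \<partial>density P (\<lambda>\<omega>. ennreal (D2 \<omega>)))"
      using nn by (simp add: integral_density)
  qed (use fin[OF i1(1)] fin[OF i1(2)] nn sets_P in auto)
  then have "AE \<omega> in P. ennreal (D1 \<omega>) = ennreal (D2 \<omega>)"
    by (intro density_unique) auto
  then show ?thesis
    by eventually_elim (auto simp: D1_def D2_def max_def split: if_splits)
qed

end

section \<open>The approximating equation\<close>

text \<open>On the exceptional null set the path is set to 0, and elsewhere time is clamped to
  [0,T]. All paths are then continuous on the real line, so the version is jointly
  measurable.\<close>

lemma process_version:
  fixes Y :: "real \<Rightarrow> 'a \<Rightarrow> 'b::{metric_space, zero}"
  assumes T: "T > 0" and c: "AE \<omega> in P. continuous_on {0..T} (\<lambda>t. Y t \<omega>)"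
    and m: "\<And>t. t \<in> {0..T} \<Longrightarrow> Y t \<in> borel_measurable P"
  obtains N Z where "N \<in> null_sets P" "\<And>t \<omega>. \<omega> \<in> space P - N \<Longrightarrow> t \<in> {0..T} \<Longrightarrow> Z t \<omega> = Y t \<omega>"
    "(\<lambda>p. Z (fst p) (snd p)) \<in> borel_measurable (borel \<Otimes>\<^sub>M P)"
    "\<And>\<omega>. continuous_on UNIV (\<lambda>t. Z t \<omega>)"
proof -
  obtain N where N: "{\<omega> \<in> space P. \<not> continuous_on {0..T} (\<lambda>t. Y t \<omega>)} \<subseteq> N" "N \<in> null_sets P"
    using AE_E[OF c] by (metis (no_types, lifting) null_setsI)
  define Z where "Z t \<omega> = (if \<omega> \<in> space P - N then Y (max 0 (min T t)) \<omega> else 0)" for t \<omega>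
  have cZ: "continuous_on UNIV (\<lambda>t. Z t \<omega>)" for \<omega>
  proof (cases "\<omega> \<in> space P - N")
    case True
    then have "continuous_on {0..T} (\<lambda>t. Y t \<omega>)" using N by auto
    then have "continuous_on UNIV (\<lambda>t. Y (max 0 (min T t)) \<omega>)"
      by (rule continuous_on_compose2) (use T in \<open>auto intro!: continuous_intros\<close>)
    then show ?thesis using True by (simp add: Z_def)
  next
    case False
    then have z: "(\<lambda>t. Z t \<omega>) = (\<lambda>t. 0)" by (auto simp: Z_def fun_eq_iff)
    show ?thesis by (subst z) (rule continuous_on_const)
  qed
  have [measurable]: "N \<in> sets P" using N(2) by auto
  have "Z t \<in> borel_measurable P" for t
  proof -
    have [measurable]: "Y (max 0 (min T t)) \<in> borel_measurable P" using T by (intro m) auto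
    have "Z t = (\<lambda>\<omega>. if \<omega> \<in> space P - N then Y (max 0 (min T t)) \<omega> else 0)" by (simp add: Z_def fun_eq_iff)
    then show ?thesis by simp
  qed
  then have "(\<lambda>p. Z (fst p) (snd p)) \<in> borel_measurable (borel \<Otimes>\<^sub>M P)"
    using cZ by (rule borel_measurable_caratheodory)
  then show thesis using that[OF N(2), of Z] cZ by (auto simp: Z_def)
qed

text \<open>The passage from x to y replaces one coordinate at a time.\<close>

lemma coordinatewise_lipschitz:
  fixes f :: "real ^ 'n \<Rightarrow> real"
  assumes "\<And>x j h. \<bar>f (x + h *\<^sub>R axis j 1) - f x\<bar> \<le> L * \<bar>h\<bar>"
  shows "\<bar>f y - f x\<bar> \<le> L * (\<Sum>j\<in>UNIV. \<bar>y $ j - x $ j\<bar>)"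
proof -
  define z where "z S = (\<chi> j. if j \<in> S then y $ j else x $ j)" for S
  have "\<bar>f (z S) - f x\<bar> \<le> L * (\<Sum>j\<in>S. \<bar>y $ j - x $ j\<bar>)" if "finite S" for S
    using that
  proof (induction S rule: finite_induct)
    case empty
    have "z {} = x" by (simp add: z_def vec_eq_iff)
    then show ?case by simp
  next
    case (insert k S)
    have "z (insert k S) = z S + (y $ k - x $ k) *\<^sub>R axis k 1"
      using insert.hyps by (auto simp: z_def vec_eq_iff axis_def)
    then have "\<bar>f (z (insert k S)) - f (z S)\<bar> \<le> L * \<bar>y $ k - x $ k\<bar>" using assms by metis
    then have "\<bar>f (z (insert k S)) - f x\<bar> \<le> L * \<bar>y $ k - x $ k\<bar> + L * (\<Sum>j\<in>S. \<bar>y $ j - x $ j\<bar>)"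
      using insert.IH by linarith
    then show ?case using insert.hyps by (simp add: algebra_simps)
  qed
  moreover have "z UNIV = y" by (simp add: z_def vec_eq_iff)
  ultimately show ?thesis by (metis finite)
qed

text \<open>Finiteness of the two double integrals makes almost all sections integrable, so that the
  difference of the time integrals is the integral of the difference; Tonelli then exchanges the
  order.\<close>

lemma nn_integral_diff_integrals_le:
  fixes f g :: "real \<times> 'a \<Rightarrow> real"
  assumes P: "prob_space P" and [measurable]: "f \<in> borel_measurable (borel \<Otimes>\<^sub>M P)" "g \<in> borel_measurable (borel \<Otimes>\<^sub>M P)"
    and f: "(\<integral>\<^sup>+s. (\<integral>\<^sup>+\<omega>. ennreal \<bar>f (s, \<omega>)\<bar> \<partial>P) \<partial>lborel) < \<infinity>" and g: "(\<integral>\<^sup>+s. (\<integral>\<^sup>+\<omega>. ennreal \<bar>g (s, \<omega>)\<bar> \<partial>P) \<partial>lborel) < \<infinity>"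
  shows "(\<integral>\<^sup>+\<omega>. ennreal \<bar>(\<integral>s. f (s, \<omega>) \<partial>lborel) - (\<integral>s. g (s, \<omega>) \<partial>lborel)\<bar> \<partial>P)
    \<le> (\<integral>\<^sup>+s. (\<integral>\<^sup>+\<omega>. ennreal \<bar>f (s, \<omega>) - g (s, \<omega>)\<bar> \<partial>P) \<partial>lborel)"
proof -
  interpret P: prob_space P by fact
  interpret pair_sigma_finite lborel P by unfold_locales
  have fm[measurable]: "f \<in> borel_measurable (lborel \<Otimes>\<^sub>M P)" and gm[measurable]: "g \<in> borel_measurable (lborel \<Otimes>\<^sub>M P)"
    using assms(2,3) measurable_cong_sets[OF sets_pair_measure_cong[OF sets_lborel refl] refl] by blast+
  have fin: "AE \<omega> in P. integrable lborel (\<lambda>s. h (s, \<omega>))"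
    if [measurable]: "h \<in> borel_measurable (lborel \<Otimes>\<^sub>M P)" and "(\<integral>\<^sup>+s. (\<integral>\<^sup>+\<omega>. ennreal \<bar>h (s, \<omega>)\<bar> \<partial>P) \<partial>lborel) < \<infinity>" for h
  proof -
    have "(\<integral>\<^sup>+\<omega>. (\<integral>\<^sup>+s. ennreal \<bar>h (s, \<omega>)\<bar> \<partial>lborel) \<partial>P) < \<infinity>"
      using that Fubini'[of "\<lambda>s \<omega>. ennreal \<bar>h (s, \<omega>)\<bar>"] by simp
    then have "AE \<omega> in P. (\<integral>\<^sup>+s. ennreal \<bar>h (s, \<omega>)\<bar> \<partial>lborel) \<noteq> \<infinity>"
      by (intro nn_integral_PInf_AE) auto
    with AE_space show ?thesis
      by eventually_elim (auto intro!: integrableI_bounded simp: less_top)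
  qed
  have "(\<integral>\<^sup>+\<omega>. ennreal \<bar>(\<integral>s. f (s, \<omega>) \<partial>lborel) - (\<integral>s. g (s, \<omega>) \<partial>lborel)\<bar> \<partial>P) \<le>
    (\<integral>\<^sup>+\<omega>. (\<integral>\<^sup>+s. ennreal \<bar>f (s, \<omega>) - g (s, \<omega>)\<bar> \<partial>lborel) \<partial>P)"
  proof (rule nn_integral_mono_AE)
    show "AE \<omega> in P. ennreal \<bar>(\<integral>s. f (s, \<omega>) \<partial>lborel) - (\<integral>s. g (s, \<omega>) \<partial>lborel)\<bar>
      \<le> (\<integral>\<^sup>+s. ennreal \<bar>f (s, \<omega>) - g (s, \<omega>)\<bar> \<partial>lborel)"
      using fin[OF fm f] fin[OF gm g]
    proof eventually_elim
      case (elim \<omega>)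
      then have "(\<integral>s. f (s, \<omega>) \<partial>lborel) - (\<integral>s. g (s, \<omega>) \<partial>lborel) = (\<integral>s. f (s, \<omega>) - g (s, \<omega>) \<partial>lborel)" by simp
      then show ?case using ennreal_norm_integral_le[of lborel "\<lambda>s. f (s, \<omega>) - g (s, \<omega>)"] by simp
    qed
  qed
  also have "\<dots> = (\<integral>\<^sup>+s. (\<integral>\<^sup>+\<omega>. ennreal \<bar>f (s, \<omega>) - g (s, \<omega>)\<bar> \<partial>P) \<partial>lborel)"
    by (rule Fubini') measurable
  finally show ?thesis .
qed

lemma vec_borel_measurableI:
  fixes f :: "'a \<Rightarrow> real ^ 'n"
  assumes "\<And>i. (\<lambda>x. f x $ i) \<in> borel_measurable M"
  shows "f \<in> borel_measurable M"
  using assms unfolding borel_measurable_euclidean_space[of f M] by (auto simp: Basis_vec_def inner_axis)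

lemma borel_measurable_vec_nth[measurable (raw)]:
  fixes f :: "'a \<Rightarrow> real ^ 'n::finite"
  assumes "f \<in> borel_measurable M"
  shows "(\<lambda>x. f x $ i) \<in> borel_measurable M"
proof (rule measurable_compose[OF assms])
  show "(\<lambda>x :: real ^ 'n. x $ i) \<in> borel_measurable borel"
    by (intro borel_measurable_continuous_onI continuous_intros)
qed

section \<open>Bounds for the coefficients, and the mild map\<close>

locale wong_zakai = fbm H T J P W
  for H T :: real and J :: "(real \<Rightarrow> real) \<Rightarrow> 'h::{real_inner, complete_space}"
    and P :: "('n::finite) path measure" and W :: "'n \<Rightarrow> 'h \<Rightarrow> 'n path \<Rightarrow> real" +
  fixes e :: "nat \<Rightarrow> 'h" and b :: "real \<Rightarrow> real ^ 'n \<Rightarrow> real ^ 'n" and \<sigma> :: "real \<Rightarrow> real ^ 'n" and c :: "real ^ 'n"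
  assumes e: "complete_orthonormal e"
    and \<xi>: "\<And>k. k \<ge> 1 \<Longrightarrow> \<exists>\<xi>. Phi_version H T J (e k) \<xi>"
    and b: "bounded_C1 T b"
    and \<sigma>: "continuous_on {0..T} \<sigma>"
begin

text \<open>Clamping the time extends b continuously to all times with the same bounds, so that
  measurability and Lipschitz estimates hold for every real time.\<close>

definition drift :: "real \<Rightarrow> real ^ 'n \<Rightarrow> real ^ 'n" where "drift s x = b (max 0 (min T s)) x"

definition sig :: "'n \<Rightarrow> real \<Rightarrow> real \<Rightarrow> 'h" where "sig i s t = J (\<lambda>r. indicator {s..t} r * \<sigma> r $ i)"

definition sigK :: "nat \<Rightarrow> 'n \<Rightarrow> real \<Rightarrow> real \<Rightarrow> 'h" where "sigK K i s t = fproj e K (sig i s t)"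

lemma drift_eq: "s \<in> {0..T} \<Longrightarrow> drift s x = b s x"
  by (simp add: drift_def)

lemma drift_continuous: "continuous_on UNIV (\<lambda>p. drift (fst p) (snd p))"
proof -
  have "continuous_on ({0..T} \<times> UNIV) (\<lambda>(t, x). b t x)" using b by (simp add: bounded_C1_def)
  then have "continuous_on UNIV (\<lambda>p. (\<lambda>(t, x). b t x) (max 0 (min T (fst p)), snd p))"
    by (rule continuous_on_compose2) (use T_pos in \<open>auto intro!: continuous_intros\<close>)
  then show ?thesis by (simp add: drift_def)
qed

lemma drift_bounded: "\<exists>M>0. \<forall>s x i. \<bar>drift s x $ i\<bar> \<le> M"
proof -
  have "bounded ((\<lambda>(t, x). b t x) ` ({0..T} \<times> UNIV))" using b by (simp add: bounded_C1_def)
  then obtain M where M: "M > 0" "\<And>z. z \<in> (\<lambda>(t, x). b t x) ` ({0..T} \<times> UNIV) \<Longrightarrow> norm z \<le> M"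
    unfolding bounded_pos by blast
  have "norm (drift s x) \<le> M" for s x unfolding drift_def using T_pos by (intro M(2)) auto
  then have "\<bar>drift s x $ i\<bar> \<le> M" for s x i using component_le_norm_cart order_trans by metis
  then show ?thesis using M(1) by blast
qed

definition Mb :: real where "Mb = (SOME M. M > 0 \<and> (\<forall>s x i. \<bar>drift s x $ i\<bar> \<le> M))"

lemma Mb: "Mb > 0" "\<bar>drift s x $ i\<bar> \<le> Mb"
  using someI_ex[OF drift_bounded] unfolding Mb_def[symmetric] by auto

lemma drift_lipschitz: "\<exists>L>0. \<forall>s x y i. \<bar>drift s y $ i - drift s x $ i\<bar> \<le> L * (\<Sum>j\<in>UNIV. \<bar>y $ j - x $ j\<bar>)"
proof -
  have "\<exists>D. bounded ((\<lambda>(t, x). D t x) ` ({0..T} \<times> UNIV)) \<and>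
    (\<forall>t\<in>{0..T}. \<forall>x. ((\<lambda>h. b t (x + h *\<^sub>R axis j 1)) has_vector_derivative D t x) (at 0))" for j
    using b unfolding bounded_C1_def by blast
  then obtain D where D: "\<And>j. bounded ((\<lambda>(t, x). D j t x) ` ({0..T} \<times> UNIV))"
    "\<And>j t x. t \<in> {0..T} \<Longrightarrow> ((\<lambda>h. b t (x + h *\<^sub>R axis j 1)) has_vector_derivative D j t x) (at 0)"
    by metis
  have "\<exists>L>0. \<forall>t\<in>{0..T}. \<forall>x. norm (D j t x) \<le> L" for j
    using D(1)[of j] unfolding bounded_pos by auto
  then obtain L where L: "\<And>j. L j > 0" "\<And>j t x. t \<in> {0..T} \<Longrightarrow> norm (D j t x) \<le> L j" by metis
  define K where "K = Max (range L)"
  have K: "L j \<le> K" for j unfolding K_def by (rule Max_ge) auto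
  have Kp: "K > 0" using K[of undefined] L(1)[of undefined] by linarith
  have "\<bar>drift s y $ i - drift s x $ i\<bar> \<le> K * (\<Sum>j\<in>UNIV. \<bar>y $ j - x $ j\<bar>)" for s x y i
  proof (rule coordinatewise_lipschitz)
    fix x j h
    define t where "t = max 0 (min T s)"
    have t: "t \<in> {0..T}" using T_pos by (auto simp: t_def)
    \<comment> \<open>The hypothesis gives the derivative at h = 0 for every base point. Moving the
      base point along the coordinate direction gives it at every h, as the mean value inequality
      requires.\<close>
    have der: "((\<lambda>h. b t (x + h *\<^sub>R axis j 1)) has_vector_derivative D j t (x + h0 *\<^sub>R axis j 1)) (at h0)" for h0
    proof -
      have "((\<lambda>h. b t ((x + h0 *\<^sub>R axis j 1) + h *\<^sub>R axis j 1)) has_vector_derivative D j t (x + h0 *\<^sub>R axis j 1))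
        (at (h0 - h0))"
        using D(2)[OF t] by simp
      moreover have "((\<lambda>h. h - h0) has_vector_derivative 1) (at h0)" by (auto intro!: derivative_eq_intros)
      ultimately have "((\<lambda>h. b t ((x + h0 *\<^sub>R axis j 1) + h *\<^sub>R axis j 1)) \<circ> (\<lambda>h. h - h0) has_vector_derivative 1
        *\<^sub>R D j t (x + h0 *\<^sub>R axis j 1)) (at h0)"
        by (intro vector_diff_chain_at)
      then show ?thesis by (simp add: o_def algebra_simps)
    qed
    have "norm (b t (x + h *\<^sub>R axis j 1) - b t (x + 0 *\<^sub>R axis j 1)) \<le> K * norm (h - 0)"
    proof (rule differentiable_bound[where S=UNIV and f="\<lambda>h. b t (x + h *\<^sub>R axis j 1)"
      and f'="\<lambda>h0 h. h *\<^sub>R D j t (x + h0 *\<^sub>R axis j 1)"])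
      show "((\<lambda>h. b t (x + h *\<^sub>R axis j 1)) has_derivative (\<lambda>h. h *\<^sub>R D j t (x + h0 *\<^sub>R axis j 1))) (at h0 within
        UNIV)" for h0
        using der[of h0] by (simp add: has_vector_derivative_def)
      show "onorm (\<lambda>h. h *\<^sub>R D j t (x + h0 *\<^sub>R axis j 1)) \<le> K" for h0
      proof (rule onorm_le)
        fix h :: real
        have "norm (D j t (x + h0 *\<^sub>R axis j 1)) \<le> K" using L(2)[OF t] K order_trans by blast
        then have "\<bar>h\<bar> * norm (D j t (x + h0 *\<^sub>R axis j 1)) \<le> \<bar>h\<bar> * K" by (rule mult_left_mono) simp
        then show "norm (h *\<^sub>R D j t (x + h0 *\<^sub>R axis j 1)) \<le> K * norm h"
          by (simp only: norm_scaleR real_norm_def mult.commute[of K])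
      qed
    qed auto
    then have "norm (b t (x + h *\<^sub>R axis j 1) - b t x) \<le> K * \<bar>h\<bar>" by simp
    then show "\<bar>drift s (x + h *\<^sub>R axis j 1) $ i - drift s x $ i\<bar> \<le> K * \<bar>h\<bar>"
      using component_le_norm_cart[of "b t (x + h *\<^sub>R axis j 1) - b t x" i]
      by (simp add: drift_def t_def)
  qed
  then show ?thesis using Kp by blast
qed

definition Lb :: real where "Lb = (SOME L. L > 0 \<and> (\<forall>s x y i. \<bar>drift s y $ i - drift s x $ i\<bar>
  \<le> L * (\<Sum>j\<in>UNIV. \<bar>y $ j - x $ j\<bar>)))"

lemma Lb: "Lb > 0" "\<bar>drift s y $ i - drift s x $ i\<bar> \<le> Lb * (\<Sum>j\<in>UNIV. \<bar>y $ j - x $ j\<bar>)"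
  using someI_ex[OF drift_lipschitz] unfolding Lb_def[symmetric] by auto

lemma \<sigma>_bounded: "\<exists>M\<ge>0. \<forall>s\<in>{0..T}. \<forall>i. \<bar>\<sigma> s $ i\<bar> \<le> M"
proof -
  have "bounded (\<sigma> ` {0..T})" by (intro compact_imp_bounded compact_continuous_image \<sigma>) simp
  then obtain M where M: "M > 0" "\<And>s. s \<in> {0..T} \<Longrightarrow> norm (\<sigma> s) \<le> M" unfolding bounded_pos by blast
  then have "\<bar>\<sigma> s $ i\<bar> \<le> M" if "s \<in> {0..T}" for s i
    using component_le_norm_cart[of "\<sigma> s" i] M(2)[OF that] by linarith
  then show ?thesis using M(1) by (intro exI[of _ M]) auto
qed

definition M\<sigma> :: real where "M\<sigma> = (SOME M. M \<ge> 0 \<and> (\<forall>s\<in>{0..T}. \<forall>i. \<bar>\<sigma> s $ i\<bar> \<le> M))"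

lemma M\<sigma>: "M\<sigma> \<ge> 0" "s \<in> {0..T} \<Longrightarrow> \<bar>\<sigma> s $ i\<bar> \<le> M\<sigma>"
  using someI_ex[OF \<sigma>_bounded] unfolding M\<sigma>_def[symmetric] by auto

lemma sig_L2: "(\<lambda>r. indicator {s..t} r * \<sigma> r $ i) \<in> L2 T"
proof (rule L2_bounded[where C=M\<sigma>])
  have "continuous_on {0..T} (\<lambda>r. \<sigma> r $ i)" using \<sigma> by (intro continuous_intros)
  then have m[measurable]: "(\<lambda>r. indicator {0..T} r *\<^sub>R \<sigma> r $ i) \<in> borel_measurable borel"
    by (intro borel_measurable_continuous_on_indicator) auto
  have "(\<lambda>r. indicator {s..t} r * (indicator {0..T} r *\<^sub>R \<sigma> r $ i)) \<in> borel_measurable borel"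
    by (intro borel_measurable_times borel_measurable_indicator m) simp
  then show "(\<lambda>r. indicator {0..T} r * (indicator {s..t} r * \<sigma> r $ i)) \<in> borel_measurable borel"
    by (simp add: mult_ac)
  show "\<bar>indicator {s..t} r * \<sigma> r $ i\<bar> \<le> M\<sigma>" if "r \<in> {0..T}" for r
    using M\<sigma>(2)[OF that] M\<sigma>(1) by (auto simp: indicator_def)
qed

lemma norm_sig: "(norm (sig i s t))\<^sup>2 \<le> phi_mass * (M\<sigma>\<^sup>2 * T)"
proof -
  have "(norm (sig i s t))\<^sup>2 \<le> phi_mass * (LBINT r:{0..T}. (indicator {s..t} r * \<sigma> r $ i)\<^sup>2)"
    unfolding sig_def by (rule norm_J_le[OF sig_L2])
  also have "\<dots> \<le> phi_mass * (LBINT r:{0..T}. M\<sigma>\<^sup>2)"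
  proof (intro mult_left_mono set_integral_mono phi_mass_pos)
    show "set_integrable lborel {0..T} (\<lambda>r. (indicator {s..t} r * \<sigma> r $ i)\<^sup>2)" using sig_L2 by (simp add: L2_def)
    show "set_integrable lborel {0..T} (\<lambda>r. M\<sigma>\<^sup>2)" by (intro borel_integrable_atLeastAtMost' continuous_intros)
    fix r assume "r \<in> {0..T}"
    then show "(indicator {s..t} r * \<sigma> r $ i)\<^sup>2 \<le> M\<sigma>\<^sup>2"
      using M\<sigma>(2)[of r i] M\<sigma>(1) by (auto simp: indicator_def abs_le_square_iff[symmetric])
  qed
  also have "(LBINT r:{0..T}. M\<sigma>\<^sup>2) = M\<sigma>\<^sup>2 * T" using T_pos by (simp add: set_lebesgue_integral_def)
  finally show ?thesis .
qed

text \<open>The two truncated integrands differ at most between s and s', so the Schur bound yields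
  continuity in the lower time.\<close>

lemma norm_sig_diff: "(norm (sig i s t - sig i s' t))\<^sup>2 \<le> phi_mass * (M\<sigma>\<^sup>2 * \<bar>s - s'\<bar>)"
proof -
  let ?h = "\<lambda>r. indicator {s..t} r * \<sigma> r $ i - indicator {s'..t} r * \<sigma> r $ i"
  have L: "?h \<in> L2 T" by (intro L2_diff sig_L2)
  have "sig i s t - sig i s' t = J ?h" unfolding sig_def by (rule J_diff[OF sig_L2 sig_L2, symmetric])
  then have "(norm (sig i s t - sig i s' t))\<^sup>2 \<le> phi_mass * (LBINT r:{0..T}. (?h r)\<^sup>2)"
    using norm_J_le[OF L] by simp
  also have "\<dots> \<le> phi_mass * (\<integral>r. indicator {min s s'..max s s'} r * M\<sigma>\<^sup>2 \<partial>lborel)"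
    unfolding set_lebesgue_integral_def
  proof (intro mult_left_mono integral_mono phi_mass_pos)
    show "integrable lborel (\<lambda>r. indicator {0..T} r *\<^sub>R (?h r)\<^sup>2)" using L by (simp add: L2_def set_integrable_def)
    show "integrable lborel (\<lambda>r. indicator {min s s'..max s s'} r * M\<sigma>\<^sup>2)"
      using borel_integrable_atLeastAtMost'[of "min s s'" "max s s'" "\<lambda>r. M\<sigma>\<^sup>2"] by (simp add: set_integrable_def)
    fix r
    show "indicator {0..T} r *\<^sub>R (?h r)\<^sup>2 \<le> indicator {min s s'..max s s'} r * M\<sigma>\<^sup>2"
    proof (cases "r \<in> {0..T}")
      case True
      then have "(\<sigma> r $ i)\<^sup>2 \<le> M\<sigma>\<^sup>2" using M\<sigma>(2)[of r i] M\<sigma>(1) by (simp add: abs_le_square_iff[symmetric])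
      then show ?thesis by (auto simp: indicator_def)
    qed simp
  qed
  also have "(\<integral>r. indicator {min s s'..max s s'} r * M\<sigma>\<^sup>2 \<partial>lborel) = M\<sigma>\<^sup>2 * \<bar>s - s'\<bar>"
    by (simp add: max_def min_def abs_if)
  finally show ?thesis .
qed

lemma norm_sigK: "norm (sigK K i s t) \<le> norm (sig i s t)"
  unfolding sigK_def by (rule norm_fproj_le[OF e])

lemma norm_sigK_sq: "(norm (sigK K i s t))\<^sup>2 \<le> phi_mass * (M\<sigma>\<^sup>2 * T)"
  using power_mono[OF norm_sigK norm_ge_zero] norm_sig by (rule order_trans)

lemma continuous_sig: "continuous_on UNIV (\<lambda>s. sig i s t)"
  unfolding continuous_on_def
proof (intro ballI)
  fix s :: real
  have "((\<lambda>u. sqrt (phi_mass * (M\<sigma>\<^sup>2 * \<bar>u - s\<bar>))) \<longlongrightarrow> sqrt (phi_mass * (M\<sigma>\<^sup>2 * \<bar>s - s\<bar>))) (at s)"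
    by (intro tendsto_intros)
  then have "((\<lambda>u. sqrt (phi_mass * (M\<sigma>\<^sup>2 * \<bar>u - s\<bar>))) \<longlongrightarrow> 0) (at s)" by simp
  then have "((\<lambda>u. sig i u t - sig i s t) \<longlongrightarrow> 0) (at s)"
    by (rule Lim_null_comparison[rotated])
      (use norm_sig_diff[of i _ t s] in \<open>auto intro!: always_eventually real_le_rsqrt\<close>)
  then show "((\<lambda>u. sig i u t) \<longlongrightarrow> sig i s t) (at s within UNIV)" by (rule LIM_zero_cancel)
qed

lemma continuous_sigK: "continuous_on UNIV (\<lambda>s. sigK K i s t)"
  unfolding sigK_def fproj_def by (intro continuous_intros continuous_sig)

lemma sigma_proj_eq: "sigma_proj J e \<sigma> K i s t = sigK K i s t"
  unfolding sigma_proj_def sigK_def sig_def by (rule orth_proj_eq_fproj[OF e])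

text \<open>The projection lies in the span of e_1, ..., e_K, so a version of its Phi exists and the
  translation prescribed by the mild equation is a Cameron--Martin shift.\<close>

lemma wick_exp_eq: "wick_exp H T J W Y i (sigK K i s t) = wick i (sigK K i s t) Y"
proof -
  have "\<exists>g. Phi_version H T J (sigK K i s t) g"
  proof (rule Phi_version_span)
    show "sigK K i s t \<in> span (e ` {1..K})" unfolding sigK_def by (rule fproj_in_span)
  qed (use \<xi> in auto)
  from translate_eq[OF this] show ?thesis
    by (simp add: wick_exp_def wick_def fun_eq_iff)
qed

definition integrand :: "nat \<Rightarrow> 'n \<Rightarrow> real \<Rightarrow> (real \<Rightarrow> 'n path \<Rightarrow> real ^ 'n) \<Rightarrow> real \<Rightarrow> 'n path \<Rightarrow> real" where
  "integrand K i t Z s = wick i (sigK K i s t) (\<lambda>\<eta>. drift s (Z s \<eta>) $ i)"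

definition jointly_measurable :: "(real \<Rightarrow> 'n path \<Rightarrow> real ^ 'n) \<Rightarrow> bool" where
  "jointly_measurable Z \<longleftrightarrow> (\<lambda>p. Z (fst p) (snd p)) \<in> borel_measurable (borel \<Otimes>\<^sub>M P)"

lemma jointly_measurable_section: "jointly_measurable Z \<Longrightarrow> Z s \<in> borel_measurable P"
proof -
  assume "jointly_measurable Z"
  then have "(\<lambda>\<omega>. (\<lambda>p. Z (fst p) (snd p)) (s, \<omega>)) \<in> borel_measurable P"
    unfolding jointly_measurable_def by (rule measurable_compose[rotated]) simp
  then show ?thesis by simp
qed

lemma drift_measurable[measurable (raw)]:
  assumes [measurable]: "f \<in> borel_measurable M" "g \<in> borel_measurable M"
  shows "(\<lambda>x. drift (f x) (g x)) \<in> borel_measurable M"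
proof -
  have "(\<lambda>p. drift (fst p) (snd p)) \<in> borel_measurable borel"
    by (rule borel_measurable_continuous_onI[OF drift_continuous])
  moreover have "(\<lambda>x. (f x, g x)) \<in> measurable M borel" unfolding borel_prod[symmetric] by measurable
  ultimately have "(\<lambda>x. (\<lambda>p. drift (fst p) (snd p)) (f x, g x)) \<in> borel_measurable M"
    by (rule measurable_compose[rotated])
  then show ?thesis by simp
qed

lemma shift_sigK_measurable: "(\<lambda>p. snd p - shift i (sigK K i (fst p) t)) \<in> measurable (borel \<Otimes>\<^sub>M P) P"
proof (rule measurable_path_space[OF T_pos sets_P])
  fix p :: "real \<times> 'n path" assume "p \<in> space (borel \<Otimes>\<^sub>M P)"
  then show "snd p - shift i (sigK K i (fst p) t) \<in> path_space T"
    by (auto simp: space_pair_measure space_P intro: path_space_diff shift_in)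
next
  fix j r assume r: "r \<in> {0..T}"
  have "continuous_on UNIV (\<lambda>s. inner (sigK K i s t) (chi r))" by (intro continuous_intros continuous_sigK)
  then have [measurable]: "(\<lambda>s. inner (sigK K i s t) (chi r)) \<in> borel_measurable borel"
    by (rule borel_measurable_continuous_onI)
  show "(\<lambda>p. B j r (snd p - shift i (sigK K i (fst p) t))) \<in> borel_measurable (borel \<Otimes>\<^sub>M P)"
    using r by (simp add: B_diff B_shift)
qed

text \<open>Linearity of \<open>W i\<close> at every path expands the Wiener integral into finitely
  many products of a continuous function of s and a random variable, which gives joint
  measurability.\<close>

lemma stoch_exp_sigK_measurable: "(\<lambda>p. stoch_exp W i (sigK K i (fst p) t) (snd p)) \<in> borel_measurable (borel \<Otimes>\<^sub>M P)"
proof -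
  have [measurable]: "(\<lambda>s. inner (sig i s t) v) \<in> borel_measurable borel" for v
    by (intro borel_measurable_continuous_onI continuous_intros continuous_sig)
  have [measurable]: "(\<lambda>s. norm (sigK K i s t)) \<in> borel_measurable borel"
    by (intro borel_measurable_continuous_onI continuous_intros continuous_sigK)
  have eq: "W i (sigK K i s t) \<omega> = (\<Sum>k=1..K. inner (sig i s t) (e k) * W i (e k) \<omega>)" if "\<omega> \<in> space P" for s \<omega>
  proof -
    have "W i (sigK K i s t) \<omega> = (\<Sum>k=1..K. W i (inner (sig i s t) (e k) *\<^sub>R e k) \<omega>)"
      unfolding sigK_def fproj_def by (rule linear_sum[OF W_linear[OF that]])
    also have "\<dots> = (\<Sum>k=1..K. inner (sig i s t) (e k) * W i (e k) \<omega>)"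
      using W_scale[OF that] by (intro sum.cong) auto
    finally show ?thesis .
  qed
  have "(\<lambda>p. exp ((\<Sum>k=1..K. inner (sig i (fst p) t) (e k) * W i (e k) (snd p)) - (norm (sigK K i (fst p) t))\<^sup>2 /
    2)) \<in> borel_measurable (borel \<Otimes>\<^sub>M P)"
    by measurable
  then show ?thesis
    by (rule measurable_cong[THEN iffD1, rotated]) (auto simp: stoch_exp_def eq space_pair_measure)
qed

lemma integrand_measurable:
  assumes Z: "jointly_measurable Z"
  shows "(\<lambda>p. integrand K i t Z (fst p) (snd p)) \<in> borel_measurable (borel \<Otimes>\<^sub>M P)"
proof -
  have "(\<lambda>p. (fst p, snd p - shift i (sigK K i (fst p) t))) \<in> measurable (borel \<Otimes>\<^sub>M P) (borel \<Otimes>\<^sub>M P)"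
    by (intro measurable_Pair measurable_fst shift_sigK_measurable)
  from measurable_compose[OF this Z[unfolded jointly_measurable_def]]
  have [measurable]: "(\<lambda>p. Z (fst p) (snd p - shift i (sigK K i (fst p) t))) \<in> borel_measurable (borel \<Otimes>\<^sub>M P)" by simp
  have "(\<lambda>p. drift (fst p) (Z (fst p) (snd p - shift i (sigK K i (fst p) t))) $ i) \<in> borel_measurable (borel \<Otimes>\<^sub>M P)"
    by measurable
  then show ?thesis unfolding integrand_def wick_def
    by (rule borel_measurable_times[OF _ stoch_exp_sigK_measurable])
qed

text \<open>The L1 isometry carries the sup bound of the drift over to the Wick product, with the
  same constant for every truncation.\<close>

lemma integrand_integrable:
  assumes Z: "jointly_measurable Z"
  shows "integrable P (\<lambda>\<eta>. drift s (Z s \<eta>) $ i)" "integrable P (integrand K i t Z s)"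
    "(\<integral>\<^sup>+\<omega>. ennreal \<bar>integrand K i t Z s \<omega>\<bar> \<partial>P) \<le> ennreal Mb"
proof -
  note [measurable] = jointly_measurable_section[OF Z]
  show i: "integrable P (\<lambda>\<eta>. drift s (Z s \<eta>) $ i)"
    by (rule integrable_const_bound[where B=Mb]) (auto simp: Mb)
  then show i': "integrable P (integrand K i t Z s)" unfolding integrand_def by (rule wick_integrable)
  have "(\<integral>\<omega>. \<bar>integrand K i t Z s \<omega>\<bar> \<partial>P) = (\<integral>\<eta>. \<bar>drift s (Z s \<eta>) $ i\<bar> \<partial>P)"
    unfolding integrand_def wick_abs using i by (intro wick_integrable) auto
  also have "\<dots> \<le> (\<integral>\<eta>. Mb \<partial>P)" using i by (intro integral_mono) (auto simp: Mb)
  finally have "(\<integral>\<omega>. \<bar>integrand K i t Z s \<omega>\<bar> \<partial>P) \<le> Mb" by (simp add: prob_space)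
  then show "(\<integral>\<^sup>+\<omega>. ennreal \<bar>integrand K i t Z s \<omega>\<bar> \<partial>P) \<le> ennreal Mb"
    using i' by (subst nn_integral_eq_integral) (auto intro: ennreal_leI)
qed

text \<open>The map F_K of the overview, for one component at one time.\<close>

definition mild_map :: "nat \<Rightarrow> 'n \<Rightarrow> real \<Rightarrow> (real \<Rightarrow> 'n path \<Rightarrow> real ^ 'n) \<Rightarrow> 'n path \<Rightarrow> real" where
  "mild_map K i t Z \<omega> = c $ i * stoch_exp W i (sigK K i 0 t) \<omega> + (\<integral>s. indicator {0..t} s * integrand K i t Z s
    \<omega> \<partial>lborel)"

text \<open>The stochastic exponential is strictly positive, so by Girsanov's theorem null sets
  remain null under the translation.\<close>

lemma AE_shift_notin:
  assumes N: "N \<in> null_sets P"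
  shows "AE \<omega> in P. \<omega> - shift i f \<notin> N"
proof -
  have [measurable]: "N \<in> sets P" using N by auto
  have "(\<integral>\<^sup>+\<omega>. indicator N (\<omega> - shift i f) * ennreal (stoch_exp W i f \<omega>) \<partial>P) = (\<integral>\<^sup>+\<omega>. indicator N \<omega> \<partial>P)"
    by (rule nn_integral_wick) simp
  also have "\<dots> = 0" using null_setsD1[OF N] by simp
  finally have "AE \<omega> in P. indicator N (\<omega> - shift i f) * ennreal (stoch_exp W i f \<omega>) = 0"
    by (subst (asm) nn_integral_0_iff_AE) auto
  then show ?thesis
    by eventually_elim (auto simp: stoch_exp_def indicator_def split: if_splits)
qed

text \<open>The mild equation evaluates the process at translated paths, which may enter the
  exceptional set. For each time this happens with probability zero, and Fubini converts this into
  almost every time for almost every path.\<close>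

lemma mild_solution_eq:
  assumes Y: "mild_solution H T P J W e b \<sigma> c K Y" and t: "t \<in> {0..T}"
    and N: "N \<in> null_sets P" and Z: "\<And>t \<omega>. \<omega> \<in> space P - N \<Longrightarrow> t \<in> {0..T} \<Longrightarrow> Z t \<omega> = Y t \<omega>"
    and Zm: "jointly_measurable Z"
  shows "AE \<omega> in P. Z t \<omega> $ i = mild_map K i t Z \<omega>"
proof -
  interpret pair_sigma_finite lborel P by unfold_locales
  have [measurable]: "N \<in> sets P" using N by auto
  note [measurable] = integrand_measurable[OF Zm, of K i t] shift_sigK_measurable[of i K t]
  let ?G = "\<lambda>\<omega> s. wick i (sigK K i s t) (\<lambda>\<eta>. b s (Y s \<eta>) $ i) \<omega>"
  have "AE \<omega> in P. \<forall>t\<in>{0..T}. set_integrable lebesgue {0..t} (\<lambda>s. wick i (sigK K i s t) (\<lambda>\<eta>. b s (Y s \<eta>) $ i) \<omega>) \<and>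
      Y t \<omega> $ i = c $ i * stoch_exp W i (sigK K i 0 t) \<omega> + (LINT s:{0..t}|lebesgue. wick i (sigK K i s t) (\<lambda>\<eta>.
        b s (Y s \<eta>) $ i) \<omega>)"
    using Y unfolding mild_solution_def wick_exp_eq sigma_proj_eq by blast
  then have mild: "AE \<omega> in P. set_integrable lebesgue {0..t} (?G \<omega>) \<and>
      Y t \<omega> $ i = c $ i * stoch_exp W i (sigK K i 0 t) \<omega> + (LINT s:{0..t}|lebesgue. ?G \<omega> s)"
    by eventually_elim (use t in blast)
  have "AE s in lborel. AE \<omega> in P. \<omega> - shift i (sigK K i s t) \<notin> N"
    using AE_shift_notin[OF N] by simp
  moreover have "{p \<in> space (lborel \<Otimes>\<^sub>M P). snd p - shift i (sigK K i (fst p) t) \<notin> N} \<in> sets (lborel \<Otimes>\<^sub>M P)"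
  proof -
    have "(\<lambda>p. snd p - shift i (sigK K i (fst p) t)) \<in> measurable (lborel \<Otimes>\<^sub>M P) P"
      using shift_sigK_measurable[of i K t] measurable_cong_sets[OF sets_pair_measure_cong[OF sets_lborel refl]
        refl] by blast
    from measurable_sets[OF this, of "space P - N"] have "(\<lambda>p. snd p - shift i (sigK K i (fst p) t)) -` (space
      P - N) \<inter> space (lborel \<Otimes>\<^sub>M P) \<in> sets (lborel \<Otimes>\<^sub>M P)" by simp
    also have "(\<lambda>p. snd p - shift i (sigK K i (fst p) t)) -` (space P - N) \<inter> space (lborel \<Otimes>\<^sub>M P)
      = {p \<in> space (lborel \<Otimes>\<^sub>M P). snd p - shift i (sigK K i (fst p) t) \<notin> N}"
      using diff_in_space[OF _ shift_in] by (auto simp: space_pair_measure)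
    finally show ?thesis .
  qed
  ultimately have "AE \<omega> in P. AE s in lborel. \<omega> - shift i (sigK K i s t) \<notin> N"
    by (subst AE_commute[symmetric]) auto
  with mild AE_space AE_not_in[OF N] show ?thesis
  proof eventually_elim
    case (elim \<omega>)
    \<comment> \<open>Outside the exceptional times, and inside [0,t], the translated path lies
      where \<open>Y\<close> and its version coincide. The Lebesgue integral of the mild equation
      therefore reduces to an integral of a Borel function.\<close>
    have eq: "AE s in lborel. indicator {0..t} s *\<^sub>R ?G \<omega> s = indicator {0..t} s * integrand K i t Z s \<omega>"
      using elim(4)
    proof eventually_elim
      case (elim s)
      show ?case
      proof (cases "s \<in> {0..t}")
        case True
        then have s: "s \<in> {0..T}" using t by auto
        have "\<omega> - shift i (sigK K i s t) \<in> space P - N"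
          using elim diff_in_space[OF \<open>\<omega> \<in> space P\<close> shift_in] by auto
        from Z[OF this s] show ?thesis by (simp add: integrand_def wick_def drift_eq[OF s])
      qed simp
    qed
    have m: "(\<lambda>s. indicator {0..t} s * integrand K i t Z s \<omega>) \<in> borel_measurable borel"
    proof -
      have "(\<lambda>s. (\<lambda>p. integrand K i t Z (fst p) (snd p)) (s, \<omega>)) \<in> borel_measurable borel"
        using integrand_measurable[OF Zm, of K i t] elim(2) by (intro measurable_compose[OF _
          integrand_measurable[OF Zm]]) auto
      then show ?thesis by simp
    qed
    have "(LINT s:{0..t}|lebesgue. ?G \<omega> s) = (\<integral>s. indicator {0..t} s * integrand K i t Z s \<omega> \<partial>lebesgue)"
      unfolding set_lebesgue_integral_def
    proof (rule integral_cong_AE)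
      show "(\<lambda>s. indicator {0..t} s *\<^sub>R ?G \<omega> s) \<in> borel_measurable lebesgue"
        using elim(1) by (auto simp: set_integrable_def)
      show "(\<lambda>s. indicator {0..t} s * integrand K i t Z s \<omega>) \<in> borel_measurable lebesgue"
        using m by (intro measurable_completion) simp
      show "AE s in lebesgue. indicator {0..t} s *\<^sub>R ?G \<omega> s = indicator {0..t} s * integrand K i t Z s \<omega>"
        using eq by (rule AE_completion)
    qed
    also have "\<dots> = (\<integral>s. indicator {0..t} s * integrand K i t Z s \<omega> \<partial>lborel)"
      using m by (intro integral_completion) simp
    finally have "Y t \<omega> $ i = mild_map K i t Z \<omega>" using elim(1) by (simp add: mild_map_def)
    moreover have "Z t \<omega> = Y t \<omega>" using Z[of \<omega> t] elim t by auto
    ultimately show ?case by simp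
  qed
qed

end

text \<open>The weight is unbounded, so L1 convergence alone is not sufficient. The quadratic bound
  G \<le> R + G^2/R acts as a smooth truncation at level R; its remainder is controlled by second
  moments of u and v and the fourth moment of G.\<close>

lemma L1_mult_tendsto:
  fixes u :: "nat \<Rightarrow> 'a \<Rightarrow> real"
  assumes i: "\<And>n. integrable M (u n)" "integrable M v"
    and u2: "\<And>n. integrable M (\<lambda>x. (u n x)\<^sup>2)" "\<And>n. (\<integral>x. (u n x)\<^sup>2 \<partial>M) \<le> C"
    and v2: "integrable M (\<lambda>x. (v x)\<^sup>2)"
    and G: "G \<in> borel_measurable M" "\<And>x. G x \<ge> 0" "integrable M (\<lambda>x. G x ^ 4)"
    and lim: "(\<lambda>n. \<integral>x. \<bar>u n x - v x\<bar> \<partial>M) \<longlonglongrightarrow> 0"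
  shows "(\<lambda>n. \<integral>x. \<bar>u n x - v x\<bar> * G x \<partial>M) \<longlonglongrightarrow> 0"
proof (rule LIMSEQ_I)
  fix r :: real assume r: "r > 0"
  note [measurable] = borel_measurable_integrable[OF i(1)] borel_measurable_integrable[OF i(2)] G(1)
  define D where "D = 2 * C + 2 * (\<integral>x. (v x)\<^sup>2 \<partial>M) + (\<integral>x. G x ^ 4 \<partial>M)"
  have "0 \<le> (\<integral>x. (u 0 x)\<^sup>2 \<partial>M)" "0 \<le> (\<integral>x. (v x)\<^sup>2 \<partial>M)" "0 \<le> (\<integral>x. G x ^ 4 \<partial>M)" by simp_all
  then have D0: "D \<ge> 0" using u2(2)[of 0] unfolding D_def by linarith
  \<comment> \<open>With this level the remainder D/(2R) stays strictly below r/2, whatever the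
    value of n.\<close>
  define R where "R = (D + 1) / r"
  have R: "R > 0" using D0 r by (simp add: R_def)
  have RD: "D / (2 * R) < r / 2"
  proof -
    have "D < R * r" using r by (simp add: R_def)
    then show ?thesis using R by (simp add: field_simps)
  qed
  have "\<forall>\<^sub>F n in sequentially. (\<integral>x. \<bar>u n x - v x\<bar> \<partial>M) < r / (2 * R)"
    using lim r R by (intro order_tendstoD(2)) auto
  then obtain N where N: "\<And>n. n \<ge> N \<Longrightarrow> (\<integral>x. \<bar>u n x - v x\<bar> \<partial>M) < r / (2 * R)"
    by (auto simp: eventually_sequentially)
  have "norm ((\<integral>x. \<bar>u n x - v x\<bar> * G x \<partial>M) - 0) < r" if n: "n \<ge> N" for n
  proof -
    let ?B = "\<lambda>x. R * \<bar>u n x - v x\<bar> + (2 * (u n x)\<^sup>2 + 2 * (v x)\<^sup>2 + G x ^ 4) / (2 * R)"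
    have iB: "integrable M ?B" using i u2(1) v2 G(3) by simp
    have "(\<integral>x. \<bar>u n x - v x\<bar> * G x \<partial>M) \<le> (\<integral>x. ?B x \<partial>M)"
    proof (rule integral_mono')
      fix x
      let ?d = "\<bar>u n x - v x\<bar>"
      have "0 \<le> (G x - R)\<^sup>2 + G x * R" using G(2)[of x] R by simp
      then have "G x * R \<le> R\<^sup>2 + (G x)\<^sup>2" by (simp add: power2_diff algebra_simps)
      then have "G x \<le> R + (G x)\<^sup>2 / R" using R by (simp add: field_simps power2_eq_square)
      then have "?d * G x \<le> ?d * (R + (G x)\<^sup>2 / R)" by (intro mult_left_mono) auto
      also have "\<dots> = R * ?d + (2 * (?d * (G x)\<^sup>2)) / (2 * R)" using R by (simp add: field_simps)
      also have "\<dots> \<le> ?B x"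
      proof -
        have "0 \<le> (?d - (G x)\<^sup>2)\<^sup>2" by simp
        then have "2 * (?d * (G x)\<^sup>2) \<le> (u n x - v x)\<^sup>2 + G x ^ 4" by (simp add: power2_diff)
        moreover have "(u n x - v x)\<^sup>2 \<le> 2 * (u n x)\<^sup>2 + 2 * (v x)\<^sup>2"
          using zero_le_power2[of "u n x + v x"] by (simp add: power2_diff power2_sum)
        ultimately have "2 * (?d * (G x)\<^sup>2) \<le> 2 * (u n x)\<^sup>2 + 2 * (v x)\<^sup>2 + G x ^ 4" by linarith
        then have "(2 * (?d * (G x)\<^sup>2)) / (2 * R) \<le> (2 * (u n x)\<^sup>2 + 2 * (v x)\<^sup>2 + G x ^ 4) / (2 * R)"
          using R by (intro divide_right_mono) auto
        then show ?thesis by simp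
      qed
      finally show "?d * G x \<le> ?B x" .
      have "0 \<le> ?d * G x" using G(2) by simp
      with \<open>?d * G x \<le> ?B x\<close> show "0 \<le> ?B x" by linarith
    qed (rule iB)
    also have "(\<integral>x. ?B x \<partial>M) = R * (\<integral>x. \<bar>u n x - v x\<bar> \<partial>M) + (2 * (\<integral>x. (u n x)\<^sup>2 \<partial>M) + 2 * (\<integral>x. (v x)\<^sup>2 \<partial>M) + (\<integral>x.
      G x ^ 4 \<partial>M)) / (2 * R)"
      using i u2(1) v2 G(3) by simp
    also have "\<dots> \<le> R * (\<integral>x. \<bar>u n x - v x\<bar> \<partial>M) + D / (2 * R)"
      using u2(2)[of n] R unfolding D_def by (intro add_left_mono divide_right_mono) auto
    also have "\<dots> < r"
    proof -
      have "R * (\<integral>x. \<bar>u n x - v x\<bar> \<partial>M) < r / 2" using N[OF n] R by (simp add: field_simps)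
      then show ?thesis using RD by linarith
    qed
    finally have "(\<integral>x. \<bar>u n x - v x\<bar> * G x \<partial>M) < r" .
    moreover have "0 \<le> (\<integral>x. \<bar>u n x - v x\<bar> * G x \<partial>M)" using G(2) by simp
    ultimately show ?thesis by simp
  qed
  then show "\<exists>no. \<forall>n\<ge>no. norm ((\<integral>x. \<bar>u n x - v x\<bar> * G x \<partial>M) - 0) < r" by blast
qed

section \<open>L1 and L2 estimates for the mild map\<close>

context wong_zakai
begin

lemma integrand_measurable_lborel:
  assumes Z: "jointly_measurable Z"
  shows "(\<lambda>p. integrand K i t Z (fst p) (snd p)) \<in> borel_measurable (lborel \<Otimes>\<^sub>M P)"
  using integrand_measurable[OF Z] measurable_cong_sets[OF sets_pair_measure_cong[OF sets_lborel refl] refl] by blast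

lemma stoch_exp_sq:
  "integrable P (\<lambda>\<omega>. (stoch_exp W i f \<omega>)\<^sup>2)" "(\<integral>\<omega>. (stoch_exp W i f \<omega>)\<^sup>2 \<partial>P) = exp ((norm f)\<^sup>2)"
proof -
  have eq: "(stoch_exp W i f \<omega>)\<^sup>2 = exp (- (norm f)\<^sup>2) * exp (2 * W i f \<omega>)" for \<omega>
    by (simp add: stoch_exp_def power2_eq_square flip: exp_add)
  show "integrable P (\<lambda>\<omega>. (stoch_exp W i f \<omega>)\<^sup>2)" unfolding eq using W_exp_integrable by simp
  show "(\<integral>\<omega>. (stoch_exp W i f \<omega>)\<^sup>2 \<partial>P) = exp ((norm f)\<^sup>2)" unfolding eq
    by (simp only: integral_mult_right_zero W_mgf) (simp flip: exp_add)
qed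

text \<open>A common bound for the squared norms of \<open>sig\<close> and of all its projections,
  hence for the logarithms of the second moments of the stochastic exponentials.\<close>

definition Rsig :: real where "Rsig = phi_mass * (M\<sigma>\<^sup>2 * T)"

lemma mild_map_measurable:
  assumes Z: "jointly_measurable Z"
  shows "mild_map K i t Z \<in> borel_measurable P"
proof -
  have "(\<lambda>(\<omega>, s). integrand K i t Z s \<omega>) \<in> borel_measurable (P \<Otimes>\<^sub>M lborel)"
    using measurable_pair_swap[OF integrand_measurable_lborel[OF Z, of K i t]] by (simp add: case_prod_beta')
  then have [measurable]: "(\<lambda>p. integrand K i t Z (snd p) (fst p)) \<in> borel_measurable (P \<Otimes>\<^sub>M lborel)"
    by (simp add: case_prod_beta')
  have "(\<lambda>\<omega>. \<integral>s. indicator {0..t} s * integrand K i t Z s \<omega> \<partial>lborel) \<in> borel_measurable P"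
    by (rule lborel.borel_measurable_lebesgue_integral) (simp add: case_prod_beta')
  then show ?thesis unfolding mild_map_def[abs_def] by measurable
qed

lemma nn_integral_indicator_le:
  assumes "\<And>s. s \<in> {0..t} \<Longrightarrow> f s \<le> ennreal C" "t \<ge> 0" "C \<ge> 0"
  shows "(\<integral>\<^sup>+s. indicator {0..t} s * f s \<partial>lborel) \<le> ennreal (t * C)"
proof -
  have "(\<integral>\<^sup>+s. indicator {0..t} s * f s \<partial>lborel) \<le> (\<integral>\<^sup>+s. ennreal C * indicator {0..t} s \<partial>lborel)"
    using assms by (intro nn_integral_mono) (auto simp: indicator_def)
  also have "\<dots> = ennreal (t * C)" using assms by (simp add: nn_integral_cmult_indicator
    ennreal_mult'[symmetric] mult.commute)
  finally show ?thesis .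
qed

lemma integrand_finite:
  assumes Z: "jointly_measurable Z" and t: "t \<ge> 0"
  shows "(\<integral>\<^sup>+s. (\<integral>\<^sup>+\<omega>. ennreal \<bar>indicator {0..t} s * integrand K i t Z s \<omega>\<bar> \<partial>P) \<partial>lborel) \<le> ennreal (t * Mb)"
proof -
  have "(\<integral>\<^sup>+\<omega>. ennreal \<bar>indicator {0..t} s * integrand K i t Z s \<omega>\<bar> \<partial>P)
    = indicator {0..t} s * (\<integral>\<^sup>+\<omega>. ennreal \<bar>integrand K i t Z s \<omega>\<bar> \<partial>P)" for s
    by (cases "s \<in> {0..t}") auto
  then show ?thesis using integrand_integrable(3)[OF Z] t Mb(1) by (simp add: nn_integral_indicator_le)
qed

text \<open>The truncation and the process are varied together so that two cases are covered: equal
  processes give the Cauchy property in K, equal truncations give the Lipschitz estimate.\<close>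

lemma mild_map_dist:
  assumes Z: "jointly_measurable Z" and Z': "jointly_measurable Z'" and t: "t \<ge> 0"
  shows "(\<integral>\<^sup>+\<omega>. ennreal \<bar>mild_map K i t Z \<omega> - mild_map K' i t Z' \<omega>\<bar> \<partial>P) \<le>
    ennreal \<bar>c $ i\<bar> * (\<integral>\<^sup>+\<omega>. ennreal \<bar>stoch_exp W i (sigK K i 0 t) \<omega> - stoch_exp W i (sigK K' i 0 t) \<omega>\<bar> \<partial>P) +
    (\<integral>\<^sup>+s. indicator {0..t} s * (\<integral>\<^sup>+\<omega>. ennreal \<bar>integrand K i t Z s \<omega> - integrand K' i t Z' s \<omega>\<bar> \<partial>P) \<partial>lborel)"
proof -
  let ?E = "\<lambda>\<omega>. stoch_exp W i (sigK K i 0 t) \<omega> - stoch_exp W i (sigK K' i 0 t) \<omega>"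
  let ?f = "\<lambda>p. indicator {0..t} (fst p) * integrand K i t Z (fst p) (snd p)"
  let ?g = "\<lambda>p. indicator {0..t} (fst p) * integrand K' i t Z' (fst p) (snd p)"
  define I where "I \<omega> = (\<integral>s. ?f (s, \<omega>) \<partial>lborel) - (\<integral>s. ?g (s, \<omega>) \<partial>lborel)" for \<omega>
  have mI: "I \<in> borel_measurable P"
  proof -
    have eq: "I = (\<lambda>\<omega>. (mild_map K i t Z \<omega> - c $ i * stoch_exp W i (sigK K i 0 t) \<omega>) - (mild_map K' i t Z' \<omega> -
      c $ i * stoch_exp W i (sigK K' i 0 t) \<omega>))"
      by (simp add: mild_map_def fun_eq_iff I_def)
    note [measurable] = mild_map_measurable[OF Z] mild_map_measurable[OF Z']
    show ?thesis unfolding eq by measurable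
  qed
  have "(\<integral>\<^sup>+\<omega>. ennreal \<bar>mild_map K i t Z \<omega> - mild_map K' i t Z' \<omega>\<bar> \<partial>P)
    \<le> (\<integral>\<^sup>+\<omega>. ennreal \<bar>c $ i\<bar> * ennreal \<bar>?E \<omega>\<bar> + ennreal \<bar>I \<omega>\<bar> \<partial>P)"
  proof (rule nn_integral_mono)
    fix \<omega>
    have "mild_map K i t Z \<omega> - mild_map K' i t Z' \<omega> = c $ i * ?E \<omega> + I \<omega>"
      by (simp add: mild_map_def I_def algebra_simps)
    then have "\<bar>mild_map K i t Z \<omega> - mild_map K' i t Z' \<omega>\<bar> \<le> \<bar>c $ i\<bar> * \<bar>?E \<omega>\<bar> + \<bar>I \<omega>\<bar>"
      using abs_triangle_ineq[of "c $ i * ?E \<omega>" "I \<omega>"] by (simp only: abs_mult)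
    then have "ennreal \<bar>mild_map K i t Z \<omega> - mild_map K' i t Z' \<omega>\<bar> \<le> ennreal (\<bar>c $ i\<bar> * \<bar>?E \<omega>\<bar> + \<bar>I \<omega>\<bar>)"
      by (rule ennreal_leI)
    also have "\<dots> = ennreal \<bar>c $ i\<bar> * ennreal \<bar>?E \<omega>\<bar> + ennreal \<bar>I \<omega>\<bar>" by (simp add: ennreal_mult)
    finally show "ennreal \<bar>mild_map K i t Z \<omega> - mild_map K' i t Z' \<omega>\<bar>
      \<le> ennreal \<bar>c $ i\<bar> * ennreal \<bar>?E \<omega>\<bar> + ennreal \<bar>I \<omega>\<bar>" .
  qed
  also have "\<dots> = ennreal \<bar>c $ i\<bar> * (\<integral>\<^sup>+\<omega>. ennreal \<bar>?E \<omega>\<bar> \<partial>P) + (\<integral>\<^sup>+\<omega>. ennreal \<bar>I \<omega>\<bar> \<partial>P)"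
    using mI by (simp add: nn_integral_add nn_integral_cmult)
  also have "(\<integral>\<^sup>+\<omega>. ennreal \<bar>I \<omega>\<bar> \<partial>P) \<le> (\<integral>\<^sup>+s. (\<integral>\<^sup>+\<omega>. ennreal \<bar>?f (s, \<omega>) - ?g (s, \<omega>)\<bar> \<partial>P) \<partial>lborel)"
    unfolding I_def
  proof (rule nn_integral_diff_integrals_le)
    show "prob_space P" by unfold_locales
    note [measurable] = integrand_measurable[OF Z, of K i t] integrand_measurable[OF Z', of K' i t]
    show "?f \<in> borel_measurable (borel \<Otimes>\<^sub>M P)" "?g \<in> borel_measurable (borel \<Otimes>\<^sub>M P)" by measurable
    show "(\<integral>\<^sup>+s. (\<integral>\<^sup>+\<omega>. ennreal \<bar>?f (s, \<omega>)\<bar> \<partial>P) \<partial>lborel) < \<infinity>"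
      using integrand_finite[OF Z t, of K i] by (auto intro: le_less_trans)
    show "(\<integral>\<^sup>+s. (\<integral>\<^sup>+\<omega>. ennreal \<bar>?g (s, \<omega>)\<bar> \<partial>P) \<partial>lborel) < \<infinity>"
      using integrand_finite[OF Z' t, of K' i] by (auto intro: le_less_trans)
  qed
  also have "(\<integral>\<^sup>+s. (\<integral>\<^sup>+\<omega>. ennreal \<bar>?f (s, \<omega>) - ?g (s, \<omega>)\<bar> \<partial>P) \<partial>lborel)
    = (\<integral>\<^sup>+s. indicator {0..t} s * (\<integral>\<^sup>+\<omega>. ennreal \<bar>integrand K i t Z s \<omega> - integrand K' i t Z' s \<omega>\<bar> \<partial>P) \<partial>lborel)"
    by (intro nn_integral_cong) (auto simp: indicator_def)
  finally show ?thesis by (simp add: add_left_mono)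
qed

lemma mild_map_nn_integral_le:
  assumes Z: "jointly_measurable Z" and t: "t \<in> {0..T}"
  shows "(\<integral>\<^sup>+\<omega>. ennreal \<bar>mild_map K i t Z \<omega>\<bar> \<partial>P) \<le> ennreal (\<bar>c $ i\<bar> + T * Mb)"
proof -
  let ?f = "\<lambda>p. indicator {0..t} (fst p) * integrand K i t Z (fst p) (snd p)"
  \<comment> \<open>The integral term is written as a difference from zero so that
    \<open>nn_integral_diff_integrals_le\<close> applies.\<close>
  define I where "I \<omega> = (\<integral>s. ?f (s, \<omega>) \<partial>lborel) - (\<integral>s. 0 \<partial>(lborel :: real measure))" for \<omega>
  have Ieq: "I \<omega> = mild_map K i t Z \<omega> - c $ i * stoch_exp W i (sigK K i 0 t) \<omega>" for \<omega>
    by (simp add: mild_map_def I_def)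
  note [measurable] = mild_map_measurable[OF Z]
  have mI: "I \<in> borel_measurable P" unfolding Ieq[abs_def] by measurable
  have t0: "t \<ge> 0" using t by simp
  have "(\<integral>\<^sup>+\<omega>. ennreal \<bar>mild_map K i t Z \<omega>\<bar> \<partial>P) \<le> (\<integral>\<^sup>+\<omega>. ennreal \<bar>c $ i\<bar> * ennreal (stoch_exp W i (sigK K i 0 t)
    \<omega>) + ennreal \<bar>I \<omega>\<bar> \<partial>P)"
  proof (rule nn_integral_mono)
    fix \<omega>
    have "\<bar>mild_map K i t Z \<omega>\<bar> \<le> \<bar>c $ i\<bar> * stoch_exp W i (sigK K i 0 t) \<omega> + \<bar>I \<omega>\<bar>"
      unfolding Ieq using abs_triangle_ineq[of "c $ i * stoch_exp W i (sigK K i 0 t) \<omega>"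
        "mild_map K i t Z \<omega> - c $ i * stoch_exp W i (sigK K i 0 t) \<omega>"]
      by (simp add: abs_mult stoch_exp_nonneg)
    then have "ennreal \<bar>mild_map K i t Z \<omega>\<bar> \<le> ennreal (\<bar>c $ i\<bar> * stoch_exp W i (sigK K i 0 t) \<omega> + \<bar>I \<omega>\<bar>)"
      by (rule ennreal_leI)
    also have "\<dots> = ennreal \<bar>c $ i\<bar> * ennreal (stoch_exp W i (sigK K i 0 t) \<omega>) + ennreal \<bar>I \<omega>\<bar>"
      by (simp add: ennreal_mult stoch_exp_nonneg)
    finally show "ennreal \<bar>mild_map K i t Z \<omega>\<bar> \<le> ennreal \<bar>c $ i\<bar> * ennreal (stoch_exp W i (sigK K i 0 t) \<omega>) +
      ennreal \<bar>I \<omega>\<bar>" .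
  qed
  also have "\<dots> = ennreal \<bar>c $ i\<bar> * (\<integral>\<^sup>+\<omega>. ennreal (stoch_exp W i (sigK K i 0 t) \<omega>) \<partial>P) + (\<integral>\<^sup>+\<omega>. ennreal \<bar>I \<omega>\<bar> \<partial>P)"
    using mI by (simp add: nn_integral_add nn_integral_cmult)
  also have "(\<integral>\<^sup>+\<omega>. ennreal (stoch_exp W i (sigK K i 0 t) \<omega>) \<partial>P) = 1"
    using stoch_exp_integral by (subst nn_integral_eq_integral) (auto simp: stoch_exp_nonneg)
  also have "(\<integral>\<^sup>+\<omega>. ennreal \<bar>I \<omega>\<bar> \<partial>P) \<le> (\<integral>\<^sup>+s. (\<integral>\<^sup>+\<omega>. ennreal \<bar>?f (s, \<omega>) - 0\<bar> \<partial>P) \<partial>lborel)"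
    unfolding I_def
  proof (rule nn_integral_diff_integrals_le[where g="\<lambda>_. 0"])
    show "prob_space P" by unfold_locales
    note [measurable] = integrand_measurable[OF Z, of K i t]
    show "?f \<in> borel_measurable (borel \<Otimes>\<^sub>M P)" by measurable
    show "(\<integral>\<^sup>+s. (\<integral>\<^sup>+\<omega>. ennreal \<bar>?f (s, \<omega>)\<bar> \<partial>P) \<partial>lborel) < \<infinity>"
      using integrand_finite[OF Z t0, of K i] by (auto intro: le_less_trans)
  qed auto
  also have "(\<integral>\<^sup>+s. (\<integral>\<^sup>+\<omega>. ennreal \<bar>?f (s, \<omega>) - 0\<bar> \<partial>P) \<partial>lborel) \<le> ennreal (T * Mb)"
  proof -
    have "t * Mb \<le> T * Mb" using t Mb(1) by (intro mult_right_mono) auto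
    then have "ennreal (t * Mb) \<le> ennreal (T * Mb)" by (rule ennreal_leI)
    with integrand_finite[OF Z t0, of K i] show ?thesis by (simp only: diff_0_right fst_conv snd_conv)
  qed
  finally show ?thesis using T_pos Mb(1) by (simp add: add_left_mono)
qed

text \<open>The isometry is restricted to L1. In L2 the boundedness of the drift is used pointwise,
  and one factor T comes from the Cauchy--Schwarz inequality in time, the other from the length of
  the integration interval.\<close>

lemma mild_map_sq:
  assumes Z: "jointly_measurable Z" and t: "t \<in> {0..T}"
  shows "(\<integral>\<^sup>+\<omega>. ennreal ((mild_map K i t Z \<omega>)\<^sup>2) \<partial>P) \<le> ennreal (2 * ((c $ i)\<^sup>2 * exp Rsig) + 2 * (T * (T * (Mb\<^sup>2 *
    exp Rsig))))"
proof -
  interpret pair_sigma_finite lborel P by unfold_locales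
  note [measurable] = integrand_measurable_lborel[OF Z, of K i t] integrand_measurable[OF Z, of K i t]
  have t0: "t \<ge> 0" using t by simp
  have R: "exp ((norm (sigK K i s t))\<^sup>2) \<le> exp Rsig" for s using norm_sigK_sq[of K i s t] by (simp add: Rsig_def)
  let ?E = "\<lambda>\<omega>. stoch_exp W i (sigK K i 0 t) \<omega>"
  let ?I = "\<lambda>\<omega>. \<integral>s. indicator {0..t} s * integrand K i t Z s \<omega> \<partial>lborel"
  have sec: "(\<lambda>s. integrand K i t Z s \<omega>) \<in> borel_measurable borel" if "\<omega> \<in> space P" for \<omega>
  proof -
    have "(\<lambda>s. (\<lambda>p. integrand K i t Z (fst p) (snd p)) (s, \<omega>)) \<in> borel_measurable borel"
      using that by (intro measurable_compose[OF _ integrand_measurable[OF Z]]) auto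
    then show ?thesis by simp
  qed
  have I: "ennreal ((?I \<omega>)\<^sup>2) \<le> ennreal t * (\<integral>\<^sup>+s. indicator {0..t} s * ennreal ((integrand K i t Z s \<omega>)\<^sup>2)
    \<partial>lborel)" if w: "\<omega> \<in> space P" for \<omega>
  proof -
    note [measurable] = sec[OF w]
    have "ennreal \<bar>?I \<omega>\<bar> \<le> (\<integral>\<^sup>+s. ennreal \<bar>indicator {0..t} s * integrand K i t Z s \<omega>\<bar> \<partial>lborel)"
      using ennreal_norm_integral_le[of lborel "\<lambda>s. indicator {0..t} s * integrand K i t Z s \<omega>"] by simp
    also have "\<dots> = (\<integral>\<^sup>+s. indicator {0..t} s * (indicator {0..t} s * ennreal \<bar>integrand K i t Z s \<omega>\<bar>) \<partial>lborel)"
      by (intro nn_integral_cong) (auto simp: indicator_def)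
    finally have "(ennreal \<bar>?I \<omega>\<bar>)\<^sup>2 \<le> (\<integral>\<^sup>+s. indicator {0..t} s * (indicator {0..t} s * ennreal \<bar>integrand K i t
      Z s \<omega>\<bar>) \<partial>lborel)\<^sup>2"
      by (intro power_mono) auto
    also have "\<dots> \<le> (\<integral>\<^sup>+s. indicator {0..t} s ^ 2 \<partial>lborel) * (\<integral>\<^sup>+s. (indicator {0..t} s * ennreal \<bar>integrand K i t
      Z s \<omega>\<bar>) ^ 2 \<partial>lborel)"
      by (rule Cauchy_Schwarz_nn_integral) measurable
    also have "(\<integral>\<^sup>+s. indicator {0..t} s ^ 2 \<partial>lborel) = (\<integral>\<^sup>+s. indicator {0..t} s \<partial>lborel)"
      by (intro nn_integral_cong) (auto simp: indicator_def)
    also have "\<dots> = ennreal t" using t0 by simp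
    also have "(\<integral>\<^sup>+s. (indicator {0..t} s * ennreal \<bar>integrand K i t Z s \<omega>\<bar>) ^ 2 \<partial>lborel)
      = (\<integral>\<^sup>+s. indicator {0..t} s * ennreal ((integrand K i t Z s \<omega>)\<^sup>2) \<partial>lborel)"
      by (intro nn_integral_cong) (auto simp: indicator_def ennreal_power)
    finally show ?thesis by (simp add: ennreal_power)
  qed
  have sq: "(\<integral>\<^sup>+\<omega>. ennreal ((integrand K i t Z s \<omega>)\<^sup>2) \<partial>P) \<le> ennreal (Mb\<^sup>2 * exp Rsig)" for s
  proof -
    have "(\<integral>\<^sup>+\<omega>. ennreal ((integrand K i t Z s \<omega>)\<^sup>2) \<partial>P) \<le> (\<integral>\<^sup>+\<omega>. ennreal (Mb\<^sup>2 * (stoch_exp W i (sigK K i s t) \<omega>)\<^sup>2) \<partial>P)"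
    proof (intro nn_integral_mono ennreal_leI)
      fix \<omega>
      \<comment> \<open>The sup bound survives the translation of the path, so only the second
        moment of the stochastic exponential remains.\<close>
      have "(drift s (Z s (\<omega> - shift i (sigK K i s t))) $ i)\<^sup>2 \<le> Mb\<^sup>2"
        using Mb by (simp add: abs_le_square_iff[symmetric])
      then show "(integrand K i t Z s \<omega>)\<^sup>2 \<le> Mb\<^sup>2 * (stoch_exp W i (sigK K i s t) \<omega>)\<^sup>2"
        by (simp add: integrand_def wick_def power_mult_distrib mult_right_mono)
    qed
    also have "\<dots> = ennreal (Mb\<^sup>2 * exp ((norm (sigK K i s t))\<^sup>2))"
      using stoch_exp_sq by (subst nn_integral_eq_integral) auto
    also have "\<dots> \<le> ennreal (Mb\<^sup>2 * exp Rsig)" using R by (intro ennreal_leI mult_left_mono) auto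
    finally show ?thesis .
  qed
  have "(\<integral>\<^sup>+\<omega>. ennreal ((mild_map K i t Z \<omega>)\<^sup>2) \<partial>P) \<le>
    (\<integral>\<^sup>+\<omega>. ennreal (2 * (c $ i)\<^sup>2) * ennreal ((?E \<omega>)\<^sup>2) + ennreal (2 * t) * (\<integral>\<^sup>+s. indicator {0..t} s * ennreal
      ((integrand K i t Z s \<omega>)\<^sup>2) \<partial>lborel) \<partial>P)"
  proof (rule nn_integral_mono)
    fix \<omega> assume w: "\<omega> \<in> space P"
    have "(mild_map K i t Z \<omega>)\<^sup>2 \<le> 2 * (c $ i)\<^sup>2 * (?E \<omega>)\<^sup>2 + 2 * (?I \<omega>)\<^sup>2"
      using zero_le_power2[of "c $ i * ?E \<omega> - ?I \<omega>"] by (simp add: mild_map_def power2_sum power2_diff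
        power_mult_distrib)
    then have "ennreal ((mild_map K i t Z \<omega>)\<^sup>2) \<le> ennreal (2 * (c $ i)\<^sup>2 * (?E \<omega>)\<^sup>2 + 2 * (?I \<omega>)\<^sup>2)" by (rule ennreal_leI)
    also have "\<dots> = ennreal (2 * (c $ i)\<^sup>2) * ennreal ((?E \<omega>)\<^sup>2) + ennreal 2 * ennreal ((?I \<omega>)\<^sup>2)"
      by (subst ennreal_plus) (auto simp: ennreal_mult)
    also have "\<dots> \<le> ennreal (2 * (c $ i)\<^sup>2) * ennreal ((?E \<omega>)\<^sup>2) + ennreal 2 * (ennreal t * (\<integral>\<^sup>+s. indicator {0..t}
      s * ennreal ((integrand K i t Z s \<omega>)\<^sup>2) \<partial>lborel))"
      by (intro add_left_mono mult_left_mono I w) auto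
    also have "ennreal 2 * (ennreal t * (\<integral>\<^sup>+s. indicator {0..t} s * ennreal ((integrand K i t Z s \<omega>)\<^sup>2) \<partial>lborel))
      = ennreal (2 * t) * (\<integral>\<^sup>+s. indicator {0..t} s * ennreal ((integrand K i t Z s \<omega>)\<^sup>2) \<partial>lborel)"
      using t0 by (simp add: ennreal_mult mult.assoc)
    finally show "ennreal ((mild_map K i t Z \<omega>)\<^sup>2) \<le> ennreal (2 * (c $ i)\<^sup>2) * ennreal ((?E \<omega>)\<^sup>2) + ennreal (2 *
      t) * (\<integral>\<^sup>+s. indicator {0..t} s * ennreal ((integrand K i t Z s \<omega>)\<^sup>2) \<partial>lborel)" .
  qed
  also have "\<dots> = ennreal (2 * (c $ i)\<^sup>2) * (\<integral>\<^sup>+\<omega>. ennreal ((?E \<omega>)\<^sup>2) \<partial>P) + ennreal (2 * t) * (\<integral>\<^sup>+\<omega>. (\<integral>\<^sup>+s. indicator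
    {0..t} s * ennreal ((integrand K i t Z s \<omega>)\<^sup>2) \<partial>lborel) \<partial>P)"
  proof -
    have m: "(\<lambda>\<omega>. \<integral>\<^sup>+s. indicator {0..t} s * ennreal ((integrand K i t Z s \<omega>)\<^sup>2) \<partial>lborel) \<in> borel_measurable P"
    proof (rule lborel.borel_measurable_nn_integral)
      have "(\<lambda>(\<omega>, s). integrand K i t Z s \<omega>) \<in> borel_measurable (P \<Otimes>\<^sub>M lborel)"
        using measurable_pair_swap[OF integrand_measurable_lborel[OF Z, of K i t]] by (simp add: case_prod_beta')
      then have [measurable]: "(\<lambda>p. integrand K i t Z (snd p) (fst p)) \<in> borel_measurable (P \<Otimes>\<^sub>M lborel)"
        by (simp add: case_prod_beta')
      show "(\<lambda>(\<omega>, s). indicator {0..t} s * ennreal ((integrand K i t Z s \<omega>)\<^sup>2)) \<in> borel_measurable (P \<Otimes>\<^sub>M lborel)"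
        unfolding case_prod_beta' by measurable
    qed
    show ?thesis by (subst nn_integral_add) (use m in \<open>auto simp: nn_integral_cmult\<close>)
  qed
  also have "(\<integral>\<^sup>+\<omega>. (\<integral>\<^sup>+s. indicator {0..t} s * ennreal ((integrand K i t Z s \<omega>)\<^sup>2) \<partial>lborel) \<partial>P)
    = (\<integral>\<^sup>+s. (\<integral>\<^sup>+\<omega>. indicator {0..t} s * ennreal ((integrand K i t Z s \<omega>)\<^sup>2) \<partial>P) \<partial>lborel)"
    by (rule Fubini') (unfold case_prod_beta', measurable)
  also have "\<dots> = (\<integral>\<^sup>+s. indicator {0..t} s * (\<integral>\<^sup>+\<omega>. ennreal ((integrand K i t Z s \<omega>)\<^sup>2) \<partial>P) \<partial>lborel)"
    by (intro nn_integral_cong) (auto simp: indicator_def)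
  also have "\<dots> \<le> ennreal (t * (Mb\<^sup>2 * exp Rsig))"
    using sq t0 by (intro nn_integral_indicator_le) auto
  also have "(\<integral>\<^sup>+\<omega>. ennreal ((?E \<omega>)\<^sup>2) \<partial>P) \<le> ennreal (exp Rsig)"
    using stoch_exp_sq R by (subst nn_integral_eq_integral) (auto intro!: ennreal_leI)
  also have "ennreal (2 * (c $ i)\<^sup>2) * ennreal (exp Rsig) + ennreal (2 * t) * ennreal (t * (Mb\<^sup>2 * exp Rsig))
    = ennreal (2 * ((c $ i)\<^sup>2 * exp Rsig) + 2 * (t * (t * (Mb\<^sup>2 * exp Rsig))))"
    using t0 by (simp add: ennreal_mult'[symmetric] ennreal_plus[symmetric] mult.assoc del: ennreal_plus)
  also have "\<dots> \<le> ennreal (2 * ((c $ i)\<^sup>2 * exp Rsig) + 2 * (T * (T * (Mb\<^sup>2 * exp Rsig))))"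
    using t by (intro ennreal_leI add_left_mono mult_left_mono mult_mono) auto
  finally show ?thesis by (simp add: add_mono mult_left_mono)
qed

end

lemma L1_tendsto_imp_cauchy:
  fixes u :: "nat \<Rightarrow> 'a \<Rightarrow> real"
  assumes u: "\<And>n. integrable M (u n)" and v: "integrable M v"
    and lim: "(\<lambda>n. \<integral>\<omega>. \<bar>u n \<omega> - v \<omega>\<bar> \<partial>M) \<longlonglongrightarrow> 0" and \<epsilon>: "\<epsilon> > 0"
  shows "\<exists>N. \<forall>m\<ge>N. \<forall>n\<ge>N. (\<integral>\<^sup>+\<omega>. ennreal \<bar>u m \<omega> - u n \<omega>\<bar> \<partial>M) \<le> ennreal \<epsilon>"
proof -
  have "\<forall>\<^sub>F n in sequentially. (\<integral>\<omega>. \<bar>u n \<omega> - v \<omega>\<bar> \<partial>M) < \<epsilon> / 2" using lim \<epsilon> by (intro order_tendstoD(2)) auto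
  then obtain N where N: "\<And>n. n \<ge> N \<Longrightarrow> (\<integral>\<omega>. \<bar>u n \<omega> - v \<omega>\<bar> \<partial>M) < \<epsilon> / 2" by (auto simp: eventually_sequentially)
  have "(\<integral>\<^sup>+\<omega>. ennreal \<bar>u m \<omega> - u n \<omega>\<bar> \<partial>M) \<le> ennreal \<epsilon>" if "m \<ge> N" "n \<ge> N" for m n
  proof -
    have "(\<integral>\<omega>. \<bar>u m \<omega> - u n \<omega>\<bar> \<partial>M) \<le> (\<integral>\<omega>. \<bar>u m \<omega> - v \<omega>\<bar> + \<bar>u n \<omega> - v \<omega>\<bar> \<partial>M)"
      by (intro integral_mono Bochner_Integration.integrable_add integrable_abs
        Bochner_Integration.integrable_diff u v) auto
    also have "\<dots> = (\<integral>\<omega>. \<bar>u m \<omega> - v \<omega>\<bar> \<partial>M) + (\<integral>\<omega>. \<bar>u n \<omega> - v \<omega>\<bar> \<partial>M)" using u v by simp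
    also have "\<dots> \<le> \<epsilon>" using N[OF that(1)] N[OF that(2)] by simp
    finally have "ennreal (\<integral>\<omega>. \<bar>u m \<omega> - u n \<omega>\<bar> \<partial>M) \<le> ennreal \<epsilon>" by (rule ennreal_leI)
    then show ?thesis using u by (subst nn_integral_eq_integral) auto
  qed
  then show ?thesis by blast
qed

lemma tendsto_ennreal_zeroI:
  fixes f :: "'a \<Rightarrow> ennreal"
  assumes "\<And>r. r > 0 \<Longrightarrow> \<forall>\<^sub>F x in F. f x \<le> ennreal r"
  shows "(f \<longlongrightarrow> 0) F"
proof (rule order_tendstoI)
  fix a :: ennreal assume "0 < a"
  then obtain b where b: "0 < b" "b < a" using dense by blast
  then obtain r where r: "b = ennreal r" "r \<ge> 0" by (cases b) auto
  then have "r > 0" using b by (auto simp: ennreal_zero_less_mult_iff less_le)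
  from assms[OF this] show "\<forall>\<^sub>F x in F. f x < a"
    by eventually_elim (use b r in \<open>auto intro: le_less_trans\<close>)
qed simp

section \<open>The Cauchy property in the truncation index\<close>

context wong_zakai
begin

lemma sigK_tendsto: "(\<lambda>K. sigK K i s t) \<longlonglongrightarrow> sig i s t"
  unfolding sigK_def by (rule fproj_tendsto[OF e])

lemma integrand_cauchy:
  assumes Z: "jointly_measurable Z" and \<epsilon>: "\<epsilon> > 0"
  shows "\<exists>N. \<forall>m\<ge>N. \<forall>n\<ge>N. (\<integral>\<^sup>+\<omega>. ennreal \<bar>integrand m i t Z s \<omega> - integrand n i t Z s \<omega>\<bar> \<partial>P) \<le> ennreal \<epsilon>"
proof (rule L1_tendsto_imp_cauchy[OF _ _ _ \<epsilon>])
  show "integrable P (integrand n i t Z s)" for n by (rule integrand_integrable(2)[OF Z])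
  show "integrable P (wick i (sig i s t) (\<lambda>\<eta>. drift s (Z s \<eta>) $ i))"
    by (rule wick_integrable) (rule integrand_integrable(1)[OF Z])
  show "(\<lambda>n. \<integral>\<omega>. \<bar>integrand n i t Z s \<omega> - wick i (sig i s t) (\<lambda>\<eta>. drift s (Z s \<eta>) $ i) \<omega>\<bar> \<partial>P) \<longlonglongrightarrow> 0"
    unfolding integrand_def by (rule wick_tendsto[OF sigK_tendsto integrand_integrable(1)[OF Z]])
qed

lemma integrand_dist_measurable:
  assumes Z: "jointly_measurable Z" and Z': "jointly_measurable Z'"
  shows "(\<lambda>s. \<integral>\<^sup>+\<omega>. ennreal \<bar>integrand m i t Z s \<omega> - integrand n i t Z' s \<omega>\<bar> \<partial>P) \<in> borel_measurable borel"
proof (rule borel_measurable_nn_integral)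
  note [measurable] = integrand_measurable[OF Z, of m i t] integrand_measurable[OF Z', of n i t]
  show "(\<lambda>(s, \<omega>). ennreal \<bar>integrand m i t Z s \<omega> - integrand n i t Z' s \<omega>\<bar>) \<in> borel_measurable (borel \<Otimes>\<^sub>M P)"
    unfolding case_prod_beta' by measurable
qed

lemma integrand_dist_le:
  assumes Z: "jointly_measurable Z"
  shows "(\<integral>\<^sup>+\<omega>. ennreal \<bar>integrand m i t Z s \<omega> - integrand n i t Z s \<omega>\<bar> \<partial>P) \<le> ennreal (2 * Mb)"
proof -
  have [measurable]: "integrand k i t Z s \<in> borel_measurable P" for k using integrand_integrable(2)[OF Z] by auto
  have "(\<integral>\<^sup>+\<omega>. ennreal \<bar>integrand m i t Z s \<omega> - integrand n i t Z s \<omega>\<bar> \<partial>P)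
    \<le> (\<integral>\<^sup>+\<omega>. ennreal \<bar>integrand m i t Z s \<omega>\<bar> + ennreal \<bar>integrand n i t Z s \<omega>\<bar> \<partial>P)"
    by (intro nn_integral_mono) (auto simp: ennreal_plus[symmetric] simp del: ennreal_plus intro!: ennreal_leI)
  also have "\<dots> = (\<integral>\<^sup>+\<omega>. ennreal \<bar>integrand m i t Z s \<omega>\<bar> \<partial>P) + (\<integral>\<^sup>+\<omega>. ennreal \<bar>integrand n i t Z s \<omega>\<bar> \<partial>P)"
    by (rule nn_integral_add) measurable
  also have "\<dots> \<le> ennreal Mb + ennreal Mb" by (intro add_mono integrand_integrable(3)[OF Z])
  also have "\<dots> = ennreal (2 * Mb)" using Mb(1) by (simp add: ennreal_plus[symmetric] del: ennreal_plus)
  finally show ?thesis .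
qed

lemma mild_map_integrable:
  assumes Z: "jointly_measurable Z" and t: "t \<in> {0..T}"
  shows "integrable P (mild_map K i t Z)" "integrable P (\<lambda>\<omega>. (mild_map K i t Z \<omega>)\<^sup>2)"
    "(\<integral>\<omega>. (mild_map K i t Z \<omega>)\<^sup>2 \<partial>P) \<le> 2 * ((c $ i)\<^sup>2 * exp Rsig) + 2 * (T * (T * (Mb\<^sup>2 * exp Rsig)))"
proof -
  note [measurable] = mild_map_measurable[OF Z]
  show "integrable P (mild_map K i t Z)"
    using mild_map_nn_integral_le[OF Z t, of K i] by (intro integrableI_bounded) (auto intro: le_less_trans)
  show i: "integrable P (\<lambda>\<omega>. (mild_map K i t Z \<omega>)\<^sup>2)"
    using mild_map_sq[OF Z t, of K i] by (intro integrableI_bounded) (auto intro: le_less_trans)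
  have "ennreal (\<integral>\<omega>. (mild_map K i t Z \<omega>)\<^sup>2 \<partial>P) \<le> ennreal (2 * ((c $ i)\<^sup>2 * exp Rsig) + 2 * (T * (T * (Mb\<^sup>2 * exp
    Rsig))))"
    using mild_map_sq[OF Z t, of K i] i by (subst (asm) nn_integral_eq_integral) auto
  then show "(\<integral>\<omega>. (mild_map K i t Z \<omega>)\<^sup>2 \<partial>P) \<le> 2 * ((c $ i)\<^sup>2 * exp Rsig) + 2 * (T * (T * (Mb\<^sup>2 * exp Rsig)))"
    using T_pos Mb(1) by (subst (asm) ennreal_le_iff) auto
qed

lemma mild_map_cauchy:
  assumes Z: "jointly_measurable Z" and t: "t \<in> {0..T}" and \<epsilon>: "\<epsilon> > 0"
  shows "\<exists>N. \<forall>m\<ge>N. \<forall>n\<ge>N. (\<integral>\<omega>. \<bar>mild_map m i t Z \<omega> - mild_map n i t Z \<omega>\<bar> \<partial>P) < \<epsilon>"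
proof -
  define a where "a m n s = (\<integral>\<^sup>+\<omega>. ennreal \<bar>integrand m i t Z s \<omega> - integrand n i t Z s \<omega>\<bar> \<partial>P)" for m n s
  have [measurable]: "a m n \<in> borel_measurable borel" for m n
    unfolding a_def[abs_def] by (rule integrand_dist_measurable[OF Z Z])
  \<comment> \<open>The distance depends on two indices. Its supremum over a tail of both is a
    sequence in N, to which dominated convergence applies; the supremum is countable, hence
    measurable.\<close>
  define \<eta> where "\<eta> N s = indicator {0..t} s * (SUP p\<in>{N..} \<times> {N..}. a (fst p) (snd p) s)" for N s
  have [measurable]: "\<eta> N \<in> borel_measurable borel" for N
  proof -
    have [measurable]: "(\<lambda>s. SUP p\<in>{N..} \<times> {N..}. a (fst p) (snd p) s) \<in> borel_measurable borel"
      by (rule borel_measurable_SUP) auto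
    show ?thesis unfolding \<eta>_def[abs_def] by measurable
  qed
  have "(\<lambda>N. \<integral>\<^sup>+s. \<eta> N s \<partial>lborel) \<longlonglongrightarrow> (\<integral>\<^sup>+s. 0 \<partial>(lborel :: real measure))"
  proof (rule nn_integral_dominated_convergence[where w="\<lambda>s. ennreal (2 * Mb) * indicator {0..t} s"])
    show "AE s in lborel. \<eta> N s \<le> ennreal (2 * Mb) * indicator {0..t} s" for N
      unfolding \<eta>_def a_def using integrand_dist_le[OF Z] by (auto simp: indicator_def intro!: AE_I2 SUP_least)
    show "(\<integral>\<^sup>+s. ennreal (2 * Mb) * indicator {0..t} s \<partial>lborel) < \<infinity>"
      using t by (simp add: nn_integral_cmult_indicator ennreal_mult_less_top)
    show "AE s in lborel. (\<lambda>N. \<eta> N s) \<longlonglongrightarrow> 0"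
    proof (rule AE_I2)
      fix s
      show "(\<lambda>N. \<eta> N s) \<longlonglongrightarrow> 0"
      proof (rule tendsto_ennreal_zeroI)
        fix r :: real assume r: "r > 0"
        obtain N where N: "\<And>m n. m \<ge> N \<Longrightarrow> n \<ge> N \<Longrightarrow> a m n s \<le> ennreal r"
          using integrand_cauchy[OF Z r, of i t s] unfolding a_def by blast
        have "\<eta> k s \<le> ennreal r" if "k \<ge> N" for k
          unfolding \<eta>_def using N that by (auto simp: indicator_def intro!: SUP_least)
        then show "\<forall>\<^sub>F N in sequentially. \<eta> N s \<le> ennreal r" by (auto simp: eventually_sequentially)
      qed
    qed
  qed auto
  then have lim: "(\<lambda>N. \<integral>\<^sup>+s. \<eta> N s \<partial>lborel) \<longlonglongrightarrow> 0" by simp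
  have "\<forall>\<^sub>F N in sequentially. (\<integral>\<^sup>+s. \<eta> N s \<partial>lborel) < ennreal (\<epsilon> / 2)"
    using lim \<epsilon> by (intro order_tendstoD(2)) auto
  then obtain N1 where N1: "(\<integral>\<^sup>+s. \<eta> N1 s \<partial>lborel) < ennreal (\<epsilon> / 2)" by (auto simp: eventually_sequentially)
  \<comment> \<open>The summand 1 admits a vanishing initial value. The initial term then costs at
    most \<epsilon>/4 and the integral term \<epsilon>/2, which leaves room for the strict
    inequality.\<close>
  define \<delta> where "\<delta> = \<epsilon> / (4 * (\<bar>c $ i\<bar> + 1))"
  have \<delta>: "\<delta> > 0" "\<bar>c $ i\<bar> * \<delta> \<le> \<epsilon> / 4"
  proof -
    show "\<delta> > 0" using \<epsilon> by (simp add: \<delta>_def)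
    have "\<bar>c $ i\<bar> * \<delta> \<le> (\<bar>c $ i\<bar> + 1) * \<delta>" using \<open>\<delta> > 0\<close> by simp
    also have "\<dots> = \<epsilon> / 4"
    proof -
      have "x * (\<epsilon> / (4 * x)) = \<epsilon> / 4" if "x > 0" for x :: real using that by simp
      from this[of "\<bar>c $ i\<bar> + 1"] show ?thesis by (simp only: \<delta>_def)
    qed
    finally show "\<bar>c $ i\<bar> * \<delta> \<le> \<epsilon> / 4" .
  qed
  obtain N2 where N2: "\<And>m n. m \<ge> N2 \<Longrightarrow> n \<ge> N2 \<Longrightarrow> (\<integral>\<^sup>+\<omega>. ennreal \<bar>stoch_exp W i (sigK m i 0 t) \<omega> - stoch_exp W i
    (sigK n i 0 t) \<omega>\<bar> \<partial>P) \<le> ennreal \<delta>"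
    using L1_tendsto_imp_cauchy[OF stoch_exp_integral(1) stoch_exp_integral(1) stoch_exp_tendsto[OF
      sigK_tendsto] \<delta>(1)] by blast
  have "(\<integral>\<omega>. \<bar>mild_map m i t Z \<omega> - mild_map n i t Z \<omega>\<bar> \<partial>P) < \<epsilon>" if m: "m \<ge> max N1 N2" and n: "n \<ge> max N1 N2" for m n
  proof -
    have t0: "t \<ge> 0" using t by simp
    have "(\<integral>\<^sup>+\<omega>. ennreal \<bar>mild_map m i t Z \<omega> - mild_map n i t Z \<omega>\<bar> \<partial>P) \<le>
      ennreal \<bar>c $ i\<bar> * (\<integral>\<^sup>+\<omega>. ennreal \<bar>stoch_exp W i (sigK m i 0 t) \<omega> - stoch_exp W i (sigK n i 0 t) \<omega>\<bar> \<partial>P) +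
      (\<integral>\<^sup>+s. indicator {0..t} s * a m n s \<partial>lborel)"
      unfolding a_def by (rule mild_map_dist[OF Z Z t0])
    also have "\<dots> \<le> ennreal \<bar>c $ i\<bar> * ennreal \<delta> + (\<integral>\<^sup>+s. \<eta> N1 s \<partial>lborel)"
    proof (intro add_mono mult_left_mono N2 nn_integral_mono)
      fix s
      show "indicator {0..t} s * a m n s \<le> \<eta> N1 s"
        unfolding \<eta>_def using m n by (intro mult_left_mono SUP_upper2[of "(m, n)"]) auto
    qed (use m n in auto)
    also have "\<dots> \<le> ennreal (\<epsilon> / 4) + ennreal (\<epsilon> / 2)"
      using N1 \<delta> by (intro add_mono) (auto simp: ennreal_mult'[symmetric] intro: ennreal_leI)
    also have "\<dots> = ennreal (3 / 4 * \<epsilon>)" using \<epsilon> by (simp add: ennreal_plus[symmetric] del: ennreal_plus)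
    finally have "ennreal (\<integral>\<omega>. \<bar>mild_map m i t Z \<omega> - mild_map n i t Z \<omega>\<bar> \<partial>P) \<le> ennreal (3 / 4 * \<epsilon>)"
      using mild_map_integrable(1)[OF Z t] by (subst (asm) nn_integral_eq_integral) auto
    then have "(\<integral>\<omega>. \<bar>mild_map m i t Z \<omega> - mild_map n i t Z \<omega>\<bar> \<partial>P) \<le> 3 / 4 * \<epsilon>"
      using \<epsilon> by (subst (asm) ennreal_le_iff) auto
    then show ?thesis using \<epsilon> by linarith
  qed
  then show ?thesis by blast
qed

section \<open>Transforms of the solutions\<close>

text \<open>A bound on weighted absolute moments that is uniform in time makes the product
  integrable over [0,t] and the path space, so expectation and time integral commute.\<close>

lemma exp_linB_weighted_fubini:
  fixes h :: "real \<Rightarrow> 'n path \<Rightarrow> real"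
  assumes xs: "valid_times T xs" and t: "t \<ge> 0"
    and m: "(\<lambda>p. h (fst p) (snd p)) \<in> borel_measurable (borel \<Otimes>\<^sub>M P)"
    and C: "\<And>s. (\<integral>\<^sup>+\<omega>. ennreal (\<bar>h s \<omega>\<bar> * exp (linB xs \<omega>)) \<partial>P) \<le> ennreal C" "C \<ge> 0"
  shows "integrable P (\<lambda>\<omega>. (\<integral>s. indicator {0..t} s * h s \<omega> \<partial>lborel) * exp (linB xs \<omega>))"
    and "(\<integral>\<omega>. (\<integral>s. indicator {0..t} s * h s \<omega> \<partial>lborel) * exp (linB xs \<omega>) \<partial>P) =
      (\<integral>s. indicator {0..t} s * (\<integral>\<omega>. h s \<omega> * exp (linB xs \<omega>) \<partial>P) \<partial>lborel)"
proof -
  interpret pair_sigma_finite lborel P by unfold_locales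
  have [measurable]: "(\<lambda>p. h (fst p) (snd p)) \<in> borel_measurable (lborel \<Otimes>\<^sub>M P)"
    using m measurable_cong_sets[OF sets_pair_measure_cong[OF sets_lborel refl] refl] by blast
  define f where "f = (\<lambda>(s, \<omega>). indicator {0..t} s * h s \<omega> * exp (linB xs \<omega>))"
  have f[measurable]: "f \<in> borel_measurable (lborel \<Otimes>\<^sub>M P)" unfolding f_def case_prod_beta' by measurable
  have "(\<integral>\<^sup>+p. ennreal (norm (f p)) \<partial>(lborel \<Otimes>\<^sub>M P)) = (\<integral>\<^sup>+s. (\<integral>\<^sup>+\<omega>. ennreal (norm (f (s, \<omega>))) \<partial>P) \<partial>lborel)"
    by (rule sigma_finite_measure.nn_integral_fst[symmetric]) (unfold_locales, measurable)
  also have "\<dots> = (\<integral>\<^sup>+s. indicator {0..t} s * (\<integral>\<^sup>+\<omega>. ennreal (\<bar>h s \<omega>\<bar> * exp (linB xs \<omega>)) \<partial>P) \<partial>lborel)"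
    by (intro nn_integral_cong) (auto simp: f_def indicator_def abs_mult)
  also have "\<dots> \<le> ennreal (t * C)" using C t by (intro nn_integral_indicator_le) auto
  finally have fi: "integrable (lborel \<Otimes>\<^sub>M P) f"
    by (intro integrableI_bounded f) (auto intro: le_less_trans)
  then have fi': "integrable (lborel \<Otimes>\<^sub>M P) (case_prod (\<lambda>s \<omega>. f (s, \<omega>)))" by simp
  have eq1: "(\<integral>s. f (s, \<omega>) \<partial>lborel) = (\<integral>s. indicator {0..t} s * h s \<omega> \<partial>lborel) * exp (linB xs \<omega>)" for \<omega>
    by (simp add: f_def)
  have eq2: "(\<integral>\<omega>. f (s, \<omega>) \<partial>P) = indicator {0..t} s * (\<integral>\<omega>. h s \<omega> * exp (linB xs \<omega>) \<partial>P)" for s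
    by (simp add: f_def mult.assoc)
  show "integrable P (\<lambda>\<omega>. (\<integral>s. indicator {0..t} s * h s \<omega> \<partial>lborel) * exp (linB xs \<omega>))"
    using integrable_snd[OF fi'] by (simp add: eq1)
  show "(\<integral>\<omega>. (\<integral>s. indicator {0..t} s * h s \<omega> \<partial>lborel) * exp (linB xs \<omega>) \<partial>P) =
      (\<integral>s. indicator {0..t} s * (\<integral>\<omega>. h s \<omega> * exp (linB xs \<omega>) \<partial>P) \<partial>lborel)"
    using Fubini_integral[OF fi'] by (simp add: eq1 eq2)
qed

definition beta :: "'n \<Rightarrow> (real \<Rightarrow> 'n path \<Rightarrow> real ^ 'n) \<Rightarrow> (real \<times> 'n \<times> real) list \<Rightarrow> real \<Rightarrow> real" where
  "beta i Z xs s = (\<integral>\<omega>. drift s (Z s \<omega>) $ i * exp (linB xs \<omega>) \<partial>P)"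

lemma exp_linB_int: "valid_times T xs \<Longrightarrow> integrable P (\<lambda>\<omega>. exp (linB xs \<omega>))"
  using exp_linB_integrable[of xs 1] by simp

lemma drift_exp_integrable:
  assumes Z: "jointly_measurable Z" and xs: "valid_times T xs"
  shows "integrable P (\<lambda>\<omega>. drift s (Z s \<omega>) $ i * exp (linB xs \<omega>))"
    and "(\<integral>\<^sup>+\<omega>. ennreal (\<bar>drift s (Z s \<omega>) $ i\<bar> * exp (linB xs \<omega>)) \<partial>P) \<le> ennreal (Mb * (\<integral>\<omega>. exp (linB xs \<omega>) \<partial>P))"
    and "\<bar>beta i Z xs s\<bar> \<le> Mb * (\<integral>\<omega>. exp (linB xs \<omega>) \<partial>P)"
proof -
  note [measurable] = jointly_measurable_section[OF Z]
  have iE: "integrable P (\<lambda>\<omega>. Mb * exp (linB xs \<omega>))" using exp_linB_int[OF xs] by simp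
  show i: "integrable P (\<lambda>\<omega>. drift s (Z s \<omega>) $ i * exp (linB xs \<omega>))"
    by (rule Bochner_Integration.integrable_bound[OF iE], measurable)
      (use Mb in \<open>auto simp: abs_mult intro!: AE_I2 mult_right_mono\<close>)
  have "(\<integral>\<^sup>+\<omega>. ennreal (\<bar>drift s (Z s \<omega>) $ i\<bar> * exp (linB xs \<omega>)) \<partial>P) \<le> (\<integral>\<^sup>+\<omega>. ennreal (Mb * exp (linB xs \<omega>)) \<partial>P)"
    using Mb by (intro nn_integral_mono ennreal_leI mult_right_mono) auto
  also have "\<dots> = ennreal (Mb * (\<integral>\<omega>. exp (linB xs \<omega>) \<partial>P))"
    using Mb(1) iE by (subst nn_integral_eq_integral) auto
  finally show *: "(\<integral>\<^sup>+\<omega>. ennreal (\<bar>drift s (Z s \<omega>) $ i\<bar> * exp (linB xs \<omega>)) \<partial>P)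
    \<le> ennreal (Mb * (\<integral>\<omega>. exp (linB xs \<omega>) \<partial>P))" .
  have "ennreal \<bar>beta i Z xs s\<bar> \<le> (\<integral>\<^sup>+\<omega>. ennreal (\<bar>drift s (Z s \<omega>) $ i\<bar> * exp (linB xs \<omega>)) \<partial>P)"
    unfolding beta_def using ennreal_norm_integral_le[of P "\<lambda>\<omega>. drift s (Z s \<omega>) $ i * exp (linB xs \<omega>)"]
      by (simp add: abs_mult)
  with * have "ennreal \<bar>beta i Z xs s\<bar> \<le> ennreal (Mb * (\<integral>\<omega>. exp (linB xs \<omega>) \<partial>P))" by (rule order_trans[rotated])
  then show "\<bar>beta i Z xs s\<bar> \<le> Mb * (\<integral>\<omega>. exp (linB xs \<omega>) \<partial>P)"
    using Mb(1) by (subst (asm) ennreal_le_iff) auto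
qed

lemma inner_sigK_le: "inner (sigK K i s t) v \<le> sqrt Rsig * norm v"
proof -
  have "norm (sigK K i s t) \<le> sqrt Rsig" using norm_sigK_sq[of K i s t] by (intro real_le_rsqrt) (simp add: Rsig_def)
  then have "norm (sigK K i s t) * norm v \<le> sqrt Rsig * norm v" by (rule mult_right_mono) simp
  then show ?thesis using norm_cauchy_schwarz[of "sigK K i s t" v] by linarith
qed

text \<open>After testing, each Wick product becomes a factor
  \<open>exp (inner (sigK K i s t) (J (stepf xs i)))\<close>. The truncation enters only through
  these numbers.\<close>

lemma mild_map_transform:
  assumes Z: "jointly_measurable Z" and t: "t \<in> {0..T}" and xs: "valid_times T xs"
  shows "(\<integral>\<omega>. mild_map K i t Z \<omega> * exp (linB xs \<omega>) \<partial>P) =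
    c $ i * (exp (inner (sigK K i 0 t) (J (stepf xs i))) * (\<integral>\<omega>. exp (linB xs \<omega>) \<partial>P)) +
    (\<integral>s. indicator {0..t} s * (exp (inner (sigK K i s t) (J (stepf xs i))) * beta i Z xs s) \<partial>lborel)"
proof -
  let ?g = "J (stepf xs i)"
  let ?EG = "\<integral>\<omega>. exp (linB xs \<omega>) \<partial>P"
  have t0: "t \<ge> 0" using t by simp
  \<comment> \<open>The initial term is a Wick product with the constant 1, so the same transform
    rule covers it.\<close>
  have se: "stoch_exp W i f \<omega> = wick i f (\<lambda>\<omega>. 1) \<omega>" for f \<omega> by (simp add: wick_def)
  have E: "integrable P (\<lambda>\<omega>. stoch_exp W i f \<omega> * exp (linB xs \<omega>))"
    "(\<integral>\<omega>. stoch_exp W i f \<omega> * exp (linB xs \<omega>) \<partial>P) = exp (inner f ?g) * ?EG" for f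
    unfolding se using wick_exp_linB[OF xs, of "\<lambda>_. 1" i f] exp_linB_int[OF xs] by simp_all
  have I: "(\<integral>\<omega>. integrand K i t Z s \<omega> * exp (linB xs \<omega>) \<partial>P) = exp (inner (sigK K i s t) ?g) * beta i Z xs s" for s
    unfolding integrand_def beta_def by (rule wick_exp_linB(2)[OF xs drift_exp_integrable(1)[OF Z xs]])
  have bnd: "(\<integral>\<^sup>+\<omega>. ennreal (\<bar>integrand K i t Z s \<omega>\<bar> * exp (linB xs \<omega>)) \<partial>P)
    \<le> ennreal (exp (sqrt Rsig * norm ?g) * (Mb * ?EG))" for s
  proof -
    have ia: "integrable P (\<lambda>\<omega>. \<bar>drift s (Z s \<omega>) $ i\<bar> * exp (linB xs \<omega>))"
      using integrable_abs[OF drift_exp_integrable(1)[OF Z xs, of s i]] by (simp add: abs_mult)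
    have "(\<integral>\<^sup>+\<omega>. ennreal (\<bar>integrand K i t Z s \<omega>\<bar> * exp (linB xs \<omega>)) \<partial>P)
      = ennreal (\<integral>\<omega>. wick i (sigK K i s t) (\<lambda>\<omega>. \<bar>drift s (Z s \<omega>) $ i\<bar>) \<omega> * exp (linB xs \<omega>) \<partial>P)"
      unfolding integrand_def wick_abs using wick_exp_linB(1)[OF xs ia]
      by (intro nn_integral_eq_integral) (auto simp: wick_def stoch_exp_nonneg)
    also have "\<dots> = ennreal (exp (inner (sigK K i s t) ?g) * (\<integral>\<omega>. \<bar>drift s (Z s \<omega>) $ i\<bar> * exp (linB xs \<omega>) \<partial>P))"
      by (simp only: wick_exp_linB(2)[OF xs ia])
    also have "\<dots> \<le> ennreal (exp (sqrt Rsig * norm ?g) * (Mb * ?EG))"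
    proof (intro ennreal_leI mult_mono)
      show "exp (inner (sigK K i s t) ?g) \<le> exp (sqrt Rsig * norm ?g)" using inner_sigK_le by simp
      have "(\<integral>\<omega>. \<bar>drift s (Z s \<omega>) $ i\<bar> * exp (linB xs \<omega>) \<partial>P) \<le> (\<integral>\<omega>. Mb * exp (linB xs \<omega>) \<partial>P)"
        using ia exp_linB_int[OF xs] Mb by (intro integral_mono mult_right_mono) auto
      then show "(\<integral>\<omega>. \<bar>drift s (Z s \<omega>) $ i\<bar> * exp (linB xs \<omega>) \<partial>P) \<le> Mb * ?EG" by simp
    qed auto
    finally show ?thesis .
  qed
  have C0: "exp (sqrt Rsig * norm ?g) * (Mb * ?EG) \<ge> 0" using Mb(1) by simp
  note fub = exp_linB_weighted_fubini[OF xs t0 integrand_measurable[OF Z, of K i t] bnd C0]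
  have "(\<integral>\<omega>. mild_map K i t Z \<omega> * exp (linB xs \<omega>) \<partial>P) =
    (\<integral>\<omega>. c $ i * (stoch_exp W i (sigK K i 0 t) \<omega> * exp (linB xs \<omega>)) + (\<integral>s. indicator {0..t} s * integrand K i t
      Z s \<omega> \<partial>lborel) * exp (linB xs \<omega>) \<partial>P)"
    by (simp add: mild_map_def algebra_simps)
  also have "\<dots> = c $ i * (\<integral>\<omega>. stoch_exp W i (sigK K i 0 t) \<omega> * exp (linB xs \<omega>) \<partial>P) + (\<integral>\<omega>. (\<integral>s. indicator {0..t}
    s * integrand K i t Z s \<omega> \<partial>lborel) * exp (linB xs \<omega>) \<partial>P)"
    using E(1) fub(1) by (subst Bochner_Integration.integral_add) auto
  also have "\<dots> = c $ i * (exp (inner (sigK K i 0 t) ?g) * ?EG) + (\<integral>s. indicator {0..t} s * (exp (inner (sigK K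
    i s t) ?g) * beta i Z xs s) \<partial>lborel)"
    by (simp only: E(2) fub(2) I)
  finally show ?thesis .
qed

lemma beta_measurable:
  assumes Z: "jointly_measurable Z"
  shows "beta i Z xs \<in> borel_measurable borel"
proof -
  have [measurable]: "(\<lambda>p. Z (fst p) (snd p)) \<in> borel_measurable (borel \<Otimes>\<^sub>M P)" using Z
    by (simp add: jointly_measurable_def)
  have "(\<lambda>s. \<integral>\<omega>. drift s (Z s \<omega>) $ i * exp (linB xs \<omega>) \<partial>P) \<in> borel_measurable borel"
    by (rule borel_measurable_lebesgue_integral) (unfold case_prod_beta', measurable)
  then show ?thesis unfolding beta_def[abs_def] .
qed

text \<open>The scalar exponents converge with the projections and are bounded by Cauchy--Schwarz
  uniformly in K and s, which gives a dominating function.\<close>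

lemma mild_map_transform_limit:
  assumes Z: "jointly_measurable Z" and t: "t \<in> {0..T}" and xs: "valid_times T xs"
  shows "(\<lambda>K. \<integral>\<omega>. mild_map K i t Z \<omega> * exp (linB xs \<omega>) \<partial>P) \<longlonglongrightarrow>
    c $ i * (exp (inner (sig i 0 t) (J (stepf xs i))) * (\<integral>\<omega>. exp (linB xs \<omega>) \<partial>P)) +
    (\<integral>s. indicator {0..t} s * (exp (inner (sig i s t) (J (stepf xs i))) * beta i Z xs s) \<partial>lborel)"
  unfolding mild_map_transform[OF Z t xs]
proof (intro tendsto_intros sigK_tendsto)
  let ?g = "J (stepf xs i)"
  let ?EG = "\<integral>\<omega>. exp (linB xs \<omega>) \<partial>P"
  note [measurable] = beta_measurable[OF Z]
  have [measurable]: "(\<lambda>s. inner (sigK K i s t) ?g) \<in> borel_measurable borel"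
    "(\<lambda>s. inner (sig i s t) ?g) \<in> borel_measurable borel" for K
    by (intro borel_measurable_continuous_onI continuous_intros continuous_sig continuous_sigK)+
  show "(\<lambda>K. \<integral>s. indicator {0..t} s * (exp (inner (sigK K i s t) ?g) * beta i Z xs s) \<partial>lborel) \<longlonglongrightarrow>
    (\<integral>s. indicator {0..t} s * (exp (inner (sig i s t) ?g) * beta i Z xs s) \<partial>lborel)"
  proof (rule integral_dominated_convergence[where w="\<lambda>s. indicator {0..t} s * (exp (sqrt Rsig * norm ?g) * (Mb
    * ?EG))"])
    show "integrable lborel (\<lambda>s. indicator {0..t} s * (exp (sqrt Rsig * norm ?g) * (Mb * ?EG)))"
      using borel_integrable_atLeastAtMost'[of 0 t "\<lambda>s. exp (sqrt Rsig * norm ?g) * (Mb * ?EG)"]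
        by (simp add: set_integrable_def)
    show "AE s in lborel. (\<lambda>K. indicator {0..t} s * (exp (inner (sigK K i s t) ?g) * beta i Z xs s))
      \<longlonglongrightarrow> indicator {0..t} s * (exp (inner (sig i s t) ?g) * beta i Z xs s)"
      by (intro AE_I2 tendsto_intros sigK_tendsto)
    show "AE s in lborel. norm (indicator {0..t} s * (exp (inner (sigK K i s t) ?g) * beta i Z xs s))
      \<le> indicator {0..t} s * (exp (sqrt Rsig * norm ?g) * (Mb * ?EG))" for K
    proof (rule AE_I2)
      fix s
      have "exp (inner (sigK K i s t) ?g) * \<bar>beta i Z xs s\<bar> \<le> exp (sqrt Rsig * norm ?g) * (Mb * ?EG)"
        using inner_sigK_le drift_exp_integrable(3)[OF Z xs] by (intro mult_mono) auto
      then show "norm (indicator {0..t} s * (exp (inner (sigK K i s t) ?g) * beta i Z xs s))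
        \<le> indicator {0..t} s * (exp (sqrt Rsig * norm ?g) * (Mb * ?EG))"
        by (auto simp: indicator_def abs_mult)
    qed
  qed measurable
qed

text \<open>The tests prescribed for the Ito integral agree with the exponentials of L up to a
  deterministic positive factor.\<close>

lemma multi_stoch_exp_eq:
  assumes xs: "valid_times T xs"
  shows "AE \<omega> in P. multi_stoch_exp J W (stepf xs) \<omega> = exp (- (\<Sum>j\<in>UNIV. (norm (J (stepf xs j)))\<^sup>2 / 2)) * exp
    (linB xs \<omega>)"
  using AE_linB[OF xs]
proof eventually_elim
  case (elim \<omega>)
  have "multi_stoch_exp J W (stepf xs) \<omega> = exp (\<Sum>j\<in>UNIV. W j (J (stepf xs j)) \<omega> - (norm (J (stepf xs j)))\<^sup>2 / 2)"
    by (simp add: multi_stoch_exp_def stoch_exp_def exp_sum)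
  then show ?case by (simp add: elim Wsum_def sum_subtractf flip: exp_add)
qed

lemma multi_stoch_exp_measurable[measurable]: "multi_stoch_exp J W f \<in> borel_measurable P"
  unfolding multi_stoch_exp_def[abs_def] by measurable

text \<open>Continuity of the forcing term, as needed for the variation of constants formula. It
  follows from the continuous paths of the version and dominated convergence.\<close>

lemma beta_continuous:
  assumes Z: "jointly_measurable Z" and Zc: "\<And>\<omega>. continuous_on UNIV (\<lambda>t. Z t \<omega>)" and xs: "valid_times T xs"
  shows "continuous_on UNIV (beta i Z xs)"
proof -
  have "(\<lambda>n. beta i Z xs (x n)) \<longlonglongrightarrow> beta i Z xs s" if x: "x \<longlonglongrightarrow> s" for x s
    unfolding beta_def
  proof (rule integral_dominated_convergence[where w="\<lambda>\<omega>. Mb * exp (linB xs \<omega>)"])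
    note [measurable] = jointly_measurable_section[OF Z]
    show "(\<lambda>\<omega>. drift s (Z s \<omega>) $ i * exp (linB xs \<omega>)) \<in> borel_measurable P" by measurable
    show "(\<lambda>\<omega>. drift (x n) (Z (x n) \<omega>) $ i * exp (linB xs \<omega>)) \<in> borel_measurable P" for n by measurable
    show "integrable P (\<lambda>\<omega>. Mb * exp (linB xs \<omega>))" using exp_linB_int[OF xs] by simp
    show "AE \<omega> in P. (\<lambda>n. drift (x n) (Z (x n) \<omega>) $ i * exp (linB xs \<omega>)) \<longlonglongrightarrow> drift s (Z s \<omega>) $ i * exp (linB xs \<omega>)"
    proof (rule AE_I2)
      fix \<omega>
      have "isCont (\<lambda>t. Z t \<omega>) s" using Zc[of \<omega>] by (simp add: continuous_on_eq_continuous_at)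
      then have "(\<lambda>n. Z (x n) \<omega>) \<longlonglongrightarrow> Z s \<omega>" using x by (rule isCont_tendsto_compose)
      with x have p: "(\<lambda>n. (x n, Z (x n) \<omega>)) \<longlonglongrightarrow> (s, Z s \<omega>)" by (rule tendsto_Pair)
      have "isCont (\<lambda>p. drift (fst p) (snd p)) (s, Z s \<omega>)" using drift_continuous
        by (simp add: continuous_on_eq_continuous_at)
      from isCont_tendsto_compose[OF this p] have "(\<lambda>n. drift (x n) (Z (x n) \<omega>)) \<longlonglongrightarrow> drift s (Z s \<omega>)" by simp
      then show "(\<lambda>n. drift (x n) (Z (x n) \<omega>) $ i * exp (linB xs \<omega>)) \<longlonglongrightarrow> drift s (Z s \<omega>) $ i * exp (linB xs \<omega>)"
        by (intro tendsto_intros)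
    qed
    show "AE \<omega> in P. norm (drift (x n) (Z (x n) \<omega>) $ i * exp (linB xs \<omega>)) \<le> Mb * exp (linB xs \<omega>)" for n
      using Mb by (auto simp: abs_mult intro!: AE_I2 mult_right_mono)
  qed
  then show ?thesis by (auto simp: continuous_on_sequentially o_def)
qed

text \<open>The operator Phi is placed on the step function, where it is a genuine continuous
  function. This matches the exponents in the variation of constants formula with those in the limit
  of the mild transform.\<close>

lemma inner_sig_stepf:
  assumes "0 \<le> s" "t \<le> T"
  shows "inner (sig i s t) (J (stepf xs i)) = (LBINT r:{s..t}. \<sigma> r $ i * Phi_fun H T (stepf xs i) r)"
proof -
  have "inner (sig i s t) (J (stepf xs i)) = phi_inner H T (stepf xs i) (\<lambda>r. indicator {s..t} r * \<sigma> r $ i)"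
    unfolding sig_def using J_inner[OF stepf_L2 sig_L2, of xs i s t i] by (simp add: inner_commute)
  also have "\<dots> = (LBINT r:{s..t}. \<sigma> r $ i * Phi_fun H T (stepf xs i) r)"
    unfolding phi_inner_eq set_lebesgue_integral_def
    by (intro Bochner_Integration.integral_cong) (use assms in \<open>auto simp: indicator_def\<close>)
  finally show ?thesis .
qed

text \<open>The characterization of the Ito integral moves the noise onto the test function: the
  stochastic integral contributes the deterministic coefficient \<open>a\<close> times the transform
  itself, and the drift contributes \<open>beta\<close>.\<close>

lemma strong_solution_integral_equation:
  fixes X :: "real \<Rightarrow> 'n path \<Rightarrow> real ^ 'n" and i :: 'n and xs :: "(real \<times> 'n \<times> real) list"
  assumes X: "strong_solution H T P J W b \<sigma> c X"
    and X2: "\<And>t i. t \<in> {0..T} \<Longrightarrow> integrable P (\<lambda>\<omega>. (X t \<omega> $ i)\<^sup>2)"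
    and N: "N \<in> null_sets P" and Z: "\<And>t \<omega>. \<omega> \<in> space P - N \<Longrightarrow> t \<in> {0..T} \<Longrightarrow> Z t \<omega> = X t \<omega>"
    and Zm: "jointly_measurable Z"
    and t: "t \<in> {0..T}" and xs: "valid_times T xs"
  defines "u \<equiv> \<lambda>s. \<integral>\<omega>. X s \<omega> $ i * exp (linB xs \<omega>) \<partial>P"
    and "a \<equiv> \<lambda>s. \<sigma> s $ i * Phi_fun H T (stepf xs i) s"
  shows "set_integrable lborel {0..t} (\<lambda>s. a s * u s)"
    and "u t = c $ i * (\<integral>\<omega>. exp (linB xs \<omega>) \<partial>P) + (LBINT s:{0..t}. beta i Z xs s) + (LBINT s:{0..t}. a s * u s)"
proof -
  let ?G = "\<lambda>\<omega>. exp (linB xs \<omega>)"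
  \<comment> \<open>The factor between the stochastic exponential and exp L. It is positive and
    occurs on both sides of the tested identity, so it cancels.\<close>
  define \<kappa> where "\<kappa> = exp (- (\<Sum>j\<in>UNIV. (norm (J (stepf xs j)))\<^sup>2 / 2))"
  have \<kappa>: "\<kappa> > 0" by (simp add: \<kappa>_def)
  have mse: "AE \<omega> in P. multi_stoch_exp J W (stepf xs) \<omega> = \<kappa> * ?G \<omega>"
    using multi_stoch_exp_eq[OF xs] by (simp add: \<kappa>_def)
  have Xm: "X s \<in> borel_measurable P" if "s \<in> {0..T}" for s using X that by (simp add: strong_solution_def)
  obtain I where ito: "ito_integral H T P J W i (\<lambda>s \<omega>. \<sigma> s $ i * X s \<omega> $ i) t I"
    and I: "AE \<omega> in P. X t \<omega> $ i = c $ i + (LBINT s:{0..t}. b s (X s \<omega>) $ i) + I \<omega>"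
    using X t unfolding strong_solution_def by blast
  have [measurable]: "I \<in> borel_measurable P" using ito by (auto simp: ito_integral_def Lp_rv_def)
  note [measurable] = Xm[OF t]
  have inner: "(\<integral>\<omega>. \<sigma> s $ i * X s \<omega> $ i * multi_stoch_exp J W (stepf xs) \<omega> \<partial>P) * Phi_fun H T (stepf xs i) s
    = \<kappa> * (a s * u s)"
    if s: "s \<in> {0..t}" for s
  proof -
    have [measurable]: "X s \<in> borel_measurable P" using s t by (intro Xm) auto
    have "(\<integral>\<omega>. \<sigma> s $ i * X s \<omega> $ i * multi_stoch_exp J W (stepf xs) \<omega> \<partial>P)
      = (\<integral>\<omega>. (\<kappa> * \<sigma> s $ i) * (X s \<omega> $ i * ?G \<omega>) \<partial>P)"
    proof (rule integral_cong_AE)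
      show "AE \<omega> in P. \<sigma> s $ i * X s \<omega> $ i * multi_stoch_exp J W (stepf xs) \<omega> = (\<kappa> * \<sigma> s $ i) * (X s \<omega> $ i * ?G \<omega>)"
        using mse by eventually_elim simp
    qed measurable
    then show ?thesis by (simp add: u_def a_def)
  qed
  have f: "\<forall>j. stepf xs j \<in> Linf T" by (simp add: stepf_Linf)
  have 1: "set_integrable lborel {0..t} (\<lambda>s. (\<integral>\<omega>. \<sigma> s $ i * X s \<omega> $ i * multi_stoch_exp J W (stepf xs) \<omega> \<partial>P) *
    Phi_fun H T (stepf xs i) s)"
    and 2: "(\<integral>\<omega>. I \<omega> * multi_stoch_exp J W (stepf xs) \<omega> \<partial>P) =
      (LBINT s:{0..t}. (\<integral>\<omega>. \<sigma> s $ i * X s \<omega> $ i * multi_stoch_exp J W (stepf xs) \<omega> \<partial>P) * Phi_fun H T (stepf xs i) s)"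
    using ito f unfolding ito_integral_def by blast+
  have "set_integrable lborel {0..t} (\<lambda>s. \<kappa> * (a s * u s))"
    using 1 by (rule set_integrable_cong[THEN iffD1, rotated 3]) (auto simp: inner)
  then show int: "set_integrable lborel {0..t} (\<lambda>s. a s * u s)"
    using \<kappa> by (simp add: set_integrable_mult_right_iff)
  have "(\<integral>\<omega>. I \<omega> * multi_stoch_exp J W (stepf xs) \<omega> \<partial>P) = (\<integral>\<omega>. \<kappa> * (I \<omega> * ?G \<omega>) \<partial>P)"
  proof (rule integral_cong_AE)
    show "AE \<omega> in P. I \<omega> * multi_stoch_exp J W (stepf xs) \<omega> = \<kappa> * (I \<omega> * ?G \<omega>)"
      using mse by eventually_elim simp
  qed measurable
  moreover have "(LBINT s:{0..t}. (\<integral>\<omega>. \<sigma> s $ i * X s \<omega> $ i * multi_stoch_exp J W (stepf xs) \<omega> \<partial>P) * Phi_fun H T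
    (stepf xs i) s) = (LBINT s:{0..t}. \<kappa> * (a s * u s))"
    by (rule set_lebesgue_integral_cong) (auto simp: inner)
  ultimately have "\<kappa> * (\<integral>\<omega>. I \<omega> * ?G \<omega> \<partial>P) = \<kappa> * (LBINT s:{0..t}. a s * u s)" using 2 by auto
  then have IG: "(\<integral>\<omega>. I \<omega> * ?G \<omega> \<partial>P) = (LBINT s:{0..t}. a s * u s)" using \<kappa> by simp
  have t0: "t \<ge> 0" using t by simp
  have bbm: "(\<lambda>p. drift (fst p) (Z (fst p) (snd p)) $ i) \<in> borel_measurable (borel \<Otimes>\<^sub>M P)"
  proof -
    have [measurable]: "(\<lambda>p. Z (fst p) (snd p)) \<in> borel_measurable (borel \<Otimes>\<^sub>M P)" using Zm
      by (simp add: jointly_measurable_def)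
    show ?thesis by measurable
  qed
  have C0: "Mb * (\<integral>\<omega>. ?G \<omega> \<partial>P) \<ge> 0" using Mb(1) by simp
  note fub = exp_linB_weighted_fubini[OF xs t0 bbm drift_exp_integrable(2)[OF Zm xs] C0]
  have bnd: "integrable P (\<lambda>\<omega>. X t \<omega> $ i * ?G \<omega>)"
    using X2[OF t] by (intro exp_linB_mult_integrable[OF xs]) measurable
  have "AE \<omega> in P. I \<omega> * ?G \<omega> = X t \<omega> $ i * ?G \<omega> - c $ i * ?G \<omega> - (\<integral>s. indicator {0..t} s * drift s (Z s \<omega>) $ i
    \<partial>lborel) * ?G \<omega>"
    using I AE_not_in[OF N] AE_space
  proof eventually_elim
    case (elim \<omega>)
    have "(LBINT s:{0..t}. b s (X s \<omega>) $ i) = (\<integral>s. indicator {0..t} s * drift s (Z s \<omega>) $ i \<partial>lborel)"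
      unfolding set_lebesgue_integral_def
    proof (intro Bochner_Integration.integral_cong refl)
      fix s
      show "indicator {0..t} s *\<^sub>R b s (X s \<omega>) $ i = indicator {0..t} s * drift s (Z s \<omega>) $ i"
        using Z[of \<omega> s] elim(2,3) t by (cases "s \<in> {0..t}") (auto simp: drift_eq)
    qed
    then have "I \<omega> = X t \<omega> $ i - c $ i - (\<integral>s. indicator {0..t} s * drift s (Z s \<omega>) $ i \<partial>lborel)" using elim(1) by simp
    then show ?case by (simp only: left_diff_distrib)
  qed
  then have "(\<integral>\<omega>. I \<omega> * ?G \<omega> \<partial>P) = (\<integral>\<omega>. X t \<omega> $ i * ?G \<omega> - c $ i * ?G \<omega> - (\<integral>s. indicator {0..t} s * drift s (Z
    s \<omega>) $ i \<partial>lborel) * ?G \<omega> \<partial>P)"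
    using bnd exp_linB_int[OF xs] fub(1) by (intro integral_cong_AE) auto
  also have "\<dots> = u t - c $ i * (\<integral>\<omega>. ?G \<omega> \<partial>P) - (\<integral>\<omega>. (\<integral>s. indicator {0..t} s * drift s (Z s \<omega>) $ i \<partial>lborel) * ?G \<omega> \<partial>P)"
    using bnd exp_linB_int[OF xs] fub(1) by (simp add: u_def)
  also have "(\<integral>\<omega>. (\<integral>s. indicator {0..t} s * drift s (Z s \<omega>) $ i \<partial>lborel) * ?G \<omega> \<partial>P) = (LBINT s:{0..t}. beta i Z xs s)"
    unfolding fub(2) beta_def set_lebesgue_integral_def by simp
  finally show "u t = c $ i * (\<integral>\<omega>. ?G \<omega> \<partial>P) + (LBINT s:{0..t}. beta i Z xs s) + (LBINT s:{0..t}. a s * u s)"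
    using IG by simp
qed

text \<open>Solving the scalar equation gives the expression found as the limit of the mild
  transforms.\<close>

lemma strong_solution_transform:
  assumes X: "strong_solution H T P J W b \<sigma> c X"
    and X2: "\<And>t i. t \<in> {0..T} \<Longrightarrow> integrable P (\<lambda>\<omega>. (X t \<omega> $ i)\<^sup>2)"
    and N: "N \<in> null_sets P" and Z: "\<And>t \<omega>. \<omega> \<in> space P - N \<Longrightarrow> t \<in> {0..T} \<Longrightarrow> Z t \<omega> = X t \<omega>"
    and Zm: "jointly_measurable Z" and Zc: "\<And>\<omega>. continuous_on UNIV (\<lambda>t. Z t \<omega>)"
    and t: "t \<in> {0..T}" and xs: "valid_times T xs"
  shows "(\<integral>\<omega>. X t \<omega> $ i * exp (linB xs \<omega>) \<partial>P) =
    c $ i * (exp (inner (sig i 0 t) (J (stepf xs i))) * (\<integral>\<omega>. exp (linB xs \<omega>) \<partial>P)) +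
    (\<integral>s. indicator {0..t} s * (exp (inner (sig i s t) (J (stepf xs i))) * beta i Z xs s) \<partial>lborel)"
proof -
  let ?a = "\<lambda>s. \<sigma> s $ i * Phi_fun H T (stepf xs i) s"
  have ca: "continuous_on {0..T} ?a"
    by (intro continuous_intros \<sigma> continuous_on_subset[OF continuous_Phi_fun_stepf[OF xs]]) auto
  have cb: "continuous_on {0..T} (beta i Z xs)"
    by (rule continuous_on_subset[OF beta_continuous[OF Zm Zc xs]]) auto
  have "(\<integral>\<omega>. X t \<omega> $ i * exp (linB xs \<omega>) \<partial>P) =
    c $ i * (\<integral>\<omega>. exp (linB xs \<omega>) \<partial>P) * exp (LBINT r:{0..t}. ?a r) + (LBINT s:{0..t}. beta i Z xs s * exp (LBINT
      r:{s..t}. ?a r))"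
    using strong_solution_integral_equation[OF X X2 N Z Zm _ xs, of _ i]
    by (intro linear_integral_equation[OF ca cb _ _ t]) auto
  also have "exp (LBINT r:{0..t}. ?a r) = exp (inner (sig i 0 t) (J (stepf xs i)))"
    using t by (simp add: inner_sig_stepf)
  also have "(LBINT s:{0..t}. beta i Z xs s * exp (LBINT r:{s..t}. ?a r))
    = (\<integral>s. indicator {0..t} s * (exp (inner (sig i s t) (J (stepf xs i))) * beta i Z xs s) \<partial>lborel)"
    unfolding set_lebesgue_integral_def[of _ "{0..t}"]
  proof (intro Bochner_Integration.integral_cong refl)
    fix s
    show "indicator {0..t} s *\<^sub>R (beta i Z xs s * exp (LBINT r:{s..t}. ?a r))
      = indicator {0..t} s * (exp (inner (sig i s t) (J (stepf xs i))) * beta i Z xs s)"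
      using t by (cases "s \<in> {0..t}") (auto simp: inner_sig_stepf)
  qed
  finally show ?thesis by (simp add: mult_ac)
qed

text \<open>Completeness produces some L1 limit of the mild maps; the transforms decide that it is
  X(t).\<close>

lemma mild_map_tendsto:
  assumes X: "strong_solution H T P J W b \<sigma> c X"
    and X2: "\<And>t i. t \<in> {0..T} \<Longrightarrow> integrable P (\<lambda>\<omega>. (X t \<omega> $ i)\<^sup>2)"
    and N: "N \<in> null_sets P" and Z: "\<And>t \<omega>. \<omega> \<in> space P - N \<Longrightarrow> t \<in> {0..T} \<Longrightarrow> Z t \<omega> = X t \<omega>"
    and Zm: "jointly_measurable Z" and Zc: "\<And>\<omega>. continuous_on UNIV (\<lambda>t. Z t \<omega>)"
    and t: "t \<in> {0..T}"
  shows "(\<lambda>K. \<integral>\<^sup>+\<omega>. ennreal \<bar>mild_map K i t Z \<omega> - X t \<omega> $ i\<bar> \<partial>P) \<longlonglongrightarrow> 0"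
proof -
  define C where "C = 2 * ((c $ i)\<^sup>2 * exp Rsig) + 2 * (T * (T * (Mb\<^sup>2 * exp Rsig)))"
  note mi = mild_map_integrable[OF Zm t, of _ i, folded C_def]
  have C0: "C \<ge> 0" unfolding C_def using T_pos by simp
  obtain v r where v: "integrable P v" and r: "strict_mono (r :: nat \<Rightarrow> nat)"
    and ae: "AE \<omega> in P. (\<lambda>n. mild_map (r n) i t Z \<omega>) \<longlonglongrightarrow> v \<omega>"
    and lim: "(\<lambda>n. \<integral>\<omega>. \<bar>mild_map n i t Z \<omega> - v \<omega>\<bar> \<partial>P) \<longlonglongrightarrow> 0"
    by (rule L1_complete[OF mi(1) mild_map_cauchy[OF Zm t]])
  have [measurable]: "X t \<in> borel_measurable P" using X t by (simp add: strong_solution_def)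
  note [measurable] = borel_measurable_integrable[OF v] mild_map_measurable[OF Zm]
  \<comment> \<open>The uniform second moments pass to the limit by Fatou's lemma along the almost
    surely convergent subsequence. Square integrability is what allows testing against unbounded
    exponentials.\<close>
  have v2: "integrable P (\<lambda>\<omega>. (v \<omega>)\<^sup>2)"
  proof (rule integrableI_bounded)
    have "(\<integral>\<^sup>+\<omega>. ennreal (norm ((v \<omega>)\<^sup>2)) \<partial>P) = (\<integral>\<^sup>+\<omega>. liminf (\<lambda>n. ennreal ((mild_map (r n) i t Z \<omega>)\<^sup>2)) \<partial>P)"
    proof (rule nn_integral_cong_AE)
      show "AE \<omega> in P. ennreal (norm ((v \<omega>)\<^sup>2)) = liminf (\<lambda>n. ennreal ((mild_map (r n) i t Z \<omega>)\<^sup>2))"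
        using ae
      proof eventually_elim
        case (elim \<omega>)
        then have "(\<lambda>n. ennreal ((mild_map (r n) i t Z \<omega>)\<^sup>2)) \<longlonglongrightarrow> ennreal (norm ((v \<omega>)\<^sup>2))"
          by (simp del: ennreal_power, intro tendsto_ennrealI tendsto_intros)
        then show ?case by (intro lim_imp_Liminf[symmetric]) auto
      qed
    qed
    also have "\<dots> \<le> liminf (\<lambda>n. \<integral>\<^sup>+\<omega>. ennreal ((mild_map (r n) i t Z \<omega>)\<^sup>2) \<partial>P)"
      by (intro nn_integral_liminf) measurable
    also have "\<dots> \<le> ennreal C"
      using mild_map_sq[OF Zm t, of _ i, folded C_def] by (intro Liminf_le always_eventually allI) auto
    finally show "(\<integral>\<^sup>+\<omega>. ennreal (norm ((v \<omega>)\<^sup>2)) \<partial>P) < \<infinity>" by (auto intro: le_less_trans)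
  qed measurable
  have "AE \<omega> in P. v \<omega> = X t \<omega> $ i"
  proof (rule AE_eq_if_exp_linB)
    show "integrable P (\<lambda>\<omega>. (v \<omega>)\<^sup>2)" by fact
    show "integrable P (\<lambda>\<omega>. (X t \<omega> $ i)\<^sup>2)" by (rule X2[OF t])
    fix xs :: "(real \<times> 'n \<times> real) list" assume xs: "valid_times T xs"
    let ?G = "\<lambda>\<omega>. exp (linB xs \<omega>)"
    \<comment> \<open>Here the L2 bounds upgrade L1 convergence to convergence against the unbounded
      weight exp L, all of whose moments are finite.\<close>
    have "(\<lambda>n. \<integral>\<omega>. \<bar>mild_map n i t Z \<omega> - v \<omega>\<bar> * ?G \<omega> \<partial>P) \<longlonglongrightarrow> 0"
    proof (rule L1_mult_tendsto[OF mi(1) v mi(2,3) v2 _ _ _ lim])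
      show "integrable P (\<lambda>\<omega>. ?G \<omega> ^ 4)"
        using exp_linB_integrable[OF xs, of 4] by (simp add: exp_of_nat_mult[of 4, simplified])
    qed auto
    then have "(\<lambda>n. (\<integral>\<omega>. mild_map n i t Z \<omega> * ?G \<omega> \<partial>P) - (\<integral>\<omega>. v \<omega> * ?G \<omega> \<partial>P)) \<longlonglongrightarrow> 0"
    proof (rule Lim_null_comparison[rotated], intro always_eventually allI)
      fix n
      have i1: "integrable P (\<lambda>\<omega>. mild_map n i t Z \<omega> * ?G \<omega>)"
        by (rule exp_linB_mult_integrable[OF xs _ mi(2)]) measurable
      have i2: "integrable P (\<lambda>\<omega>. v \<omega> * ?G \<omega>)" by (rule exp_linB_mult_integrable[OF xs _ v2]) measurable
      have "norm ((\<integral>\<omega>. mild_map n i t Z \<omega> * ?G \<omega> \<partial>P) - (\<integral>\<omega>. v \<omega> * ?G \<omega> \<partial>P))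
        = norm (\<integral>\<omega>. mild_map n i t Z \<omega> * ?G \<omega> - v \<omega> * ?G \<omega> \<partial>P)"
        using i1 i2 by simp
      also have "\<dots> \<le> (\<integral>\<omega>. norm (mild_map n i t Z \<omega> * ?G \<omega> - v \<omega> * ?G \<omega>) \<partial>P)" by (rule integral_norm_bound)
      also have "\<dots> = (\<integral>\<omega>. \<bar>mild_map n i t Z \<omega> - v \<omega>\<bar> * ?G \<omega> \<partial>P)"
        by (intro Bochner_Integration.integral_cong) (auto simp: abs_mult simp flip: left_diff_distrib)
      finally show "norm ((\<integral>\<omega>. mild_map n i t Z \<omega> * ?G \<omega> \<partial>P) - (\<integral>\<omega>. v \<omega> * ?G \<omega> \<partial>P))
        \<le> (\<integral>\<omega>. \<bar>mild_map n i t Z \<omega> - v \<omega>\<bar> * ?G \<omega> \<partial>P)" .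
    qed
    then have "(\<lambda>n. \<integral>\<omega>. mild_map n i t Z \<omega> * ?G \<omega> \<partial>P) \<longlonglongrightarrow> (\<integral>\<omega>. v \<omega> * ?G \<omega> \<partial>P)" by (rule LIM_zero_cancel)
    from LIMSEQ_unique[OF this mild_map_transform_limit[OF Zm t xs]]
    show "(\<integral>\<omega>. v \<omega> * ?G \<omega> \<partial>P) = (\<integral>\<omega>. X t \<omega> $ i * ?G \<omega> \<partial>P)"
      by (simp only: strong_solution_transform[OF X X2 N Z Zm Zc t xs])
  qed measurable
  have "(\<integral>\<^sup>+\<omega>. ennreal \<bar>mild_map K i t Z \<omega> - X t \<omega> $ i\<bar> \<partial>P) = ennreal (\<integral>\<omega>. \<bar>mild_map K i t Z \<omega> - v \<omega>\<bar> \<partial>P)" for K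
  proof -
    have "(\<integral>\<^sup>+\<omega>. ennreal \<bar>mild_map K i t Z \<omega> - X t \<omega> $ i\<bar> \<partial>P) = (\<integral>\<^sup>+\<omega>. ennreal \<bar>mild_map K i t Z \<omega> - v \<omega>\<bar> \<partial>P)"
      using \<open>AE \<omega> in P. v \<omega> = X t \<omega> $ i\<close> by (intro nn_integral_cong_AE) auto
    also have "\<dots> = ennreal (\<integral>\<omega>. \<bar>mild_map K i t Z \<omega> - v \<omega>\<bar> \<partial>P)"
      using mi(1) v by (intro nn_integral_eq_integral) auto
    finally show ?thesis .
  qed
  then show ?thesis using tendsto_ennrealI[OF lim] by simp
qed

section \<open>Convergence\<close>

text \<open>Equal truncations share one translation and one exponential, so the isometry removes
  both; the Lipschitz constant of the mild map thereby becomes free of K.\<close>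

lemma integrand_dist_eq:
  assumes Z: "jointly_measurable Z" and Z': "jointly_measurable Z'"
  shows "(\<integral>\<^sup>+\<omega>. ennreal \<bar>integrand K i t Z s \<omega> - integrand K i t Z' s \<omega>\<bar> \<partial>P)
    = (\<integral>\<^sup>+\<omega>. ennreal \<bar>drift s (Z s \<omega>) $ i - drift s (Z' s \<omega>) $ i\<bar> \<partial>P)"
proof -
  note [measurable] = jointly_measurable_section[OF Z] jointly_measurable_section[OF Z']
  have "(\<integral>\<^sup>+\<omega>. ennreal \<bar>integrand K i t Z s \<omega> - integrand K i t Z' s \<omega>\<bar> \<partial>P) =
    (\<integral>\<^sup>+\<omega>. (\<lambda>\<omega>. ennreal \<bar>drift s (Z s \<omega>) $ i - drift s (Z' s \<omega>) $ i\<bar>) (\<omega> - shift i (sigK K i s t)) * ennreal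
      (stoch_exp W i (sigK K i s t) \<omega>) \<partial>P)"
    unfolding integrand_def wick_diff wick_abs
    by (intro nn_integral_cong) (simp add: wick_def ennreal_mult stoch_exp_nonneg)
  also have "\<dots> = (\<integral>\<^sup>+\<omega>. ennreal \<bar>drift s (Z s \<omega>) $ i - drift s (Z' s \<omega>) $ i\<bar> \<partial>P)"
    by (rule nn_integral_wick) measurable
  finally show ?thesis .
qed

text \<open>All components are summed because the drift couples them. Values in ennreal allow a
  distance to be formed before its finiteness is known.\<close>

definition L1_dist :: "(real \<Rightarrow> 'n path \<Rightarrow> real ^ 'n) \<Rightarrow> (real \<Rightarrow> 'n path \<Rightarrow> real ^ 'n) \<Rightarrow> real \<Rightarrow> ennreal" where
  "L1_dist Z Z' s = (\<Sum>j\<in>UNIV. \<integral>\<^sup>+\<omega>. ennreal \<bar>Z s \<omega> $ j - Z' s \<omega> $ j\<bar> \<partial>P)"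

lemma L1_dist_measurable:
  assumes Z: "jointly_measurable Z" and Z': "jointly_measurable Z'"
  shows "L1_dist Z Z' \<in> borel_measurable borel"
proof -
  have [measurable]: "(\<lambda>p. Z (fst p) (snd p)) \<in> borel_measurable (borel \<Otimes>\<^sub>M P)"
    "(\<lambda>p. Z' (fst p) (snd p)) \<in> borel_measurable (borel \<Otimes>\<^sub>M P)"
    using Z Z' by (simp_all add: jointly_measurable_def)
  have "(\<lambda>s. \<integral>\<^sup>+\<omega>. ennreal \<bar>Z s \<omega> $ j - Z' s \<omega> $ j\<bar> \<partial>P) \<in> borel_measurable borel" for j
    by (rule borel_measurable_nn_integral) (unfold case_prod_beta', measurable)
  then show ?thesis unfolding L1_dist_def[abs_def] by (intro borel_measurable_sum)
qed

lemma integrand_dist_le_L1_dist: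
  assumes Z: "jointly_measurable Z" and Z': "jointly_measurable Z'"
  shows "(\<integral>\<^sup>+\<omega>. ennreal \<bar>integrand K i t Z s \<omega> - integrand K i t Z' s \<omega>\<bar> \<partial>P) \<le> ennreal Lb * L1_dist Z Z' s"
proof -
  note [measurable] = jointly_measurable_section[OF Z] jointly_measurable_section[OF Z']
  have "(\<integral>\<^sup>+\<omega>. ennreal \<bar>drift s (Z s \<omega>) $ i - drift s (Z' s \<omega>) $ i\<bar> \<partial>P)
    \<le> (\<integral>\<^sup>+\<omega>. ennreal Lb * (\<Sum>j\<in>UNIV. ennreal \<bar>Z s \<omega> $ j - Z' s \<omega> $ j\<bar>) \<partial>P)"
  proof (rule nn_integral_mono)
    fix \<omega>
    have "ennreal \<bar>drift s (Z s \<omega>) $ i - drift s (Z' s \<omega>) $ i\<bar> \<le> ennreal (Lb * (\<Sum>j\<in>UNIV. \<bar>Z s \<omega> $ j - Z' s \<omega> $ j\<bar>))"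
      by (rule ennreal_leI[OF Lb(2)])
    also have "\<dots> = ennreal Lb * (\<Sum>j\<in>UNIV. ennreal \<bar>Z s \<omega> $ j - Z' s \<omega> $ j\<bar>)"
      using Lb(1) by (simp add: ennreal_mult sum_nonneg sum_ennreal)
    finally show "ennreal \<bar>drift s (Z s \<omega>) $ i - drift s (Z' s \<omega>) $ i\<bar>
      \<le> ennreal Lb * (\<Sum>j\<in>UNIV. ennreal \<bar>Z s \<omega> $ j - Z' s \<omega> $ j\<bar>)" .
  qed
  also have "\<dots> = ennreal Lb * L1_dist Z Z' s"
    unfolding L1_dist_def by (subst nn_integral_cmult, measurable, subst nn_integral_sum) auto
  finally show ?thesis by (simp only: integrand_dist_eq[OF Z Z'])
qed

lemma mild_map_dist_le_L1_dist:
  assumes Z: "jointly_measurable Z" and Z': "jointly_measurable Z'" and t: "t \<ge> 0"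
  shows "(\<integral>\<^sup>+\<omega>. ennreal \<bar>mild_map K i t Z \<omega> - mild_map K i t Z' \<omega>\<bar> \<partial>P)
    \<le> ennreal Lb * (\<integral>\<^sup>+s. L1_dist Z Z' s * indicator {0..t} s \<partial>lborel)"
proof -
  note [measurable] = L1_dist_measurable[OF Z Z']
  have "(\<integral>\<^sup>+\<omega>. ennreal \<bar>mild_map K i t Z \<omega> - mild_map K i t Z' \<omega>\<bar> \<partial>P) \<le>
    (\<integral>\<^sup>+s. indicator {0..t} s * (\<integral>\<^sup>+\<omega>. ennreal \<bar>integrand K i t Z s \<omega> - integrand K i t Z' s \<omega>\<bar> \<partial>P) \<partial>lborel)"
    using mild_map_dist[OF Z Z' t, of K i K] by simp
  also have "\<dots> \<le> (\<integral>\<^sup>+s. ennreal Lb * (L1_dist Z Z' s * indicator {0..t} s) \<partial>lborel)"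
    using integrand_dist_le_L1_dist[OF Z Z'] by (intro nn_integral_mono) (auto simp: indicator_def)
  also have "\<dots> = ennreal Lb * (\<integral>\<^sup>+s. L1_dist Z Z' s * indicator {0..t} s \<partial>lborel)"
    by (rule nn_integral_cmult) measurable
  finally show ?thesis .
qed

text \<open>The error is at most the consistency error plus C times its time integral. Passing to
  the upper limit first removes the consistency error at each fixed time, so that convergence
  uniform in time is never called for and Gronwall's inequality applies to the limit.\<close>

lemma approximation_tendsto_0:
  fixes Zn :: "nat \<Rightarrow> real \<Rightarrow> 'n path \<Rightarrow> real ^ 'n"
  assumes Zn: "\<And>n. jointly_measurable (Zn n)" and Z: "jointly_measurable Z"
    and fixed: "\<And>n t i. t \<in> {0..T} \<Longrightarrow> AE \<omega> in P. Zn n t \<omega> $ i = mild_map (Suc n) i t (Zn n) \<omega>"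
    and lim: "\<And>t i. t \<in> {0..T} \<Longrightarrow> (\<lambda>K. \<integral>\<^sup>+\<omega>. ennreal \<bar>mild_map K i t Z \<omega> - Z t \<omega> $ i\<bar> \<partial>P) \<longlonglongrightarrow> 0"
    and t: "t \<in> {0..T}"
  shows "(\<lambda>n. L1_dist (Zn n) Z t) \<longlonglongrightarrow> 0"
proof -
  define v where "v n s = L1_dist (Zn n) Z s" for n s
  have vm[measurable]: "v n \<in> borel_measurable borel" for n unfolding v_def[abs_def]
    by (rule L1_dist_measurable[OF Zn Z])
  define C where "C = real CARD('n) * Lb"
  have C: "C \<ge> 0" using Lb(1) by (simp add: C_def)
  define \<rho> where "\<rho> n s = (\<Sum>i\<in>UNIV. \<integral>\<^sup>+\<omega>. ennreal \<bar>mild_map (Suc n) i s Z \<omega> - Z s \<omega> $ i\<bar> \<partial>P)" for n s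
  note [measurable] = jointly_measurable_section[OF Zn] jointly_measurable_section[OF Z] mild_map_measurable[OF
    Zn] mild_map_measurable[OF Z]
  have \<rho>: "(\<lambda>n. \<rho> n s) \<longlonglongrightarrow> 0" if s: "s \<in> {0..T}" for s
  proof -
    have "(\<lambda>n. \<rho> n s) \<longlonglongrightarrow> (\<Sum>i\<in>(UNIV :: 'n set). 0)" unfolding \<rho>_def
      by (intro tendsto_sum LIMSEQ_Suc[OF lim[OF s]])
    then show ?thesis by simp
  qed
  have tri: "(\<integral>\<^sup>+\<omega>. ennreal \<bar>f \<omega> - h \<omega>\<bar> \<partial>P) \<le> (\<integral>\<^sup>+\<omega>. ennreal \<bar>f \<omega> - g \<omega>\<bar> \<partial>P) + (\<integral>\<^sup>+\<omega>. ennreal \<bar>g \<omega> - h \<omega>\<bar> \<partial>P)"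
    if [measurable]: "f \<in> borel_measurable P" "g \<in> borel_measurable P" "h \<in> borel_measurable P" for f g h ::
      "'n path \<Rightarrow> real"
  proof -
    have "(\<integral>\<^sup>+\<omega>. ennreal \<bar>f \<omega> - h \<omega>\<bar> \<partial>P) \<le> (\<integral>\<^sup>+\<omega>. ennreal \<bar>f \<omega> - g \<omega>\<bar> + ennreal \<bar>g \<omega> - h \<omega>\<bar> \<partial>P)"
      by (intro nn_integral_mono) (auto simp: ennreal_plus[symmetric] simp del: ennreal_plus intro!: ennreal_leI)
    also have "\<dots> = (\<integral>\<^sup>+\<omega>. ennreal \<bar>f \<omega> - g \<omega>\<bar> \<partial>P) + (\<integral>\<^sup>+\<omega>. ennreal \<bar>g \<omega> - h \<omega>\<bar> \<partial>P)"
      by (rule nn_integral_add) measurable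
    finally show ?thesis .
  qed
  have ineq: "v n s \<le> \<rho> n s + ennreal C * (\<integral>\<^sup>+r. v n r * indicator {0..s} r \<partial>lborel)" if s: "s \<in> {0..T}" for n s
  proof -
    have s0: "s \<ge> 0" using s by simp
    have "v n s \<le> (\<Sum>i\<in>UNIV. ennreal Lb * (\<integral>\<^sup>+r. v n r * indicator {0..s} r \<partial>lborel) + (\<integral>\<^sup>+\<omega>. ennreal \<bar>mild_map
      (Suc n) i s Z \<omega> - Z s \<omega> $ i\<bar> \<partial>P))"
      unfolding v_def L1_dist_def[of _ _ s]
    proof (rule sum_mono)
      fix i
      have "(\<integral>\<^sup>+\<omega>. ennreal \<bar>Zn n s \<omega> $ i - Z s \<omega> $ i\<bar> \<partial>P) = (\<integral>\<^sup>+\<omega>. ennreal \<bar>mild_map (Suc n) i s (Zn n) \<omega> - Z s \<omega>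
        $ i\<bar> \<partial>P)"
        using fixed[OF s, of n i] by (intro nn_integral_cong_AE) auto
      also have "\<dots> \<le> (\<integral>\<^sup>+\<omega>. ennreal \<bar>mild_map (Suc n) i s (Zn n) \<omega> - mild_map (Suc n) i s Z \<omega>\<bar> \<partial>P) + (\<integral>\<^sup>+\<omega>.
        ennreal \<bar>mild_map (Suc n) i s Z \<omega> - Z s \<omega> $ i\<bar> \<partial>P)"
        by (rule tri) measurable
      also have "\<dots> \<le> ennreal Lb * (\<integral>\<^sup>+r. L1_dist (Zn n) Z r * indicator {0..s} r \<partial>lborel) + (\<integral>\<^sup>+\<omega>. ennreal
        \<bar>mild_map (Suc n) i s Z \<omega> - Z s \<omega> $ i\<bar> \<partial>P)"
        by (intro add_right_mono mild_map_dist_le_L1_dist[OF Zn Z s0])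
      finally show "(\<integral>\<^sup>+\<omega>. ennreal \<bar>Zn n s \<omega> $ i - Z s \<omega> $ i\<bar> \<partial>P)
        \<le> ennreal Lb * (\<integral>\<^sup>+r. L1_dist (Zn n) Z r * indicator {0..s} r \<partial>lborel) + (\<integral>\<^sup>+\<omega>. ennreal \<bar>mild_map (Suc n)
          i s Z \<omega> - Z s \<omega> $ i\<bar> \<partial>P)" .
    qed
    also have "\<dots> = \<rho> n s + ennreal C * (\<integral>\<^sup>+r. v n r * indicator {0..s} r \<partial>lborel)"
      using Lb(1) by (simp add: sum.distrib \<rho>_def C_def ennreal_mult ennreal_of_nat_eq_real_of_nat mult.assoc
        add.commute)
    finally show ?thesis .
  qed
  define D where "D i = \<bar>c $ i\<bar> + T * Mb" for i
  have D0: "D i \<ge> 0" for i using T_pos Mb(1) by (simp add: D_def)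
  define M where "M = (\<Sum>i\<in>UNIV. D i + D i)"
  have M0: "M \<ge> 0" unfolding M_def using D0 by (intro sum_nonneg) simp
  \<comment> \<open>Z is an L1 limit of mild maps, whose first moments are bounded uniformly in K
    and in time. Together with the same bound for \<open>Zn\<close> this supplies the constant
    dominating function for the reverse Fatou lemma.\<close>
  have bZ: "(\<integral>\<^sup>+\<omega>. ennreal \<bar>Z s \<omega> $ i\<bar> \<partial>P) \<le> ennreal (D i)" if s: "s \<in> {0..T}" for s i
  proof (rule LIMSEQ_le_const)
    show "(\<lambda>K. (\<integral>\<^sup>+\<omega>. ennreal \<bar>mild_map K i s Z \<omega> - Z s \<omega> $ i\<bar> \<partial>P) + ennreal (D i)) \<longlonglongrightarrow> ennreal (D i)"
      using tendsto_add[OF lim[OF s, of i] tendsto_const[of "ennreal (D i)"]] by simp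
    have "(\<integral>\<^sup>+\<omega>. ennreal \<bar>Z s \<omega> $ i\<bar> \<partial>P) \<le> (\<integral>\<^sup>+\<omega>. ennreal \<bar>mild_map K i s Z \<omega> - Z s \<omega> $ i\<bar> \<partial>P) + ennreal (D i)" for K
    proof -
      have "(\<integral>\<^sup>+\<omega>. ennreal \<bar>Z s \<omega> $ i\<bar> \<partial>P) = (\<integral>\<^sup>+\<omega>. ennreal \<bar>Z s \<omega> $ i - 0\<bar> \<partial>P)" by simp
      also have "\<dots> \<le> (\<integral>\<^sup>+\<omega>. ennreal \<bar>Z s \<omega> $ i - mild_map K i s Z \<omega>\<bar> \<partial>P) + (\<integral>\<^sup>+\<omega>. ennreal \<bar>mild_map K i s Z \<omega> - 0\<bar> \<partial>P)"
        by (rule tri) measurable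
      also have "\<dots> \<le> (\<integral>\<^sup>+\<omega>. ennreal \<bar>mild_map K i s Z \<omega> - Z s \<omega> $ i\<bar> \<partial>P) + ennreal (D i)"
        using mild_map_nn_integral_le[OF Z s, of K i] by (simp add: D_def abs_minus_commute add_left_mono)
      finally show ?thesis .
    qed
    then show "\<exists>N. \<forall>n\<ge>N. (\<integral>\<^sup>+\<omega>. ennreal \<bar>Z s \<omega> $ i\<bar> \<partial>P) \<le> (\<integral>\<^sup>+\<omega>. ennreal \<bar>mild_map n i s Z \<omega> - Z s \<omega> $ i\<bar> \<partial>P) +
      ennreal (D i)" by blast
  qed
  have bZn: "(\<integral>\<^sup>+\<omega>. ennreal \<bar>Zn n s \<omega> $ i\<bar> \<partial>P) \<le> ennreal (D i)" if s: "s \<in> {0..T}" for n s i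
  proof -
    have "(\<integral>\<^sup>+\<omega>. ennreal \<bar>Zn n s \<omega> $ i\<bar> \<partial>P) = (\<integral>\<^sup>+\<omega>. ennreal \<bar>mild_map (Suc n) i s (Zn n) \<omega>\<bar> \<partial>P)"
      using fixed[OF s, of n i] by (intro nn_integral_cong_AE) auto
    then show ?thesis using mild_map_nn_integral_le[OF Zn s, of "Suc n" i n] by (simp add: D_def)
  qed
  have vM: "v n s \<le> ennreal M" if s: "s \<in> {0..T}" for n s
  proof -
    have "v n s \<le> (\<Sum>i\<in>UNIV. ennreal (D i + D i))"
      unfolding v_def L1_dist_def
    proof (rule sum_mono)
      fix i
      have "(\<integral>\<^sup>+\<omega>. ennreal \<bar>Zn n s \<omega> $ i - Z s \<omega> $ i\<bar> \<partial>P) \<le> (\<integral>\<^sup>+\<omega>. ennreal \<bar>Zn n s \<omega> $ i - 0\<bar> \<partial>P) + (\<integral>\<^sup>+\<omega>. ennreal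
        \<bar>0 - Z s \<omega> $ i\<bar> \<partial>P)"
        by (rule tri) measurable
      also have "\<dots> \<le> ennreal (D i) + ennreal (D i)" using bZ[OF s] bZn[OF s] by (intro add_mono) auto
      finally show "(\<integral>\<^sup>+\<omega>. ennreal \<bar>Zn n s \<omega> $ i - Z s \<omega> $ i\<bar> \<partial>P) \<le> ennreal (D i + D i)"
        by (simp only: ennreal_plus[OF D0 D0])
    qed
    also have "\<dots> = ennreal M" unfolding M_def using D0 by (intro sum_ennreal) simp
    finally show ?thesis .
  qed
  \<comment> \<open>The upper limit is bounded and measurable, and it satisfies a homogeneous
    integral inequality.\<close>
  define w where "w s = limsup (\<lambda>n. v n s)" for s
  have [measurable]: "w \<in> borel_measurable borel" unfolding w_def[abs_def] by measurable
  have "w t = 0"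
  proof (rule gronwall_eq_0[OF _ _ M0 C _ t])
    show "w s \<le> ennreal M" if "s \<in> {0..T}" for s
      unfolding w_def using vM[OF that] by (intro Limsup_bounded always_eventually allI) auto
    show "w s \<le> ennreal C * (\<integral>\<^sup>+r. w r * indicator {0..s} r \<partial>lborel)" if s: "s \<in> {0..T}" for s
    proof (rule ennreal_le_epsilon)
      fix \<epsilon> :: real assume \<epsilon>: "\<epsilon> > 0"
      let ?q = "\<lambda>n. \<integral>\<^sup>+r. v n r * indicator {0..s} r \<partial>lborel"
      have "\<forall>\<^sub>F n in sequentially. \<rho> n s < ennreal \<epsilon>" using \<rho>[OF s] \<epsilon> by (intro order_tendstoD(2)) auto
      then have "\<forall>\<^sub>F n in sequentially. v n s \<le> ennreal C * ?q n + ennreal \<epsilon>"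
      proof eventually_elim
        case (elim n)
        have "v n s \<le> \<rho> n s + ennreal C * ?q n" by (rule ineq[OF s])
        also have "\<dots> \<le> ennreal \<epsilon> + ennreal C * ?q n" using elim by (intro add_right_mono) simp
        finally show ?case by (simp add: add.commute)
      qed
      then have "w s \<le> limsup (\<lambda>n. ennreal C * ?q n + ennreal \<epsilon>)" unfolding w_def by (rule Limsup_mono)
      also have "\<dots> = ennreal C * limsup ?q + ennreal \<epsilon>"
      \<comment> \<open>An increasing continuous affine map commutes with the upper limit, which
        leaves the upper limit of the integrals for the reverse Fatou lemma.\<close>
      proof (rule Limsup_compose_continuous_mono[where f="\<lambda>x. ennreal C * x + ennreal \<epsilon>"])
        show "continuous_on UNIV (\<lambda>x. ennreal C * x + ennreal \<epsilon>)"
          by (intro continuous_intros ennreal_continuous_on_cmult) auto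
        show "mono (\<lambda>x. ennreal C * x + ennreal \<epsilon>)" by (intro monoI add_right_mono mult_left_mono) auto
      qed simp
      also have "\<dots> \<le> ennreal C * (\<integral>\<^sup>+r. w r * indicator {0..s} r \<partial>lborel) + ennreal \<epsilon>"
      proof (intro add_right_mono mult_left_mono)
        have "limsup ?q \<le> (\<integral>\<^sup>+r. limsup (\<lambda>n. v n r * indicator {0..s} r) \<partial>lborel)"
        proof (rule nn_integral_limsup[where w="\<lambda>r. ennreal M * indicator {0..s} r"])
          show "AE r in lborel. v n r * indicator {0..s} r \<le> ennreal M * indicator {0..s} r" for n
            using vM s by (auto simp: indicator_def intro!: AE_I2)
          show "(\<integral>\<^sup>+r. ennreal M * indicator {0..s} r \<partial>lborel) < \<infinity>"
            using s by (simp add: nn_integral_cmult_indicator ennreal_mult_less_top)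
        qed measurable
        also have "\<dots> = (\<integral>\<^sup>+r. w r * indicator {0..s} r \<partial>lborel)"
          by (intro nn_integral_cong) (auto simp: w_def indicator_def Limsup_const)
        finally show "limsup ?q \<le> (\<integral>\<^sup>+r. w r * indicator {0..s} r \<partial>lborel)" .
      qed simp
      finally show "w s \<le> ennreal C * (\<integral>\<^sup>+r. w r * indicator {0..s} r \<partial>lborel) + ennreal \<epsilon>" .
    qed
  qed measurable
  then have "limsup (\<lambda>n. v n t) = 0" by (simp add: w_def)
  then show ?thesis unfolding v_def by (rule tendsto_0_if_Limsup_eq_0_ennreal)
qed

lemma continuous_version:
  fixes Y :: "real \<Rightarrow> 'n path \<Rightarrow> real ^ 'n"
  assumes c: "AE \<omega> in P. continuous_on {0..T} (\<lambda>t. Y t \<omega>)"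
    and m: "\<And>t. t \<in> {0..T} \<Longrightarrow> Y t \<in> borel_measurable P"
  shows "\<exists>N Z. N \<in> null_sets P \<and> (\<forall>t \<omega>. \<omega> \<in> space P - N \<longrightarrow> t \<in> {0..T} \<longrightarrow> Z t \<omega> = Y t \<omega>) \<and>
    jointly_measurable Z \<and> (\<forall>\<omega>. continuous_on UNIV (\<lambda>t. Z t \<omega>))"
proof (rule process_version[OF T_pos c m])
  fix N Z
  assume "N \<in> null_sets P" "\<And>t \<omega>. \<omega> \<in> space P - N \<Longrightarrow> t \<in> {0..T} \<Longrightarrow> Z t \<omega> = Y t \<omega>"
    "(\<lambda>p. Z (fst p) (snd p)) \<in> borel_measurable (borel \<Otimes>\<^sub>M P)" "\<And>\<omega>. continuous_on UNIV (\<lambda>t. Z t \<omega>)"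
  then show ?thesis unfolding jointly_measurable_def by (intro exI[of _ N] exI[of _ Z]) blast
qed

lemma wong_zakai_convergence:
  assumes XK: "\<And>K. K \<ge> 1 \<Longrightarrow> mild_solution H T P J W e b \<sigma> c K (XK K)"
    and X: "strong_solution H T P J W b \<sigma> c X"
    and X2: "\<And>t i. t \<in> {0..T} \<Longrightarrow> integrable P (\<lambda>\<omega>. (X t \<omega> $ i)\<^sup>2)"
    and t: "t \<in> {0..T}"
  shows "(\<lambda>K. \<Sum>i\<in>UNIV. \<integral>\<omega>. \<bar>XK K t \<omega> $ i - X t \<omega> $ i\<bar> \<partial>P) \<longlonglongrightarrow> 0"
proof -
  have Xm: "X t \<in> borel_measurable P" if "t \<in> {0..T}" for t using X that by (simp add: strong_solution_def)
  have Xc: "AE \<omega> in P. continuous_on {0..T} (\<lambda>t. X t \<omega>)" using X by (simp add: strong_solution_def)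
  obtain N Z where N: "N \<in> null_sets P" and Z: "\<And>t \<omega>. \<omega> \<in> space P - N \<Longrightarrow> t \<in> {0..T} \<Longrightarrow> Z t \<omega> = X t \<omega>"
    and Zm: "jointly_measurable Z" and Zc: "\<And>\<omega>. continuous_on UNIV (\<lambda>t. Z t \<omega>)"
    using continuous_version[OF Xc Xm] by blast
  \<comment> \<open>Truncations start at K = 1, so sequences are indexed by \<open>Suc n\<close>;
    the first term is restored at the end.\<close>
  have mK: "mild_solution H T P J W e b \<sigma> c (Suc n) (XK (Suc n))" for n by (rule XK) simp
  have XKm: "XK (Suc n) t \<in> borel_measurable P" if t: "t \<in> {0..T}" for n t
  proof (rule vec_borel_measurableI)
    fix i
    obtain p where "Lp_rv P p (\<lambda>\<omega>. XK (Suc n) t \<omega> $ i)" using mK[of n, unfolded mild_solution_def] t by blast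
    then show "(\<lambda>\<omega>. XK (Suc n) t \<omega> $ i) \<in> borel_measurable P" by (simp add: Lp_rv_def)
  qed
  have "\<forall>n. \<exists>N Z. N \<in> null_sets P \<and> (\<forall>t \<omega>. \<omega> \<in> space P - N \<longrightarrow> t \<in> {0..T} \<longrightarrow> Z t \<omega> = XK (Suc n) t \<omega>) \<and>
      jointly_measurable Z \<and> (\<forall>\<omega>. continuous_on UNIV (\<lambda>t. Z t \<omega>))"
  proof
    fix n
    show "\<exists>N Z. N \<in> null_sets P \<and> (\<forall>t \<omega>. \<omega> \<in> space P - N \<longrightarrow> t \<in> {0..T} \<longrightarrow> Z t \<omega> = XK (Suc n) t \<omega>) \<and>
      jointly_measurable Z \<and> (\<forall>\<omega>. continuous_on UNIV (\<lambda>t. Z t \<omega>))"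
      by (rule continuous_version[OF conjunct1[OF mK[unfolded mild_solution_def]] XKm])
  qed
  then obtain Nn Zn where NZn: "\<forall>n. Nn n \<in> null_sets P \<and> (\<forall>t \<omega>. \<omega> \<in> space P - Nn n \<longrightarrow> t \<in> {0..T} \<longrightarrow> Zn n t \<omega>
    = XK (Suc n) t \<omega>) \<and>
      jointly_measurable (Zn n) \<and> (\<forall>\<omega>. continuous_on UNIV (\<lambda>t. Zn n t \<omega>))"
    unfolding choice_iff by (elim exE)
  have Nn: "Nn n \<in> null_sets P" and Zn: "\<And>t \<omega>. \<omega> \<in> space P - Nn n \<Longrightarrow> t \<in> {0..T} \<Longrightarrow> Zn n t \<omega> = XK (Suc n) t \<omega>"
    and Znm: "jointly_measurable (Zn n)" for n
    using NZn[THEN spec[of _ n]] by simp_all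
  have AEZ: "AE \<omega> in P. Z s \<omega> = X s \<omega>" if "s \<in> {0..T}" for s
    using AE_not_in[OF N] AE_space by eventually_elim (use Z that in auto)
  have AEZn: "AE \<omega> in P. Zn n s \<omega> = XK (Suc n) s \<omega>" if "s \<in> {0..T}" for n s
    using AE_not_in[OF Nn] AE_space by eventually_elim (use Zn that in auto)
  have lim: "(\<lambda>n. L1_dist (Zn n) Z t) \<longlonglongrightarrow> 0"
  proof (rule approximation_tendsto_0[OF Znm Zm _ _ t])
    show "AE \<omega> in P. Zn n s \<omega> $ i = mild_map (Suc n) i s (Zn n) \<omega>" if "s \<in> {0..T}" for n s i
      by (rule mild_solution_eq[OF mK that Nn Zn Znm])
    show "(\<lambda>K. \<integral>\<^sup>+\<omega>. ennreal \<bar>mild_map K i s Z \<omega> - Z s \<omega> $ i\<bar> \<partial>P) \<longlonglongrightarrow> 0" if s: "s \<in> {0..T}" for s i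
    proof -
      have "(\<integral>\<^sup>+\<omega>. ennreal \<bar>mild_map K i s Z \<omega> - Z s \<omega> $ i\<bar> \<partial>P)
        = (\<integral>\<^sup>+\<omega>. ennreal \<bar>mild_map K i s Z \<omega> - X s \<omega> $ i\<bar> \<partial>P)" for K
        using AEZ[OF s] by (intro nn_integral_cong_AE) auto
      then show ?thesis using mild_map_tendsto[OF X X2 N Z Zm Zc s] by simp
    qed
  qed
  let ?d = "\<lambda>n. \<Sum>i\<in>UNIV. \<integral>\<omega>. \<bar>XK (Suc n) t \<omega> $ i - X t \<omega> $ i\<bar> \<partial>P"
  have le: "ennreal (?d n) \<le> L1_dist (Zn n) Z t" for n
  proof -
    have "ennreal (?d n) = (\<Sum>i\<in>UNIV. ennreal (\<integral>\<omega>. \<bar>XK (Suc n) t \<omega> $ i - X t \<omega> $ i\<bar> \<partial>P))"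
      by (rule sum_ennreal[symmetric]) simp
    also have "\<dots> \<le> (\<Sum>i\<in>UNIV. \<integral>\<^sup>+\<omega>. ennreal \<bar>Zn n t \<omega> $ i - Z t \<omega> $ i\<bar> \<partial>P)"
    proof (rule sum_mono)
      fix i
      \<comment> \<open>The Bochner integral never exceeds the ennreal integral, also under the
        convention that it is 0 for a non-integrable function.\<close>
      have "ennreal (\<integral>\<omega>. \<bar>XK (Suc n) t \<omega> $ i - X t \<omega> $ i\<bar> \<partial>P) \<le> (\<integral>\<^sup>+\<omega>. ennreal \<bar>XK (Suc n) t \<omega> $ i - X t \<omega> $ i\<bar> \<partial>P)"
        using ennreal_norm_integral_le[of P "\<lambda>\<omega>. \<bar>XK (Suc n) t \<omega> $ i - X t \<omega> $ i\<bar>"] by simp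
      also have "\<dots> = (\<integral>\<^sup>+\<omega>. ennreal \<bar>Zn n t \<omega> $ i - Z t \<omega> $ i\<bar> \<partial>P)"
      proof (rule nn_integral_cong_AE)
        show "AE \<omega> in P. ennreal \<bar>XK (Suc n) t \<omega> $ i - X t \<omega> $ i\<bar> = ennreal \<bar>Zn n t \<omega> $ i - Z t \<omega> $ i\<bar>"
          using AEZ[OF t] AEZn[OF t, of n] by eventually_elim simp
      qed
      finally show "ennreal (\<integral>\<omega>. \<bar>XK (Suc n) t \<omega> $ i - X t \<omega> $ i\<bar> \<partial>P)
        \<le> (\<integral>\<^sup>+\<omega>. ennreal \<bar>Zn n t \<omega> $ i - Z t \<omega> $ i\<bar> \<partial>P)" .
    qed
    finally show ?thesis by (simp add: L1_dist_def)
  qed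
  have "(\<lambda>n. ennreal (?d n)) \<longlonglongrightarrow> ennreal 0"
    unfolding ennreal_0 by (rule tendsto_sandwich[OF _ _ tendsto_const lim]) (use le
      in \<open>auto intro!: always_eventually\<close>)
  then have "?d \<longlonglongrightarrow> 0"
    by (subst (asm) tendsto_ennreal_iff) (auto intro!: always_eventually sum_nonneg)
  then show ?thesis by (rule LIMSEQ_imp_Suc)
qed

end

theorem theorem1p4:
  fixes H T :: real
    and P :: "('n::finite) path measure"
    and J :: "(real \<Rightarrow> real) \<Rightarrow> 'h::{real_inner, complete_space}"
    and W :: "'n \<Rightarrow> 'h \<Rightarrow> 'n path \<Rightarrow> real"
    and e :: "nat \<Rightarrow> 'h"
    and b :: "real \<Rightarrow> real ^ 'n \<Rightarrow> real ^ 'n"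
    and \<sigma> :: "real \<Rightarrow> real ^ 'n"
    and c :: "real ^ 'n"
    and XK :: "nat \<Rightarrow> real \<Rightarrow> 'n path \<Rightarrow> real ^ 'n"
    and X :: "real \<Rightarrow> 'n path \<Rightarrow> real ^ 'n"
  assumes "T > 0" and "1 / 2 < H" and "H < 1"
    and "fbm_law H T P"
    and "phi_completion H T J"
    and "wiener_integral T P J W"
    and "complete_orthonormal e"
    and "\<And>k. k \<ge> 1 \<Longrightarrow> \<exists>\<xi>. continuous_on {0..T} \<xi> \<and> Phi_version H T J (e k) \<xi>"
    and "bounded_C1 T b"
    and "continuous_on {0..T} \<sigma>" and "bounded (\<sigma> ` {0..T})"
    and "\<And>K. K \<ge> 1 \<Longrightarrow> mild_solution H T P J W e b \<sigma> c K (XK K)"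
    and "unique_strong_solution H T P J W b \<sigma> c X"
    and "\<And>p t i. p \<ge> 1 \<Longrightarrow> t \<in> {0..T} \<Longrightarrow> Lp_rv P p (\<lambda>\<omega>. X t \<omega> $ i)"
  shows "\<forall>t\<in>{0..T}.
    (\<lambda>K. \<Sum>i\<in>UNIV. \<integral>\<omega>. \<bar>XK K t \<omega> $ i - X t \<omega> $ i\<bar> \<partial>P) \<longlonglongrightarrow> 0"
proof
  fix t assume t: "t \<in> {0..T}"
  interpret wong_zakai H T J P W e b \<sigma> c
  proof unfold_locales
    show "\<exists>\<xi>. Phi_version H T J (e k) \<xi>" if "k \<ge> 1" for k using assms(8)[OF that] by blast
  qed (fact assms)+
  show "(\<lambda>K. \<Sum>i\<in>UNIV. \<integral>\<omega>. \<bar>XK K t \<omega> $ i - X t \<omega> $ i\<bar> \<partial>P) \<longlonglongrightarrow> 0"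
    using assms(13) by (intro wong_zakai_convergence[OF assms(12) _ _ t] Lp_rv_2 assms(14))
      (auto simp: unique_strong_solution_def)
qed

end
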